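(* For every $n\ge2$ there exists a constant $C=C_n>0$ such that for all integers $N_1\ge N_2\ge\cdots\ge N_n\ge1$, $$\mathfrak C_{\mathrm{prod}}(N_1,\dots,N_n;n)\le C\Big[\prod_{k=2}^nN_k\Big]^{1/2}\log\Big(\frac{N_1}{N_2}+1\Big).$$ The bound is sharp in the following sense: there is a constant $c=c_n>0$ such that for all integers $N_1\ge N_2\ge\cdots\ge N_n\ge1$, the direction set $\Omega=\prod_{k=1}^nU_{N_k}$, where $U_M=\{j/M:1\le j\le M\}$, satisfies $$\|H_\Omega\|_{2\to2}\ge c\Big[\prod_{k=2}^nN_k\Big]^{1/2}\log\Big(\frac{N_1}{N_2}+1\Big).$$
   Context: For $v\in\mathbb R^n$ write $\langle v,1\rangle=(v_1,\dots,v_n,1)\in\mathbb R^{n+1}$. The directional Hilbert transform on $\mathbb R^{n+1}$ is $H_vf(x)=\mathrm{p.v.}\,\frac1\pi\int_{\mathbb R}f(x-t\langle v,1\rangle)\frac{dt}{t}$, bounded on $L^2(\mathbb R^{n+1})$. For finite $\Omega\subset\mathbb R^n$, $H_\Omega f(x)=\sup_{v\in\Omega}|H_vf(x)|$, and $\|H_\Omega\|_{2\to2}$ is its operator norm on $L^2(\mathbb R^{n+1})$. For integers $N_1\ge\cdots\ge N_n\ge1$, $\mathfrak C_{\mathrm{prod}}(N_1,\dots,N_n;n)$ is the supremum of $\|H_\Omega\|_{2\to2}$ over all sets $\Omega=\Omega_1\times\cdots\times\Omega_n$ with $\Omega_j\subset\mathbb R$ and $\#(\Omega_j)\le N_j$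 for all $1\le j\le n$. *)

theory Defs
  imports "HOL-Analysis.Analysis"
begin

(* R^m is modelled by the product measure space of m copies of R with coordinates 1, ..., m
   (extensional functions on {1..m}), so that the dimension can be quantified over. *)

definition euclid :: "nat \<Rightarrow> (nat \<Rightarrow> real) measure" where
  "euclid m = (\<Pi>\<^sub>M i\<in>{1..m}. lborel)"

(* The L^2 norm of a nonnegative function; infinite if the integral of the square is. *)

definition l2_norm :: "nat \<Rightarrow> ((nat \<Rightarrow> real) \<Rightarrow> ennreal) \<Rightarrow> ennreal" where
  "l2_norm m g =
     (let I = (\<integral>\<^sup>+ x. (g x)\<^sup>2 \<partial>euclid m)
      in if I = \<infinity> then \<infinity> else ennreal (sqrt (enn2real I)))"

(* Borel representatives: every Lebesgue measurable function agrees with a Borel function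
   almost everywhere. *)

definition L2_functions :: "nat \<Rightarrow> ((nat \<Rightarrow> real) \<Rightarrow> complex) set" where
  "L2_functions m =
     {f. f \<in> borel_measurable (euclid m) \<and> l2_norm m (\<lambda>x. ennreal (cmod (f x))) < \<infinity>}"

(* x - t <v,1> in R^(n+1), where <v,1> = (v_1, ..., v_n, 1) *)

definition shift_along :: "nat \<Rightarrow> (nat \<Rightarrow> real) \<Rightarrow> real \<Rightarrow> (nat \<Rightarrow> real) \<Rightarrow> (nat \<Rightarrow> real)" where
  "shift_along n v t x = (\<lambda>i\<in>{1..Suc n}. x i - t * (if i = Suc n then 1 else v i))"

(* The principal value is the limit of the truncations to \<bar>t\<bar> > \<epsilon>. For f in L^2 and almost every x
   the truncated integrals converge absolutely and the limit exists; on the remaining null set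
   the value is a junk value, which does not affect L^2 norms. *)

definition directional_hilbert ::
    "nat \<Rightarrow> (nat \<Rightarrow> real) \<Rightarrow> ((nat \<Rightarrow> real) \<Rightarrow> complex) \<Rightarrow> (nat \<Rightarrow> real) \<Rightarrow> complex" where
  "directional_hilbert n v f x =
     Lim (at_right 0) (\<lambda>\<epsilon>::real.
       complex_of_real (1 / pi) *
         (LINT t:{t. \<epsilon> < \<bar>t\<bar>}|lborel. f (shift_along n v t x) / complex_of_real t))"

definition maximal_hilbert ::
    "nat \<Rightarrow> (nat \<Rightarrow> real) set \<Rightarrow> ((nat \<Rightarrow> real) \<Rightarrow> complex) \<Rightarrow> (nat \<Rightarrow> real) \<Rightarrow> ennreal" where
  "maximal_hilbert n \<Omega> f x = (SUP v\<in>\<Omega>. ennreal (cmod (directional_hilbert n v f x)))"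

(* The operator norm on L^2(R^(n+1)), as an extended nonnegative real. *)

definition maximal_hilbert_norm :: "nat \<Rightarrow> (nat \<Rightarrow> real) set \<Rightarrow> ennreal" where
  "maximal_hilbert_norm n \<Omega> =
     (SUP f\<in>{f \<in> L2_functions (Suc n). l2_norm (Suc n) (\<lambda>x. ennreal (cmod (f x))) \<le> 1}.
        l2_norm (Suc n) (maximal_hilbert n \<Omega> f))"

definition C_prod :: "nat \<Rightarrow> (nat \<Rightarrow> nat) \<Rightarrow> ennreal" where
  "C_prod n N =
     (SUP \<Omega>\<in>{\<Omega> :: nat \<Rightarrow> real set. \<forall>j\<in>{1..n}. finite (\<Omega> j) \<and> card (\<Omega> j) \<le> N j}.
        maximal_hilbert_norm n (\<Pi>\<^sub>E j\<in>{1..n}. \<Omega> j))"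

definition uniform_set :: "nat \<Rightarrow> real set" where
  "uniform_set M = {real j / real M | j. 1 \<le> j \<and> j \<le> M}"

end

(* Upper bound. The square sum of the increments of v |-> H_v f along a line of directions
   v_0 < v_1 < ... < v_q that differ in one coordinate is bounded: the middle one of three collinear
   directions is, after rescaling, the product of two commuting flows A, C, and the increments
   H_C f - H_AC f and H_AC f - H_A f are orthogonal, so the squares telescope to
   |H_(v_q) f - H_(v_0) f|^2 <= 4 |f|^2. Orthogonality follows, without Fourier transform, from an
   algebraic identity between products of Poisson and conjugate Poisson kernels, because Poisson
   averages converge to f. The supremum over a grid is then controlled by rounding all coordinates
   dyadically and refining one digit at a time: at resolution 2^j there are about
   prod_{k>=2} min(2^j, N_k) grid lines, the square roots of these numbers grow geometrically in j
   until 2^j exceeds N_2, and each of the remaining log(N_1 / N_2) levels costs the square root of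
   prod_{k>=2} N_k.

   Lower bound. With R^2 = N_1 / N_2, test on s = x_(n+1) |-> 1/s over
   {1 <= s <= R, 0 <= x_1 <= 2 s, 0 <= x_k <= 2 R}: a line of slope v through a point at height
   r in (R N_2, N_1) that meets this set all along contributes log R / (pi r), and the strips of such
   points for the different slopes j / N_k are disjoint. *)
theory Submission
  imports Defs "HOL-Real_Asymp.Real_Asymp"
begin

section \<open>Poisson and conjugate Poisson kernels\<close>

text \<open>On the Fourier side H_v multiplies by -i times the sign of the linear form <xi, (v,1)>.
  If the form of b is a sum of positive multiples of those of a and c, its sign agrees almost
  everywhere with one of theirs, so (sgn c - sgn b)(sgn b - sgn a) = 0. This is the orthogonality;
  the identity between kernels is its real-variable form. The obstacle is that 1/t and the conjugate
  Poisson kernel are not integrable, so Fubini fails to converge absolutely for general f in L^2.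
  Statements are therefore proved first for bounded integrable f supported at bounded height and
  then carried over by contraction bounds. Principal values exist almost everywhere for this reason:
  a fast sequence of conjugate Poisson averages converges to some h on almost every line, Poisson
  averages of h are then conjugate Poisson averages of f, and the former converge at Lebesgue points
  of h. In the chaining, weighted Cauchy-Schwarz puts the weight sqrt(number of lines) on each
  level, so that one integrable function dominates all squares and the cost is the sum of these
  square roots.\<close>

lemma filterlim_times_pos_at_right_0:
  fixes c :: real
  assumes "c > 0"
  shows "filterlim ((*) c) (at_right 0) (at_right 0)"
  unfolding filterlim_at using assms
  by (auto intro!: tendsto_eq_intros simp: eventually_at_right_field intro: exI[of _ 1])

definition poisson_kernel :: "real \<Rightarrow> real \<Rightarrow> real" where
  "poisson_kernel e t = e / (pi * (t\<^sup>2 + e\<^sup>2))"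

text \<open>A smooth substitute for 1/(pi t) cut off at \<open>e\<close>. The tail is still of order
  1/t, so it is square integrable but not integrable; this is why compactly supported correlations
  are needed below.\<close>

definition conj_kernel :: "real \<Rightarrow> real \<Rightarrow> real" where
  "conj_kernel e t = t / (pi * (t\<^sup>2 + e\<^sup>2))"

lemma sumsq_pos: "e > 0 \<Longrightarrow> t\<^sup>2 + e\<^sup>2 > (0::real)"
  by (simp add: add_nonneg_pos)

lemma poisson_kernel_measurable [measurable]: "poisson_kernel e \<in> borel_measurable borel"
  unfolding poisson_kernel_def by measurable

lemma conj_kernel_measurable [measurable]: "conj_kernel e \<in> borel_measurable borel"
  unfolding conj_kernel_def by measurable

lemma poisson_kernel_pos: "e > 0 \<Longrightarrow> poisson_kernel e t > 0"
  unfolding poisson_kernel_def using sumsq_pos[of e t] by simp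

lemma poisson_kernel_nonneg: "e > 0 \<Longrightarrow> poisson_kernel e t \<ge> 0"
  using poisson_kernel_pos[of e t] by simp

lemma poisson_kernel_minus [simp]: "poisson_kernel e (- t) = poisson_kernel e t"
  by (simp add: poisson_kernel_def)

lemma conj_kernel_minus [simp]: "conj_kernel e (- t) = - conj_kernel e t"
  by (simp add: conj_kernel_def)

lemma poisson_kernel_antimono:
  assumes "e > 0" "\<bar>s\<bar> \<le> \<bar>t\<bar>"
  shows "poisson_kernel e t \<le> poisson_kernel e s"
proof -
  have "s\<^sup>2 \<le> t\<^sup>2" using assms(2) by (simp add: abs_le_square_iff)
  then show ?thesis
    unfolding poisson_kernel_def using assms sumsq_pos[of e s]
    by (intro divide_left_mono mult_left_mono) (auto intro!: mult_pos_pos simp: sumsq_pos)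
qed

lemma poisson_kernel_le:
  assumes "e > 0" shows "poisson_kernel e t \<le> 1 / (pi * e)"
  using poisson_kernel_antimono[of e 0 t] assms
  by (simp add: poisson_kernel_def power2_eq_square)

text \<open>The squares of the two kernels add up to \<open>poisson_kernel e t / (pi * e)\<close>,
  so the Poisson kernel also supplies the integrability of both squares.\<close>

lemma conj_kernel_sq_le:
  assumes "e > 0" shows "(conj_kernel e t)\<^sup>2 \<le> poisson_kernel e t / (pi * e)"
proof -
  have p: "t\<^sup>2 + e\<^sup>2 > 0" using assms by (rule sumsq_pos)
  have "(conj_kernel e t)\<^sup>2 = t\<^sup>2 / (pi\<^sup>2 * (t\<^sup>2 + e\<^sup>2)\<^sup>2)"
    by (simp add: conj_kernel_def power_divide power_mult_distrib)
  also have "\<dots> \<le> (t\<^sup>2 + e\<^sup>2) / (pi\<^sup>2 * (t\<^sup>2 + e\<^sup>2)\<^sup>2)"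
    by (intro divide_right_mono) auto
  also have "\<dots> = poisson_kernel e t / (pi * e)"
    using p assms by (simp add: poisson_kernel_def power2_eq_square)
  finally show ?thesis .
qed

lemma poisson_kernel_sq_le:
  assumes "e > 0" shows "(poisson_kernel e t)\<^sup>2 \<le> poisson_kernel e t / (pi * e)"
  using mult_left_mono[OF poisson_kernel_le[OF assms, of t] poisson_kernel_nonneg[OF assms, of t]]
  by (simp add: power2_eq_square)

lemma abs_conj_kernel_le:
  assumes "e > 0" shows "\<bar>conj_kernel e t\<bar> \<le> 1 / (pi * e)"
proof -
  have "(conj_kernel e t)\<^sup>2 \<le> (1 / (pi * e))\<^sup>2"
  proof -
    have "(conj_kernel e t)\<^sup>2 \<le> poisson_kernel e t / (pi * e)" by (rule conj_kernel_sq_le[OF assms])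
    also have "\<dots> \<le> (1 / (pi * e)) / (pi * e)"
      using assms by (intro divide_right_mono poisson_kernel_le) auto
    finally show ?thesis by (simp add: power2_eq_square)
  qed
  then have "\<bar>conj_kernel e t\<bar> \<le> \<bar>1 / (pi * e)\<bar>" by (subst abs_le_square_iff)
  also have "\<dots> = 1 / (pi * e)" using assms by (intro abs_of_pos) simp
  finally show ?thesis .
qed

lemma poisson_kernel_integral:
  assumes e: "e > 0"
  shows "integrable lborel (poisson_kernel e)" "(\<integral>t. poisson_kernel e t \<partial>lborel) = 1"
proof -
  let ?F = "\<lambda>t. arctan (t / e) / pi"
  have D: "DERIV ?F x :> poisson_kernel e x" for x
  proof -
    have p: "e\<^sup>2 + x\<^sup>2 > 0" using sumsq_pos[of e x] e by (simp add: add.commute)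
    have "DERIV ?F x :> (inverse (1 + (x/e)\<^sup>2) * (1/e)) / pi"
      using e by (auto intro!: derivative_eq_intros)
    also have "(inverse (1 + (x/e)\<^sup>2) * (1/e)) / pi = poisson_kernel e x"
    proof -
      have "1 + (x/e)\<^sup>2 = (e\<^sup>2 + x\<^sup>2) / e\<^sup>2" using e by (simp add: power_divide field_simps)
      then show ?thesis using e p by (simp add: poisson_kernel_def field_simps power2_eq_square)
    qed
    finally show ?thesis .
  qed
  have c: "isCont (poisson_kernel e) x" for x
    unfolding poisson_kernel_def using sumsq_pos[OF e, of x] by (auto intro!: continuous_intros)
  have A: "(?F \<longlongrightarrow> -1/2) at_bot" using e by real_asymp
  have B: "(?F \<longlongrightarrow> 1/2) at_top" using e by real_asymp
  have A': "((?F \<circ> real_of_ereal) \<longlongrightarrow> -1/2) (at_right (-\<infinity>))"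
    and B': "((?F \<circ> real_of_ereal) \<longlongrightarrow> 1/2) (at_left \<infinity>)"
    using A B unfolding ereal_tendsto_simps by auto
  have *: "set_integrable lborel (einterval (-\<infinity>) \<infinity>) (poisson_kernel e)"
          "(LBINT x=-\<infinity>..\<infinity>. poisson_kernel e x) = 1/2 - (-1/2)"
    using interval_integral_FTC_nonneg[of "-\<infinity>" "\<infinity>" ?F "poisson_kernel e" "-1/2" "1/2", OF _ D c _ A' B']
      poisson_kernel_nonneg[OF e] by auto
  show "integrable lborel (poisson_kernel e)" using *(1) by (simp add: set_integrable_def)
  show "(\<integral>t. poisson_kernel e t \<partial>lborel) = 1"
    using *(2) by (simp add: interval_lebesgue_integral_def set_lebesgue_integral_def)
qed

lemma poisson_kernel_nn_integral:
  assumes e: "e > 0"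
  shows "(\<integral>\<^sup>+t. ennreal (poisson_kernel e t) \<partial>lborel) = 1"
  using poisson_kernel_integral[OF e] poisson_kernel_nonneg[OF e]
  by (subst nn_integral_eq_integral) auto

lemma conj_kernel_sq_integrable:
  assumes "e > 0" shows "integrable lborel (\<lambda>t. (conj_kernel e t)\<^sup>2)"
proof (rule Bochner_Integration.integrable_bound)
  show "integrable lborel (\<lambda>t. poisson_kernel e t / (pi * e))"
    using poisson_kernel_integral(1)[OF assms] by simp
  show "AE x in lborel. norm ((conj_kernel e x)\<^sup>2) \<le> norm (poisson_kernel e x / (pi * e))"
    using order_trans[OF conj_kernel_sq_le[OF assms] abs_ge_self] by (intro AE_I2) (simp del: abs_divide)
qed auto

lemma poisson_kernel_sq_integrable:
  assumes "e > 0" shows "integrable lborel (\<lambda>t. (poisson_kernel e t)\<^sup>2)"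
proof (rule Bochner_Integration.integrable_bound)
  show "integrable lborel (\<lambda>t. poisson_kernel e t / (pi * e))"
    using poisson_kernel_integral(1)[OF assms] by simp
  show "AE x in lborel. norm ((poisson_kernel e x)\<^sup>2) \<le> norm (poisson_kernel e x / (pi * e))"
    using order_trans[OF poisson_kernel_sq_le[OF assms] abs_ge_self] by (intro AE_I2) (simp del: abs_divide)
qed auto

(* The antiderivative is explicit: the logarithmic part has limit 0 at both ends. *)
lemma partial_fraction_integral:
  fixes \<alpha> \<beta> \<gamma> y d e :: real
  assumes e: "e > 0" and d: "d > 0" and int: "integrable lborel g"
    and g: "\<And>s. g s = \<alpha> * ((s + y) / ((s + y)\<^sup>2 + e\<^sup>2) - s / (s\<^sup>2 + d\<^sup>2))
                  + \<beta> * (e / ((s + y)\<^sup>2 + e\<^sup>2)) + \<gamma> * (d / (s\<^sup>2 + d\<^sup>2))"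
  shows "(\<integral>s. g s \<partial>lborel) = pi * (\<beta> + \<gamma>)"
proof -
  let ?F = "\<lambda>s. \<alpha> / 2 * (ln ((s + y)\<^sup>2 + e\<^sup>2) - ln (s\<^sup>2 + d\<^sup>2)) + \<beta> * arctan ((s + y) / e) + \<gamma> * arctan (s / d)"
  have at: "DERIV (\<lambda>s. arctan ((s + z) / a)) x :> a / ((x + z)\<^sup>2 + a\<^sup>2)" if "a > 0" for a x z :: real
  proof -
    have p: "a\<^sup>2 + (x+z)\<^sup>2 > 0" using sumsq_pos[of a "x+z"] that by (simp add: add.commute)
    have "DERIV (\<lambda>s. arctan ((s + z) / a)) x :> inverse (1 + ((x+z)/a)\<^sup>2) * (1/a)"
      using that by (auto intro!: derivative_eq_intros)
    moreover have "1 + ((x+z)/a)\<^sup>2 = (a\<^sup>2 + (x+z)\<^sup>2) / a\<^sup>2" using that by (simp add: power_divide field_simps)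
    ultimately show ?thesis using that p by (simp add: field_simps power2_eq_square)
  qed
  have ll: "DERIV (\<lambda>s. ln ((s + z)\<^sup>2 + a\<^sup>2)) x :> 2 * ((x + z) / ((x + z)\<^sup>2 + a\<^sup>2))" if "a > 0" for a x z :: real
    using sumsq_pos[OF that, of "x+z"] by (auto intro!: derivative_eq_intros simp: field_simps)
  have D: "DERIV ?F x :> g x" for x
    unfolding g
    by (rule derivative_eq_intros ll[OF e] ll[OF d, where z=0, simplified] at[OF e] at[OF d, where z=0, simplified] refl
        | simp add: field_simps)+
  have D': "(?F has_vector_derivative g x) (at x)" for x
    using D has_real_derivative_iff_has_vector_derivative by blast
  have c: "isCont g x" for x
  proof -
    have "g = (\<lambda>s. \<alpha> * ((s + y) / ((s + y)\<^sup>2 + e\<^sup>2) - s / (s\<^sup>2 + d\<^sup>2))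
                  + \<beta> * (e / ((s + y)\<^sup>2 + e\<^sup>2)) + \<gamma> * (d / (s\<^sup>2 + d\<^sup>2)))" using g by auto
    then show ?thesis using sumsq_pos[OF e, of "x+y"] sumsq_pos[OF d, of x]
      by (auto intro!: continuous_intros)
  qed
  have l1: "((\<lambda>s. ln ((s + y)\<^sup>2 + e\<^sup>2) - ln (s\<^sup>2 + d\<^sup>2)) \<longlongrightarrow> 0) at_bot"
    "((\<lambda>s. ln ((s + y)\<^sup>2 + e\<^sup>2) - ln (s\<^sup>2 + d\<^sup>2)) \<longlongrightarrow> 0) at_top" by real_asymp+
  have l2: "((\<lambda>s. arctan ((s + y) / e)) \<longlongrightarrow> -(pi/2)) at_bot" "((\<lambda>s. arctan ((s + y) / e)) \<longlongrightarrow> pi/2) at_top"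
    "((\<lambda>s. arctan (s / d)) \<longlongrightarrow> -(pi/2)) at_bot" "((\<lambda>s. arctan (s / d)) \<longlongrightarrow> pi/2) at_top"
    using e d by real_asymp+
  have A: "(?F \<longlongrightarrow> \<alpha>/2 * 0 + \<beta> * (-(pi/2)) + \<gamma> * (-(pi/2))) at_bot"
    by (intro tendsto_intros l1 l2)
  have B: "(?F \<longlongrightarrow> \<alpha>/2 * 0 + \<beta> * (pi/2) + \<gamma> * (pi/2)) at_top"
    by (intro tendsto_intros l1 l2)
  have A': "((?F \<circ> real_of_ereal) \<longlongrightarrow> \<alpha>/2 * 0 + \<beta> * (-(pi/2)) + \<gamma> * (-(pi/2))) (at_right (-\<infinity>))"
    and B': "((?F \<circ> real_of_ereal) \<longlongrightarrow> \<alpha>/2 * 0 + \<beta> * (pi/2) + \<gamma> * (pi/2)) (at_left \<infinity>)"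
    using A B unfolding ereal_tendsto_simps by auto
  have "set_integrable lborel (einterval (-\<infinity>) \<infinity>) g"
    using int by (simp add: set_integrable_def)
  then have "(LBINT x=-\<infinity>..\<infinity>. g x) = (\<alpha>/2 * 0 + \<beta> * (pi/2) + \<gamma> * (pi/2)) - (\<alpha>/2 * 0 + \<beta> * (-(pi/2)) + \<gamma> * (-(pi/2)))"
    using interval_integral_FTC_integrable[of "-\<infinity>" "\<infinity>" ?F g, OF _ D' c _ A' B'] by simp
  then show ?thesis
    by (simp add: interval_lebesgue_integral_def set_lebesgue_integral_def algebra_simps)
qed

section \<open>Convolutions of Poisson and conjugate Poisson kernels\<close>

lemma pi_sq_cancel: "pi\<^sup>2 * i = pi * x \<Longrightarrow> i = x / pi"
  by (simp add: power2_eq_square field_simps)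

text \<open>The quadratic denominators stay opaque as \<open>X\<close> and \<open>Y\<close>; each
  convolution below then reduces to a polynomial identity between numerators.\<close>

lemma partial_fraction_split:
  fixes a b c d e u v X Y D :: real
  assumes "X \<noteq> 0" "Y \<noteq> 0" "D \<noteq> 0"
  shows "(a * (u * Y - v * X) + b * e * Y + c * d * X) / (D * (X * Y)) = a / D * (u / X - v / Y) + b / D * (e / X) + c / D * (d / Y)"
proof -
  have 1: "a / D * (u / X - v / Y) = (a * (u * Y - v * X)) / (D * (X * Y))"
    using assms by (simp add: diff_frac_eq)
  have 2: "b / D * (e / X) = (b * e * Y) / (D * (X * Y))" "c / D * (d / Y) = (c * d * X) / (D * (X * Y))"
    using assms by auto
  show ?thesis unfolding 1 2 by (simp add: add_divide_distrib)
qed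

lemma integrable_mult_L2:
  fixes f g :: "'a \<Rightarrow> real"
  assumes [measurable]: "f \<in> borel_measurable M" "g \<in> borel_measurable M"
    and "integrable M (\<lambda>x. (f x)\<^sup>2)" "integrable M (\<lambda>x. (g x)\<^sup>2)"
  shows "integrable M (\<lambda>x. f x * g x)"
proof (rule Bochner_Integration.integrable_bound)
  show "integrable M (\<lambda>x. (f x)\<^sup>2 + (g x)\<^sup>2)" using assms by simp
  have "\<bar>a * b\<bar> \<le> a\<^sup>2 + b\<^sup>2" for a b :: real
  proof -
    have "2 * (\<bar>a\<bar> * \<bar>b\<bar>) \<le> a\<^sup>2 + b\<^sup>2" using sum_squares_bound[of "\<bar>a\<bar>" "\<bar>b\<bar>"] by (simp add: mult.assoc)
    moreover have "0 \<le> \<bar>a\<bar> * \<bar>b\<bar>" by simp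
    ultimately show ?thesis unfolding abs_mult by linarith
  qed
  then show "AE x in M. norm (f x * g x) \<le> norm ((f x)\<^sup>2 + (g x)\<^sup>2)" by auto
qed auto

lemma lborel_integrable_translate:
  fixes f :: "real \<Rightarrow> real"
  assumes "integrable lborel f" shows "integrable lborel (\<lambda>s. f (s + y))"
  using lborel_integrable_real_affine[OF assms, of 1 y] by (simp add: add.commute)

text \<open>The conjugate kernel has the Fourier multiplier -i sgn(xi) exp(-e |xi|), and in a
  correlation the factors -i and i cancel, which leaves exp(-(e + d) |xi|). At \<open>y = 0\<close>
  with \<open>e = d\<close> the partial fractions degenerate; the identity is used only almost
  everywhere.\<close>

lemma conj_kernel_conv_conj_kernel:
  assumes e: "e > 0" and d: "d > 0" and y: "y \<noteq> 0"
  shows "(\<integral>s. conj_kernel e (s + y) * conj_kernel d s \<partial>lborel) = poisson_kernel (e + d) y"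
proof -
  \<comment> \<open>\<open>D\<close> is the resultant of the two quadratics in \<open>s\<close>; it
    is the common denominator of the partial fraction coefficients and is positive because
    \<open>y\<close> is nonzero.\<close>
  define D where "D = (y\<^sup>2 + (e+d)\<^sup>2) * (y\<^sup>2 + (e-d)\<^sup>2)"
  have p1: "y\<^sup>2 + (e+d)\<^sup>2 > 0" "y\<^sup>2 + (e-d)\<^sup>2 > 0" using y by (auto intro: add_pos_nonneg)
  then have Dp: "D > 0" by (simp add: D_def)
  define \<alpha> \<beta> \<gamma> where "\<alpha> = (- y) * (y\<^sup>2 + e\<^sup>2 + d\<^sup>2) / D" and "\<beta> = e * (y\<^sup>2 - d\<^sup>2 + e\<^sup>2) / D"
    and "\<gamma> = d * (y\<^sup>2 - e\<^sup>2 + d\<^sup>2) / D"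
  let ?g = "\<lambda>s. pi\<^sup>2 * (conj_kernel e (s + y) * conj_kernel d s)"
  have int: "integrable lborel ?g"
    using integrable_mult_L2[of "\<lambda>s. conj_kernel e (s+y)" lborel "conj_kernel d"]
      lborel_integrable_translate[OF conj_kernel_sq_integrable[OF e], of y] conj_kernel_sq_integrable[OF d] by simp
  have "(\<integral>s. ?g s \<partial>lborel) = pi * (\<beta> + \<gamma>)"
  proof (rule partial_fraction_integral[OF e d int, where \<alpha> = \<alpha> and y = y])
    fix s
    have q: "(s+y)\<^sup>2 + e\<^sup>2 > 0" "s\<^sup>2 + d\<^sup>2 > 0" using sumsq_pos e d by auto
    have num: "D * ((s+y) * s) = (- y) * (y\<^sup>2 + e\<^sup>2 + d\<^sup>2) * ((s+y) * (s\<^sup>2+d\<^sup>2) - s * ((s+y)\<^sup>2+e\<^sup>2))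
      + e * (y\<^sup>2 - d\<^sup>2 + e\<^sup>2) * e * (s\<^sup>2 + d\<^sup>2) + d * (y\<^sup>2 - e\<^sup>2 + d\<^sup>2) * d * ((s+y)\<^sup>2+e\<^sup>2)"
      unfolding D_def by algebra
    have "?g s = (s+y) * s / (((s+y)\<^sup>2+e\<^sup>2) * (s\<^sup>2+d\<^sup>2))"
      by (simp add: conj_kernel_def power2_eq_square)
    also have "\<dots> = D * ((s+y) * s) / (D * (((s+y)\<^sup>2+e\<^sup>2) * (s\<^sup>2+d\<^sup>2)))" using Dp by simp
    also have "\<dots> = \<alpha> * ((s + y) / ((s + y)\<^sup>2 + e\<^sup>2) - s / (s\<^sup>2 + d\<^sup>2)) + \<beta> * (e / ((s + y)\<^sup>2 + e\<^sup>2)) + \<gamma> * (d / (s\<^sup>2 + d\<^sup>2))"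
      unfolding num \<alpha>_def \<beta>_def \<gamma>_def by (rule partial_fraction_split) (use q Dp in auto)
    finally show "?g s = \<dots>" .
  qed
  moreover have "\<beta> + \<gamma> = (e + d) / (y\<^sup>2 + (e+d)\<^sup>2)"
  proof -
    have "\<beta> + \<gamma> = ((e + d) * (y\<^sup>2 + (e-d)\<^sup>2)) / D"
      unfolding \<beta>_def \<gamma>_def by (simp add: add_divide_distrib[symmetric]) (simp add: algebra_simps power2_eq_square)
    then show ?thesis using p1 y by (simp add: D_def)
  qed
  ultimately have "pi\<^sup>2 * (\<integral>s. conj_kernel e (s + y) * conj_kernel d s \<partial>lborel) = pi * ((e + d) / (y\<^sup>2 + (e+d)\<^sup>2))" by simp
  from pi_sq_cancel[OF this] show ?thesis by (simp add: poisson_kernel_def[of "e + d"] mult.commute)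
qed

text \<open>Both kernels come from i/(pi z), holomorphic in the upper half plane, so averaging
  against the Poisson kernel of height \<open>d\<close> moves the point up from height
  \<open>e\<close> to \<open>e + d\<close>.\<close>

lemma poisson_kernel_conv_conj_kernel:
  assumes e: "e > 0" and d: "d > 0" and y: "y \<noteq> 0"
  shows "(\<integral>s. poisson_kernel d s * conj_kernel e (y - s) \<partial>lborel) = conj_kernel (e + d) y"
proof -
  define D where "D = (y\<^sup>2 + (e+d)\<^sup>2) * (y\<^sup>2 + (e-d)\<^sup>2)"
  have p1: "y\<^sup>2 + (e+d)\<^sup>2 > 0" "y\<^sup>2 + (e-d)\<^sup>2 > 0" using y by (auto intro: add_pos_nonneg)
  then have Dp: "D > 0" by (simp add: D_def)
  define \<alpha> \<beta> \<gamma> where "\<alpha> = d * (e\<^sup>2 - d\<^sup>2 - y\<^sup>2) / D" and "\<beta> = (-2) * d * y * e / D"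
    and "\<gamma> = y * (y\<^sup>2 + e\<^sup>2 + d\<^sup>2) / D"
  let ?g = "\<lambda>s. pi\<^sup>2 * (poisson_kernel d s * conj_kernel e (y - s))"
  have i1: "integrable lborel (\<lambda>s. (conj_kernel e (y - s))\<^sup>2)"
    using lborel_integrable_real_affine[OF conj_kernel_sq_integrable[OF e], of "-1" y] by simp
  have int: "integrable lborel ?g"
    using integrable_mult_L2[of "poisson_kernel d" lborel "\<lambda>s. conj_kernel e (y - s)"]
      i1 poisson_kernel_sq_integrable[OF d] by simp
  have "(\<integral>s. ?g s \<partial>lborel) = pi * (\<beta> + \<gamma>)"
  proof (rule partial_fraction_integral[OF e d int, where \<alpha> = \<alpha> and y = "-y"])
    fix s
    have q: "(s-y)\<^sup>2 + e\<^sup>2 > 0" "s\<^sup>2 + d\<^sup>2 > 0" using sumsq_pos e d by auto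
    have num: "D * (d * (y-s)) = d * (e\<^sup>2 - d\<^sup>2 - y\<^sup>2) * ((s-y) * (s\<^sup>2+d\<^sup>2) - s * ((s-y)\<^sup>2+e\<^sup>2))
      + ((-2) * d * y * e) * e * (s\<^sup>2 + d\<^sup>2) + y * (y\<^sup>2 + e\<^sup>2 + d\<^sup>2) * d * ((s-y)\<^sup>2+e\<^sup>2)"
      unfolding D_def by algebra
    have "?g s = d*(y-s) / (((s-y)\<^sup>2+e\<^sup>2) * (s\<^sup>2+d\<^sup>2))"
      by (simp add: conj_kernel_def poisson_kernel_def power2_eq_square) (simp add: algebra_simps)
    also have "\<dots> = D * (d*(y-s)) / (D * (((s-y)\<^sup>2+e\<^sup>2) * (s\<^sup>2+d\<^sup>2)))" using Dp by simp
    also have "\<dots> = \<alpha> * ((s + -y) / ((s + -y)\<^sup>2 + e\<^sup>2) - s / (s\<^sup>2 + d\<^sup>2)) + \<beta> * (e / ((s + -y)\<^sup>2 + e\<^sup>2)) + \<gamma> * (d / (s\<^sup>2 + d\<^sup>2))"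
      unfolding num \<alpha>_def \<beta>_def \<gamma>_def by (subst partial_fraction_split[symmetric]) (use q Dp in auto)
    finally show "?g s = \<dots>" .
  qed
  moreover have "\<beta> + \<gamma> = y / (y\<^sup>2 + (e+d)\<^sup>2)"
  proof -
    have "\<beta> + \<gamma> = (y * (y\<^sup>2 + (e-d)\<^sup>2)) / D"
      unfolding \<beta>_def \<gamma>_def by (simp add: add_divide_distrib[symmetric] diff_divide_distrib[symmetric]) (simp add: algebra_simps power2_eq_square)
    then show ?thesis using p1 y by (simp add: D_def)
  qed
  ultimately have "pi\<^sup>2 * (\<integral>s. poisson_kernel d s * conj_kernel e (y - s) \<partial>lborel) = pi * (y / (y\<^sup>2 + (e+d)\<^sup>2))" by simp
  from pi_sq_cancel[OF this] show ?thesis by (simp add: conj_kernel_def[of "e + d"] mult.commute)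
qed

(* The real part of (i/z) (i/w) = (i/(z + w)) (i/z + i/w) for z = s + i e and w = t - s + i e: the
   Poisson and conjugate Poisson kernels are the real and imaginary part of i/(pi z). *)
lemma kernel_identity:
  assumes e: "e > 0"
  shows "conj_kernel e s * conj_kernel e (t - s) - conj_kernel (2*e) t * conj_kernel e (t - s)
           - conj_kernel e s * conj_kernel (2*e) t
       = poisson_kernel e s * poisson_kernel e (t - s) - poisson_kernel (2*e) t * poisson_kernel e (t - s)
           - poisson_kernel e s * poisson_kernel (2*e) t"
proof -
  have p: "s\<^sup>2 + e\<^sup>2 > 0" "(t-s)\<^sup>2 + e\<^sup>2 > 0" "t\<^sup>2 + (2*e)\<^sup>2 > 0" using e by (intro sumsq_pos; simp)+
  define a b c where "a = s\<^sup>2 + e\<^sup>2" and "b = (t-s)\<^sup>2 + e\<^sup>2" and "c = t\<^sup>2 + (2*e)\<^sup>2"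
  have num: "s * (t-s) * c - t * (t-s) * a - s * t * b = e * e * c - 2*e*e*a - e*(2*e) * b"
    unfolding a_def b_def c_def by algebra
  have n: "a \<noteq> 0" "b \<noteq> 0" "c \<noteq> 0" using p by (auto simp: a_def b_def c_def)
  have "s/a * ((t-s)/b) - t/c * ((t-s)/b) - s/a * (t/c) = (s * (t-s) * c - t * (t-s) * a - s * t * b) / (a*b*c)"
    using n by (simp add: field_simps)
  also have "\<dots> = e/a * (e/b) - (2*e)/c * (e/b) - e/a * ((2*e)/c)"
    unfolding num using n by (simp add: field_simps)
  finally have *: "s/a * ((t-s)/b) - t/c * ((t-s)/b) - s/a * (t/c) = e/a * (e/b) - (2*e)/c * (e/b) - e/a * ((2*e)/c)" .
  have r: "x / (pi * u) = (x / u) / pi" for x u :: real by simp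
  have h: "(A/pi)*(B/pi) - (C/pi)*(B/pi) - (A/pi)*(C/pi) = (A*B - C*B - A*C) / pi\<^sup>2" for A B C
    by (simp add: field_simps power2_eq_square)
  show ?thesis
    unfolding poisson_kernel_def conj_kernel_def a_def[symmetric] b_def[symmetric] c_def[symmetric] r h *
    by simp
qed

lemma poisson_kernel_gt_iff:
  assumes e: "e > 0" and z: "z > 0"
  shows "z < poisson_kernel e t \<longleftrightarrow> t\<^sup>2 < e / (pi * z) - e\<^sup>2"
proof -
  have "z < poisson_kernel e t \<longleftrightarrow> z * (pi * (t\<^sup>2 + e\<^sup>2)) < e"
    unfolding poisson_kernel_def using sumsq_pos[OF e, of t] by (subst pos_less_divide_eq) auto
  also have "\<dots> \<longleftrightarrow> (t\<^sup>2 + e\<^sup>2) * (pi * z) < e" by (simp add: mult_ac)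
  also have "\<dots> \<longleftrightarrow> t\<^sup>2 + e\<^sup>2 < e / (pi * z)" using z by (subst pos_less_divide_eq) auto
  finally show ?thesis by auto
qed

(* Layer-cake: the superlevel sets of the Poisson kernel are symmetric intervals. *)
lemma poisson_kernel_average_le:
  fixes u :: "real \<Rightarrow> ennreal"
  assumes e: "e > 0" and [measurable]: "u \<in> borel_measurable lborel" and \<eta>: "\<eta> > 0"
    and avg: "\<And>r. 0 < r \<Longrightarrow> r \<le> \<eta> \<Longrightarrow> (\<integral>\<^sup>+t. u t * indicator {-r<..<r} t \<partial>lborel) \<le> ennreal (2 * r) * C"
  shows "(\<integral>\<^sup>+t. u t * ennreal (poisson_kernel e t) * indicator {-\<eta><..<\<eta>} t \<partial>lborel) \<le> C"
proof -
  have lc: "ennreal (poisson_kernel e t) = (\<integral>\<^sup>+z. indicator {z. 0 < z \<and> z < poisson_kernel e t} z \<partial>lborel)" for t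
  proof -
    have "{z. 0 < z \<and> z < poisson_kernel e t} = {0<..<poisson_kernel e t}" by auto
    then show ?thesis using poisson_kernel_nonneg[OF e, of t] by simp
  qed
  define S where "S z t \<longleftrightarrow> 0 < z \<and> z < poisson_kernel e t \<and> -\<eta> < t \<and> t < \<eta>" for z t
  have [measurable]: "Measurable.pred (lborel \<Otimes>\<^sub>M lborel) (\<lambda>(t, z). S z t)" "Measurable.pred (lborel \<Otimes>\<^sub>M lborel) (\<lambda>(z, t). S z t)"
    unfolding S_def by measurable
  have e1: "v * ennreal (poisson_kernel e t) * indicator {-\<eta><..<\<eta>} t = (\<integral>\<^sup>+z. v * (if S z t then 1 else 0) \<partial>lborel)" for t and v :: ennreal
  proof -
    have "(\<integral>\<^sup>+z. v * (if S z t then 1 else 0) \<partial>lborel) = (\<integral>\<^sup>+z. (v * indicator {-\<eta><..<\<eta>} t) * indicator {z. 0 < z \<and> z < poisson_kernel e t} z \<partial>lborel)"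
      by (intro nn_integral_cong) (auto simp: S_def indicator_def)
    also have "\<dots> = (v * indicator {-\<eta><..<\<eta>} t) * ennreal (poisson_kernel e t)"
      unfolding lc by (intro nn_integral_cmult) measurable
    finally show ?thesis by (simp add: mult_ac)
  qed
  have swap: "(\<integral>\<^sup>+t. v t * ennreal (poisson_kernel e t) * indicator {-\<eta><..<\<eta>} t \<partial>lborel)
      = (\<integral>\<^sup>+z. \<integral>\<^sup>+t. v t * (if S z t then 1 else 0) \<partial>lborel \<partial>lborel)"
    if [measurable]: "v \<in> borel_measurable lborel" for v :: "real \<Rightarrow> ennreal"
    unfolding e1 by (intro lborel_pair.Fubini') measurable
  have "(\<integral>\<^sup>+t. u t * ennreal (poisson_kernel e t) * indicator {-\<eta><..<\<eta>} t \<partial>lborel)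
      = (\<integral>\<^sup>+z. \<integral>\<^sup>+t. u t * (if S z t then 1 else 0) \<partial>lborel \<partial>lborel)"
    by (rule swap) fact
  also have "\<dots> \<le> (\<integral>\<^sup>+z. \<integral>\<^sup>+t. C * (if S z t then 1 else 0) \<partial>lborel \<partial>lborel)"
  proof (rule nn_integral_mono)
    fix z
    define w where "w = e / (pi * z) - e\<^sup>2"
    show "(\<integral>\<^sup>+t. u t * (if S z t then 1 else 0) \<partial>lborel) \<le> (\<integral>\<^sup>+t. C * (if S z t then 1 else 0) \<partial>lborel)"
    proof (cases "z > 0 \<and> w > 0")
      case False
      have "\<not> S z t" for t
      proof
        assume "S z t"
        then have "z > 0" "t\<^sup>2 < w" using poisson_kernel_gt_iff[OF e, of z t] by (auto simp: S_def w_def)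
        then show False using False zero_le_power2[of t] by linarith
      qed
      then show ?thesis by simp
    next
      case True
      define r where "r = min \<eta> (sqrt w)"
      have r: "0 < r" "r \<le> \<eta>" using True \<eta> by (auto simp: r_def)
      have S: "S z t \<longleftrightarrow> t \<in> {-r<..<r}" for t
      proof -
        have "t\<^sup>2 < w \<longleftrightarrow> \<bar>t\<bar> < sqrt w"
          using True real_less_rsqrt real_sqrt_less_iff[of "t\<^sup>2" w] by simp
        then show ?thesis using poisson_kernel_gt_iff[OF e, of z t] True by (auto simp: S_def w_def r_def)
      qed
      have "(\<integral>\<^sup>+t. u t * (if S z t then 1 else 0) \<partial>lborel) = (\<integral>\<^sup>+t. u t * indicator {-r<..<r} t \<partial>lborel)"
        unfolding S by (intro nn_integral_cong) (auto simp: indicator_def)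
      also have "\<dots> \<le> ennreal (2 * r) * C" by (rule avg[OF r])
      also have "\<dots> = C * emeasure lborel {-r<..<r}" using r by (simp add: mult.commute)
      also have "\<dots> = (\<integral>\<^sup>+t. C * indicator {-r<..<r} t \<partial>lborel)" by (subst nn_integral_cmult_indicator) auto
      also have "\<dots> = (\<integral>\<^sup>+t. C * (if S z t then 1 else 0) \<partial>lborel)"
        unfolding S by (intro nn_integral_cong) (auto simp: indicator_def)
      finally show ?thesis .
    qed
  qed
  also have "\<dots> = (\<integral>\<^sup>+t. C * ennreal (poisson_kernel e t) * indicator {-\<eta><..<\<eta>} t \<partial>lborel)"
    by (rule swap[symmetric]) measurable
  also have "\<dots> \<le> (\<integral>\<^sup>+t. C * ennreal (poisson_kernel e t) \<partial>lborel)"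
    by (intro nn_integral_mono) (auto simp: indicator_def)
  also have "\<dots> = C" using poisson_kernel_nn_integral[OF e] by (subst nn_integral_cmult) auto
  finally show ?thesis .
qed

section \<open>Lebesgue points and truncated Hilbert transforms\<close>

(* Centres c and radii r are rational, and the constants are quantified over nat, so that the set
   of Lebesgue points is a countable combination of measurable sets. *)
definition lebesgue_pt :: "(real \<Rightarrow> real) \<Rightarrow> real \<Rightarrow> bool" where
  "lebesgue_pt g x \<longleftrightarrow> (\<forall>c\<in>\<rat>. \<forall>k::nat. \<exists>m::nat. \<forall>r\<in>\<rat>. 0 < r \<and> r < 1 / real (Suc m) \<longrightarrow>
     (\<integral>\<^sup>+t. ennreal \<bar>g (x + t) - c\<bar> * indicator {-r<..<r} t \<partial>lborel) \<le> ennreal (2 * r * (\<bar>g x - c\<bar> + 1 / real (Suc k))))"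

text \<open>The Lebesgue condition is known only for rational radii. A real radius is enlarged
  slightly to a rational one: the integral can only grow, and the right-hand side is continuous in
  the radius.\<close>

lemma nn_integral_Ioo_real_le:
  fixes u :: "real \<Rightarrow> ennreal"
  assumes [measurable]: "u \<in> borel_measurable lborel" and r: "0 < r" "r < \<eta>" and C: "C \<ge> 0"
    and avg: "\<And>r. r \<in> \<rat> \<Longrightarrow> 0 < r \<Longrightarrow> r < \<eta> \<Longrightarrow> (\<integral>\<^sup>+t. u t * indicator {-r<..<r} t \<partial>lborel) \<le> ennreal (2 * r * C)"
  shows "(\<integral>\<^sup>+t. u t * indicator {-r<..<r} t \<partial>lborel) \<le> ennreal (2 * r) * ennreal C"
proof (rule ccontr)
  assume "\<not> ?thesis"
  then have less: "ennreal (2 * r * C) < (\<integral>\<^sup>+t. u t * indicator {-r<..<r} t \<partial>lborel)" (is "_ < ?I")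
    using r C by (simp add: ennreal_mult[symmetric] not_le)
  obtain b where b: "ennreal (2 * r * C) < b" "b < ?I" using dense[OF less] by blast
  have bt: "b < top" using b(2) by (metis less_top order_less_le_trans top_greatest leD)
  define b' where "b' = enn2real b"
  have b': "ennreal b' = b" "2 * r * C < b'" 
  proof -
    show *: "ennreal b' = b" using bt by (simp add: b'_def)
    have "0 \<le> 2 * r * C" using r C by simp
    then show "2 * r * C < b'" using b(1) unfolding *[symmetric] by (simp only: ennreal_less_iff)
  qed
  \<comment> \<open>A strict gap below \<open>b'\<close> leaves room for a rational \<open>q\<close>
    beyond \<open>r\<close>; for \<open>C = 0\<close> every \<open>q\<close> fits.\<close>
  have "\<exists>q\<in>\<rat>. r < q \<and> q < \<eta> \<and> 2 * q * C \<le> b'"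
  proof (cases "C = 0")
    case True
    then show ?thesis using Rats_dense_in_real[OF r(2)] b' by auto
  next
    case False
    then have C: "C > 0" using assms by simp
    have "r < min \<eta> (b' / (2 * C))" using r b'(2) C by (simp add: field_simps)
    from Rats_dense_in_real[OF this] obtain q where "q \<in> \<rat>" "r < q" "q < \<eta>" "q < b' / (2*C)" by auto
    then show ?thesis using C by (intro bexI[of _ q]) (auto simp: field_simps)
  qed
  then obtain q where q: "q \<in> \<rat>" "r < q" "q < \<eta>" "2 * q * C \<le> b'" by blast
  have "?I \<le> (\<integral>\<^sup>+t. u t * indicator {-q<..<q} t \<partial>lborel)"
    using q by (intro nn_integral_mono) (auto simp: indicator_def)
  also have "\<dots> \<le> ennreal (2 * q * C)" using avg[of q] q r by simp
  also have "\<dots> \<le> b" using q(4) b'(1) by (metis ennreal_leI)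
  finally show False using b(2) by simp
qed

lemma AE_lebesgue_pt_shift_limit:
  fixes g :: "real \<Rightarrow> real"
  assumes [measurable]: "g \<in> borel_measurable lborel" and loc: "\<And>a b. set_integrable lborel {a..b} g"
  shows "AE x in lborel. \<forall>e>0. \<exists>d>0. \<forall>h. 0 < h \<and> h < d \<longrightarrow> \<bar>(\<integral>t. g t * indicator {x..x+h} t \<partial>lborel) / h - g x\<bar> < e"
proof -
  have hk: "(g integrable_on {a..b}) \<and> integral {a..b} g = (\<integral>t. g t * indicator {a..b} t \<partial>lborel)" for a b
    using set_borel_integral_eq_integral[OF loc[of a b]] by (simp add: set_lebesgue_integral_def mult.commute)
  have "\<And>a b. g integrable_on cbox a b" using hk by auto
  from integrable_ccontinuous_explicit[OF this] obtain N where N: "negligible N"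
    "\<And>x e. \<lbrakk>x \<notin> N; 0 < e\<rbrakk> \<Longrightarrow> \<exists>d>0. \<forall>h. 0 < h \<and> h < d \<longrightarrow>
                         norm(integral (cbox x (x + h *\<^sub>R One)) g /\<^sub>R h ^ DIM(real) - g x) < e" by metis
  have "AE x in lebesgue. x \<notin> N"
    using N(1) by (intro AE_not_in) (simp add: negligible_iff_null_sets)
  then have "AE x in lborel. x \<notin> N" by (simp add: AE_completion_iff)
  then show ?thesis
  proof (rule AE_mp, intro AE_I2 impI allI)
    fix x e :: real assume "x \<notin> N" "0 < e"
    then obtain d where d: "d > 0" "\<forall>h. 0 < h \<and> h < d \<longrightarrow> norm(integral (cbox x (x + h *\<^sub>R One)) g /\<^sub>R h ^ DIM(real) - g x) < e" using N(2) by blast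
    then show "\<exists>d>0. \<forall>h. 0 < h \<and> h < d \<longrightarrow> \<bar>(\<integral>t. g t * indicator {x..x+h} t \<partial>lborel) / h - g x\<bar> < e"
      using hk by (intro exI[of _ d]) (auto simp: divide_inverse mult.commute)
  qed
qed

text \<open>The differentiation theorem above yields averages over [x, x + h] only. It is applied to
  |g - c| and to its reflection, and the two halves are added. Rational \<open>c\<close> are
  countably many, so one null set serves for all of them.\<close>

lemma AE_lebesgue_pt:
  fixes g :: "real \<Rightarrow> real"
  assumes [measurable]: "g \<in> borel_measurable lborel" and loc: "\<And>a b. set_integrable lborel {a..b} g"
  shows "AE x in lborel. lebesgue_pt g x"
proof -
  define P where "P c x \<longleftrightarrow> (\<forall>e>0. \<exists>d>0. \<forall>r. 0 < r \<and> r < d \<longrightarrow>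
     (\<integral>\<^sup>+t. ennreal \<bar>g (x + t) - c\<bar> * indicator {-r<..<r} t \<partial>lborel) \<le> ennreal (2 * r * (\<bar>g x - c\<bar> + e)))" for c x
  have AEP: "AE x in lborel. P c x" for c
  proof -
    let ?u = "\<lambda>t. \<bar>g t - c\<bar>"
    have lu: "set_integrable lborel {a..b} ?u" for a b
    proof -
      have "set_integrable lborel {a..b} (\<lambda>t. c)" by (intro borel_integrable_atLeastAtMost' continuous_intros)
      with loc[of a b] have "set_integrable lborel {a..b} (\<lambda>t. g t - c)" by (rule set_integral_diff)
      then show ?thesis by (rule set_integrable_abs)
    qed
    have lu': "set_integrable lborel {a..b} (\<lambda>t. ?u (- t))" for a b
    proof -
      have "integrable lborel (\<lambda>t. indicator {-b..-a} (0 + (-1) * t) *\<^sub>R ?u (0 + (-1) * t))"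
        using lborel_integrable_real_affine[OF lu[of "-b" "-a", unfolded set_integrable_def], of "-1" 0] by simp
      also have "(\<lambda>t. indicator {-b..-a} (0 + (-1) * t) *\<^sub>R ?u (0 + (-1) * t)) = (\<lambda>t. indicator {a..b} t *\<^sub>R ?u (- t))"
        by (auto simp: indicator_def)
      finally show ?thesis by (simp add: set_integrable_def)
    qed
    have A: "AE x in lborel. \<forall>e>0. \<exists>d>0. \<forall>h. 0 < h \<and> h < d \<longrightarrow> \<bar>(\<integral>t. ?u t * indicator {x..x+h} t \<partial>lborel) / h - ?u x\<bar> < e"
      by (intro AE_lebesgue_pt_shift_limit lu) measurable
    have B: "AE x in lborel. \<forall>e>0. \<exists>d>0. \<forall>h. 0 < h \<and> h < d \<longrightarrow> \<bar>(\<integral>t. ?u (- t) * indicator {x..x+h} t \<partial>lborel) / h - ?u (- x)\<bar> < e"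
      by (rule AE_lebesgue_pt_shift_limit[of "\<lambda>t. ?u (- t)", OF _ lu']) measurable
    have B': "AE x in lborel. \<forall>e>0. \<exists>d>0. \<forall>h. 0 < h \<and> h < d \<longrightarrow> \<bar>(\<integral>t. ?u (- t) * indicator {-x..-x+h} t \<partial>lborel) / h - ?u x\<bar> < e"
    proof -
      have "AE x in distr lborel borel uminus. \<forall>e>0. \<exists>d>0. \<forall>h. 0 < h \<and> h < d \<longrightarrow> \<bar>(\<integral>t. ?u (- t) * indicator {x..x+h} t \<partial>lborel) / h - ?u (- x)\<bar> < e"
        by (subst lborel_distr_uminus) (rule B)
      from AE_distrD[OF _ this] show ?thesis by simp
    qed
    show ?thesis using A B'
    proof eventually_elim
      case (elim x)
      show "P c x" unfolding P_def
      proof (intro allI impI)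
        fix e :: real assume e: "e > 0"
        from elim(1)[rule_format, OF e] obtain d1 where d1: "d1 > 0" "\<And>h. 0 < h \<Longrightarrow> h < d1 \<Longrightarrow> \<bar>(\<integral>t. ?u t * indicator {x..x+h} t \<partial>lborel) / h - ?u x\<bar> < e" by blast
        from elim(2)[rule_format, OF e] obtain d2 where d2: "d2 > 0" "\<And>h. 0 < h \<Longrightarrow> h < d2 \<Longrightarrow> \<bar>(\<integral>t. ?u (- t) * indicator {-x..-x+h} t \<partial>lborel) / h - ?u x\<bar> < e" by blast
        show "\<exists>d>0. \<forall>r. 0 < r \<and> r < d \<longrightarrow>
          (\<integral>\<^sup>+t. ennreal \<bar>g (x + t) - c\<bar> * indicator {-r<..<r} t \<partial>lborel) \<le> ennreal (2 * r * (\<bar>g x - c\<bar> + e))"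
        proof (intro exI[of _ "min d1 d2"] conjI allI impI)
          show "min d1 d2 > 0" using d1 d2 by simp
          fix r assume r: "0 < r \<and> r < min d1 d2"
          have I1: "(\<integral>t. ?u t * indicator {x..x+r} t \<partial>lborel) \<le> r * (?u x + e)"
          proof -
            have "(\<integral>t. ?u t * indicator {x..x+r} t \<partial>lborel) / r < ?u x + e" using d1(2)[of r] r by linarith
            then show ?thesis using r by (simp add: pos_divide_less_eq mult.commute)
          qed
          have I2: "(\<integral>t. ?u (- t) * indicator {-x..-x+r} t \<partial>lborel) \<le> r * (?u x + e)"
          proof -
            have "(\<integral>t. ?u (- t) * indicator {-x..-x+r} t \<partial>lborel) / r < ?u x + e" using d2(2)[of r] r by linarith
            then show ?thesis using r by (simp add: pos_divide_less_eq mult.commute)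
          qed
          have E1: "(\<integral>\<^sup>+t. ennreal (?u t * indicator {x..x+r} t) \<partial>lborel) = ennreal (\<integral>t. ?u t * indicator {x..x+r} t \<partial>lborel)"
            using lu[of x "x+r"] by (intro nn_integral_eq_integral) (auto simp: set_integrable_def mult.commute)
          have E2: "(\<integral>\<^sup>+t. ennreal (?u (- t) * indicator {-x..-x+r} t) \<partial>lborel) = ennreal (\<integral>t. ?u (- t) * indicator {-x..-x+r} t \<partial>lborel)"
            using lu'[of "-x" "-x+r"] by (intro nn_integral_eq_integral) (auto simp: set_integrable_def mult.commute)
          have F1: "(\<integral>\<^sup>+t. ennreal (?u t * indicator {x..x+r} t) \<partial>lborel) = (\<integral>\<^sup>+t. ennreal (?u (x + t)) * indicator {0..r} t \<partial>lborel)"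
            by (subst nn_integral_real_affine[where c=1 and t=x])
               (auto intro!: nn_integral_cong simp: indicator_def)
          have F2: "(\<integral>\<^sup>+t. ennreal (?u (- t) * indicator {-x..-x+r} t) \<partial>lborel) = (\<integral>\<^sup>+t. ennreal (?u (x + t)) * indicator {-r..0} t \<partial>lborel)"
            by (subst nn_integral_real_affine[where c="-1" and t="-x"])
               (auto intro!: nn_integral_cong simp: indicator_def)
          have "(\<integral>\<^sup>+t. ennreal \<bar>g (x + t) - c\<bar> * indicator {-r<..<r} t \<partial>lborel)
             \<le> (\<integral>\<^sup>+t. ennreal (?u (x + t)) * indicator {0..r} t + ennreal (?u (x + t)) * indicator {-r..0} t \<partial>lborel)"
            by (intro nn_integral_mono) (auto simp: indicator_def)
          also have "\<dots> = (\<integral>\<^sup>+t. ennreal (?u (x + t)) * indicator {0..r} t \<partial>lborel) + (\<integral>\<^sup>+t. ennreal (?u (x + t)) * indicator {-r..0} t \<partial>lborel)"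
            by (intro nn_integral_add) measurable
          also have "\<dots> \<le> ennreal (r * (?u x + e)) + ennreal (r * (?u x + e))"
            unfolding F1[symmetric] F2[symmetric] E1 E2 by (intro add_mono ennreal_leI I1 I2)
          also have "\<dots> = ennreal (2 * r * (\<bar>g x - c\<bar> + e))"
            using r e by (subst ennreal_plus[symmetric]) (auto simp: algebra_simps)
          finally show "(\<integral>\<^sup>+t. ennreal \<bar>g (x + t) - c\<bar> * indicator {-r<..<r} t \<partial>lborel) \<le> ennreal (2 * r * (\<bar>g x - c\<bar> + e))" .
        qed
      qed
    qed
  qed
  have "AE x in lborel. \<forall>c\<in>\<rat>. P c x"
    using AEP by (subst AE_ball_countable) (auto simp: countable_rat)
  then show ?thesis
  proof (rule AE_mp, intro AE_I2 impI)
    fix x assume H: "\<forall>c\<in>\<rat>. P c x"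
    show "lebesgue_pt g x" unfolding lebesgue_pt_def
    proof (intro ballI allI)
      fix c :: real and k :: nat assume "c \<in> \<rat>"
      then have "P c x" using H by blast
      moreover have "1 / real (Suc k) > 0" by simp
      ultimately obtain d where d: "d > 0" "\<forall>r. 0 < r \<and> r < d \<longrightarrow>
     (\<integral>\<^sup>+t. ennreal \<bar>g (x + t) - c\<bar> * indicator {-r<..<r} t \<partial>lborel) \<le> ennreal (2 * r * (\<bar>g x - c\<bar> + 1 / real (Suc k)))"
        unfolding P_def by blast
      obtain m where m: "1 / real (Suc m) < d" using nat_approx_posE[OF d(1)] by metis
      show "\<exists>m. \<forall>r\<in>\<rat>. 0 < r \<and> r < 1 / real (Suc m) \<longrightarrow>
        (\<integral>\<^sup>+t. ennreal \<bar>g (x + t) - c\<bar> * indicator {-r<..<r} t \<partial>lborel) \<le> ennreal (2 * r * (\<bar>g x - c\<bar> + 1 / real (Suc k)))"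
        using d m by (intro exI[of _ m]) auto
    qed
  qed
qed

lemma lebesgue_pt_shift: "lebesgue_pt (\<lambda>t. g (x + t)) y \<longleftrightarrow> lebesgue_pt g (x + y)"
  by (simp add: lebesgue_pt_def add.assoc)

section \<open>Kernel averages at a Lebesgue point\<close>

lemma integrable_mult_poisson:
  assumes "e > 0" "g \<in> borel_measurable lborel" "integrable lborel (\<lambda>t. (g t)\<^sup>2)"
  shows "integrable lborel (\<lambda>t. g t * poisson_kernel e t)"
  using assms by (intro integrable_mult_L2 poisson_kernel_sq_integrable) auto

lemma integrable_mult_conj:
  assumes "e > 0" "g \<in> borel_measurable lborel" "integrable lborel (\<lambda>t. (g t)\<^sup>2)"
  shows "integrable lborel (\<lambda>t. g t * conj_kernel e t)"
  using assms by (intro integrable_mult_L2 conj_kernel_sq_integrable) auto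

lemma inverse_square_tail_le:
  fixes \<eta> t :: real
  assumes \<eta>: "\<eta> > 0" and t: "\<eta> \<le> \<bar>t\<bar>"
  shows "1 / t\<^sup>2 \<le> (1 + 1 / \<eta>\<^sup>2) / (t\<^sup>2 + 1)"
proof -
  have t2: "\<eta>\<^sup>2 \<le> t\<^sup>2" using \<eta> t by (metis abs_le_square_iff abs_of_pos)
  have tp: "t\<^sup>2 > 0" "t\<^sup>2 + 1 > 0" using t \<eta> by (auto intro: add_nonneg_pos)
  have "1 \<le> t\<^sup>2 / \<eta>\<^sup>2" using t2 \<eta> by (simp add: pos_le_divide_eq)
  then have *: "t\<^sup>2 + 1 \<le> (1 + 1 / \<eta>\<^sup>2) * t\<^sup>2" by (simp add: algebra_simps)
  define K where "K = 1 + 1 / \<eta>\<^sup>2"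
  have "1 / t\<^sup>2 * (t\<^sup>2 + 1) \<le> K" using * tp by (simp add: K_def[symmetric] pos_divide_le_eq)
  then show ?thesis using tp by (simp add: K_def[symmetric] pos_le_divide_eq)
qed

text \<open>Away from 0 the kernel is \<open>e\<close> times a fixed integrable function, so tails
  vanish linearly in \<open>e\<close>.\<close>

lemma poisson_kernel_tail_le:
  assumes e: "e > 0" and \<eta>: "\<eta> > 0" and t: "\<eta> \<le> \<bar>t\<bar>"
  shows "poisson_kernel e t \<le> e * (1 + 1 / \<eta>\<^sup>2) * poisson_kernel 1 t"
proof -
  have tp: "t\<^sup>2 > 0" using t \<eta> by auto
  have "poisson_kernel e t \<le> e / (pi * t\<^sup>2)"
    unfolding poisson_kernel_def using tp e by (intro divide_left_mono mult_left_mono mult_pos_pos) (auto simp: sumsq_pos)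
  also have "\<dots> = e / pi * (1 / t\<^sup>2)" by simp
  also have "1 / t\<^sup>2 \<le> (1 + 1 / \<eta>\<^sup>2) / (t\<^sup>2 + 1)" by (rule inverse_square_tail_le[OF \<eta> t])
  then have "e / pi * (1 / t\<^sup>2) \<le> e / pi * ((1 + 1 / \<eta>\<^sup>2) / (t\<^sup>2 + 1))" using e by (intro mult_left_mono) auto
  also have "\<dots> = e * (1 + 1 / \<eta>\<^sup>2) * poisson_kernel 1 t" by (simp add: poisson_kernel_def)
  finally show ?thesis .
qed

text \<open>A rational \<open>c\<close> near \<open>g 0\<close> stands in for it, because the
  Lebesgue condition is stated for rational constants. Near 0 the layer-cake bound turns interval
  averages into Poisson averages; the rest is the linear tail.\<close>

lemma lebesgue_pt_poisson:
  assumes [measurable]: "g \<in> borel_measurable lborel" and g2: "integrable lborel (\<lambda>t. (g t)\<^sup>2)"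
    and leb: "lebesgue_pt g 0"
  shows "((\<lambda>e. \<integral>t. \<bar>g t - g 0\<bar> * poisson_kernel e t \<partial>lborel) \<longlongrightarrow> 0) (at_right 0)"
proof (rule tendstoI)
  fix K :: real assume K: "K > 0"
  \<comment> \<open>Of five shares, the part near 0 takes at most two, the replacement of
    \<open>g 0\<close> by \<open>c\<close> one, and the tail less than one.\<close>
  define \<kappa> where "\<kappa> = K / 5"
  have \<kappa>: "\<kappa> > 0" using K by (simp add: \<kappa>_def)
  obtain c where c: "c \<in> \<rat>" "\<bar>g 0 - c\<bar> < \<kappa>"
    using Rats_dense_in_real[of "g 0 - \<kappa>" "g 0 + \<kappa>"] \<kappa> by (auto simp: abs_less_iff)
  obtain k where k: "1 / real (Suc k) < \<kappa>" using nat_approx_posE[OF \<kappa>] by metis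
  obtain m where m: "\<And>r. r \<in> \<rat> \<Longrightarrow> 0 < r \<Longrightarrow> r < 1 / real (Suc m) \<Longrightarrow>
     (\<integral>\<^sup>+t. ennreal \<bar>g t - c\<bar> * indicator {-r<..<r} t \<partial>lborel) \<le> ennreal (2 * r * (\<bar>g 0 - c\<bar> + 1 / real (Suc k)))"
    using leb c(1) unfolding lebesgue_pt_def by (simp) blast
  define \<eta> where "\<eta> = 1 / real (Suc m) / 2"
  have \<eta>: "\<eta> > 0" "\<eta> < 1 / real (Suc m)" by (auto simp: \<eta>_def field_simps)
  define C where "C = \<bar>g 0 - c\<bar> + 1 / real (Suc k)"
  have C: "0 \<le> C" "C \<le> 2 * \<kappa>" using c k by (auto simp: C_def)
  have near: "(\<integral>\<^sup>+t. ennreal \<bar>g t - c\<bar> * ennreal (poisson_kernel e t) * indicator {-\<eta><..<\<eta>} t \<partial>lborel) \<le> ennreal C" if "e > 0" for e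
  proof (rule poisson_kernel_average_le[OF that _ \<eta>(1)])
    fix r assume r: "0 < r" "r \<le> \<eta>"
    show "(\<integral>\<^sup>+t. ennreal \<bar>g t - c\<bar> * indicator {-r<..<r} t \<partial>lborel) \<le> ennreal (2 * r) * ennreal C"
      by (rule nn_integral_Ioo_real_le[where \<eta> = "1 / real (Suc m)"]) (use r \<eta> C m in \<open>auto simp: C_def\<close>)
  qed measurable
  define T where "T = (\<integral>t. \<bar>g t - c\<bar> * poisson_kernel 1 t \<partial>lborel)"
  have ic: "integrable lborel (\<lambda>t. \<bar>g t - d\<bar> * poisson_kernel e t)" if "e > 0" for e d
  proof -
    have "integrable lborel (\<lambda>t. g t * poisson_kernel e t - d * poisson_kernel e t)"
      using integrable_mult_poisson[OF that _ g2] poisson_kernel_integral(1)[OF that] by auto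
    then have "integrable lborel (\<lambda>t. \<bar>g t * poisson_kernel e t - d * poisson_kernel e t\<bar>)" by (rule integrable_abs)
    then show ?thesis using poisson_kernel_nonneg[OF that] by (simp add: abs_mult left_diff_distrib[symmetric])
  qed
  have T0: "T \<ge> 0" unfolding T_def by (intro integral_nonneg_AE AE_I2) (simp add: poisson_kernel_nonneg)
  define L where "L = (1 + 1 / \<eta>\<^sup>2) * T"
  have L0: "L \<ge> 0" using T0 by (simp add: L_def)
  have bd: "(\<integral>t. \<bar>g t - g 0\<bar> * poisson_kernel e t \<partial>lborel) \<le> 3 * \<kappa> + e * L" if e: "e > 0" for e
  proof -
    let ?n = "\<lambda>t. \<bar>g t - c\<bar> * poisson_kernel e t * indicator {-\<eta><..<\<eta>} t"
    have in1: "integrable lborel ?n" by (rule integrable_real_mult_indicator[OF _ ic[OF e]]) simp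
    have n1: "(\<integral>t. ?n t \<partial>lborel) \<le> C"
    proof -
      have "ennreal (\<integral>t. ?n t \<partial>lborel) = (\<integral>\<^sup>+t. ennreal (?n t) \<partial>lborel)"
        using poisson_kernel_nonneg[OF e] by (intro nn_integral_eq_integral[symmetric] in1) auto
      also have "\<dots> = (\<integral>\<^sup>+t. ennreal \<bar>g t - c\<bar> * ennreal (poisson_kernel e t) * indicator {-\<eta><..<\<eta>} t \<partial>lborel)"
        using poisson_kernel_nonneg[OF e] by (intro nn_integral_cong) (auto simp: indicator_def ennreal_mult)
      also have "\<dots> \<le> ennreal C" by (rule near[OF e])
      finally show ?thesis using C by (simp add: ennreal_le_iff)
    qed
    have pw: "\<bar>g t - g 0\<bar> * poisson_kernel e t \<le> (?n t + (e * (1 + 1 / \<eta>\<^sup>2)) * (\<bar>g t - c\<bar> * poisson_kernel 1 t)) + \<kappa> * poisson_kernel e t" for t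
    proof -
      have "\<bar>g t - g 0\<bar> * poisson_kernel e t \<le> (\<bar>g t - c\<bar> + \<kappa>) * poisson_kernel e t"
        using c(2) by (intro mult_right_mono poisson_kernel_nonneg[OF e]) linarith
      moreover have "\<bar>g t - c\<bar> * poisson_kernel e t \<le> ?n t + (e * (1 + 1 / \<eta>\<^sup>2)) * (\<bar>g t - c\<bar> * poisson_kernel 1 t)"
      proof (cases "t \<in> {-\<eta><..<\<eta>}")
        case True
        then show ?thesis using e by (simp add: poisson_kernel_nonneg)
      next
        case False
        then have "\<eta> \<le> \<bar>t\<bar>" by auto
        from mult_left_mono[OF poisson_kernel_tail_le[OF e \<eta>(1) this], of "\<bar>g t - c\<bar>"] False
        show ?thesis by (simp add: mult_ac)
      qed
      ultimately show ?thesis by (simp add: algebra_simps)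
    qed
    have "(\<integral>t. \<bar>g t - g 0\<bar> * poisson_kernel e t \<partial>lborel) \<le> (\<integral>t. (?n t + (e * (1 + 1 / \<eta>\<^sup>2)) * (\<bar>g t - c\<bar> * poisson_kernel 1 t)) + \<kappa> * poisson_kernel e t \<partial>lborel)"
      using in1 ic poisson_kernel_integral(1)[OF e] e by (intro integral_mono pw) auto
    also have "\<dots> = (\<integral>t. ?n t \<partial>lborel) + (e * (1 + 1 / \<eta>\<^sup>2)) * T + \<kappa>"
      using in1 ic[of 1 c] poisson_kernel_integral[OF e] by (simp add: T_def)
    also have "\<dots> \<le> 3 * \<kappa> + e * L" using n1 C(2) by (simp add: L_def)
    finally show ?thesis .
  qed
  have "eventually (\<lambda>e::real. 0 < e \<and> e < \<kappa> / (L + 1)) (at_right 0)"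
    using \<kappa> L0 by (intro eventually_conj eventually_at_right_less eventually_at_rightI[of 0 "\<kappa> / (L+1)"]) auto
  then show "eventually (\<lambda>e. dist (\<integral>t. \<bar>g t - g 0\<bar> * poisson_kernel e t \<partial>lborel) 0 < K) (at_right 0)"
  proof eventually_elim
    case (elim e)
    have "e * L \<le> e * (L + 1)" using elim by simp
    also have "\<dots> < \<kappa>" using elim L0 by (simp add: pos_less_divide_eq)
    finally have "(\<integral>t. \<bar>g t - g 0\<bar> * poisson_kernel e t \<partial>lborel) < 4 * \<kappa>" using bd[of e] elim by linarith
    moreover have "(\<integral>t. \<bar>g t - g 0\<bar> * poisson_kernel e t \<partial>lborel) \<ge> 0"
      using elim by (intro integral_nonneg_AE AE_I2) (simp add: poisson_kernel_nonneg)
    ultimately show ?case using \<kappa> by (simp add: \<kappa>_def)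
  qed
qed

lemma lebesgue_pt_poisson_tendsto:
  assumes [measurable]: "g \<in> borel_measurable lborel" and g2: "integrable lborel (\<lambda>t. (g t)\<^sup>2)"
    and leb: "lebesgue_pt g 0"
  shows "((\<lambda>e. \<integral>t. g t * poisson_kernel e t \<partial>lborel) \<longlongrightarrow> g 0) (at_right 0)"
proof -
  have "((\<lambda>e. (\<integral>t. g t * poisson_kernel e t \<partial>lborel) - g 0) \<longlongrightarrow> 0) (at_right 0)"
  proof (rule Lim_null_comparison[OF _ lebesgue_pt_poisson[OF assms]])
    show "\<forall>\<^sub>F e in at_right 0. norm ((\<integral>t. g t * poisson_kernel e t \<partial>lborel) - g 0) \<le> (\<integral>t. \<bar>g t - g 0\<bar> * poisson_kernel e t \<partial>lborel)"
      using eventually_at_right_less[of 0]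
    proof eventually_elim
      case (elim e)
      note pi = poisson_kernel_integral[OF elim]
      have i: "integrable lborel (\<lambda>t. g t * poisson_kernel e t - g 0 * poisson_kernel e t)"
        using integrable_mult_poisson[OF elim _ g2] pi by auto
      have "(\<integral>t. g t * poisson_kernel e t \<partial>lborel) - g 0 = (\<integral>t. g t * poisson_kernel e t - g 0 * poisson_kernel e t \<partial>lborel)"
        using integrable_mult_poisson[OF elim _ g2] pi by simp
      also have "norm \<dots> \<le> (\<integral>t. norm (g t * poisson_kernel e t - g 0 * poisson_kernel e t) \<partial>lborel)"
        by (rule integral_norm_bound)
      also have "\<dots> = (\<integral>t. \<bar>g t - g 0\<bar> * poisson_kernel e t \<partial>lborel)"
        using poisson_kernel_nonneg[OF elim] by (intro Bochner_Integration.integral_cong) (auto simp: abs_mult left_diff_distrib[symmetric])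
      finally show ?case .
    qed
  qed
  from tendsto_add[OF this tendsto_const[of "g 0"]] show ?thesis by simp
qed

section \<open>Truncated integrals against conjugate Poisson averages\<close>

definition trunc_hilbert :: "(real \<Rightarrow> real) \<Rightarrow> real \<Rightarrow> real" where
  "trunc_hilbert g e = 1 / pi * (LINT t:{t. e < \<bar>t\<bar>}|lborel. g t / t)"

lemma integrable_trunc:
  fixes g :: "real \<Rightarrow> real"
  assumes [measurable]: "g \<in> borel_measurable lborel" and g2: "integrable lborel (\<lambda>t. (g t)\<^sup>2)" and e: "e > 0"
  shows "set_integrable lborel {t. e < \<bar>t\<bar>} (\<lambda>t. g t / t)"
proof -
  let ?k = "\<lambda>t::real. indicator {t. e < \<bar>t\<bar>} t / t :: real"
  have "integrable lborel (\<lambda>t. (?k t)\<^sup>2)"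
  proof (rule Bochner_Integration.integrable_bound)
    show "integrable lborel (\<lambda>t. pi * (1 + 1 / e\<^sup>2) * poisson_kernel 1 t)"
      using poisson_kernel_integral(1)[of 1] by simp
    show "AE t in lborel. norm ((?k t)\<^sup>2) \<le> norm (pi * (1 + 1 / e\<^sup>2) * poisson_kernel 1 t)"
    proof (rule AE_I2)
      fix t :: real
      show "norm ((?k t)\<^sup>2) \<le> norm (pi * (1 + 1 / e\<^sup>2) * poisson_kernel 1 t)"
      proof (cases "e < \<bar>t\<bar>")
        case True
        have "1 / t\<^sup>2 \<le> (1 + 1 / e\<^sup>2) / (t\<^sup>2 + 1)" using True by (intro inverse_square_tail_le e) simp
        also have "\<dots> = pi * (1 + 1 / e\<^sup>2) * poisson_kernel 1 t" by (simp add: poisson_kernel_def)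
        also have "\<dots> \<le> norm \<dots>" by simp
        finally show ?thesis using True by (simp add: power_divide)
      qed (simp add: poisson_kernel_nonneg)
    qed
  qed measurable
  from integrable_mult_L2[OF _ _ g2 this] have "integrable lborel (\<lambda>t. g t * ?k t)" by simp
  then show ?thesis by (simp add: set_integrable_def mult.commute)
qed

text \<open>Outside [-e, e] the difference is e^2/(pi t (t^2 + e^2)) with e/|t| < 1; inside only the
  conjugate kernel remains and |t| is at most \<open>e\<close>.\<close>

lemma trunc_kernel_diff_le:
  fixes e t :: real
  assumes e: "e > 0"
  shows "\<bar>indicator {t. e < \<bar>t\<bar>} t / (pi * t) - conj_kernel e t\<bar> \<le> poisson_kernel e t"
proof (cases "e < \<bar>t\<bar>")
  case True
  then have t: "t \<noteq> 0" using e by auto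
  have p: "t\<^sup>2 + e\<^sup>2 > 0" by (rule sumsq_pos[OF e])
  have "1 / (pi * t) - conj_kernel e t = e * (e / t) / (pi * (t\<^sup>2 + e\<^sup>2))"
    unfolding conj_kernel_def using t p by (simp add: divide_simps) (simp add: algebra_simps power2_eq_square)
  then have "\<bar>1 / (pi * t) - conj_kernel e t\<bar> = e * (e / \<bar>t\<bar>) / (pi * (t\<^sup>2 + e\<^sup>2))"
    using e p by (simp add: abs_mult)
  also have "\<dots> \<le> e * 1 / (pi * (t\<^sup>2 + e\<^sup>2))"
    using e p True by (intro divide_right_mono mult_left_mono) auto
  finally show ?thesis using True by (simp add: poisson_kernel_def)
next
  case False
  then show ?thesis unfolding conj_kernel_def poisson_kernel_def using e sumsq_pos[OF e, of t]
    by (simp add: divide_right_mono)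
qed

text \<open>The difference of the two kernels is odd, hence has integral 0, so \<open>g t\<close>
  may be replaced by \<open>g t - g 0\<close>. As it is dominated by the Poisson kernel,
  \<open>lebesgue_pt_poisson\<close> applies.\<close>

lemma lebesgue_pt_trunc:
  assumes [measurable]: "g \<in> borel_measurable lborel" and g2: "integrable lborel (\<lambda>t. (g t)\<^sup>2)"
    and leb: "lebesgue_pt g 0"
  shows "((\<lambda>e. trunc_hilbert g e - (\<integral>t. g t * conj_kernel e t \<partial>lborel)) \<longlongrightarrow> 0) (at_right 0)"
proof (rule Lim_null_comparison[OF _ lebesgue_pt_poisson[OF assms]])
  show "\<forall>\<^sub>F e in at_right 0. norm (trunc_hilbert g e - (\<integral>t. g t * conj_kernel e t \<partial>lborel)) \<le> (\<integral>t. \<bar>g t - g 0\<bar> * poisson_kernel e t \<partial>lborel)"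
    using eventually_at_right_less[of 0]
  proof eventually_elim
    case (elim e)
    let ?d = "\<lambda>t::real. indicator {t. e < \<bar>t\<bar>} t / (pi * t) - conj_kernel e t"
    have di: "integrable lborel ?d"
      by (rule Bochner_Integration.integrable_bound[OF poisson_kernel_integral(1)[OF elim]])
         (auto intro!: AE_I2 order_trans[OF trunc_kernel_diff_le[OF elim] abs_ge_self])
    have d0: "(\<integral>t. ?d t \<partial>lborel) = 0"
    proof -
      have "(\<integral>t. ?d t \<partial>lborel) = (\<integral>t. ?d (0 + (-1) * t) \<partial>lborel)"
        using lborel_integral_real_affine[of "-1" ?d 0] by simp
      also have "\<dots> = (\<integral>t. - ?d t \<partial>lborel)" by (intro Bochner_Integration.integral_cong) (auto simp: indicator_def)
      also have "\<dots> = - (\<integral>t. ?d t \<partial>lborel)" by (rule Bochner_Integration.integral_minus)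
      finally show ?thesis by simp
    qed
    have i1: "integrable lborel (\<lambda>t. g t * conj_kernel e t)" by (rule integrable_mult_conj[OF elim _ g2]) simp
    have i2: "integrable lborel (\<lambda>t. g t * (indicator {t. e < \<bar>t\<bar>} t / (pi * t)))"
      using integrable_mult_right[OF integrable_trunc[OF _ g2 elim, unfolded set_integrable_def], of "1/pi"]
      by (simp add: mult_ac)
    have id: "integrable lborel (\<lambda>t. g t * ?d t)"
      unfolding right_diff_distrib by (rule Bochner_Integration.integrable_diff[OF i2 i1])
    have "trunc_hilbert g e = (\<integral>t. g t * (indicator {t. e < \<bar>t\<bar>} t / (pi * t)) \<partial>lborel)"
      unfolding trunc_hilbert_def set_lebesgue_integral_def
      by (subst integral_mult_right_zero[symmetric]) (intro Bochner_Integration.integral_cong, auto)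
    then have "trunc_hilbert g e - (\<integral>t. g t * conj_kernel e t \<partial>lborel) = (\<integral>t. g t * ?d t \<partial>lborel)"
      using i1 i2 by (simp add: right_diff_distrib)
    also have "\<dots> = (\<integral>t. g t * ?d t \<partial>lborel) - (\<integral>t. g 0 * ?d t \<partial>lborel)"
      by (simp only: integral_mult_right_zero d0)
    also have "\<dots> = (\<integral>t. g t * ?d t - g 0 * ?d t \<partial>lborel)"
      by (rule Bochner_Integration.integral_diff[symmetric, OF id integrable_mult_right[OF di]])
    finally have eq: "trunc_hilbert g e - (\<integral>t. g t * conj_kernel e t \<partial>lborel) = (\<integral>t. g t * ?d t - g 0 * ?d t \<partial>lborel)" .
    have "norm (trunc_hilbert g e - (\<integral>t. g t * conj_kernel e t \<partial>lborel)) \<le> (\<integral>t. norm (g t * ?d t - g 0 * ?d t) \<partial>lborel)"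
      unfolding eq by (rule integral_norm_bound)
    also have "\<dots> \<le> (\<integral>t. \<bar>g t - g 0\<bar> * poisson_kernel e t \<partial>lborel)"
    proof (rule integral_mono)
      show "integrable lborel (\<lambda>t. norm (g t * ?d t - g 0 * ?d t))"
        by (intro integrable_norm Bochner_Integration.integrable_diff id integrable_mult_right[OF di])
      have "integrable lborel (\<lambda>t. g t * poisson_kernel e t - g 0 * poisson_kernel e t)"
        using integrable_mult_poisson[OF elim _ g2] poisson_kernel_integral[OF elim] by auto
      then have "integrable lborel (\<lambda>t. \<bar>g t * poisson_kernel e t - g 0 * poisson_kernel e t\<bar>)" by (rule integrable_abs)
      then show "integrable lborel (\<lambda>t. \<bar>g t - g 0\<bar> * poisson_kernel e t)"
        using poisson_kernel_nonneg[OF elim] by (simp add: abs_mult left_diff_distrib[symmetric])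
      fix t
      have "norm (g t * ?d t - g 0 * ?d t) = \<bar>g t - g 0\<bar> * \<bar>?d t\<bar>" by (simp only: left_diff_distrib[symmetric] abs_mult real_norm_def)
      also have "\<dots> \<le> \<bar>g t - g 0\<bar> * poisson_kernel e t" by (intro mult_left_mono trunc_kernel_diff_le[OF elim]) auto
      finally show "norm (g t * ?d t - g 0 * ?d t) \<le> \<bar>g t - g 0\<bar> * poisson_kernel e t" .
    qed
    finally show ?case .
  qed
qed

section \<open>Square-integrable functions\<close>

text \<open>The L^2 theory is developed for real functions; a complex function enters at the end
  through its real and imaginary parts.\<close>

definition sq_int :: "'a measure \<Rightarrow> ('a \<Rightarrow> real) \<Rightarrow> bool" where
  "sq_int M f \<longleftrightarrow> f \<in> borel_measurable M \<and> integrable M (\<lambda>x. (f x)\<^sup>2)"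

definition l2_ip :: "'a measure \<Rightarrow> ('a \<Rightarrow> real) \<Rightarrow> ('a \<Rightarrow> real) \<Rightarrow> real" where
  "l2_ip M f g = (\<integral>x. f x * g x \<partial>M)"

definition l2_nrm :: "'a measure \<Rightarrow> ('a \<Rightarrow> real) \<Rightarrow> real" where
  "l2_nrm M f = sqrt (\<integral>x. (f x)\<^sup>2 \<partial>M)"

lemma sq_int_measurable: "sq_int M f \<Longrightarrow> f \<in> borel_measurable M"
  by (simp add: sq_int_def)

lemma sq_int_mult: "sq_int M f \<Longrightarrow> sq_int M g \<Longrightarrow> integrable M (\<lambda>x. f x * g x)"
  unfolding sq_int_def by (intro integrable_mult_L2) auto

lemma sq_int_add: "sq_int M f \<Longrightarrow> sq_int M g \<Longrightarrow> sq_int M (\<lambda>x. f x + g x)"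
  using sq_int_mult[of M f g] by (auto simp: sq_int_def power2_sum mult.assoc)

lemma sq_int_cmult: "sq_int M f \<Longrightarrow> sq_int M (\<lambda>x. c * f x)"
  by (auto simp: sq_int_def power_mult_distrib)

lemma sq_int_diff: "sq_int M f \<Longrightarrow> sq_int M g \<Longrightarrow> sq_int M (\<lambda>x. f x - g x)"
  using sq_int_add[of M f "\<lambda>x. -1 * g x"] sq_int_cmult[of M g "-1"] by simp

lemma l2_nrm_nonneg: "0 \<le> l2_nrm M f"
  by (simp add: l2_nrm_def)

lemma l2_nrm_sq: "(l2_nrm M f)\<^sup>2 = (\<integral>x. (f x)\<^sup>2 \<partial>M)"
  by (simp add: l2_nrm_def)

lemma l2_ip_self: "l2_ip M f f = (l2_nrm M f)\<^sup>2"
  unfolding l2_nrm_sq by (simp add: l2_ip_def power2_eq_square)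

lemma l2_ip_commute: "l2_ip M f g = l2_ip M g f"
  by (simp add: l2_ip_def mult.commute)

lemma l2_ip_diff_left: "sq_int M f \<Longrightarrow> sq_int M g \<Longrightarrow> sq_int M h \<Longrightarrow> l2_ip M (\<lambda>x. f x - g x) h = l2_ip M f h - l2_ip M g h"
  by (simp add: l2_ip_def left_diff_distrib sq_int_mult)

lemma l2_ip_diff_right: "sq_int M f \<Longrightarrow> sq_int M g \<Longrightarrow> sq_int M h \<Longrightarrow> l2_ip M h (\<lambda>x. f x - g x) = l2_ip M h f - l2_ip M h g"
  using l2_ip_diff_left[of M f g h] by (simp add: l2_ip_commute)

lemma l2_nrm_diff_sq:
  assumes "sq_int M f" "sq_int M g"
  shows "(l2_nrm M (\<lambda>x. f x - g x))\<^sup>2 = (l2_nrm M f)\<^sup>2 + (l2_nrm M g)\<^sup>2 - 2 * l2_ip M f g"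
  using assms sq_int_mult[OF assms] unfolding l2_nrm_sq l2_ip_def sq_int_def by (simp add: power2_diff mult.assoc)

lemma l2_ip_cauchy_schwarz:
  assumes f: "sq_int M f" and g: "sq_int M g"
  shows "\<bar>l2_ip M f g\<bar> \<le> l2_nrm M f * l2_nrm M g"
proof -
  define a b c where "a = (l2_nrm M f)\<^sup>2" and "b = l2_ip M f g" and "c = (l2_nrm M g)\<^sup>2"
  have pos: "0 \<le> a - 2 * s * b + s\<^sup>2 * c" for s
  proof -
    have ip: "l2_ip M f (\<lambda>x. s * g x) = s * b" by (simp add: l2_ip_def b_def mult.left_commute)
    have "(l2_nrm M (\<lambda>x. s * g x))\<^sup>2 = s\<^sup>2 * c" by (simp add: l2_nrm_sq c_def power_mult_distrib)
    then show ?thesis using l2_nrm_diff_sq[OF f sq_int_cmult[OF g, of s]] zero_le_power2[of "l2_nrm M (\<lambda>x. f x - s * g x)"]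
      by (simp add: ip a_def mult_ac)
  qed
  have "b\<^sup>2 \<le> a * c"
  proof (cases "c = 0")
    case True
    have "b = 0"
    proof (rule ccontr)
      assume b: "b \<noteq> 0"
      \<comment> \<open>With \<open>c = 0\<close> the quadratic is linear in s, and this value of s
        makes it -1.\<close>
      have "0 \<le> a - 2 * ((a + 1) / (2 * b)) * b" using pos[of "(a + 1) / (2 * b)"] True by simp
      then show False using b by (simp add: field_simps)
    qed
    then show ?thesis by (simp add: a_def c_def)
  next
    case False
    then have c: "c > 0" by (simp add: c_def)
    have "0 \<le> a - 2 * (b / c) * b + (b / c)\<^sup>2 * c" by (rule pos)
    also have "\<dots> = a - b\<^sup>2 / c" using c by (simp add: field_simps power2_eq_square)
    finally have "b\<^sup>2 / c \<le> a" by simp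
    then show ?thesis using c by (simp add: pos_divide_le_eq)
  qed
  then have "b\<^sup>2 \<le> (l2_nrm M f * l2_nrm M g)\<^sup>2" by (simp add: a_def c_def power_mult_distrib)
  then have "\<bar>b\<bar> \<le> \<bar>l2_nrm M f * l2_nrm M g\<bar>" by (simp only: abs_le_square_iff)
  then show ?thesis by (simp add: b_def l2_nrm_nonneg)
qed

lemma l2_nrm_triangle:
  assumes f: "sq_int M f" and g: "sq_int M g"
  shows "l2_nrm M (\<lambda>x. f x + g x) \<le> l2_nrm M f + l2_nrm M g"
proof (rule power2_le_imp_le)
  have m: "l2_nrm M (\<lambda>x. -1 * g x) = l2_nrm M g" by (simp add: l2_nrm_def)
  have i: "l2_ip M f (\<lambda>x. -1 * g x) = - l2_ip M f g" by (simp add: l2_ip_def)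
  have "(l2_nrm M (\<lambda>x. f x + g x))\<^sup>2 = (l2_nrm M f)\<^sup>2 + (l2_nrm M g)\<^sup>2 + 2 * l2_ip M f g"
    using l2_nrm_diff_sq[OF f sq_int_cmult[OF g, of "-1"]] unfolding m i by simp
  then show "(l2_nrm M (\<lambda>x. f x + g x))\<^sup>2 \<le> (l2_nrm M f + l2_nrm M g)\<^sup>2"
    using l2_ip_cauchy_schwarz[OF f g] by (simp add: power2_sum)
qed (simp add: l2_nrm_nonneg)

lemma l2_nrm_minus_commute: "l2_nrm M (\<lambda>x. f x - g x) = l2_nrm M (\<lambda>x. g x - f x)"
  by (simp add: l2_nrm_def power2_commute)

lemma l2_nrm_triangle3:
  assumes "sq_int M f" "sq_int M g" "sq_int M h"
  shows "l2_nrm M (\<lambda>x. f x - h x) \<le> l2_nrm M (\<lambda>x. f x - g x) + l2_nrm M (\<lambda>x. g x - h x)"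
  using l2_nrm_triangle[OF sq_int_diff[OF assms(1,2)] sq_int_diff[OF assms(2,3)]] by simp

lemma l2_nrm_cong_AE:
  assumes "f \<in> borel_measurable M" "g \<in> borel_measurable M" "AE x in M. f x = g x"
  shows "l2_nrm M f = l2_nrm M g"
proof -
  have "(\<integral>x. (f x)\<^sup>2 \<partial>M) = (\<integral>x. (g x)\<^sup>2 \<partial>M)"
    using assms by (intro integral_cong_AE) auto
  then show ?thesis by (simp add: l2_nrm_def)
qed

lemma l2_ip_tendsto:
  assumes u: "sq_int M u" and w: "sq_int M w"
    and uk: "eventually (\<lambda>k. sq_int M (U k)) F" and wk: "eventually (\<lambda>k. sq_int M (W k)) F"
    and lu: "((\<lambda>k. l2_nrm M (\<lambda>x. U k x - u x)) \<longlongrightarrow> 0) F" and lw: "((\<lambda>k. l2_nrm M (\<lambda>x. W k x - w x)) \<longlongrightarrow> 0) F"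
  shows "((\<lambda>k. l2_ip M (U k) (W k)) \<longlongrightarrow> l2_ip M u w) F"
proof -
  let ?a = "\<lambda>k. l2_nrm M (\<lambda>x. U k x - u x)" and ?b = "\<lambda>k. l2_nrm M (\<lambda>x. W k x - w x)"
  have lim: "((\<lambda>k. ?a k * ?b k + ?a k * l2_nrm M w + l2_nrm M u * ?b k) \<longlongrightarrow> 0 * 0 + 0 * l2_nrm M w + l2_nrm M u * 0) F"
    by (intro tendsto_intros lu lw)
  have "((\<lambda>k. l2_ip M (U k) (W k) - l2_ip M u w) \<longlongrightarrow> 0) F"
  proof (rule Lim_null_comparison)
    show "((\<lambda>k. ?a k * ?b k + ?a k * l2_nrm M w + l2_nrm M u * ?b k) \<longlongrightarrow> 0) F" using lim by simp
    show "\<forall>\<^sub>F k in F. norm (l2_ip M (U k) (W k) - l2_ip M u w) \<le> ?a k * ?b k + ?a k * l2_nrm M w + l2_nrm M u * ?b k"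
      using uk wk
    proof eventually_elim
      case (elim k)
      have d: "sq_int M (\<lambda>x. U k x - u x)" "sq_int M (\<lambda>x. W k x - w x)" using elim u w by (auto intro: sq_int_diff)
      have "l2_ip M (U k) (W k) - l2_ip M u w = l2_ip M (\<lambda>x. U k x - u x) (\<lambda>x. W k x - w x)
          + l2_ip M (\<lambda>x. U k x - u x) w + l2_ip M u (\<lambda>x. W k x - w x)"
        using elim u w d by (simp add: l2_ip_diff_left l2_ip_diff_right)
      then show ?case using l2_ip_cauchy_schwarz[OF d] l2_ip_cauchy_schwarz[OF d(1) w] l2_ip_cauchy_schwarz[OF u d(2)]
        by simp
    qed
  qed
  from tendsto_add[OF this tendsto_const[of "l2_ip M u w"]] show ?thesis by simp
qed

lemma sq_int_nn_integral:
  assumes "sq_int M f" shows "(\<integral>\<^sup>+x. ennreal ((f x)\<^sup>2) \<partial>M) = ennreal ((l2_nrm M f)\<^sup>2)"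
  unfolding l2_nrm_sq using assms by (intro nn_integral_eq_integral) (auto simp: sq_int_def)

lemma sq_intI_nn:
  assumes [measurable]: "f \<in> borel_measurable M" and K: "K \<ge> 0" "(\<integral>\<^sup>+x. ennreal ((f x)\<^sup>2) \<partial>M) \<le> ennreal (K\<^sup>2)"
  shows "sq_int M f" "l2_nrm M f \<le> K"
proof -
  have "(\<integral>\<^sup>+x. ennreal ((f x)\<^sup>2) \<partial>M) < \<infinity>" using K(2) by (metis ennreal_less_top infinity_ennreal_def le_less_trans)
  then have "integrable M (\<lambda>x. (f x)\<^sup>2)" by (intro integrableI_nonneg) auto
  then show s: "sq_int M f" by (simp add: sq_int_def)
  have "(l2_nrm M f)\<^sup>2 \<le> K\<^sup>2" using K sq_int_nn_integral[OF s] by simp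
  then show "l2_nrm M f \<le> K" using K(1) by (rule power2_le_imp_le)
qed

section \<open>Completeness and truncation in L^2\<close>

lemma geometric_limit:
  fixes u :: "nat \<Rightarrow> real"
  assumes d: "\<And>k. \<bar>u (Suc k) - u k\<bar> \<le> c * (1/2) ^ k"
  shows "u \<longlonglongrightarrow> lim u" "\<bar>u k - lim u\<bar> \<le> 2 * c * (1/2) ^ k"
proof -
  have c: "c \<ge> 0" using d[of 0] by simp
  have b: "\<bar>u (k + j) - u k\<bar> \<le> 2 * c * (1/2) ^ k - 2 * c * (1/2) ^ (k + j)" for k j
  proof (induction j)
    case (Suc j)
    have "\<bar>u (k + Suc j) - u k\<bar> \<le> \<bar>u (Suc (k + j)) - u (k + j)\<bar> + \<bar>u (k + j) - u k\<bar>" by simp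
    also have "\<dots> \<le> c * (1/2) ^ (k + j) + (2 * c * (1/2) ^ k - 2 * c * (1/2) ^ (k + j))"
      by (intro add_mono d Suc)
    finally show ?case by simp
  qed simp
  have b': "\<bar>u (k + j) - u k\<bar> \<le> 2 * c * (1/2) ^ k" for k j
    using b[of k j] c by (smt (verit) mult_nonneg_nonneg zero_le_power divide_nonneg_nonneg)
  have "Cauchy u"
  proof (rule metric_CauchyI)
    fix e :: real assume e: "e > 0"
    have "(\<lambda>k. 2 * c * (1/2) ^ k) \<longlonglongrightarrow> 2 * c * 0" by (intro tendsto_intros LIMSEQ_realpow_zero) auto
    then have "eventually (\<lambda>k. 2 * c * (1/2) ^ k < e / 2) sequentially" using e by (intro order_tendstoD(2)[where y=0]) auto
    then obtain N where N: "2 * c * (1/2) ^ N < e / 2" by (auto simp: eventually_sequentially)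
    show "\<exists>N. \<forall>m\<ge>N. \<forall>n\<ge>N. dist (u m) (u n) < e"
    proof (intro exI[of _ N] allI impI)
      fix m n assume "N \<le> m" "N \<le> n"
      then have "\<bar>u m - u N\<bar> < e / 2" "\<bar>u n - u N\<bar> < e / 2"
        using b'[of N "m - N"] b'[of N "n - N"] N by auto
      then show "dist (u m) (u n) < e" unfolding dist_real_def by linarith
    qed
  qed
  then show L: "u \<longlonglongrightarrow> lim u" by (simp add: Cauchy_convergent_iff convergent_LIMSEQ_iff)
  have "(\<lambda>j. \<bar>u (k + j) - u k\<bar>) \<longlonglongrightarrow> \<bar>lim u - u k\<bar>"
    using LIMSEQ_ignore_initial_segment[OF L, of k] by (intro tendsto_intros) (simp add: add.commute)
  then have "\<bar>lim u - u k\<bar> \<le> 2 * c * (1/2) ^ k" using b'[of k] by (intro LIMSEQ_le_const2) auto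
  then show "\<bar>u k - lim u\<bar> \<le> 2 * c * (1/2) ^ k" by linarith
qed

(* The majorant S makes the convergence pointwise, so that it can later be transferred to almost every line. *)
lemma L2_complete:
  fixes u :: "nat \<Rightarrow> 'a \<Rightarrow> real"
  assumes u: "\<And>k. sq_int M (u k)" and d: "\<And>k. l2_nrm M (\<lambda>x. u (Suc k) x - u k x) \<le> (1/4) ^ k"
  obtains h S where "h \<in> borel_measurable M" "S \<in> borel_measurable M" "(\<integral>\<^sup>+x. S x \<partial>M) < \<infinity>"
    "\<And>x k. S x < \<infinity> \<Longrightarrow> ennreal ((u k x - h x)\<^sup>2) \<le> ennreal (4 * (1/4) ^ k) * S x"
proof
  note [measurable] = sq_int_measurable[OF u]
  \<comment> \<open>The factor 4^k is a compromise: the squared increments have integral at most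
    16^(-k), so the series still has a finite integral, while each term being at most
    \<open>S x\<close> forces pointwise decay like 2^(-k).\<close>
  define D where "D k x = 4 ^ k * (u (Suc k) x - u k x)\<^sup>2" for k x
  define S where "S x = (\<Sum>k. ennreal (D k x))" for x
  define h where "h x = lim (\<lambda>k. u k x)" for x
  show "h \<in> borel_measurable M" unfolding h_def by measurable
  have [measurable]: "D k \<in> borel_measurable M" for k unfolding D_def by measurable
  show "S \<in> borel_measurable M" unfolding S_def by measurable
  have "(\<integral>\<^sup>+x. S x \<partial>M) = (\<Sum>k. \<integral>\<^sup>+x. ennreal (D k x) \<partial>M)"
    unfolding S_def by (intro nn_integral_suminf) measurable
  also have "\<dots> \<le> (\<Sum>k. ennreal ((1/4) ^ k))"
  proof (intro suminf_le allI)
    fix k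
    have "(\<integral>\<^sup>+x. ennreal (D k x) \<partial>M) = (\<integral>\<^sup>+x. ennreal (4 ^ k) * ennreal ((u (Suc k) x - u k x)\<^sup>2) \<partial>M)"
      by (intro nn_integral_cong) (simp add: D_def ennreal_mult)
    also have "\<dots> = ennreal (4 ^ k) * ennreal ((l2_nrm M (\<lambda>x. u (Suc k) x - u k x))\<^sup>2)"
      using sq_int_nn_integral[OF sq_int_diff[OF u u]] by (subst nn_integral_cmult) auto
    also have "\<dots> = ennreal (4 ^ k * (l2_nrm M (\<lambda>x. u (Suc k) x - u k x))\<^sup>2)" by (simp add: ennreal_mult)
    also have "\<dots> \<le> ennreal (4 ^ k * ((1/4) ^ k)\<^sup>2)"
      by (intro ennreal_leI mult_left_mono power_mono d l2_nrm_nonneg) auto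
    also have "4 ^ k * ((1/4) ^ k)\<^sup>2 = (1/4 :: real) ^ k"
      by (simp add: power2_eq_square power_mult_distrib[symmetric])
    finally show "(\<integral>\<^sup>+x. ennreal (D k x) \<partial>M) \<le> ennreal ((1/4) ^ k)" .
  qed auto
  also have "\<dots> = ennreal (\<Sum>k. (1/4) ^ k)" by (intro suminf_ennreal2) (auto intro: summable_geometric)
  also have "\<dots> < \<infinity>" by simp
  finally show "(\<integral>\<^sup>+x. S x \<partial>M) < \<infinity>" .
  show "ennreal ((u k x - h x)\<^sup>2) \<le> ennreal (4 * (1/4) ^ k) * S x" if S: "S x < \<infinity>" for x k
  proof -
    define s where "s = enn2real (S x)"
    have s: "S x = ennreal s" "s \<ge> 0" using S by (auto simp: s_def)
    have D: "D k x \<le> s" for k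
    proof -
      have "ennreal (D k x) \<le> S x" unfolding S_def
        using sum_le_suminf[of "\<lambda>k. ennreal (D k x)" "{k}"] by simp
      then show ?thesis using s by (simp add: ennreal_le_iff)
    qed
    have "\<bar>u (Suc k) x - u k x\<bar> \<le> sqrt s * (1/2) ^ k" for k
    proof (rule power2_le_imp_le)
      have "\<bar>u (Suc k) x - u k x\<bar>\<^sup>2 * 4 ^ k \<le> s" using D[of k] by (simp add: D_def mult.commute)
      then have "\<bar>u (Suc k) x - u k x\<bar>\<^sup>2 \<le> s / 4 ^ k" by (simp add: pos_le_divide_eq)
      also have "\<dots> = (sqrt s * (1/2) ^ k)\<^sup>2"
      proof -
        have "((1/2) ^ k)\<^sup>2 = 1 / (4::real) ^ k" by (simp add: power2_eq_square power_mult_distrib[symmetric] power_divide)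
        then show ?thesis using s by (simp add: power_mult_distrib)
      qed
      finally show "\<bar>u (Suc k) x - u k x\<bar>\<^sup>2 \<le> (sqrt s * (1/2) ^ k)\<^sup>2" .
    qed (use s in auto)
    from geometric_limit(2)[OF this, of k] have "\<bar>u k x - h x\<bar>\<^sup>2 \<le> (2 * sqrt s * (1/2) ^ k)\<^sup>2"
      unfolding h_def by (intro power_mono) auto
    also have "\<dots> = 4 * (1/4) ^ k * s"
    proof -
      have "((1/2) ^ k)\<^sup>2 = (1/4::real) ^ k" by (simp add: power2_eq_square power_mult_distrib[symmetric])
      then show ?thesis using s by (simp add: power_mult_distrib)
    qed
    finally have "ennreal ((u k x - h x)\<^sup>2) \<le> ennreal (4 * (1/4) ^ k * s)" by (intro ennreal_leI) simp
    then show ?thesis using s by (simp add: ennreal_mult)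
  qed
qed

text \<open>The lower cutoff \<open>1 \<le> real m * \<bar>f x\<bar>\<close> gives |f| <= m f^2 on
  the support and so makes a square integrable function integrable. \<open>H\<close> will be built
  from heights, which confines the support.\<close>

definition level_trunc :: "('a \<Rightarrow> real) \<Rightarrow> nat \<Rightarrow> ('a \<Rightarrow> real) \<Rightarrow> 'a \<Rightarrow> real" where
  "level_trunc H m f x = (if \<bar>f x\<bar> \<le> real m \<and> 1 \<le> real m * \<bar>f x\<bar> \<and> H x \<le> real m then f x else 0)"

lemma level_trunc_measurable [measurable]:
  assumes [measurable]: "f \<in> borel_measurable M" "H \<in> borel_measurable M"
  shows "level_trunc H m f \<in> borel_measurable M"
  unfolding level_trunc_def by measurable

lemma abs_level_trunc_le: "\<bar>level_trunc H m f x\<bar> \<le> \<bar>f x\<bar>" "\<bar>level_trunc H m f x\<bar> \<le> real m"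
  by (auto simp: level_trunc_def)

lemma level_trunc_support: "level_trunc H m f x \<noteq> 0 \<Longrightarrow> H x \<le> real m"
  by (auto simp: level_trunc_def split: if_splits)

lemma level_trunc_eventually: "eventually (\<lambda>m. level_trunc H m f x = f x) sequentially"
proof (cases "f x = 0")
  case True
  then show ?thesis by (simp add: level_trunc_def)
next
  case False
  obtain N :: nat where N: "real N \<ge> max (max \<bar>f x\<bar> (1 / \<bar>f x\<bar>)) (H x)" using real_arch_simple by blast
  show ?thesis unfolding eventually_sequentially
  proof (intro exI[of _ N] allI impI)
    fix m assume "N \<le> m"
    then have m: "real N \<le> real m" by simp
    then have "1 / \<bar>f x\<bar> \<le> real m" "\<bar>f x\<bar> \<le> real m" "H x \<le> real m" using N by auto
    then show "level_trunc H m f x = f x" using False by (simp add: level_trunc_def pos_divide_le_eq)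
  qed
qed

lemma level_trunc_tendsto: "(\<lambda>m. level_trunc H m f x) \<longlonglongrightarrow> f x"
  using level_trunc_eventually[of H f x] by (rule tendsto_eventually)

lemma sq_int_level_trunc:
  assumes f: "sq_int M f" and [measurable]: "H \<in> borel_measurable M"
  shows "sq_int M (level_trunc H m f)" "integrable M (level_trunc H m f)"
    "l2_nrm M (level_trunc H m f) \<le> l2_nrm M f"
proof -
  note [measurable] = sq_int_measurable[OF f]
  have sq: "(level_trunc H m f x)\<^sup>2 \<le> (f x)\<^sup>2" for x
    using abs_level_trunc_le(1)[of H m f x] by (simp add: abs_le_square_iff)
  have i: "integrable M (\<lambda>x. (f x)\<^sup>2)" using f by (simp add: sq_int_def)
  show s: "sq_int M (level_trunc H m f)" unfolding sq_int_def
    using sq by (auto intro!: Bochner_Integration.integrable_bound[OF i])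
  show "integrable M (level_trunc H m f)"
  proof (rule Bochner_Integration.integrable_bound)
    show "integrable M (\<lambda>x. real m * (f x)\<^sup>2)" using i by simp
    show "AE x in M. norm (level_trunc H m f x) \<le> norm (real m * (f x)\<^sup>2)"
    proof (rule AE_I2)
      fix x
      have "1 \<le> real m * \<bar>f x\<bar> \<Longrightarrow> \<bar>f x\<bar> \<le> real m * (f x)\<^sup>2"
        using mult_right_mono[of 1 "real m * \<bar>f x\<bar>" "\<bar>f x\<bar>"] by (simp add: mult.assoc power2_eq_square)
      then show "norm (level_trunc H m f x) \<le> norm (real m * (f x)\<^sup>2)" by (auto simp: level_trunc_def)
    qed
  qed measurable
  have "(\<integral>x. (level_trunc H m f x)\<^sup>2 \<partial>M) \<le> (\<integral>x. (f x)\<^sup>2 \<partial>M)"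
    using s i sq by (intro integral_mono) (auto simp: sq_int_def)
  then show "l2_nrm M (level_trunc H m f) \<le> l2_nrm M f" by (simp add: l2_nrm_def)
qed

lemma level_trunc_L2_tendsto:
  assumes f: "sq_int M f" and [measurable]: "H \<in> borel_measurable M"
  shows "(\<lambda>m. l2_nrm M (\<lambda>x. level_trunc H m f x - f x)) \<longlonglongrightarrow> 0"
proof -
  note [measurable] = sq_int_measurable[OF f]
  have i: "integrable M (\<lambda>x. (f x)\<^sup>2)" using f by (simp add: sq_int_def)
  have "(\<lambda>m. \<integral>x. (level_trunc H m f x - f x)\<^sup>2 \<partial>M) \<longlonglongrightarrow> (\<integral>x. 0 \<partial>M)"
  proof (rule integral_dominated_convergence[where w = "\<lambda>x. (f x)\<^sup>2"])
    show "AE x in M. (\<lambda>m. (level_trunc H m f x - f x)\<^sup>2) \<longlonglongrightarrow> 0"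
    proof (rule AE_I2)
      fix x
      have "(\<lambda>m. (level_trunc H m f x - f x)\<^sup>2) \<longlonglongrightarrow> (f x - f x)\<^sup>2" by (intro tendsto_intros level_trunc_tendsto)
      then show "(\<lambda>m. (level_trunc H m f x - f x)\<^sup>2) \<longlonglongrightarrow> 0" by simp
    qed
    show "AE x in M. norm ((level_trunc H m f x - f x)\<^sup>2) \<le> (f x)\<^sup>2" for m
      by (auto simp: level_trunc_def)
  qed (use i in auto)
  then have "(\<lambda>m. sqrt (\<integral>x. (level_trunc H m f x - f x)\<^sup>2 \<partial>M)) \<longlonglongrightarrow> sqrt (\<integral>x. 0 \<partial>M)" by (intro tendsto_intros)
  then show ?thesis by (simp add: l2_nrm_def)
qed

text \<open>Inner products of kernel averages become double integrals of correlations, where the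
  kernels can be convolved. \<open>F\<close> and \<open>G\<close> are left general so that averages
  along different flows can be paired; the third claim is what permits the later change of variables
  in (t, s).\<close>

lemma gram_fubini:
  fixes F :: "real \<Rightarrow> 'a \<Rightarrow> real" and G :: "real \<Rightarrow> 'a \<Rightarrow> real"
  assumes "sigma_finite_measure M"
    and F [measurable]: "(\<lambda>p. F (fst p) (snd p)) \<in> borel_measurable (borel \<Otimes>\<^sub>M M)"
    and G [measurable]: "(\<lambda>p. G (fst p) (snd p)) \<in> borel_measurable (borel \<Otimes>\<^sub>M M)"
    and [measurable]: "k \<in> borel_measurable borel" "l \<in> borel_measurable borel"
    and fin: "(\<integral>\<^sup>+t. \<integral>\<^sup>+s. ennreal \<bar>k t * l s\<bar> * (\<integral>\<^sup>+x. ennreal \<bar>F t x * G s x\<bar> \<partial>M) \<partial>lborel \<partial>lborel) < \<infinity>"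
  shows "integrable M (\<lambda>x. (\<integral>t. F t x * k t \<partial>lborel) * (\<integral>s. G s x * l s \<partial>lborel))"
    and "(\<integral>x. (\<integral>t. F t x * k t \<partial>lborel) * (\<integral>s. G s x * l s \<partial>lborel) \<partial>M)
      = (\<integral>t. \<integral>s. k t * l s * (\<integral>x. F t x * G s x \<partial>M) \<partial>lborel \<partial>lborel)"
    and "integrable (lborel \<Otimes>\<^sub>M lborel) (\<lambda>(t, s). k t * l s * (\<integral>x. F t x * G s x \<partial>M))"
proof -
  interpret M: sigma_finite_measure M by fact
  interpret P: pair_sigma_finite "lborel \<Otimes>\<^sub>M lborel :: (real \<times> real) measure" M
    by (intro pair_sigma_finite.intro lborel_pair.sigma_finite_measure_axioms) fact
  have [measurable]: "(\<lambda>x. F (f x) (g x)) \<in> borel_measurable N" if "f \<in> borel_measurable N" "g \<in> N \<rightarrow>\<^sub>M M" for f g and N :: "'c measure"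
    using measurable_compose[OF measurable_Pair[OF that] F] by simp
  have [measurable]: "(\<lambda>x. G (f x) (g x)) \<in> borel_measurable N" if "f \<in> borel_measurable N" "g \<in> N \<rightarrow>\<^sub>M M" for f g and N :: "'c measure"
    using measurable_compose[OF measurable_Pair[OF that] G] by simp
  define h where "h p x = F (fst p) x * k (fst p) * (G (snd p) x * l (snd p))" for p x
  have [measurable]: "(\<lambda>(p, x). h p x) \<in> borel_measurable ((lborel \<Otimes>\<^sub>M lborel) \<Otimes>\<^sub>M M)"
    unfolding h_def by measurable
  have int: "integrable ((lborel \<Otimes>\<^sub>M lborel) \<Otimes>\<^sub>M M) (\<lambda>(p, x). h p x)"
  proof (rule integrableI_bounded)
    have "(\<integral>\<^sup>+z. ennreal (norm (case z of (p, x) \<Rightarrow> h p x)) \<partial>((lborel \<Otimes>\<^sub>M lborel) \<Otimes>\<^sub>M M))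
      = (\<integral>\<^sup>+p. \<integral>\<^sup>+x. ennreal \<bar>h p x\<bar> \<partial>M \<partial>(lborel \<Otimes>\<^sub>M lborel))"
      by (subst M.nn_integral_fst[symmetric]) (auto simp: case_prod_beta)
    also have "\<dots> = (\<integral>\<^sup>+t. \<integral>\<^sup>+s. \<integral>\<^sup>+x. ennreal \<bar>h (t, s) x\<bar> \<partial>M \<partial>lborel \<partial>lborel)"
      by (subst lborel.nn_integral_fst[symmetric]) auto
    also have "\<dots> = (\<integral>\<^sup>+t. \<integral>\<^sup>+s. ennreal \<bar>k t * l s\<bar> * (\<integral>\<^sup>+x. ennreal \<bar>F t x * G s x\<bar> \<partial>M) \<partial>lborel \<partial>lborel)"
      by (intro nn_integral_cong, subst nn_integral_cmult[symmetric])
         (auto simp: h_def abs_mult ennreal_mult[symmetric] mult_ac intro!: nn_integral_cong)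
    finally show "(\<integral>\<^sup>+z. ennreal (norm (case z of (p, x) \<Rightarrow> h p x)) \<partial>((lborel \<Otimes>\<^sub>M lborel) \<Otimes>\<^sub>M M)) < \<infinity>"
      using fin by simp
  qed measurable
  have e1: "(\<integral>x. h (t, s) x \<partial>M) = k t * l s * (\<integral>x. F t x * G s x \<partial>M)" for t s
    unfolding integral_mult_right_zero[symmetric] h_def by (intro Bochner_Integration.integral_cong) auto
  have i1: "integrable (lborel \<Otimes>\<^sub>M lborel) (\<lambda>p. \<integral>x. h p x \<partial>M)"
    using P.integrable_fst[OF int] .
  have "(\<lambda>p. \<integral>x. h p x \<partial>M) = (\<lambda>(t, s). k t * l s * (\<integral>x. F t x * G s x \<partial>M))" using e1 by auto
  with i1 show i1': "integrable (lborel \<Otimes>\<^sub>M lborel) (\<lambda>(t, s). k t * l s * (\<integral>x. F t x * G s x \<partial>M))" by simp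
  have e2: "AE x in M. (\<integral>p. h p x \<partial>(lborel \<Otimes>\<^sub>M lborel)) = (\<integral>t. F t x * k t \<partial>lborel) * (\<integral>s. G s x * l s \<partial>lborel)"
    using P.AE_integrable_snd[OF int]
  proof eventually_elim
    case (elim x)
    have "(\<integral>p. h p x \<partial>(lborel \<Otimes>\<^sub>M lborel)) = (\<integral>t. \<integral>s. h (t, s) x \<partial>lborel \<partial>lborel)"
      using elim by (intro lborel_pair.integral_fst'[symmetric]) simp
    also have "\<dots> = (\<integral>t. F t x * k t * (\<integral>s. G s x * l s \<partial>lborel) \<partial>lborel)"
      by (simp add: h_def)
    also have "\<dots> = (\<integral>t. F t x * k t \<partial>lborel) * (\<integral>s. G s x * l s \<partial>lborel)" by simp
    finally show ?case .
  qed
  have i2: "integrable M (\<lambda>x. \<integral>p. h p x \<partial>(lborel \<Otimes>\<^sub>M lborel))"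
    using P.integrable_snd[OF int] .
  have [measurable]: "(\<lambda>x. (\<integral>t. F t x * k t \<partial>lborel) * (\<integral>s. G s x * l s \<partial>lborel)) \<in> borel_measurable M" by measurable
  show "integrable M (\<lambda>x. (\<integral>t. F t x * k t \<partial>lborel) * (\<integral>s. G s x * l s \<partial>lborel))"
    using i2 e2 by (subst integrable_cong_AE[of _ _ "\<lambda>x. \<integral>p. h p x \<partial>(lborel \<Otimes>\<^sub>M lborel)"]) auto
  have "(\<integral>x. (\<integral>t. F t x * k t \<partial>lborel) * (\<integral>s. G s x * l s \<partial>lborel) \<partial>M) = (\<integral>x. \<integral>p. h p x \<partial>(lborel \<Otimes>\<^sub>M lborel) \<partial>M)"
    using e2 i2 by (intro integral_cong_AE) auto
  also have "\<dots> = (\<integral>p. \<integral>x. h p x \<partial>M \<partial>(lborel \<Otimes>\<^sub>M lborel))"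
    using P.Fubini_integral[OF int] .
  also have "\<dots> = (\<integral>t. \<integral>s. (\<integral>x. h (t, s) x \<partial>M) \<partial>lborel \<partial>lborel)"
    using i1 by (intro lborel_pair.integral_fst'[symmetric]) simp
  finally show "(\<integral>x. (\<integral>t. F t x * k t \<partial>lborel) * (\<integral>s. G s x * l s \<partial>lborel) \<partial>M)
      = (\<integral>t. \<integral>s. k t * l s * (\<integral>x. F t x * G s x \<partial>M) \<partial>lborel \<partial>lborel)" unfolding e1 .
qed

section \<open>Hilbert transforms along measure-preserving flows\<close>

(* The height ht decreases at unit speed along orbits. A function supported where ht is bounded has
   correlations of compact support, which makes the Fubini integrals below absolutely convergent. *)
locale measure_flow = sigma_finite_measure M for M :: "'a measure" +
  fixes A :: "real \<Rightarrow> 'a \<Rightarrow> 'a" and ht :: "'a \<Rightarrow> real"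
  assumes flow_measurable': "(\<lambda>p. A (fst p) (snd p)) \<in> borel \<Otimes>\<^sub>M M \<rightarrow>\<^sub>M M"
    and flow_distr: "distr M M (A t) = M"
    and flow_add: "x \<in> space M \<Longrightarrow> A s (A t x) = A (s + t) x"
    and flow_zero: "x \<in> space M \<Longrightarrow> A 0 x = x"
    and ht_measurable [measurable]: "ht \<in> borel_measurable M"
    and ht_flow: "x \<in> space M \<Longrightarrow> ht (A t x) = ht x - t"
begin

lemma flow_measurable [measurable (raw)]:
  "f \<in> borel_measurable N \<Longrightarrow> g \<in> N \<rightarrow>\<^sub>M M \<Longrightarrow> (\<lambda>x. A (f x) (g x)) \<in> N \<rightarrow>\<^sub>M M"
  using measurable_compose[OF measurable_Pair flow_measurable'] by simp

lemma flow_measurable_t [measurable]: "A t \<in> M \<rightarrow>\<^sub>M M"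
  by measurable

lemma flow_space: "x \<in> space M \<Longrightarrow> A t x \<in> space M"
  using measurable_space[OF flow_measurable_t] .

lemma nn_integral_flow:
  assumes [measurable]: "u \<in> borel_measurable M"
  shows "(\<integral>\<^sup>+x. u (A t x) \<partial>M) = (\<integral>\<^sup>+x. u x \<partial>M)"
  using nn_integral_distr[of "A t" M M u] by (simp add: flow_distr)

lemma integral_flow:
  fixes u :: "'a \<Rightarrow> real"
  assumes [measurable]: "u \<in> borel_measurable M"
  shows "(\<integral>x. u (A t x) \<partial>M) = (\<integral>x. u x \<partial>M)"
  using integral_distr[of "A t" M M u] by (simp add: flow_distr)

lemma integrable_flow:
  fixes u :: "'a \<Rightarrow> real"
  assumes [measurable]: "u \<in> borel_measurable M"
  shows "integrable M (\<lambda>x. u (A t x)) \<longleftrightarrow> integrable M u"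
  using integrable_distr_eq[of "A t" M M u] by (simp add: flow_distr)

section \<open>Passing between the space and almost every orbit\<close>

sublocale line: pair_sigma_finite "lborel :: real measure" M ..

text \<open>The exceptional set has the same measure as each of its preimages under
  \<open>A t\<close>. Averaging over t in [0, 1] and exchanging integrals expresses that measure by
  the times at which orbits lie in the set, and these are null for almost every orbit.\<close>

lemma AE_from_lines:
  assumes [measurable]: "Measurable.pred M P" and lines: "AE x in M. AE t in lborel. P (A t x)"
  shows "AE x in M. P x"
proof -
  define B where "B = {x \<in> space M. \<not> P x}"
  have [measurable]: "B \<in> sets M" unfolding B_def by measurable
  have "emeasure M B = (\<integral>\<^sup>+t. indicator {0..1::real} t * emeasure M B \<partial>lborel)"
    by (subst nn_integral_multc) auto
  also have "\<dots> = (\<integral>\<^sup>+t. indicator {0..1::real} t * (\<integral>\<^sup>+x. indicator B (A t x) \<partial>M) \<partial>lborel)"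
    by (intro nn_integral_cong arg_cong2[where f = times] refl, subst nn_integral_flow) auto
  also have "\<dots> = (\<integral>\<^sup>+t. \<integral>\<^sup>+x. indicator {0..1::real} t * indicator B (A t x) \<partial>M \<partial>lborel)"
    by (intro nn_integral_cong nn_integral_cmult[symmetric]) measurable
  also have "\<dots> = (\<integral>\<^sup>+x. \<integral>\<^sup>+t. indicator {0..1::real} t * indicator B (A t x) \<partial>lborel \<partial>M)"
    by (rule line.Fubini'[symmetric]) measurable
  also have "\<dots> = (\<integral>\<^sup>+x. 0 \<partial>M)"
  proof (rule nn_integral_cong_AE, rule AE_mp[OF lines], intro AE_I2 impI)
    fix x assume "AE t in lborel. P (A t x)"
    then have "AE t in lborel. indicator {0..1::real} t * indicator B (A t x) = (0::ennreal)"
      by eventually_elim (auto simp: B_def indicator_def)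
    then show "(\<integral>\<^sup>+t. indicator {0..1::real} t * indicator B (A t x) \<partial>lborel) = (0::ennreal)"
      using nn_integral_cong_AE[of "\<lambda>t. indicator {0..1::real} t * indicator B (A t x)" "\<lambda>_. 0" lborel] by simp
  qed
  finally have "emeasure M B = 0" by simp
  then show ?thesis unfolding B_def by (subst AE_iff_measurable[OF _ refl]) (auto simp: B_def)
qed

text \<open>An orbit integral over all times, integrated over the whole space, would count every
  point infinitely often. Restricted to starting points with height in [k, k + 1) it counts each
  point for exactly unit time, by the unit speed of \<open>ht\<close>, so the total is the integral
  of \<open>u\<close>.\<close>

lemma AE_line_finite:
  assumes [measurable]: "u \<in> borel_measurable M" and fin: "(\<integral>\<^sup>+x. u x \<partial>M) < (\<infinity>::ennreal)"
  shows "AE x in M. (\<integral>\<^sup>+t. u (A t x) \<partial>lborel) < \<infinity>"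
proof -
  have "AE x in M. \<forall>k::int. real_of_int k \<le> ht x \<and> ht x < real_of_int k + 1 \<longrightarrow> (\<integral>\<^sup>+t. u (A t x) \<partial>lborel) < \<infinity>"
  proof (subst AE_all_countable, intro allI)
    fix k :: int
    let ?I = "\<lambda>r. indicator {real_of_int k..<real_of_int k + 1} r :: ennreal"
    have "(\<integral>\<^sup>+x. \<integral>\<^sup>+t. ?I (ht x) * u (A t x) \<partial>lborel \<partial>M) = (\<integral>\<^sup>+t. \<integral>\<^sup>+x. ?I (ht x) * u (A t x) \<partial>M \<partial>lborel)"
      by (rule line.Fubini') measurable
    also have "\<dots> = (\<integral>\<^sup>+t. \<integral>\<^sup>+x. ?I (ht x + t) * u x \<partial>M \<partial>lborel)"
    proof (rule nn_integral_cong)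
      fix t :: real
      have "(\<integral>\<^sup>+x. ?I (ht x) * u (A t x) \<partial>M) = (\<integral>\<^sup>+x. ?I (ht (A t x) + t) * u (A t x) \<partial>M)"
        by (intro nn_integral_cong) (simp add: ht_flow)
      also have "\<dots> = (\<integral>\<^sup>+x. ?I (ht x + t) * u x \<partial>M)" by (rule nn_integral_flow) measurable
      finally show "(\<integral>\<^sup>+x. ?I (ht x) * u (A t x) \<partial>M) = (\<integral>\<^sup>+x. ?I (ht x + t) * u x \<partial>M)" .
    qed
    also have "\<dots> = (\<integral>\<^sup>+x. \<integral>\<^sup>+t. ?I (ht x + t) * u x \<partial>lborel \<partial>M)"
      by (rule line.Fubini'[symmetric]) measurable
    also have "\<dots> = (\<integral>\<^sup>+x. u x \<partial>M)"
    proof (rule nn_integral_cong)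
      fix x
      have "(\<integral>\<^sup>+t. ?I (ht x + t) * u x \<partial>lborel) = (\<integral>\<^sup>+t. ?I (ht x + t) \<partial>lborel) * u x"
        by (rule nn_integral_multc) measurable
      also have "(\<integral>\<^sup>+t. ?I (ht x + t) \<partial>lborel) = (\<integral>\<^sup>+t. indicator {real_of_int k - ht x..<real_of_int k + 1 - ht x} t \<partial>lborel)"
        by (intro nn_integral_cong) (auto simp: indicator_def)
      also have "\<dots> = 1" by simp
      finally show "(\<integral>\<^sup>+t. ?I (ht x + t) * u x \<partial>lborel) = u x" by simp
    qed
    finally have "(\<integral>\<^sup>+x. \<integral>\<^sup>+t. ?I (ht x) * u (A t x) \<partial>lborel \<partial>M) \<noteq> \<infinity>" using fin by simp
    then have "AE x in M. (\<integral>\<^sup>+t. ?I (ht x) * u (A t x) \<partial>lborel) \<noteq> \<infinity>"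
      by (rule nn_integral_PInf_AE[rotated]) measurable
    then show "AE x in M. real_of_int k \<le> ht x \<and> ht x < real_of_int k + 1 \<longrightarrow> (\<integral>\<^sup>+t. u (A t x) \<partial>lborel) < \<infinity>"
      by eventually_elim (auto simp: less_top)
  qed
  then show ?thesis
  proof (rule AE_mp, intro AE_I2 impI)
    fix x assume "\<forall>k::int. real_of_int k \<le> ht x \<and> ht x < real_of_int k + 1 \<longrightarrow> (\<integral>\<^sup>+t. u (A t x) \<partial>lborel) < \<infinity>"
    from spec[OF this, of "\<lfloor>ht x\<rfloor>"] show "(\<integral>\<^sup>+t. u (A t x) \<partial>lborel) < \<infinity>" by auto
  qed
qed

definition line_sq :: "('a \<Rightarrow> real) \<Rightarrow> 'a \<Rightarrow> bool" where
  "line_sq f x \<longleftrightarrow> integrable lborel (\<lambda>t. (f (A t x))\<^sup>2)"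

lemma AE_line_sq:
  assumes f: "sq_int M f" shows "AE x in M. line_sq f x"
proof -
  note [measurable] = sq_int_measurable[OF f]
  have "(\<integral>\<^sup>+x. ennreal ((f x)\<^sup>2) \<partial>M) < \<infinity>" by (simp add: sq_int_nn_integral[OF f])
  from AE_line_finite[OF _ this] have "AE x in M. (\<integral>\<^sup>+t. ennreal ((f (A t x))\<^sup>2) \<partial>lborel) < \<infinity>" by simp
  then show ?thesis
    by (rule AE_mp) (intro AE_I2 impI, auto simp: line_sq_def intro!: integrableI_nonneg)
qed

lemma line_measurable:
  assumes [measurable]: "f \<in> borel_measurable M" and "x \<in> space M"
  shows "(\<lambda>t. f (A t x)) \<in> borel_measurable lborel"
  using assms by measurable

lemma line_shift: "x \<in> space M \<Longrightarrow> f (A t (A s x)) = f (A (s + t) x)"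
  by (simp add: flow_add add.commute)

text \<open>Moving the starting point to \<open>A s x\<close> turns the condition at time 0 into the
  condition at time \<open>s\<close> on the orbit of \<open>x\<close>, where the one-dimensional
  theorem holds for almost every \<open>s\<close>.\<close>

lemma AE_line_lebesgue_pt:
  assumes f: "sq_int M f" shows "AE x in M. lebesgue_pt (\<lambda>t. f (A t x)) 0"
proof (rule AE_from_lines)
  note [measurable] = sq_int_measurable[OF f]
  show "Measurable.pred M (\<lambda>x. lebesgue_pt (\<lambda>t. f (A t x)) 0)"
    unfolding lebesgue_pt_def Rats_def ball_simps by measurable
  show "AE x in M. AE s in lborel. lebesgue_pt (\<lambda>t. f (A t (A s x))) 0"
    using AE_line_sq[OF f]
  proof (rule AE_mp[OF _ AE_I2], intro impI)
    fix x assume x: "x \<in> space M" and sq: "line_sq f x"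
    let ?g = "\<lambda>t. f (A t x)"
    have [measurable]: "?g \<in> borel_measurable lborel" by (intro line_measurable x) measurable
    have "AE s in lborel. lebesgue_pt ?g s"
    proof (rule AE_lebesgue_pt)
      fix a b
      have "integrable lborel (\<lambda>t. (indicator {a..b} t :: real) + (?g t)\<^sup>2)"
        using sq unfolding line_sq_def by (intro Bochner_Integration.integrable_add integrable_real_indicator) (auto simp: emeasure_lborel_Icc_eq)
      then show "set_integrable lborel {a..b} ?g" unfolding set_integrable_def
      proof (rule Bochner_Integration.integrable_bound)
        have "\<bar>r\<bar> \<le> 1 + r\<^sup>2" for r :: real
          using sum_squares_bound[of 1 "\<bar>r\<bar>"] by simp
        then show "AE t in lborel. norm (indicator {a..b} t *\<^sub>R ?g t) \<le> norm ((indicator {a..b} t :: real) + (?g t)\<^sup>2)"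
          by (intro AE_I2) (auto simp: indicator_def)
      qed measurable
    qed measurable
    then show "AE s in lborel. lebesgue_pt (\<lambda>t. f (A t (A s x))) 0"
      by eventually_elim (use x lebesgue_pt_shift[of "\<lambda>t. f (A t x)" _ 0] in \<open>simp add: line_shift\<close>)
  qed
qed

section \<open>Poisson averages along a flow\<close>

definition pois :: "('a \<Rightarrow> real) \<Rightarrow> real \<Rightarrow> 'a \<Rightarrow> real" where
  "pois f e x = (\<integral>t. f (A t x) * poisson_kernel e t \<partial>lborel)"

definition conjp :: "('a \<Rightarrow> real) \<Rightarrow> real \<Rightarrow> 'a \<Rightarrow> real" where
  "conjp f e x = (\<integral>t. f (A t x) * conj_kernel e t \<partial>lborel)"

lemma pois_measurable [measurable]:
  assumes [measurable]: "f \<in> borel_measurable M"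
  shows "pois f e \<in> borel_measurable M"
  unfolding pois_def by measurable

lemma conjp_measurable [measurable]:
  assumes [measurable]: "f \<in> borel_measurable M"
  shows "conjp f e \<in> borel_measurable M"
  unfolding conjp_def by measurable

definition corr :: "('a \<Rightarrow> real) \<Rightarrow> real \<Rightarrow> real" where
  "corr f y = (\<integral>x. f (A y x) * f x \<partial>M)"

lemma corr_measurable [measurable]:
  assumes [measurable]: "f \<in> borel_measurable M"
  shows "corr f \<in> borel_measurable borel"
  unfolding corr_def by measurable

lemma sq_int_flow: "sq_int M f \<Longrightarrow> sq_int M (\<lambda>x. f (A t x))"
  unfolding sq_int_def using integrable_flow[of "\<lambda>x. (f x)\<^sup>2" t] by auto

lemma l2_nrm_flow: "f \<in> borel_measurable M \<Longrightarrow> l2_nrm M (\<lambda>x. f (A t x)) = l2_nrm M f"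
  unfolding l2_nrm_def using integral_flow[of "\<lambda>x. (f x)\<^sup>2" t] by simp

lemma flow_corr_nn_le:
  assumes f: "sq_int M f"
  shows "(\<integral>\<^sup>+x. ennreal \<bar>f (A t x) * f (A s x)\<bar> \<partial>M) \<le> ennreal ((l2_nrm M f)\<^sup>2)"
proof -
  have i: "sq_int M (\<lambda>x. \<bar>f (A t x)\<bar>)" "sq_int M (\<lambda>x. \<bar>f (A s x)\<bar>)"
    using sq_int_flow[OF f] sq_int_measurable[OF f] by (auto simp: sq_int_def intro!: borel_measurable_abs)
  have n: "l2_nrm M (\<lambda>x. \<bar>f (A t x)\<bar>) = l2_nrm M f" for t
    using l2_nrm_flow[OF sq_int_measurable[OF f]] by (simp add: l2_nrm_def)
  have "(\<integral>\<^sup>+x. ennreal \<bar>f (A t x) * f (A s x)\<bar> \<partial>M) = (\<integral>\<^sup>+x. ennreal (\<bar>f (A t x)\<bar> * \<bar>f (A s x)\<bar>) \<partial>M)" by (simp add: abs_mult)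
  also have "\<dots> = ennreal (l2_ip M (\<lambda>x. \<bar>f (A t x)\<bar>) (\<lambda>x. \<bar>f (A s x)\<bar>))"
    unfolding l2_ip_def by (intro nn_integral_eq_integral sq_int_mult i) auto
  also have "\<dots> \<le> ennreal ((l2_nrm M f)\<^sup>2)"
    using l2_ip_cauchy_schwarz[OF i] n by (intro ennreal_leI) (simp add: power2_eq_square)
  finally show ?thesis .
qed

lemma abs_corr_le:
  assumes f: "sq_int M f" shows "\<bar>corr f y\<bar> \<le> (l2_nrm M f)\<^sup>2"
  using l2_ip_cauchy_schwarz[OF sq_int_flow[OF f, of y] f] l2_nrm_flow[OF sq_int_measurable[OF f], of y]
  by (simp add: corr_def l2_ip_def power2_eq_square)

lemma flow_corr_eq:
  assumes [measurable]: "f \<in> borel_measurable M"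
  shows "(\<integral>x. f (A t x) * f (A s x) \<partial>M) = corr f (t - s)"
proof -
  have "(\<integral>x. f (A t x) * f (A s x) \<partial>M) = (\<integral>x. f (A (t - s) (A s x)) * f (A s x) \<partial>M)"
    by (intro Bochner_Integration.integral_cong) (simp_all add: flow_add)
  also have "\<dots> = corr f (t - s)"
    unfolding corr_def by (rule integral_flow[where u = "\<lambda>x. f (A (t - s) x) * f x"]) measurable
  finally show ?thesis .
qed

text \<open>An average of isometric translates against a probability density, hence a contraction.
  Here the kernel is integrable, and the Gram integral converges for every square integrable
  \<open>f\<close>.\<close>

lemma pois_L2:
  assumes f: "sq_int M f" and e: "e > 0"
  shows "sq_int M (pois f e)" "l2_nrm M (pois f e) \<le> l2_nrm M f"
proof -
  note [measurable] = sq_int_measurable[OF f]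
  let ?K = "(l2_nrm M f)\<^sup>2" and ?p = "poisson_kernel e"
  have "(\<integral>\<^sup>+t. \<integral>\<^sup>+s. ennreal \<bar>?p t * ?p s\<bar> * (\<integral>\<^sup>+x. ennreal \<bar>f (A t x) * f (A s x)\<bar> \<partial>M) \<partial>lborel \<partial>lborel)
     \<le> (\<integral>\<^sup>+t. \<integral>\<^sup>+s. ennreal (?p t) * (ennreal (?p s) * ennreal ?K) \<partial>lborel \<partial>lborel)"
  proof (intro nn_integral_mono)
    fix t s
    show "ennreal \<bar>?p t * ?p s\<bar> * (\<integral>\<^sup>+x. ennreal \<bar>f (A t x) * f (A s x)\<bar> \<partial>M) \<le> ennreal (?p t) * (ennreal (?p s) * ennreal ?K)"
      using mult_left_mono[OF flow_corr_nn_le[OF f, of t s], of "ennreal \<bar>?p t * ?p s\<bar>"]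
      by (simp add: poisson_kernel_nonneg[OF e] ennreal_mult abs_mult mult.assoc)
  qed
  also have "\<dots> = (\<integral>\<^sup>+t. ennreal (?p t) * ennreal ?K \<partial>lborel)"
    by (intro nn_integral_cong) (simp add: nn_integral_cmult nn_integral_multc poisson_kernel_nn_integral[OF e])
  also have "\<dots> = ennreal ?K" by (simp add: nn_integral_multc poisson_kernel_nn_integral[OF e])
  finally have fin: "(\<integral>\<^sup>+t. \<integral>\<^sup>+s. ennreal \<bar>?p t * ?p s\<bar> * (\<integral>\<^sup>+x. ennreal \<bar>f (A t x) * f (A s x)\<bar> \<partial>M) \<partial>lborel \<partial>lborel) < \<infinity>"
    by (rule le_less_trans) simp
  note G = gram_fubini[where F = "\<lambda>t x. f (A t x)" and G = "\<lambda>t x. f (A t x)", OF sigma_finite_measure_axioms _ _ _ _ fin]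
  have "integrable M (\<lambda>x. pois f e x * pois f e x)" unfolding pois_def by (rule G(1)) measurable
  then show s: "sq_int M (pois f e)" by (simp add: sq_int_def power2_eq_square)
  have "(l2_nrm M (pois f e))\<^sup>2 = (\<integral>x. pois f e x * pois f e x \<partial>M)"
    unfolding l2_nrm_sq by (simp only: power2_eq_square)
  also have "\<dots> = (\<integral>t. \<integral>s. ?p t * ?p s * corr f (t - s) \<partial>lborel \<partial>lborel)"
    unfolding pois_def flow_corr_eq[OF sq_int_measurable[OF f], symmetric]
    by (rule G(2)) measurable
  also have "\<dots> \<le> (\<integral>t. ?p t * ?K \<partial>lborel)"
  proof (rule integral_mono')
    show "integrable lborel (\<lambda>t. ?p t * ?K)" using poisson_kernel_integral(1)[OF e] by simp
    fix t
    have "(\<integral>s. ?p t * ?p s * corr f (t - s) \<partial>lborel) = ?p t * (\<integral>s. ?p s * corr f (t - s) \<partial>lborel)"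
      by (simp add: mult.assoc)
    also have "\<dots> \<le> ?p t * (\<integral>s. ?p s * ?K \<partial>lborel)"
      using poisson_kernel_integral(1)[OF e] poisson_kernel_nonneg[OF e] abs_corr_le[OF f]
      by (intro mult_left_mono integral_mono') (auto intro!: mult_left_mono simp: abs_le_iff)
    finally show "(\<integral>s. ?p t * ?p s * corr f (t - s) \<partial>lborel) \<le> ?p t * ?K"
      by (simp add: poisson_kernel_integral[OF e])
  qed (simp add: poisson_kernel_nonneg[OF e])
  also have "\<dots> = ?K" by (simp add: poisson_kernel_integral[OF e])
  finally show "l2_nrm M (pois f e) \<le> l2_nrm M f" by (rule power2_le_imp_le) (rule l2_nrm_nonneg)
qed

lemma AE_pois_tendsto:
  assumes f: "sq_int M f"
  shows "AE x in M. ((\<lambda>e. pois f e x) \<longlongrightarrow> f x) (at_right 0)"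
  using AE_line_sq[OF f] AE_line_lebesgue_pt[OF f]
proof (rule AE_mp[OF AE_conjI], intro AE_I2 impI)
  fix x assume x: "x \<in> space M" and H: "line_sq f x \<and> lebesgue_pt (\<lambda>t. f (A t x)) 0"
  from lebesgue_pt_poisson_tendsto[OF line_measurable[OF sq_int_measurable[OF f] x]] H
  show "((\<lambda>e. pois f e x) \<longlongrightarrow> f x) (at_right 0)" by (simp add: line_sq_def pois_def flow_zero x)
qed

lemma pois_ip:
  assumes f: "sq_int M f" and e: "e > 0"
  shows "l2_ip M (pois f e) f = (\<integral>y. corr f y * poisson_kernel e y \<partial>lborel)"
proof -
  note [measurable] = sq_int_measurable[OF f]
  let ?K = "(l2_nrm M f)\<^sup>2" and ?p = "poisson_kernel e"
  have fin: "(\<integral>\<^sup>+z. ennreal (norm (case z of (t, x) \<Rightarrow> ?p t * (f (A t x) * f x))) \<partial>(lborel \<Otimes>\<^sub>M M)) < \<infinity>"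
  proof -
    have "(\<integral>\<^sup>+z. ennreal (norm (case z of (t, x) \<Rightarrow> ?p t * (f (A t x) * f x))) \<partial>(lborel \<Otimes>\<^sub>M M))
      = (\<integral>\<^sup>+t. \<integral>\<^sup>+x. ennreal \<bar>?p t * (f (A t x) * f x)\<bar> \<partial>M \<partial>lborel)"
      by (subst nn_integral_fst[symmetric]) (auto simp: case_prod_beta)
    also have "\<dots> = (\<integral>\<^sup>+t. ennreal (?p t) * (\<integral>\<^sup>+x. ennreal \<bar>f (A t x) * f x\<bar> \<partial>M) \<partial>lborel)"
      using poisson_kernel_nonneg[OF e]
      by (intro nn_integral_cong, subst nn_integral_cmult[symmetric]) (auto simp: abs_mult ennreal_mult)
    also have "\<dots> \<le> (\<integral>\<^sup>+t. ennreal (?p t) * ennreal ?K \<partial>lborel)"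
    proof (intro nn_integral_mono mult_left_mono)
      fix t
      have "(\<integral>\<^sup>+x. ennreal \<bar>f (A t x) * f x\<bar> \<partial>M) = (\<integral>\<^sup>+x. ennreal \<bar>f (A t x) * f (A 0 x)\<bar> \<partial>M)"
        by (intro nn_integral_cong) (simp add: flow_zero)
      then show "(\<integral>\<^sup>+x. ennreal \<bar>f (A t x) * f x\<bar> \<partial>M) \<le> ennreal ?K" using flow_corr_nn_le[OF f, of t 0] by simp
    qed auto
    also have "\<dots> = ennreal ?K" by (simp add: nn_integral_multc poisson_kernel_nn_integral[OF e])
    also have "\<dots> < \<infinity>" by simp
    finally show ?thesis .
  qed
  have int: "integrable (lborel \<Otimes>\<^sub>M M) (\<lambda>(t, x). ?p t * (f (A t x) * f x))"
    by (rule integrableI_bounded[OF _ fin]) measurable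
  have "l2_ip M (pois f e) f = (\<integral>x. \<integral>t. ?p t * (f (A t x) * f x) \<partial>lborel \<partial>M)"
    unfolding l2_ip_def pois_def
    by (intro Bochner_Integration.integral_cong refl, subst integral_mult_left_zero[symmetric])
       (intro Bochner_Integration.integral_cong, auto simp: mult_ac)
  also have "\<dots> = (\<integral>t. \<integral>x. ?p t * (f (A t x) * f x) \<partial>M \<partial>lborel)"
    by (rule line.Fubini_integral[OF int])
  also have "\<dots> = (\<integral>y. corr f y * ?p y \<partial>lborel)" by (simp add: corr_def mult.commute)
  finally show ?thesis .
qed

lemma pois_ip_tendsto:
  assumes f: "sq_int M f" and fi: "integrable M f" and B: "\<And>x. \<bar>f x\<bar> \<le> B"
  shows "((\<lambda>e. l2_ip M (pois f e) f) \<longlongrightarrow> (l2_nrm M f)\<^sup>2) (at_right 0)"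
  unfolding tendsto_at_iff_sequentially
proof (intro allI impI)
  note [measurable] = sq_int_measurable[OF f]
  fix X :: "nat \<Rightarrow> real" assume X: "\<forall>i. X i \<in> {0<..} - {0}" "X \<longlonglongrightarrow> 0"
  have "(\<lambda>i. \<integral>x. pois f (X i) x * f x \<partial>M) \<longlonglongrightarrow> (\<integral>x. f x * f x \<partial>M)"
  proof (rule integral_dominated_convergence[where w = "\<lambda>x. B * \<bar>f x\<bar>"])
    show "integrable M (\<lambda>x. B * \<bar>f x\<bar>)" using fi by auto
    show "AE x in M. (\<lambda>i. pois f (X i) x * f x) \<longlonglongrightarrow> f x * f x"
      using AE_pois_tendsto[OF f]
    proof eventually_elim
      case (elim x)
      then have "(\<lambda>i. pois f (X i) x) \<longlonglongrightarrow> f x"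
        using X unfolding tendsto_at_iff_sequentially comp_def by auto
      then show ?case by (intro tendsto_intros)
    qed
    show "AE x in M. norm (pois f (X i) x * f x) \<le> B * \<bar>f x\<bar>" for i
    proof (rule AE_I2)
      fix x assume x: "x \<in> space M"
      have e: "X i > 0" using X(1) by auto
      have B0: "B \<ge> 0" using B[of x] by linarith
      have "\<bar>pois f (X i) x\<bar> \<le> (\<integral>t. \<bar>f (A t x) * poisson_kernel (X i) t\<bar> \<partial>lborel)"
        unfolding pois_def by (rule integral_abs_bound)
      also have "\<dots> \<le> (\<integral>t. B * poisson_kernel (X i) t \<partial>lborel)"
        using poisson_kernel_integral(1)[OF e] poisson_kernel_nonneg[OF e] B B0
        by (intro integral_mono') (auto simp: abs_mult intro!: mult_right_mono)
      also have "\<dots> = B" by (simp add: poisson_kernel_integral[OF e])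
      finally show "norm (pois f (X i) x * f x) \<le> B * \<bar>f x\<bar>" by (simp add: abs_mult mult_right_mono)
    qed
  qed measurable
  then show "((\<lambda>e. l2_ip M (pois f e) f) \<circ> X) \<longlonglongrightarrow> (l2_nrm M f)\<^sup>2"
    by (simp add: l2_ip_self[symmetric] l2_ip_def comp_def)
qed

text \<open>Contractivity gives ||P_e f - f||^2 <= 2 ||f||^2 - 2 <P_e f, f>, so convergence of the
  inner products suffices.\<close>

lemma pois_L2_tendsto:
  assumes f: "sq_int M f" and fi: "integrable M f" and B: "\<And>x. \<bar>f x\<bar> \<le> B"
  shows "((\<lambda>e. l2_nrm M (\<lambda>x. pois f e x - f x)) \<longlongrightarrow> 0) (at_right 0)"
proof -
  let ?K = "(l2_nrm M f)\<^sup>2"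
  have lim: "((\<lambda>e. 2 * ?K - 2 * l2_ip M (pois f e) f) \<longlongrightarrow> 2 * ?K - 2 * ?K) (at_right 0)"
    by (intro tendsto_intros pois_ip_tendsto[OF assms])
  have "((\<lambda>e. (l2_nrm M (\<lambda>x. pois f e x - f x))\<^sup>2) \<longlongrightarrow> 0) (at_right 0)"
  proof (rule Lim_null_comparison)
    show "((\<lambda>e. 2 * ?K - 2 * l2_ip M (pois f e) f) \<longlongrightarrow> 0) (at_right 0)" using lim by simp
    show "\<forall>\<^sub>F e in at_right 0. norm ((l2_nrm M (\<lambda>x. pois f e x - f x))\<^sup>2) \<le> 2 * ?K - 2 * l2_ip M (pois f e) f"
      using eventually_at_right_less[of 0]
    proof eventually_elim
      case (elim e)
      have "(l2_nrm M (pois f e))\<^sup>2 \<le> ?K" by (intro power_mono pois_L2 f elim l2_nrm_nonneg)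
      then show ?case using l2_nrm_diff_sq[OF pois_L2(1)[OF f elim] f]
        unfolding real_norm_def abs_power2 by linarith
    qed
  qed
  then have "((\<lambda>e. sqrt ((l2_nrm M (\<lambda>x. pois f e x - f x))\<^sup>2)) \<longlongrightarrow> sqrt 0) (at_right 0)" by (intro tendsto_intros)
  then show ?thesis by (simp add: l2_nrm_nonneg)
qed

end

lemma l2_fatou:
  assumes u: "\<And>m. sq_int M (u m)" and K: "\<And>m. l2_nrm M (u m) \<le> K"
    and [measurable]: "v \<in> borel_measurable M" and lim: "AE x in M. (\<lambda>m. u m x) \<longlonglongrightarrow> v x"
  shows "sq_int M v" "l2_nrm M v \<le> K"
proof -
  note [measurable] = sq_int_measurable[OF u]
  have K0: "K \<ge> 0" using K[of 0] l2_nrm_nonneg[of M "u 0"] by linarith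
  have "(\<integral>\<^sup>+x. ennreal ((v x)\<^sup>2) \<partial>M) = (\<integral>\<^sup>+x. liminf (\<lambda>m. ennreal ((u m x)\<^sup>2)) \<partial>M)"
  proof (rule nn_integral_cong_AE, use lim in eventually_elim)
    case (elim x)
    have "(\<lambda>m. ennreal ((u m x)\<^sup>2)) \<longlonglongrightarrow> ennreal ((v x)\<^sup>2)" by (intro tendsto_intros tendsto_ennrealI elim)
    from lim_imp_Liminf[OF _ this] show ?case by simp
  qed
  also have "\<dots> \<le> liminf (\<lambda>m. \<integral>\<^sup>+x. ennreal ((u m x)\<^sup>2) \<partial>M)" by (intro nn_integral_liminf) measurable
  also have "\<dots> \<le> liminf (\<lambda>m. ennreal (K\<^sup>2))"
    by (intro Liminf_mono always_eventually allI) (auto simp: sq_int_nn_integral[OF u] intro!: ennreal_leI power_mono K l2_nrm_nonneg)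
  also have "\<dots> = ennreal (K\<^sup>2)" by (simp add: Liminf_const)
  finally have "(\<integral>\<^sup>+x. ennreal ((v x)\<^sup>2) \<partial>M) \<le> ennreal (K\<^sup>2)" .
  from sq_intI_nn[OF _ K0 this] show "sq_int M v" "l2_nrm M v \<le> K" by auto
qed

section \<open>Conjugate Poisson averages along a flow\<close>

lemma correlation_fubini:
  fixes k l \<rho> :: "real \<Rightarrow> real"
  assumes [measurable]: "k \<in> borel_measurable borel" "l \<in> borel_measurable borel" "\<rho> \<in> borel_measurable borel"
    and int: "integrable (lborel \<Otimes>\<^sub>M lborel) (\<lambda>(t, s). k t * l s * \<rho> (t - s))"
  shows "(\<integral>t. \<integral>s. k t * l s * \<rho> (t - s) \<partial>lborel \<partial>lborel) = (\<integral>y. \<rho> y * (\<integral>s. k (s + y) * l s \<partial>lborel) \<partial>lborel)"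
proof -
  let ?F = "\<lambda>s y. k (s + y) * l s * \<rho> y"
  have int2: "integrable (lborel \<Otimes>\<^sub>M lborel) (\<lambda>(s, y). ?F s y)"
  proof (rule integrableI_bounded)
    have "(\<integral>\<^sup>+z. ennreal (norm (case z of (s, y) \<Rightarrow> ?F s y)) \<partial>(lborel \<Otimes>\<^sub>M lborel)) = (\<integral>\<^sup>+s. \<integral>\<^sup>+y. ennreal \<bar>?F s y\<bar> \<partial>lborel \<partial>lborel)"
      by (subst lborel.nn_integral_fst[symmetric]) (auto simp: case_prod_beta)
    also have "\<dots> = (\<integral>\<^sup>+s. \<integral>\<^sup>+t. ennreal \<bar>k t * l s * \<rho> (t - s)\<bar> \<partial>lborel \<partial>lborel)"
    proof (rule nn_integral_cong)
      fix s :: real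
      show "(\<integral>\<^sup>+y. ennreal \<bar>?F s y\<bar> \<partial>lborel) = (\<integral>\<^sup>+t. ennreal \<bar>k t * l s * \<rho> (t - s)\<bar> \<partial>lborel)"
        by (subst nn_integral_real_affine[where c = 1 and t = s, of "\<lambda>t. ennreal \<bar>k t * l s * \<rho> (t - s)\<bar>"]) auto
    qed
    also have "\<dots> = (\<integral>\<^sup>+t. \<integral>\<^sup>+s. ennreal \<bar>k t * l s * \<rho> (t - s)\<bar> \<partial>lborel \<partial>lborel)"
      by (rule lborel_pair.Fubini') measurable
    also have "\<dots> = (\<integral>\<^sup>+z. ennreal (norm (case z of (t, s) \<Rightarrow> k t * l s * \<rho> (t - s))) \<partial>(lborel \<Otimes>\<^sub>M lborel))"
      by (subst lborel.nn_integral_fst[symmetric]) (auto simp: case_prod_beta)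
    also have "\<dots> < \<infinity>" using int by (simp add: integrable_iff_bounded)
    finally show "(\<integral>\<^sup>+z. ennreal (norm (case z of (s, y) \<Rightarrow> ?F s y)) \<partial>(lborel \<Otimes>\<^sub>M lborel)) < \<infinity>" .
  qed measurable
  have "(\<integral>t. \<integral>s. k t * l s * \<rho> (t - s) \<partial>lborel \<partial>lborel) = (\<integral>s. \<integral>t. k t * l s * \<rho> (t - s) \<partial>lborel \<partial>lborel)"
    by (rule lborel_pair.Fubini_integral[OF int, symmetric])
  also have "\<dots> = (\<integral>s. \<integral>y. ?F s y \<partial>lborel \<partial>lborel)"
  proof (rule Bochner_Integration.integral_cong[OF refl])
    fix s :: real
    show "(\<integral>t. k t * l s * \<rho> (t - s) \<partial>lborel) = (\<integral>y. ?F s y \<partial>lborel)"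
      by (subst lborel_integral_real_affine[where c = 1 and t = s]) auto
  qed
  also have "\<dots> = (\<integral>y. \<integral>s. ?F s y \<partial>lborel \<partial>lborel)"
    by (rule lborel_pair.Fubini_integral[OF int2, symmetric])
  also have "\<dots> = (\<integral>y. \<rho> y * (\<integral>s. k (s + y) * l s \<partial>lborel) \<partial>lborel)" by (simp add: mult.commute)
  finally show ?thesis .
qed

lemma conj_kernel_sq_nn_integral_finite:
  assumes "e > 0" shows "(\<integral>\<^sup>+t. ennreal ((conj_kernel e t)\<^sup>2) \<partial>lborel) < \<infinity>"
  using conj_kernel_sq_integrable[OF assms] by (subst nn_integral_eq_integral) auto

lemma abs_mult_le_sum_sq: "\<bar>a * b\<bar> \<le> a\<^sup>2 + (b::real)\<^sup>2"
proof -
  have "2 * (\<bar>a\<bar> * \<bar>b\<bar>) \<le> a\<^sup>2 + b\<^sup>2" using sum_squares_bound[of "\<bar>a\<bar>" "\<bar>b\<bar>"] by (simp add: mult.assoc)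
  moreover have "0 \<le> \<bar>a\<bar> * \<bar>b\<bar>" by simp
  ultimately show ?thesis unfolding abs_mult by linarith
qed

text \<open>The product of two conjugate kernels is not integrable over the plane. In the band |t -
  s| <= R it is: |a b| <= a^2 + b^2 leaves one square integrable factor, and the other variable runs
  over an interval of bounded length.\<close>

lemma conj_kernel_band_finite:
  assumes e: "e > 0" and d: "d > 0"
  shows "(\<integral>\<^sup>+t. \<integral>\<^sup>+s. ennreal \<bar>conj_kernel e t * conj_kernel d s\<bar> * indicator {-R..R} (t - s) \<partial>lborel \<partial>lborel) < \<infinity>"
proof -
  let ?a = "\<lambda>t. ennreal ((conj_kernel e t)\<^sup>2)" and ?b = "\<lambda>s. ennreal ((conj_kernel d s)\<^sup>2)"
  let ?I = "\<lambda>r. indicator {-R..R} r :: ennreal"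
  have len: "(\<integral>\<^sup>+s. ?I (t - s) \<partial>lborel) = ennreal (max 0 (2 * R))" for t
  proof -
    have "(\<integral>\<^sup>+s. ?I (t - s) \<partial>lborel) = (\<integral>\<^sup>+s. indicator {t-R..t+R} s \<partial>lborel)"
      by (intro nn_integral_cong) (auto simp: indicator_def)
    then show ?thesis by (auto simp: emeasure_lborel_Icc_eq)
  qed
  have len': "(\<integral>\<^sup>+t. ?I (t - s) \<partial>lborel) = ennreal (max 0 (2 * R))" for s
  proof -
    have "(\<integral>\<^sup>+t. ?I (t - s) \<partial>lborel) = (\<integral>\<^sup>+t. indicator {s-R..s+R} t \<partial>lborel)"
      by (intro nn_integral_cong) (auto simp: indicator_def)
    then show ?thesis by (auto simp: emeasure_lborel_Icc_eq)
  qed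
  have "(\<integral>\<^sup>+t. \<integral>\<^sup>+s. ennreal \<bar>conj_kernel e t * conj_kernel d s\<bar> * ?I (t - s) \<partial>lborel \<partial>lborel)
     \<le> (\<integral>\<^sup>+t. \<integral>\<^sup>+s. ?a t * ?I (t - s) + ?b s * ?I (t - s) \<partial>lborel \<partial>lborel)"
  proof (intro nn_integral_mono)
    fix t s
    have "ennreal \<bar>conj_kernel e t * conj_kernel d s\<bar> \<le> ?a t + ?b s"
      unfolding ennreal_plus[symmetric, OF zero_le_power2 zero_le_power2] by (intro ennreal_leI abs_mult_le_sum_sq)
    from mult_right_mono[OF this, of "?I (t - s)"]
    show "ennreal \<bar>conj_kernel e t * conj_kernel d s\<bar> * ?I (t - s) \<le> ?a t * ?I (t - s) + ?b s * ?I (t - s)"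
      by (simp add: distrib_right)
  qed
  also have "\<dots> = (\<integral>\<^sup>+t. (\<integral>\<^sup>+s. ?a t * ?I (t - s) \<partial>lborel) + (\<integral>\<^sup>+s. ?b s * ?I (t - s) \<partial>lborel) \<partial>lborel)"
    by (rule nn_integral_cong, rule nn_integral_add) measurable
  also have "\<dots> = (\<integral>\<^sup>+t. (\<integral>\<^sup>+s. ?a t * ?I (t - s) \<partial>lborel) \<partial>lborel) + (\<integral>\<^sup>+t. (\<integral>\<^sup>+s. ?b s * ?I (t - s) \<partial>lborel) \<partial>lborel)"
    by (rule nn_integral_add) measurable
  also have "(\<integral>\<^sup>+t. (\<integral>\<^sup>+s. ?b s * ?I (t - s) \<partial>lborel) \<partial>lborel) = (\<integral>\<^sup>+s. (\<integral>\<^sup>+t. ?b s * ?I (t - s) \<partial>lborel) \<partial>lborel)"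
    by (rule lborel_pair.Fubini') measurable
  also have "(\<integral>\<^sup>+t. (\<integral>\<^sup>+s. ?a t * ?I (t - s) \<partial>lborel) \<partial>lborel) = (\<integral>\<^sup>+t. ?a t \<partial>lborel) * ennreal (max 0 (2 * R))"
    by (simp add: nn_integral_cmult nn_integral_multc len)
  also have "(\<integral>\<^sup>+s. (\<integral>\<^sup>+t. ?b s * ?I (t - s) \<partial>lborel) \<partial>lborel) = (\<integral>\<^sup>+s. ?b s \<partial>lborel) * ennreal (max 0 (2 * R))"
    by (simp add: nn_integral_cmult nn_integral_multc len')
  also have "(\<integral>\<^sup>+t. ?a t \<partial>lborel) * ennreal (max 0 (2 * R)) + (\<integral>\<^sup>+s. ?b s \<partial>lborel) * ennreal (max 0 (2 * R)) < \<infinity>"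
    using conj_kernel_sq_nn_integral_finite[OF e] conj_kernel_sq_nn_integral_finite[OF d]
    by (auto simp: ennreal_mult_less_top)
  finally show ?thesis .
qed

text \<open>On one line, a Poisson average of conjugate Poisson averages is again a conjugate
  Poisson average, at the sum of the two scales. This will identify the Poisson averages of the
  limit function.\<close>

lemma poisson_conj_assoc:
  assumes d: "d > 0" and e: "e > 0" and [measurable]: "g \<in> borel_measurable lborel" and g2: "integrable lborel (\<lambda>t. (g t)\<^sup>2)"
  shows "(\<integral>t. (\<integral>s. g (s + t) * conj_kernel e s \<partial>lborel) * poisson_kernel d t \<partial>lborel) = (\<integral>y. g y * conj_kernel (e + d) y \<partial>lborel)"
proof -
  let ?F = "\<lambda>t y. poisson_kernel d t * (g y * conj_kernel e (y - t))"
  have gf: "(\<integral>\<^sup>+y. ennreal ((g y)\<^sup>2) \<partial>lborel) < \<infinity>" using g2 by (subst nn_integral_eq_integral) auto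
  define K where "K = (\<integral>\<^sup>+y. ennreal ((g y)\<^sup>2) \<partial>lborel) + (\<integral>\<^sup>+y. ennreal ((conj_kernel e y)\<^sup>2) \<partial>lborel)"
  have int: "integrable (lborel \<Otimes>\<^sub>M lborel) (\<lambda>(t, y). ?F t y)"
  proof (rule integrableI_bounded)
    have "(\<integral>\<^sup>+z. ennreal (norm (case z of (t, y) \<Rightarrow> ?F t y)) \<partial>(lborel \<Otimes>\<^sub>M lborel)) = (\<integral>\<^sup>+t. \<integral>\<^sup>+y. ennreal \<bar>?F t y\<bar> \<partial>lborel \<partial>lborel)"
      by (subst lborel.nn_integral_fst[symmetric]) (auto simp: case_prod_beta)
    also have "\<dots> \<le> (\<integral>\<^sup>+t. ennreal (poisson_kernel d t) * K \<partial>lborel)"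
    proof (rule nn_integral_mono)
      fix t :: real
      have "(\<integral>\<^sup>+y. ennreal \<bar>?F t y\<bar> \<partial>lborel) \<le> (\<integral>\<^sup>+y. ennreal (poisson_kernel d t) * (ennreal ((g y)\<^sup>2) + ennreal ((conj_kernel e (y - t))\<^sup>2)) \<partial>lborel)"
      proof (rule nn_integral_mono)
        fix y
        have "ennreal \<bar>?F t y\<bar> = ennreal (poisson_kernel d t) * ennreal \<bar>g y * conj_kernel e (y - t)\<bar>"
          using poisson_kernel_nonneg[OF d] by (simp add: abs_mult ennreal_mult)
        also have "\<dots> \<le> ennreal (poisson_kernel d t) * (ennreal ((g y)\<^sup>2) + ennreal ((conj_kernel e (y - t))\<^sup>2))"
          unfolding ennreal_plus[symmetric, OF zero_le_power2 zero_le_power2] by (intro mult_left_mono ennreal_leI abs_mult_le_sum_sq) auto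
        finally show "ennreal \<bar>?F t y\<bar> \<le> ennreal (poisson_kernel d t) * (ennreal ((g y)\<^sup>2) + ennreal ((conj_kernel e (y - t))\<^sup>2))" .
      qed
      also have "\<dots> = ennreal (poisson_kernel d t) * ((\<integral>\<^sup>+y. ennreal ((g y)\<^sup>2) \<partial>lborel) + (\<integral>\<^sup>+y. ennreal ((conj_kernel e (y - t))\<^sup>2) \<partial>lborel))"
        by (subst nn_integral_cmult) (auto simp: nn_integral_add)
      also have "(\<integral>\<^sup>+y. ennreal ((conj_kernel e (y - t))\<^sup>2) \<partial>lborel) = (\<integral>\<^sup>+y. ennreal ((conj_kernel e y)\<^sup>2) \<partial>lborel)"
        by (subst nn_integral_real_affine[where c = 1 and t = "-t", of "\<lambda>y. ennreal ((conj_kernel e y)\<^sup>2)"]) (auto simp: add.commute)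
      finally show "(\<integral>\<^sup>+y. ennreal \<bar>?F t y\<bar> \<partial>lborel) \<le> ennreal (poisson_kernel d t) * K" by (simp add: K_def)
    qed
    also have "\<dots> = K" by (simp add: nn_integral_multc poisson_kernel_nn_integral[OF d])
    also have "K < \<infinity>" using gf conj_kernel_sq_nn_integral_finite[OF e] by (simp add: K_def)
    finally show "(\<integral>\<^sup>+z. ennreal (norm (case z of (t, y) \<Rightarrow> ?F t y)) \<partial>(lborel \<Otimes>\<^sub>M lborel)) < \<infinity>" .
  qed measurable
  have "(\<integral>t. (\<integral>s. g (s + t) * conj_kernel e s \<partial>lborel) * poisson_kernel d t \<partial>lborel) = (\<integral>t. \<integral>y. ?F t y \<partial>lborel \<partial>lborel)"
  proof (rule Bochner_Integration.integral_cong[OF refl])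
    fix t :: real
    have "(\<integral>s. g (s + t) * conj_kernel e s \<partial>lborel) = (\<integral>y. g y * conj_kernel e (y - t) \<partial>lborel)"
      by (subst lborel_integral_real_affine[where c = 1 and t = t, of "\<lambda>y. g y * conj_kernel e (y - t)"]) (auto simp: add.commute)
    then show "(\<integral>s. g (s + t) * conj_kernel e s \<partial>lborel) * poisson_kernel d t = (\<integral>y. ?F t y \<partial>lborel)" by simp
  qed
  also have "\<dots> = (\<integral>y. \<integral>t. ?F t y \<partial>lborel \<partial>lborel)"
    by (rule lborel_pair.Fubini_integral[OF int, symmetric])
  also have "\<dots> = (\<integral>y. g y * (\<integral>t. poisson_kernel d t * conj_kernel e (y - t) \<partial>lborel) \<partial>lborel)"
    by (simp add: mult.left_commute)
  also have "\<dots> = (\<integral>y. g y * conj_kernel (e + d) y \<partial>lborel)"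
  proof (rule integral_cong_AE)
    show "AE y in lborel. g y * (\<integral>t. poisson_kernel d t * conj_kernel e (y - t) \<partial>lborel) = g y * conj_kernel (e + d) y"
      using AE_lborel_singleton[of 0] by eventually_elim (simp add: poisson_kernel_conv_conj_kernel[OF e d])
  qed measurable
  finally show ?thesis .
qed

lemma conj_kernel_shift_tendsto:
  assumes d: "d > 0" and [measurable]: "g \<in> borel_measurable lborel" and g2: "integrable lborel (\<lambda>t. (g t)\<^sup>2)"
    and \<epsilon>: "\<And>k. \<epsilon> k > 0" "\<epsilon> \<longlonglongrightarrow> 0"
  shows "(\<lambda>k. \<integral>y. g y * conj_kernel (\<epsilon> k + d) y \<partial>lborel) \<longlonglongrightarrow> (\<integral>y. g y * conj_kernel d y \<partial>lborel)"
proof (rule integral_dominated_convergence[where w = "\<lambda>y. \<bar>g y * conj_kernel d y\<bar>"])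
  show "integrable lborel (\<lambda>y. \<bar>g y * conj_kernel d y\<bar>)" using integrable_mult_conj[OF d _ g2] by auto
  show "AE y in lborel. (\<lambda>k. g y * conj_kernel (\<epsilon> k + d) y) \<longlonglongrightarrow> g y * conj_kernel d y"
  proof (rule AE_I2)
    fix y
    have "y\<^sup>2 + (0 + d)\<^sup>2 > 0" using sumsq_pos[OF d] by simp
    then have "(\<lambda>k. g y * (y / (pi * (y\<^sup>2 + (\<epsilon> k + d)\<^sup>2)))) \<longlonglongrightarrow> g y * (y / (pi * (y\<^sup>2 + (0 + d)\<^sup>2)))"
      by (intro tendsto_intros \<epsilon>) auto
    then show "(\<lambda>k. g y * conj_kernel (\<epsilon> k + d) y) \<longlonglongrightarrow> g y * conj_kernel d y" by (simp add: conj_kernel_def)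
  qed
  show "AE y in lborel. norm (g y * conj_kernel (\<epsilon> k + d) y) \<le> \<bar>g y * conj_kernel d y\<bar>" for k
  proof (rule AE_I2)
    fix y
    have p: "y\<^sup>2 + d\<^sup>2 > 0" "y\<^sup>2 + d\<^sup>2 \<le> y\<^sup>2 + (\<epsilon> k + d)\<^sup>2" using sumsq_pos[OF d] \<epsilon>(1)[of k] d by auto
    then have "\<bar>y\<bar> / (pi * (y\<^sup>2 + (\<epsilon> k + d)\<^sup>2)) \<le> \<bar>y\<bar> / (pi * (y\<^sup>2 + d\<^sup>2))"
      by (intro divide_left_mono mult_left_mono mult_pos_pos) auto
    then have "\<bar>conj_kernel (\<epsilon> k + d) y\<bar> \<le> \<bar>conj_kernel d y\<bar>" using p by (simp add: conj_kernel_def)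
    then show "norm (g y * conj_kernel (\<epsilon> k + d) y) \<le> \<bar>g y * conj_kernel d y\<bar>" by (simp add: abs_mult mult_left_mono)
  qed
qed measurable

context measure_flow
begin

text \<open>Two points of one orbit that both lie in the support are at most 2 R apart in time, so
  the Gram integral lives on a band. The substitution y = t - s then leaves the correlation of two
  conjugate kernels, a Poisson kernel.\<close>

lemma conjp_gram:
  assumes f: "sq_int M f" and R: "\<And>x. x \<in> space M \<Longrightarrow> f x \<noteq> 0 \<Longrightarrow> \<bar>ht x\<bar> \<le> R" and e: "e > 0" and d: "d > 0"
  shows "integrable M (\<lambda>x. conjp f e x * conjp f d x)"
    "l2_ip M (conjp f e) (conjp f d) = (\<integral>y. corr f y * poisson_kernel (e + d) y \<partial>lborel)"
proof -
  note [measurable] = sq_int_measurable[OF f]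
  let ?K = "(l2_nrm M f)\<^sup>2" and ?q = "conj_kernel e" and ?r = "conj_kernel d"
  have supp: "(\<integral>\<^sup>+x. ennreal \<bar>f (A t x) * f (A s x)\<bar> \<partial>M) \<le> indicator {-(2*R)..2*R} (t - s) * ennreal ?K" for t s
  proof (cases "t - s \<in> {-(2*R)..2*R}")
    case True
    then show ?thesis using flow_corr_nn_le[OF f, of t s] by simp
  next
    case False
    have "f (A t x) * f (A s x) = 0" if x: "x \<in> space M" for x
    proof (rule ccontr)
      assume "f (A t x) * f (A s x) \<noteq> 0"
      then have "\<bar>ht x - t\<bar> \<le> R" "\<bar>ht x - s\<bar> \<le> R" using R[of "A t x"] R[of "A s x"] flow_space[OF x] ht_flow[OF x] by auto
      then show False using False by auto
    qed
    then have "(\<integral>\<^sup>+x. ennreal \<bar>f (A t x) * f (A s x)\<bar> \<partial>M) = (\<integral>\<^sup>+x. 0 \<partial>M)" by (intro nn_integral_cong) simp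
    then show ?thesis by simp
  qed
  have "(\<integral>\<^sup>+t. \<integral>\<^sup>+s. ennreal \<bar>?q t * ?r s\<bar> * (\<integral>\<^sup>+x. ennreal \<bar>f (A t x) * f (A s x)\<bar> \<partial>M) \<partial>lborel \<partial>lborel)
     \<le> (\<integral>\<^sup>+t. \<integral>\<^sup>+s. ennreal \<bar>?q t * ?r s\<bar> * indicator {-(2*R)..2*R} (t - s) * ennreal ?K \<partial>lborel \<partial>lborel)"
    by (intro nn_integral_mono) (auto simp: mult.assoc intro!: mult_left_mono supp simp del: abs_mult)
  also have "\<dots> = (\<integral>\<^sup>+t. \<integral>\<^sup>+s. ennreal \<bar>?q t * ?r s\<bar> * indicator {-(2*R)..2*R} (t - s) \<partial>lborel \<partial>lborel) * ennreal ?K"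
    by (simp add: nn_integral_multc)
  also have "\<dots> < \<infinity>" using conj_kernel_band_finite[OF e d, of "2*R"] by (simp add: ennreal_mult_less_top)
  finally have fin: "(\<integral>\<^sup>+t. \<integral>\<^sup>+s. ennreal \<bar>?q t * ?r s\<bar> * (\<integral>\<^sup>+x. ennreal \<bar>f (A t x) * f (A s x)\<bar> \<partial>M) \<partial>lborel \<partial>lborel) < \<infinity>" .
  note G = gram_fubini[where F = "\<lambda>t x. f (A t x)" and G = "\<lambda>t x. f (A t x)", OF sigma_finite_measure_axioms _ _ _ _ fin]
  show "integrable M (\<lambda>x. conjp f e x * conjp f d x)" unfolding conjp_def by (rule G(1)) measurable
  have int: "integrable (lborel \<Otimes>\<^sub>M lborel) (\<lambda>(t, s). ?q t * ?r s * corr f (t - s))"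
    unfolding flow_corr_eq[OF sq_int_measurable[OF f], symmetric] by (rule G(3)) measurable
  have "l2_ip M (conjp f e) (conjp f d) = (\<integral>t. \<integral>s. ?q t * ?r s * corr f (t - s) \<partial>lborel \<partial>lborel)"
    unfolding l2_ip_def conjp_def flow_corr_eq[OF sq_int_measurable[OF f], symmetric]
    by (rule G(2)) measurable
  also have "\<dots> = (\<integral>y. corr f y * (\<integral>s. ?q (s + y) * ?r s \<partial>lborel) \<partial>lborel)"
    by (rule correlation_fubini[OF _ _ _ int]) measurable
  also have "\<dots> = (\<integral>y. corr f y * poisson_kernel (e + d) y \<partial>lborel)"
  proof (rule integral_cong_AE)
    show "AE y in lborel. corr f y * (\<integral>s. ?q (s + y) * ?r s \<partial>lborel) = corr f y * poisson_kernel (e + d) y"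
      using AE_lborel_singleton[of 0] by eventually_elim (simp add: conj_kernel_conv_conj_kernel[OF e d])
  qed measurable
  finally show "l2_ip M (conjp f e) (conjp f d) = (\<integral>y. corr f y * poisson_kernel (e + d) y \<partial>lborel)" .
qed

text \<open>Boundedness and integrability serve the dominated convergence of Poisson averages as
  \<open>e\<close> tends to 0; bounded height serves the Gram formula for conjugate
  averages.\<close>

definition nice :: "('a \<Rightarrow> real) \<Rightarrow> bool" where
  "nice f \<longleftrightarrow> sq_int M f \<and> integrable M f \<and> (\<exists>B. \<forall>x. \<bar>f x\<bar> \<le> B) \<and> (\<exists>R. \<forall>x\<in>space M. f x \<noteq> 0 \<longrightarrow> \<bar>ht x\<bar> \<le> R)"

lemma nice_level_trunc:
  assumes f: "sq_int M f" and [measurable]: "H \<in> borel_measurable M" and H: "\<And>x. \<bar>ht x\<bar> \<le> H x"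
  shows "nice (level_trunc H m f)"
  unfolding nice_def
proof (intro conjI)
  show "sq_int M (level_trunc H m f)" "integrable M (level_trunc H m f)" using sq_int_level_trunc[OF f] by auto
  show "\<exists>B. \<forall>x. \<bar>level_trunc H m f x\<bar> \<le> B" using abs_level_trunc_le(2)[of H m f] by blast
  show "\<exists>R. \<forall>x\<in>space M. level_trunc H m f x \<noteq> 0 \<longrightarrow> \<bar>ht x\<bar> \<le> R"
    using level_trunc_support[of H m f] H by (intro exI[of _ "real m"]) (auto intro: order_trans)
qed

lemma conjp_ip_nice:
  assumes f: "nice f" and e: "e > 0" and d: "d > 0"
  shows "sq_int M (conjp f e)" "l2_ip M (conjp f e) (conjp f d) = l2_ip M (pois f (e + d)) f"
proof -
  have s: "sq_int M f" using f by (simp add: nice_def)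
  note [measurable] = sq_int_measurable[OF s]
  obtain R where R: "\<And>x. x \<in> space M \<Longrightarrow> f x \<noteq> 0 \<Longrightarrow> \<bar>ht x\<bar> \<le> R" using f unfolding nice_def by blast
  show "sq_int M (conjp f e)" using conjp_gram(1)[OF s R e e] by (simp add: sq_int_def power2_eq_square)
  show "l2_ip M (conjp f e) (conjp f d) = l2_ip M (pois f (e + d)) f"
    using conjp_gram(2)[OF s R e d] pois_ip[OF s, of "e + d"] e d by simp
qed

lemma conjp_nrm_nice:
  assumes f: "nice f" and e: "e > 0"
  shows "l2_nrm M (conjp f e) \<le> l2_nrm M f"
proof (rule power2_le_imp_le)
  have s: "sq_int M f" using f by (simp add: nice_def)
  have "(l2_nrm M (conjp f e))\<^sup>2 = l2_ip M (pois f (e + e)) f"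
    unfolding l2_ip_self[symmetric] by (rule conjp_ip_nice[OF f e e])
  also have "\<dots> \<le> l2_nrm M (pois f (e + e)) * l2_nrm M f"
    using l2_ip_cauchy_schwarz[OF pois_L2(1)[OF s] s, of "e + e"] e by simp
  also have "\<dots> \<le> l2_nrm M f * l2_nrm M f" using e by (intro mult_right_mono pois_L2 s l2_nrm_nonneg) auto
  finally show "(l2_nrm M (conjp f e))\<^sup>2 \<le> (l2_nrm M f)\<^sup>2" by (simp add: power2_eq_square)
qed (rule l2_nrm_nonneg)

text \<open>Inner products of conjugate averages depend only on the sum of their scales, so the
  squared distance is phi(2e) + phi(2d) - 2 phi(e + d), where phi tends to ||f||^2.\<close>

lemma conjp_cauchy_nice:
  assumes f: "nice f" and \<eta>: "\<eta> > 0"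
  shows "\<exists>\<delta>>0. \<forall>e d. 0 < e \<and> e < \<delta> \<and> 0 < d \<and> d < \<delta> \<longrightarrow> l2_nrm M (\<lambda>x. conjp f e x - conjp f d x) \<le> \<eta>"
proof -
  have s: "sq_int M f" "integrable M f" using f by (auto simp: nice_def)
  obtain B where B: "\<And>x. \<bar>f x\<bar> \<le> B" using f unfolding nice_def by blast
  define K where "K = (l2_nrm M f)\<^sup>2"
  define \<phi> where "\<phi> e = l2_ip M (pois f e) f" for e
  have "(\<phi> \<longlongrightarrow> K) (at_right 0)" unfolding K_def \<phi>_def by (rule pois_ip_tendsto[OF s B])
  \<comment> \<open>The deviations of phi enter with weights 1, 1 and 2, hence the quarter.\<close>
  then have "eventually (\<lambda>e. dist (\<phi> e) K < \<eta>\<^sup>2 / 4) (at_right 0)" using \<eta> by (intro tendstoD) auto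
  then obtain b where b: "b > 0" "\<And>e. 0 < e \<Longrightarrow> e < b \<Longrightarrow> \<bar>\<phi> e - K\<bar> < \<eta>\<^sup>2 / 4"
    unfolding eventually_at_right_field dist_real_def by auto
  show ?thesis
  proof (intro exI[of _ "b / 2"] conjI allI impI)
    show "b / 2 > 0" using b by simp
    fix e d assume ed: "0 < e \<and> e < b / 2 \<and> 0 < d \<and> d < b / 2"
    have "(l2_nrm M (\<lambda>x. conjp f e x - conjp f d x))\<^sup>2 = \<phi> (e + e) + \<phi> (d + d) - 2 * \<phi> (e + d)"
    proof -
      have q: "sq_int M (conjp f e)" "sq_int M (conjp f d)" using ed conjp_ip_nice(1)[OF f] by auto
      show ?thesis unfolding l2_nrm_diff_sq[OF q] unfolding l2_ip_self[symmetric] \<phi>_def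
        using ed by (simp add: conjp_ip_nice(2)[OF f])
    qed
    also have "\<dots> \<le> \<eta>\<^sup>2"
    proof -
      have "\<bar>\<phi> (e + e) - K\<bar> < \<eta>\<^sup>2 / 4" "\<bar>\<phi> (d + d) - K\<bar> < \<eta>\<^sup>2 / 4" "\<bar>\<phi> (e + d) - K\<bar> < \<eta>\<^sup>2 / 4"
        by (rule b(2); use ed in linarith)+
      then show ?thesis unfolding abs_less_iff by linarith
    qed
    finally show "l2_nrm M (\<lambda>x. conjp f e x - conjp f d x) \<le> \<eta>" by (rule power2_le_imp_le) (use \<eta> in simp)
  qed
qed

lemma integrable_line_conj:
  assumes "f \<in> borel_measurable M" "x \<in> space M" "line_sq f x" "e > 0"
  shows "integrable lborel (\<lambda>t. f (A t x) * conj_kernel e t)"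
  using assms line_measurable[of f x] by (intro integrable_mult_conj) (auto simp: line_sq_def)

text \<open>Truncations of \<open>f\<close> are nice with norms at most that of \<open>f\<close>. On
  almost every orbit their conjugate averages converge by dominated convergence, and Fatou carries
  the norm bound to the limit.\<close>

lemma conjp_L2:
  assumes f: "sq_int M f" and e: "e > 0"
  shows "sq_int M (conjp f e)" "l2_nrm M (conjp f e) \<le> l2_nrm M f"
proof -
  note [measurable] = sq_int_measurable[OF f]
  let ?f = "\<lambda>m. level_trunc (\<lambda>x. \<bar>ht x\<bar>) m f"
  have n: "nice (?f m)" for m by (rule nice_level_trunc[OF f]) auto
  have lim: "AE x in M. (\<lambda>m. conjp (?f m) e x) \<longlonglongrightarrow> conjp f e x"
    using AE_line_sq[OF f]
  proof (rule AE_mp[OF _ AE_I2], intro impI)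
    fix x assume x: "x \<in> space M" and sq: "line_sq f x"
    show "(\<lambda>m. conjp (?f m) e x) \<longlonglongrightarrow> conjp f e x" unfolding conjp_def
    proof (rule integral_dominated_convergence[where w = "\<lambda>t. \<bar>f (A t x) * conj_kernel e t\<bar>"])
      show "integrable lborel (\<lambda>t. \<bar>f (A t x) * conj_kernel e t\<bar>)" using integrable_line_conj[OF _ x sq e] by auto
      show "AE t in lborel. (\<lambda>m. ?f m (A t x) * conj_kernel e t) \<longlonglongrightarrow> f (A t x) * conj_kernel e t"
        by (intro AE_I2 tendsto_intros level_trunc_tendsto)
      show "AE t in lborel. norm (?f m (A t x) * conj_kernel e t) \<le> \<bar>f (A t x) * conj_kernel e t\<bar>" for m
        by (intro AE_I2) (auto simp: abs_mult intro!: mult_right_mono abs_level_trunc_le)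
    qed (use x in measurable)
  qed
  have K: "l2_nrm M (conjp (?f m) e) \<le> l2_nrm M f" for m
    using conjp_nrm_nice[OF n e] sq_int_level_trunc(3)[OF f] by (rule order_trans) auto
  show "sq_int M (conjp f e)" "l2_nrm M (conjp f e) \<le> l2_nrm M f"
    using l2_fatou[OF conjp_ip_nice(1)[OF n e e] K _ lim] by auto
qed

lemma AE_conjp_diff:
  assumes f: "sq_int M f" and g: "sq_int M g" and e: "e > 0"
  shows "AE x in M. conjp (\<lambda>x. f x - g x) e x = conjp f e x - conjp g e x"
  using AE_line_sq[OF f] AE_line_sq[OF g]
proof (rule AE_mp[OF AE_conjI AE_I2], intro impI)
  fix x assume x: "x \<in> space M" and "line_sq f x \<and> line_sq g x"
  then show "conjp (\<lambda>x. f x - g x) e x = conjp f e x - conjp g e x"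
    unfolding conjp_def using integrable_line_conj[OF sq_int_measurable[OF f] x _ e] integrable_line_conj[OF sq_int_measurable[OF g] x _ e]
    by (simp add: left_diff_distrib)
qed

lemma conjp_diff_nrm:
  assumes f: "sq_int M f" and g: "sq_int M g" and e: "e > 0"
  shows "l2_nrm M (\<lambda>x. conjp f e x - conjp g e x) \<le> l2_nrm M (\<lambda>x. f x - g x)"
proof -
  note [measurable] = sq_int_measurable[OF f] sq_int_measurable[OF g]
  have "l2_nrm M (\<lambda>x. conjp f e x - conjp g e x) = l2_nrm M (conjp (\<lambda>x. f x - g x) e)"
    by (rule l2_nrm_cong_AE) (use AE_conjp_diff[OF assms] in auto)
  also have "\<dots> \<le> l2_nrm M (\<lambda>x. f x - g x)" by (rule conjp_L2[OF sq_int_diff[OF f g] e])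
  finally show ?thesis .
qed

lemma conjp_cauchy:
  assumes f: "sq_int M f" and \<eta>: "\<eta> > 0"
  shows "\<exists>\<delta>>0. \<forall>e d. 0 < e \<and> e < \<delta> \<and> 0 < d \<and> d < \<delta> \<longrightarrow> l2_nrm M (\<lambda>x. conjp f e x - conjp f d x) \<le> \<eta>"
proof -
  let ?f = "\<lambda>m. level_trunc (\<lambda>x. \<bar>ht x\<bar>) m f"
  have "(\<lambda>m. l2_nrm M (\<lambda>x. ?f m x - f x)) \<longlonglongrightarrow> 0" by (rule level_trunc_L2_tendsto[OF f]) measurable
  then have "eventually (\<lambda>m. l2_nrm M (\<lambda>x. ?f m x - f x) < \<eta> / 3) sequentially"
    using \<eta> by (intro order_tendstoD(2)) auto
  then obtain m where m: "l2_nrm M (\<lambda>x. ?f m x - f x) < \<eta> / 3" by (auto simp: eventually_sequentially)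
  have n: "nice (?f m)" by (rule nice_level_trunc[OF f]) auto
  then have s: "sq_int M (?f m)" by (simp add: nice_def)
  obtain \<delta> where \<delta>: "\<delta> > 0" "\<And>e d. 0 < e \<and> e < \<delta> \<and> 0 < d \<and> d < \<delta> \<Longrightarrow> l2_nrm M (\<lambda>x. conjp (?f m) e x - conjp (?f m) d x) \<le> \<eta> / 3"
    using conjp_cauchy_nice[OF n, of "\<eta> / 3"] \<eta> by auto
  show ?thesis
  proof (intro exI[of _ \<delta>] conjI allI impI)
    fix e d assume ed: "0 < e \<and> e < \<delta> \<and> 0 < d \<and> d < \<delta>"
    have q: "sq_int M (conjp f e)" "sq_int M (conjp f d)" "sq_int M (conjp (?f m) e)" "sq_int M (conjp (?f m) d)"
      using ed conjp_L2(1)[OF f] conjp_L2(1)[OF s] by auto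
    have "l2_nrm M (\<lambda>x. conjp f e x - conjp f d x) \<le> l2_nrm M (\<lambda>x. conjp f e x - conjp (?f m) e x) + l2_nrm M (\<lambda>x. conjp (?f m) e x - conjp f d x)"
      by (rule l2_nrm_triangle3[OF q(1,3,2)])
    also have "l2_nrm M (\<lambda>x. conjp (?f m) e x - conjp f d x) \<le> l2_nrm M (\<lambda>x. conjp (?f m) e x - conjp (?f m) d x) + l2_nrm M (\<lambda>x. conjp (?f m) d x - conjp f d x)"
      by (rule l2_nrm_triangle3[OF q(3,4,2)])
    also have "l2_nrm M (\<lambda>x. conjp (?f m) d x - conjp f d x) \<le> \<eta> / 3"
      using conjp_diff_nrm[OF s f, of d] m ed by simp
    also have "l2_nrm M (\<lambda>x. conjp f e x - conjp (?f m) e x) \<le> \<eta> / 3"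
      using conjp_diff_nrm[OF s f, of e] m ed by (simp add: l2_nrm_minus_commute)
    also have "l2_nrm M (\<lambda>x. conjp (?f m) e x - conjp (?f m) d x) \<le> \<eta> / 3" by (rule \<delta>(2)[OF ed])
    finally show "l2_nrm M (\<lambda>x. conjp f e x - conjp f d x) \<le> \<eta>" by simp
  qed (rule \<delta>(1))
qed

end

section \<open>The Hilbert transform as a limit, in L^2 and on almost every orbit\<close>

context measure_flow
begin

text \<open>The orbit integral of the majorant is finite on almost every orbit, so there the
  conjugate averages converge to \<open>h\<close> in L^2 of the line. Their Poisson averages at
  scale \<open>d\<close> are conjugate averages at scale \<open>\<epsilon> k + d\<close>, and
  letting k grow gives both sides.\<close>

lemma AE_line_limit:
  fixes S :: "'a \<Rightarrow> ennreal"
  assumes [measurable]: "S \<in> borel_measurable M" and fin: "(\<integral>\<^sup>+x. S x \<partial>M) < \<infinity>"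
    and f: "sq_int M f" and h: "sq_int M h" and \<epsilon>: "\<And>k. \<epsilon> k > 0" "\<epsilon> \<longlonglongrightarrow> 0"
    and maj: "\<And>x k. S x < \<infinity> \<Longrightarrow> ennreal ((conjp f (\<epsilon> k) x - h x)\<^sup>2) \<le> ennreal (4 * (1/4) ^ k) * S x"
  shows "AE x in M. \<forall>d>0. pois h d x = conjp f d x"
proof (rule AE_mp[OF AE_conjI[OF AE_line_finite[OF _ fin] AE_conjI[OF AE_line_sq[OF f] AE_line_sq[OF h]]] AE_I2], simp, intro impI allI)
  note [measurable] = sq_int_measurable[OF f] sq_int_measurable[OF h]
  fix x and d :: real assume x: "x \<in> space M" and H: "(\<integral>\<^sup>+t. S (A t x) \<partial>lborel) < \<infinity> \<and> line_sq f x \<and> line_sq h x" and d: "0 < d"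
  define s where "s = enn2real (\<integral>\<^sup>+t. S (A t x) \<partial>lborel)"
  have s: "(\<integral>\<^sup>+t. S (A t x) \<partial>lborel) = ennreal s" "s \<ge> 0" using H by (auto simp: s_def)
  have [measurable]: "(\<lambda>t. A t x) \<in> borel \<rightarrow>\<^sub>M M" using x by measurable
  have hl: "sq_int lborel (\<lambda>t. h (A t x))" using H by (auto simp: sq_int_def line_sq_def)
  have pl: "sq_int lborel (poisson_kernel d)" using poisson_kernel_sq_integrable[OF d] by (simp add: sq_int_def)
  define u where "u k t = conjp f (\<epsilon> k) (A t x)" for k t
  have [measurable]: "u k \<in> borel_measurable lborel" for k unfolding u_def by measurable
  have Sfin: "AE t in lborel. S (A t x) < \<infinity>"
  proof -
    have "AE t in lborel. S (A t x) \<noteq> \<infinity>" using H by (intro nn_integral_PInf_AE) auto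
    then show ?thesis by eventually_elim (simp add: less_top)
  qed
  have dif: "sq_int lborel (\<lambda>t. u k t - h (A t x))" "l2_nrm lborel (\<lambda>t. u k t - h (A t x)) \<le> 2 * (1/2) ^ k * sqrt s" for k
  proof -
    have "(\<integral>\<^sup>+t. ennreal ((u k t - h (A t x))\<^sup>2) \<partial>lborel) \<le> (\<integral>\<^sup>+t. ennreal (4 * (1/4) ^ k) * S (A t x) \<partial>lborel)"
      by (rule nn_integral_mono_AE, use Sfin in eventually_elim) (simp add: u_def maj)
    also have "\<dots> = ennreal (4 * (1/4) ^ k) * ennreal s" by (simp add: nn_integral_cmult s)
    also have "\<dots> = ennreal ((2 * (1/2) ^ k * sqrt s)\<^sup>2)"
    proof -
      have "((1/2) ^ k)\<^sup>2 = (1/4::real) ^ k" by (simp add: power2_eq_square power_mult_distrib[symmetric])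
      then show ?thesis using s(2) by (simp add: ennreal_mult[symmetric] power_mult_distrib)
    qed
    finally have *: "(\<integral>\<^sup>+t. ennreal ((u k t - h (A t x))\<^sup>2) \<partial>lborel) \<le> ennreal ((2 * (1/2) ^ k * sqrt s)\<^sup>2)" .
    from sq_intI_nn[OF _ _ this] s(2) show "sq_int lborel (\<lambda>t. u k t - h (A t x))" "l2_nrm lborel (\<lambda>t. u k t - h (A t x)) \<le> 2 * (1/2) ^ k * sqrt s"
      by auto
  qed
  have ul: "sq_int lborel (u k)" for k using sq_int_add[OF dif(1) hl] by simp
  have "(\<lambda>k. 2 * (1/2) ^ k * sqrt s) \<longlonglongrightarrow> 2 * 0 * sqrt s" by (intro tendsto_intros LIMSEQ_realpow_zero) auto
  then have bd: "(\<lambda>k. 2 * (1/2) ^ k * sqrt s) \<longlonglongrightarrow> 0" by simp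
  have ulim: "(\<lambda>k. l2_nrm lborel (\<lambda>t. u k t - h (A t x))) \<longlonglongrightarrow> 0"
    by (rule tendsto_sandwich[OF always_eventually always_eventually tendsto_const bd]) (simp_all add: l2_nrm_nonneg dif(2))
  have "(\<lambda>k. l2_ip lborel (u k) (poisson_kernel d)) \<longlonglongrightarrow> l2_ip lborel (\<lambda>t. h (A t x)) (poisson_kernel d)"
  proof (rule l2_ip_tendsto[OF hl pl _ _ ulim])
    show "(\<lambda>k. l2_nrm lborel (\<lambda>x. poisson_kernel d x - poisson_kernel d x)) \<longlonglongrightarrow> 0" by (simp add: l2_nrm_def)
  qed (simp_all add: ul pl)
  also have "l2_ip lborel (\<lambda>t. h (A t x)) (poisson_kernel d) = pois h d x" by (simp add: l2_ip_def pois_def)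
  finally have 1: "(\<lambda>k. l2_ip lborel (u k) (poisson_kernel d)) \<longlonglongrightarrow> pois h d x" .
  let ?g = "\<lambda>t. f (A t x)"
  have g2: "integrable lborel (\<lambda>t. (?g t)\<^sup>2)" using H by (simp add: line_sq_def)
  have "l2_ip lborel (u k) (poisson_kernel d) = (\<integral>y. ?g y * conj_kernel (\<epsilon> k + d) y \<partial>lborel)" for k
    unfolding poisson_conj_assoc[OF d \<epsilon>(1)[of k] _ g2, simplified, symmetric] l2_ip_def u_def conjp_def
    using x by (simp add: flow_add)
  then have "(\<lambda>k. l2_ip lborel (u k) (poisson_kernel d)) \<longlonglongrightarrow> conjp f d x"
    unfolding conjp_def using conj_kernel_shift_tendsto[OF d _ g2 \<epsilon>] by simp
  with 1 show "pois h d x = conjp f d x" by (rule LIMSEQ_unique)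
qed

text \<open>By \<open>AE_line_limit\<close> the conjugate averages of \<open>f\<close> are Poisson
  averages of \<open>h\<close> at every scale, and these tend to \<open>h x\<close> for almost every
  x. The truncated integrals have the same limit because their difference from the conjugate
  averages vanishes at Lebesgue points of \<open>f\<close>.\<close>

theorem hilbert_exists:
  assumes f: "sq_int M f"
  shows "\<exists>h. sq_int M h \<and> ((\<lambda>e. l2_nrm M (\<lambda>x. conjp f e x - h x)) \<longlongrightarrow> 0) (at_right 0)
    \<and> (AE x in M. (trunc_hilbert (\<lambda>t. f (A t x)) \<longlongrightarrow> h x) (at_right 0))"
proof -
  note [measurable] = sq_int_measurable[OF f]
  have "\<forall>k. \<exists>\<delta>>0. \<forall>e d. 0 < e \<and> e < \<delta> \<and> 0 < d \<and> d < \<delta> \<longrightarrow> l2_nrm M (\<lambda>x. conjp f e x - conjp f d x) \<le> (1/4) ^ k"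
    by (intro allI conjp_cauchy[OF f]) simp
  then obtain \<delta> where \<delta>: "\<And>k. \<delta> k > 0"
    "\<And>k e d. 0 < e \<Longrightarrow> e < \<delta> k \<Longrightarrow> 0 < d \<Longrightarrow> d < \<delta> k \<Longrightarrow> l2_nrm M (\<lambda>x. conjp f e x - conjp f d x) \<le> (1/4) ^ k"
    by metis
  define \<mu> where "\<mu> k = Min (\<delta> ` {..k})" for k
  have \<mu>: "\<mu> k > 0" "j \<le> k \<Longrightarrow> \<mu> k \<le> \<delta> j" for j k unfolding \<mu>_def using \<delta>(1) by (auto simp: Min_gr_iff)
  \<comment> \<open>Below every \<open>\<delta> j\<close> with \<open>j \<le> k\<close>, so that
    both members of consecutive pairs are admissible; the denominator forces convergence to 0, which
    the choice of the \<open>\<delta> j\<close> does not guarantee.\<close>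
  define \<epsilon> where "\<epsilon> k = \<mu> k / real (k + 2)" for k
  have \<epsilon>0: "\<epsilon> k > 0" for k using \<mu>(1) by (simp add: \<epsilon>_def)
  have \<epsilon>\<delta>: "\<epsilon> k < \<delta> j" if "j \<le> k" for j k
  proof -
    have "\<epsilon> k < \<mu> k" unfolding \<epsilon>_def using \<mu>(1)[of k] by (simp add: divide_less_eq)
    then show ?thesis using \<mu>(2)[OF that] by simp
  qed
  have \<epsilon>lim: "\<epsilon> \<longlonglongrightarrow> 0"
  proof (rule tendsto_sandwich[OF _ _ tendsto_const])
    show "(\<lambda>k. \<delta> 0 * inverse (real (Suc (k + 1)))) \<longlonglongrightarrow> 0"
      using tendsto_mult[OF tendsto_const[of "\<delta> 0"] LIMSEQ_ignore_initial_segment[OF LIMSEQ_inverse_real_of_nat, of 1]] by simp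
    show "\<forall>\<^sub>F k in sequentially. 0 \<le> \<epsilon> k" by (intro always_eventually allI less_imp_le \<epsilon>0)
    have "\<epsilon> k \<le> \<delta> 0 * inverse (real (Suc (k + 1)))" for k
      unfolding \<epsilon>_def divide_inverse using \<mu>(2)[of 0 k] by (intro mult_mono) (use \<delta>(1)[of 0] in auto)
    then show "\<forall>\<^sub>F k in sequentially. \<epsilon> k \<le> \<delta> 0 * inverse (real (Suc (k + 1)))" by auto
  qed
  have uL: "sq_int M (conjp f (\<epsilon> k))" for k by (rule conjp_L2(1)[OF f \<epsilon>0])
  have ud: "l2_nrm M (\<lambda>x. conjp f (\<epsilon> (Suc k)) x - conjp f (\<epsilon> k) x) \<le> (1/4) ^ k" for k
    by (rule \<delta>(2)) (auto intro: \<epsilon>0 \<epsilon>\<delta>)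
  obtain h S where [measurable]: "h \<in> borel_measurable M" "S \<in> borel_measurable M" and fin: "(\<integral>\<^sup>+x. S x \<partial>M) < \<infinity>"
    and maj: "\<And>x k. S x < \<infinity> \<Longrightarrow> ennreal ((conjp f (\<epsilon> k) x - h x)\<^sup>2) \<le> ennreal (4 * (1/4) ^ k) * S x"
    using L2_complete[of M "\<lambda>k. conjp f (\<epsilon> k)", OF uL ud] by blast
  define s where "s = enn2real (\<integral>\<^sup>+x. S x \<partial>M)"
  have s: "(\<integral>\<^sup>+x. S x \<partial>M) = ennreal s" "s \<ge> 0" using fin by (auto simp: s_def)
  have Sfin: "AE x in M. S x < \<infinity>"
  proof -
    have "AE x in M. S x \<noteq> \<infinity>" using fin by (intro nn_integral_PInf_AE) auto
    then show ?thesis by eventually_elim (simp add: less_top)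
  qed
  have dif: "sq_int M (\<lambda>x. conjp f (\<epsilon> k) x - h x)" "l2_nrm M (\<lambda>x. conjp f (\<epsilon> k) x - h x) \<le> 2 * (1/2) ^ k * sqrt s" for k
  proof -
    have "(\<integral>\<^sup>+x. ennreal ((conjp f (\<epsilon> k) x - h x)\<^sup>2) \<partial>M) \<le> (\<integral>\<^sup>+x. ennreal (4 * (1/4) ^ k) * S x \<partial>M)"
      by (rule nn_integral_mono_AE, use Sfin in eventually_elim) (simp add: maj)
    also have "\<dots> = ennreal (4 * (1/4) ^ k) * ennreal s" by (simp add: nn_integral_cmult s)
    also have "\<dots> = ennreal ((2 * (1/2) ^ k * sqrt s)\<^sup>2)"
    proof -
      have "((1/2) ^ k)\<^sup>2 = (1/4::real) ^ k" by (simp add: power2_eq_square power_mult_distrib[symmetric])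
      then show ?thesis using s(2) by (simp add: ennreal_mult[symmetric] power_mult_distrib)
    qed
    finally have *: "(\<integral>\<^sup>+x. ennreal ((conjp f (\<epsilon> k) x - h x)\<^sup>2) \<partial>M) \<le> ennreal ((2 * (1/2) ^ k * sqrt s)\<^sup>2)" .
    from sq_intI_nn[OF _ _ this] s(2) show "sq_int M (\<lambda>x. conjp f (\<epsilon> k) x - h x)" "l2_nrm M (\<lambda>x. conjp f (\<epsilon> k) x - h x) \<le> 2 * (1/2) ^ k * sqrt s"
      by auto
  qed
  have hL: "sq_int M h" using sq_int_diff[OF uL[of 0] dif(1)[of 0]] by simp
  have L2lim: "((\<lambda>e. l2_nrm M (\<lambda>x. conjp f e x - h x)) \<longlongrightarrow> 0) (at_right 0)"
  proof (rule tendstoI)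
    fix \<eta> :: real assume \<eta>: "\<eta> > 0"
    have "(\<lambda>k. (1/4) ^ k + 2 * (1/2) ^ k * sqrt s) \<longlonglongrightarrow> 0 + 2 * 0 * sqrt s" by (intro tendsto_intros LIMSEQ_realpow_zero) auto
    then have "eventually (\<lambda>k. (1/4) ^ k + 2 * (1/2) ^ k * sqrt s < \<eta>) sequentially" using \<eta> by (intro order_tendstoD(2)[where y = 0]) auto
    then obtain k where k: "(1/4) ^ k + 2 * (1/2) ^ k * sqrt s < \<eta>" by (auto simp: eventually_sequentially)
    show "\<forall>\<^sub>F e in at_right 0. dist (l2_nrm M (\<lambda>x. conjp f e x - h x)) 0 < \<eta>"
      unfolding eventually_at_right_field
    proof (intro exI[of _ "\<delta> k"] conjI allI impI \<delta>(1))
      fix e assume e: "e > 0" "e < \<delta> k"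
      have "l2_nrm M (\<lambda>x. conjp f e x - h x) \<le> l2_nrm M (\<lambda>x. conjp f e x - conjp f (\<epsilon> k) x) + l2_nrm M (\<lambda>x. conjp f (\<epsilon> k) x - h x)"
        by (intro l2_nrm_triangle3 conjp_L2 f hL e \<epsilon>0)
      also have "\<dots> \<le> (1/4) ^ k + 2 * (1/2) ^ k * sqrt s"
        by (intro add_mono dif(2) \<delta>(2)) (use e \<epsilon>0 \<epsilon>\<delta> in auto)
      finally show "dist (l2_nrm M (\<lambda>x. conjp f e x - h x)) 0 < \<eta>" using k by (simp add: l2_nrm_nonneg)
    qed
  qed
  have "AE x in M. (trunc_hilbert (\<lambda>t. f (A t x)) \<longlongrightarrow> h x) (at_right 0)"
  proof (rule AE_mp[OF AE_conjI[OF AE_line_limit[OF _ fin f hL \<epsilon>0 \<epsilon>lim maj]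
          AE_conjI[OF AE_pois_tendsto[OF hL] AE_conjI[OF AE_line_sq[OF f] AE_line_lebesgue_pt[OF f]]]] AE_I2], simp, simp, intro impI)
    fix x assume x: "x \<in> space M" and H: "(\<forall>d>0. pois h d x = conjp f d x) \<and> ((\<lambda>e. pois h e x) \<longlongrightarrow> h x) (at_right 0) \<and> line_sq f x \<and> lebesgue_pt (\<lambda>t. f (A t x)) 0"
    have "((\<lambda>e. conjp f e x) \<longlongrightarrow> h x) (at_right 0)"
    proof (rule Lim_transform_eventually)
      show "((\<lambda>e. pois h e x) \<longlongrightarrow> h x) (at_right 0)" using H by simp
      show "\<forall>\<^sub>F e in at_right 0. pois h e x = conjp f e x"
        using eventually_at_right_less[of 0] by eventually_elim (use H in auto)
    qed
    moreover have "((\<lambda>e. trunc_hilbert (\<lambda>t. f (A t x)) e - conjp f e x) \<longlongrightarrow> 0) (at_right 0)"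
      unfolding conjp_def using H line_measurable[OF sq_int_measurable[OF f] x] by (intro lebesgue_pt_trunc) (auto simp: line_sq_def)
    ultimately have "((\<lambda>e. (trunc_hilbert (\<lambda>t. f (A t x)) e - conjp f e x) + conjp f e x) \<longlongrightarrow> 0 + h x) (at_right 0)"
      by (intro tendsto_add)
    then show "(trunc_hilbert (\<lambda>t. f (A t x)) \<longlongrightarrow> h x) (at_right 0)" by simp
  qed
  with hL L2lim show ?thesis by blast
qed

text \<open>Determined up to a null set. The norm limit gives access to the Gram formulas, the
  pointwise limit is the principal value itself.\<close>

definition hilb :: "('a \<Rightarrow> real) \<Rightarrow> 'a \<Rightarrow> real" where
  "hilb f = (SOME h. sq_int M h \<and> ((\<lambda>e. l2_nrm M (\<lambda>x. conjp f e x - h x)) \<longlongrightarrow> 0) (at_right 0)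
    \<and> (AE x in M. (trunc_hilbert (\<lambda>t. f (A t x)) \<longlongrightarrow> h x) (at_right 0)))"

lemma hilb:
  assumes "sq_int M f"
  shows "sq_int M (hilb f)" "((\<lambda>e. l2_nrm M (\<lambda>x. conjp f e x - hilb f x)) \<longlongrightarrow> 0) (at_right 0)"
    "AE x in M. (trunc_hilbert (\<lambda>t. f (A t x)) \<longlongrightarrow> hilb f x) (at_right 0)"
  using someI_ex[OF hilbert_exists[OF assms]] unfolding hilb_def[symmetric] by auto

lemma hilb_diff_nrm:
  assumes f: "sq_int M f" and g: "sq_int M g"
  shows "l2_nrm M (\<lambda>x. hilb f x - hilb g x) \<le> l2_nrm M (\<lambda>x. f x - g x)"
proof -
  let ?a = "\<lambda>e. l2_nrm M (\<lambda>x. conjp f e x - hilb f x)" and ?b = "\<lambda>e. l2_nrm M (\<lambda>x. conjp g e x - hilb g x)"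
  have lim: "((\<lambda>e. ?a e + (l2_nrm M (\<lambda>x. f x - g x) + ?b e)) \<longlongrightarrow> 0 + (l2_nrm M (\<lambda>x. f x - g x) + 0)) (at_right 0)"
    by (intro tendsto_intros hilb f g)
  have "l2_nrm M (\<lambda>x. hilb f x - hilb g x) \<le> 0 + (l2_nrm M (\<lambda>x. f x - g x) + 0)"
  proof (rule tendsto_lowerbound[OF lim])
    show "\<forall>\<^sub>F e in at_right 0. l2_nrm M (\<lambda>x. hilb f x - hilb g x) \<le> ?a e + (l2_nrm M (\<lambda>x. f x - g x) + ?b e)"
      using eventually_at_right_less[of 0]
    proof eventually_elim
      case (elim e)
      note s = conjp_L2(1)[OF f elim] conjp_L2(1)[OF g elim] hilb(1)[OF f] hilb(1)[OF g]
      have "l2_nrm M (\<lambda>x. hilb f x - hilb g x) \<le> l2_nrm M (\<lambda>x. hilb f x - conjp f e x) + l2_nrm M (\<lambda>x. conjp f e x - hilb g x)"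
        by (intro l2_nrm_triangle3 s)
      also have "l2_nrm M (\<lambda>x. conjp f e x - hilb g x) \<le> l2_nrm M (\<lambda>x. conjp f e x - conjp g e x) + ?b e"
        by (intro l2_nrm_triangle3 s)
      also have "l2_nrm M (\<lambda>x. conjp f e x - conjp g e x) \<le> l2_nrm M (\<lambda>x. f x - g x)" by (rule conjp_diff_nrm[OF f g elim])
      finally show ?case by (simp add: l2_nrm_minus_commute[of M "hilb f"])
    qed
  qed simp
  then show ?thesis by simp
qed

lemma hilb_nrm:
  assumes f: "sq_int M f"
  shows "l2_nrm M (hilb f) \<le> l2_nrm M f"
proof -
  let ?a = "\<lambda>e. l2_nrm M (\<lambda>x. conjp f e x - hilb f x)"
  have lim: "((\<lambda>e. ?a e + l2_nrm M f) \<longlongrightarrow> 0 + l2_nrm M f) (at_right 0)"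
    by (intro tendsto_intros hilb f)
  have "l2_nrm M (hilb f) \<le> 0 + l2_nrm M f"
  proof (rule tendsto_lowerbound[OF lim])
    show "\<forall>\<^sub>F e in at_right 0. l2_nrm M (hilb f) \<le> ?a e + l2_nrm M f"
      using eventually_at_right_less[of 0]
    proof eventually_elim
      case (elim e)
      note s = conjp_L2(1)[OF f elim] hilb(1)[OF f]
      have "l2_nrm M (hilb f) \<le> l2_nrm M (\<lambda>x. hilb f x - conjp f e x) + l2_nrm M (conjp f e)"
        using l2_nrm_triangle[OF sq_int_diff[OF s(2,1)] s(1)] by simp
      then show ?case using conjp_L2(2)[OF f elim] by (simp add: l2_nrm_minus_commute[of M "hilb f"])
    qed
  qed simp
  then show ?thesis by simp
qed

text \<open>An isometry, not merely a contraction: the orthogonality proof needs the exact value of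
  <B,B>. It is the Gram formula with equal scales e, e, read at scale 2e.\<close>

lemma hilb_ip_nice:
  assumes f: "nice f"
  shows "l2_ip M (hilb f) (hilb f) = (l2_nrm M f)\<^sup>2"
proof -
  have s: "sq_int M f" "integrable M f" using f by (auto simp: nice_def)
  obtain B where B: "\<And>x. \<bar>f x\<bar> \<le> B" using f unfolding nice_def by blast
  have ev: "\<forall>\<^sub>F e in at_right 0. sq_int M (conjp f e)"
    using eventually_at_right_less[of 0] by eventually_elim (rule conjp_L2[OF s(1)])
  have 1: "((\<lambda>e. l2_ip M (conjp f e) (conjp f e)) \<longlongrightarrow> l2_ip M (hilb f) (hilb f)) (at_right 0)"
    by (intro l2_ip_tendsto hilb s ev)
  have "((\<lambda>e. l2_ip M (pois f (2 * e)) f) \<longlongrightarrow> (l2_nrm M f)\<^sup>2) (at_right 0)"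
  proof (rule filterlim_compose[OF pois_ip_tendsto[OF s B]])
    show "filterlim ((*) 2) (at_right 0) (at_right (0::real))" by (rule filterlim_times_pos_at_right_0) simp
  qed
  moreover have "\<forall>\<^sub>F e in at_right 0. l2_ip M (pois f (2 * e)) f = l2_ip M (conjp f e) (conjp f e)"
    using eventually_at_right_less[of 0] by eventually_elim (simp add: conjp_ip_nice[OF f])
  ultimately have "((\<lambda>e. l2_ip M (conjp f e) (conjp f e)) \<longlongrightarrow> (l2_nrm M f)\<^sup>2) (at_right 0)"
    by (rule Lim_transform_eventually)
  with 1 show ?thesis by (rule tendsto_unique[rotated]) simp
qed

end

lemma conj_kernel_bounded: "e > 0 \<Longrightarrow> \<bar>conj_kernel e t\<bar> \<le> 1 / (pi * e)"
  by (rule abs_conj_kernel_le)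

lemma poisson_kernel_bounded: "e > 0 \<Longrightarrow> \<bar>poisson_kernel e t\<bar> \<le> 1 / (pi * e)"
  using poisson_kernel_le[of e t] poisson_kernel_nonneg[of e t] by simp

lemma flow_reflect_integral:
  fixes g :: "real \<Rightarrow> real"
  shows "(\<integral>t. g (- t) \<partial>lborel) = (\<integral>t. g t \<partial>lborel)"
  using lborel_integral_real_affine[of "-1" g 0] by simp

lemma flow_translate_integral:
  fixes g :: "real \<Rightarrow> real"
  shows "(\<integral>t. g (t + s) \<partial>lborel) = (\<integral>t. g t \<partial>lborel)"
  using lborel_integral_real_affine[of 1 g s] by (simp add: add.commute)

section \<open>Orthogonality for collinear directions\<close>

text \<open>Each height is invariant under the other flow, so the two heights act as independent
  coordinates on the joint orbits. A function supported where both are bounded has a correlation of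
  compact support in both times.\<close>

locale two_flows = A: measure_flow M A hA + C: measure_flow M C hC
  for M :: "'a measure" and A C :: "real \<Rightarrow> 'a \<Rightarrow> 'a" and hA hC :: "'a \<Rightarrow> real" +
  assumes flow_commute: "x \<in> space M \<Longrightarrow> A s (C t x) = C t (A s x)"
    and hA_C: "x \<in> space M \<Longrightarrow> hA (C t x) = hA x"
    and hC_A: "x \<in> space M \<Longrightarrow> hC (A t x) = hC x"
begin

definition B :: "real \<Rightarrow> 'a \<Rightarrow> 'a" where
  "B t x = A t (C t x)"

sublocale B: measure_flow M B hA
proof
  show "(\<lambda>p. B (fst p) (snd p)) \<in> borel \<Otimes>\<^sub>M M \<rightarrow>\<^sub>M M" unfolding B_def by measurable
  show "distr M M (B t) = M" for t
  proof -
    have "distr M M (B t) = distr (distr M M (C t)) M (A t)"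
      by (subst distr_distr) (auto simp: B_def comp_def intro!: arg_cong[where f = "distr M M"])
    then show ?thesis by (simp add: A.flow_distr C.flow_distr)
  qed
  fix x t s assume x: "x \<in> space M"
  have "A s (C s (A t (C t x))) = A s (A t (C s (C t x)))"
    using x by (simp add: flow_commute[symmetric] C.flow_space)
  then show "B s (B t x) = B (s + t) x" using x by (simp add: B_def A.flow_add C.flow_add C.flow_space)
  show "B 0 x = x" using x by (simp add: B_def A.flow_zero C.flow_zero)
  show "hA (B t x) = hA x - t" using x by (simp add: B_def A.ht_flow hA_C C.flow_space)
qed measurable

lemma hC_B: "x \<in> space M \<Longrightarrow> hC (B t x) = hC x - t"
  by (simp add: B_def hC_A C.flow_space C.ht_flow)

text \<open>Because the flows commute, the correlation of any two of \<open>A\<close>,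
  \<open>B\<close>, \<open>C\<close> is a value of this one function. All six Gram integrals thus
  become integrals against the same weight, and a pointwise identity between kernels can be
  integrated.\<close>

definition corr2 :: "('a \<Rightarrow> real) \<Rightarrow> real \<Rightarrow> real \<Rightarrow> real" where
  "corr2 f s t = (\<integral>x. f (A s (C t x)) * f x \<partial>M)"

lemma corr2_measurable:
  assumes [measurable]: "f \<in> borel_measurable M"
  shows "(\<lambda>p. corr2 f (fst p) (snd p)) \<in> borel_measurable (borel \<Otimes>\<^sub>M borel)"
  unfolding corr2_def by measurable

lemma corr2_BC:
  assumes [measurable]: "f \<in> borel_measurable M"
  shows "(\<integral>x. f (B s x) * f (C t x) \<partial>M) = corr2 f (-s) (t - s)"
proof -
  have "corr2 f (-s) (t - s) = (\<integral>x. f (A (-s) (C (t - s) (B s x))) * f (B s x) \<partial>M)"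
    unfolding corr2_def by (rule B.integral_flow[symmetric, where u = "\<lambda>x. f (A (-s) (C (t - s) x)) * f x"]) measurable
  also have "\<dots> = (\<integral>x. f (B s x) * f (C t x) \<partial>M)"
  proof (rule Bochner_Integration.integral_cong[OF refl])
    fix x assume x: "x \<in> space M"
    have "C (t - s) (A s (C s x)) = A s (C t x)" using x by (simp add: flow_commute[symmetric] C.flow_space C.flow_add)
    then have "A (-s) (C (t - s) (B s x)) = C t x" using x by (simp add: B_def A.flow_add C.flow_space A.flow_zero)
    then show "f (A (-s) (C (t - s) (B s x))) * f (B s x) = f (B s x) * f (C t x)" by simp
  qed
  finally show ?thesis by simp
qed

lemma corr2_BA:
  assumes [measurable]: "f \<in> borel_measurable M"
  shows "(\<integral>x. f (B t x) * f (A s x) \<partial>M) = corr2 f (s - t) (-t)"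
proof -
  have "corr2 f (s - t) (-t) = (\<integral>x. f (A (s - t) (C (-t) (B t x))) * f (B t x) \<partial>M)"
    unfolding corr2_def by (rule B.integral_flow[symmetric, where u = "\<lambda>x. f (A (s - t) (C (-t) x)) * f x"]) measurable
  also have "\<dots> = (\<integral>x. f (B t x) * f (A s x) \<partial>M)"
  proof (rule Bochner_Integration.integral_cong[OF refl])
    fix x assume x: "x \<in> space M"
    have "C (-t) (A t (C t x)) = A t x" using x by (simp add: flow_commute[symmetric] C.flow_space C.flow_add C.flow_zero)
    then have "A (s - t) (C (-t) (B t x)) = A s x" using x by (simp add: B_def A.flow_add)
    then show "f (A (s - t) (C (-t) (B t x))) * f (B t x) = f (B t x) * f (A s x)" by simp
  qed
  finally show ?thesis by simp
qed

lemma corr2_AC: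
  assumes [measurable]: "f \<in> borel_measurable M"
  shows "(\<integral>x. f (A s x) * f (C t x) \<partial>M) = corr2 f (-s) t"
proof -
  have "corr2 f (-s) t = (\<integral>x. f (A (-s) (C t (A s x))) * f (A s x) \<partial>M)"
    unfolding corr2_def by (rule A.integral_flow[symmetric, where u = "\<lambda>x. f (A (-s) (C t x)) * f x"]) measurable
  also have "\<dots> = (\<integral>x. f (A s x) * f (C t x) \<partial>M)"
  proof (rule Bochner_Integration.integral_cong[OF refl])
    fix x assume x: "x \<in> space M"
    have "A (-s) (C t (A s x)) = C t x" using x by (simp add: flow_commute[symmetric] C.flow_space A.flow_add A.flow_zero)
    then show "f (A (-s) (C t (A s x))) * f (A s x) = f (A s x) * f (C t x)" by simp
  qed
  finally show ?thesis by simp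
qed

lemma abs_corr2_le:
  assumes f: "sq_int M f" shows "\<bar>corr2 f s t\<bar> \<le> (l2_nrm M f)\<^sup>2"
proof -
  note [measurable] = sq_int_measurable[OF f]
  have 1: "sq_int M (\<lambda>x. f (A s (C t x)))" using C.sq_int_flow[OF A.sq_int_flow[OF f]] .
  have 2: "l2_nrm M (\<lambda>x. f (A s (C t x))) = l2_nrm M f"
    using C.l2_nrm_flow[of "\<lambda>x. f (A s x)" t] A.l2_nrm_flow[of f s] by simp
  show ?thesis using l2_ip_cauchy_schwarz[OF 1 f] 2 by (simp add: corr2_def l2_ip_def power2_eq_square)
qed

definition nice2 :: "('a \<Rightarrow> real) \<Rightarrow> real \<Rightarrow> bool" where
  "nice2 f R \<longleftrightarrow> A.nice f \<and> C.nice f \<and> (\<forall>x\<in>space M. f x \<noteq> 0 \<longrightarrow> \<bar>hA x\<bar> \<le> R \<and> \<bar>hC x\<bar> \<le> R)"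

lemma nice2_sq: "nice2 f R \<Longrightarrow> sq_int M f"
  by (simp add: nice2_def A.nice_def)

lemma corr2_zero:
  assumes f: "nice2 f R" and "\<not> (\<bar>s\<bar> \<le> 2 * R \<and> \<bar>t\<bar> \<le> 2 * R)"
  shows "corr2 f s t = 0"
proof -
  have "f (A s (C t x)) * f x = 0" if x: "x \<in> space M" for x
  proof (rule ccontr)
    assume "f (A s (C t x)) * f x \<noteq> 0"
    then have n: "f (A s (C t x)) \<noteq> 0" "f x \<noteq> 0" by auto
    have sp: "C t x \<in> space M" "A s (C t x) \<in> space M" using x by (auto intro: A.flow_space C.flow_space)
    have "\<bar>hA x\<bar> \<le> R" "\<bar>hC x\<bar> \<le> R" "\<bar>hA (A s (C t x))\<bar> \<le> R" "\<bar>hC (A s (C t x))\<bar> \<le> R"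
      using n x sp f unfolding nice2_def by blast+
    then have "\<bar>hA x\<bar> \<le> R" "\<bar>hC x\<bar> \<le> R" "\<bar>hA x - s\<bar> \<le> R" "\<bar>hC x - t\<bar> \<le> R"
      using x sp by (auto simp: A.ht_flow hA_C hC_A C.ht_flow)
    then show False using assms(2) by (auto simp: abs_le_iff)
  qed
  then have "corr2 f s t = (\<integral>x. 0 \<partial>M)" unfolding corr2_def by (intro Bochner_Integration.integral_cong) auto
  then show ?thesis by simp
qed

lemma corr2_integrable:
  assumes f: "nice2 f R" and [measurable]: "\<Phi> \<in> borel_measurable (borel \<Otimes>\<^sub>M borel)" and c: "\<And>p. \<bar>\<Phi> p\<bar> \<le> c"
  shows "integrable (lborel \<Otimes>\<^sub>M lborel) (\<lambda>p. \<Phi> p * corr2 f (fst p) (snd p))"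
proof -
  note [measurable] = corr2_measurable[OF sq_int_measurable[OF nice2_sq[OF f]]]
  let ?Q = "{-(2*R)..2*R} \<times> {-(2*R)..2*R}"
  have c0: "c \<ge> 0" using c[of undefined] by linarith
  show ?thesis
  proof (rule Bochner_Integration.integrable_bound)
    have "emeasure (lborel \<Otimes>\<^sub>M lborel) ?Q < \<infinity>"
      by (subst lborel.emeasure_pair_measure_Times) (auto simp: emeasure_lborel_Icc_eq ennreal_mult_less_top)
    then show "integrable (lborel \<Otimes>\<^sub>M lborel) (\<lambda>p. (c * (l2_nrm M f)\<^sup>2) * indicator ?Q p)"
      by (intro integrable_mult_right integrable_real_indicator) auto
    show "AE p in lborel \<Otimes>\<^sub>M lborel. norm (\<Phi> p * corr2 f (fst p) (snd p)) \<le> norm ((c * (l2_nrm M f)\<^sup>2) * indicator ?Q p)"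
    proof (rule AE_I2)
      fix p :: "real \<times> real"
      show "norm (\<Phi> p * corr2 f (fst p) (snd p)) \<le> norm ((c * (l2_nrm M f)\<^sup>2) * indicator ?Q p)"
      proof (cases "p \<in> ?Q")
        case True
        have "\<bar>\<Phi> p\<bar> * \<bar>corr2 f (fst p) (snd p)\<bar> \<le> c * (l2_nrm M f)\<^sup>2"
          using c0 by (intro mult_mono c abs_corr2_le nice2_sq[OF f]) auto
        then show ?thesis using True c0 by (simp add: abs_mult)
      next
        case False
        then have "corr2 f (fst p) (snd p) = 0" by (intro corr2_zero[OF f]) (cases p, auto simp: abs_le_iff)
        then show ?thesis by simp
      qed
    qed
  qed measurable
qed

section \<open>Gram integrals as pairings with the two-variable correlation\<close>

definition pairing :: "('a \<Rightarrow> real) \<Rightarrow> (real \<Rightarrow> real \<Rightarrow> real) \<Rightarrow> real" where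
  "pairing f \<Phi> = (\<integral>p. \<Phi> (fst p) (snd p) * corr2 f (fst p) (snd p) \<partial>(lborel \<Otimes>\<^sub>M lborel))"

text \<open>The supports confine both times to [-R, R], so bounded kernels already give absolute
  convergence; this covers the conjugate kernels too.\<close>

lemma gram_bounded:
  fixes X Y :: "real \<Rightarrow> 'a \<Rightarrow> 'a"
  assumes f: "sq_int M f" and [measurable]: "(\<lambda>p. f (X (fst p) (snd p))) \<in> borel_measurable (borel \<Otimes>\<^sub>M M)"
      "(\<lambda>p. f (Y (fst p) (snd p))) \<in> borel_measurable (borel \<Otimes>\<^sub>M M)"
    and X: "\<And>t. sq_int M (\<lambda>x. f (X t x))" "\<And>t. l2_nrm M (\<lambda>x. f (X t x)) = l2_nrm M f"
    and Y: "\<And>t. sq_int M (\<lambda>x. f (Y t x))" "\<And>t. l2_nrm M (\<lambda>x. f (Y t x)) = l2_nrm M f"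
    and supp: "\<And>t s x. x \<in> space M \<Longrightarrow> f (X t x) \<noteq> 0 \<Longrightarrow> f (Y s x) \<noteq> 0 \<Longrightarrow> \<bar>t\<bar> \<le> R \<and> \<bar>s\<bar> \<le> R"
    and [measurable]: "k \<in> borel_measurable borel" "l \<in> borel_measurable borel"
    and k: "\<And>t. \<bar>k t\<bar> \<le> c" and l: "\<And>t. \<bar>l t\<bar> \<le> c"
  shows "l2_ip M (\<lambda>x. \<integral>t. f (X t x) * k t \<partial>lborel) (\<lambda>x. \<integral>s. f (Y s x) * l s \<partial>lborel)
    = (\<integral>t. \<integral>s. k t * l s * (\<integral>x. f (X t x) * f (Y s x) \<partial>M) \<partial>lborel \<partial>lborel)"
proof -
  let ?K = "(l2_nrm M f)\<^sup>2" and ?I = "\<lambda>t. indicator {-R..R} t :: ennreal"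
  have c0: "c \<ge> 0" using k[of 0] by linarith
  have nn: "(\<integral>\<^sup>+x. ennreal \<bar>f (X t x) * f (Y s x)\<bar> \<partial>M) \<le> ?I t * (?I s * ennreal ?K)" for t s
  proof (cases "\<bar>t\<bar> \<le> R \<and> \<bar>s\<bar> \<le> R")
    case True
    have i: "sq_int M (\<lambda>x. \<bar>f (X t x)\<bar>)" "sq_int M (\<lambda>x. \<bar>f (Y s x)\<bar>)"
      using X(1)[of t] Y(1)[of s] by (auto simp: sq_int_def intro!: borel_measurable_abs)
    have n: "l2_nrm M (\<lambda>x. \<bar>f (X t x)\<bar>) = l2_nrm M f" "l2_nrm M (\<lambda>x. \<bar>f (Y s x)\<bar>) = l2_nrm M f"
      using X(2)[of t] Y(2)[of s] by (auto simp: l2_nrm_def)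
    have "(\<integral>\<^sup>+x. ennreal \<bar>f (X t x) * f (Y s x)\<bar> \<partial>M) = (\<integral>\<^sup>+x. ennreal (\<bar>f (X t x)\<bar> * \<bar>f (Y s x)\<bar>) \<partial>M)" by (simp add: abs_mult)
    also have "\<dots> = ennreal (l2_ip M (\<lambda>x. \<bar>f (X t x)\<bar>) (\<lambda>x. \<bar>f (Y s x)\<bar>))"
      unfolding l2_ip_def by (intro nn_integral_eq_integral sq_int_mult i) auto
    also have "\<dots> \<le> ennreal ?K"
      using l2_ip_cauchy_schwarz[OF i] n by (intro ennreal_leI) (simp add: power2_eq_square)
    finally show ?thesis using True by (simp add: indicator_def abs_le_iff)
  next
    case False
    have "f (X t x) * f (Y s x) = 0" if "x \<in> space M" for x using supp[OF that, of t s] False by auto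
    then have "(\<integral>\<^sup>+x. ennreal \<bar>f (X t x) * f (Y s x)\<bar> \<partial>M) = (\<integral>\<^sup>+x. 0 \<partial>M)" by (intro nn_integral_cong) simp
    then show ?thesis by simp
  qed
  have "(\<integral>\<^sup>+t. \<integral>\<^sup>+s. ennreal \<bar>k t * l s\<bar> * (\<integral>\<^sup>+x. ennreal \<bar>f (X t x) * f (Y s x)\<bar> \<partial>M) \<partial>lborel \<partial>lborel)
     \<le> (\<integral>\<^sup>+t. \<integral>\<^sup>+s. ennreal (c * c) * (?I t * (?I s * ennreal ?K)) \<partial>lborel \<partial>lborel)"
    unfolding abs_mult using c0 by (intro nn_integral_mono mult_mono nn[unfolded abs_mult] ennreal_leI k l) auto
  also have "\<dots> = ennreal (c * c) * (emeasure lborel {-R..R} * (emeasure lborel {-R..R} * ennreal ?K))"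
    by (simp add: nn_integral_cmult nn_integral_multc)
  also have "\<dots> < \<infinity>" by (auto simp: emeasure_lborel_Icc_eq ennreal_mult_less_top)
  finally have fin: "(\<integral>\<^sup>+t. \<integral>\<^sup>+s. ennreal \<bar>k t * l s\<bar> * (\<integral>\<^sup>+x. ennreal \<bar>f (X t x) * f (Y s x)\<bar> \<partial>M) \<partial>lborel \<partial>lborel) < \<infinity>" .
  show ?thesis unfolding l2_ip_def
    by (rule gram_fubini(2)[where F = "\<lambda>t x. f (X t x)" and G = "\<lambda>t x. f (Y t x)", OF A.sigma_finite_measure_axioms _ _ _ _ fin]) measurable
qed

text \<open>The parity \<sigma> is 1 for Poisson kernels and -1 for conjugate ones, so one
  computation serves both. In each inner product exactly one kernel is reflected, which produces the
  single factor \<sigma>.\<close>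

context
  fixes f :: "'a \<Rightarrow> real" and R c \<sigma> :: real and k l :: "real \<Rightarrow> real"
  assumes f: "nice2 f R"
    and [measurable]: "k \<in> borel_measurable borel" "l \<in> borel_measurable borel"
    and k: "\<And>t. \<bar>k t\<bar> \<le> c" and l: "\<And>t. \<bar>l t\<bar> \<le> c"
    and k\<sigma>: "\<And>t. k (- t) = \<sigma> * k t" and l\<sigma>: "\<And>t. l (- t) = \<sigma> * l t"
begin

private lemma meas [measurable]: "f \<in> borel_measurable M"
  by (rule sq_int_measurable[OF nice2_sq[OF f]])

private lemma sq: "sq_int M f" by (rule nice2_sq[OF f])

private lemma c0: "c \<ge> 0" using k[of 0] by linarith

private lemma R1: "x \<in> space M \<Longrightarrow> f x \<noteq> 0 \<Longrightarrow> \<bar>hA x\<bar> \<le> R \<and> \<bar>hC x\<bar> \<le> R"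
  using f unfolding nice2_def by blast

private lemma bnd: "\<bar>k s * l t\<bar> \<le> c * c"
  unfolding abs_mult by (intro mult_mono k l c0) simp

private lemma bnd2: "\<bar>l t * k s\<bar> \<le> c * c"
  unfolding abs_mult by (intro mult_mono k l c0) simp

lemma ip_BC:
  "l2_ip M (\<lambda>x. \<integral>t. f (B t x) * k t \<partial>lborel) (\<lambda>x. \<integral>t. f (C t x) * l t \<partial>lborel) = \<sigma> * pairing f (\<lambda>s t. k s * l (t - s))"
proof -
  \<comment> \<open>The height \<open>hA\<close> bounds t by 2 R, and \<open>hC\<close> keeps s
    within 2 R of t, hence 4 R for both.\<close>
  have sup: "\<bar>t\<bar> \<le> 4 * R \<and> \<bar>s\<bar> \<le> 4 * R" if x: "x \<in> space M" and n: "f (B t x) \<noteq> 0" "f (C s x) \<noteq> 0" for t s x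
  proof -
    have "\<bar>hA x - t\<bar> \<le> R" "\<bar>hC x - t\<bar> \<le> R" using R1[OF B.flow_space[OF x] n(1)] by (simp_all only: B.ht_flow[OF x, of t] hC_B[OF x, of t])
    moreover have "\<bar>hA x\<bar> \<le> R" "\<bar>hC x - s\<bar> \<le> R" using R1[OF C.flow_space[OF x] n(2)] by (simp_all only: hA_C[OF x, of s] C.ht_flow[OF x, of s])
    ultimately show ?thesis by linarith
  qed
  have int: "integrable (lborel \<Otimes>\<^sub>M lborel) (\<lambda>p. k (fst p) * l (snd p - fst p) * corr2 f (fst p) (snd p))"
    by (rule corr2_integrable[OF f, where \<Phi> = "\<lambda>p. k (fst p) * l (snd p - fst p)" and c = "c * c"]) (measurable, rule bnd)
  have "l2_ip M (\<lambda>x. \<integral>t. f (B t x) * k t \<partial>lborel) (\<lambda>x. \<integral>t. f (C t x) * l t \<partial>lborel)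
     = (\<integral>s. \<integral>t. k s * l t * (\<integral>x. f (B s x) * f (C t x) \<partial>M) \<partial>lborel \<partial>lborel)"
    by (rule gram_bounded[OF sq _ _ B.sq_int_flow[OF sq] B.l2_nrm_flow[OF meas] C.sq_int_flow[OF sq] C.l2_nrm_flow[OF meas] sup _ _ k l]) measurable
  also have "\<dots> = (\<integral>s. \<integral>t. k s * l t * corr2 f (-s) (t - s) \<partial>lborel \<partial>lborel)" by (simp add: corr2_BC)
  also have "\<dots> = (\<integral>s. \<integral>t. k (-s) * l t * corr2 f s (t + s) \<partial>lborel \<partial>lborel)"
    by (subst flow_reflect_integral[symmetric]) simp
  also have "\<dots> = (\<integral>s. \<integral>t. k (-s) * l (t - s) * corr2 f s t \<partial>lborel \<partial>lborel)"
  proof (rule Bochner_Integration.integral_cong[OF refl])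
    fix s :: real
    show "(\<integral>t. k (-s) * l t * corr2 f s (t + s) \<partial>lborel) = (\<integral>t. k (-s) * l (t - s) * corr2 f s t \<partial>lborel)"
      using flow_translate_integral[of "\<lambda>t. k (-s) * l (t - s) * corr2 f s t" s] by simp
  qed
  also have "\<dots> = \<sigma> * (\<integral>s. \<integral>t. k s * l (t - s) * corr2 f s t \<partial>lborel \<partial>lborel)"
    by (simp add: k\<sigma> mult.assoc)
  also have "(\<integral>s. \<integral>t. k s * l (t - s) * corr2 f s t \<partial>lborel \<partial>lborel) = pairing f (\<lambda>s t. k s * l (t - s))"
    unfolding pairing_def using lborel_pair.integral_fst'[OF int] by simp
  finally show ?thesis .
qed

lemma ip_BA:
  "l2_ip M (\<lambda>x. \<integral>t. f (B t x) * l t \<partial>lborel) (\<lambda>x. \<integral>t. f (A t x) * k t \<partial>lborel) = \<sigma> * pairing f (\<lambda>s t. l t * k (s - t))"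
proof -
  have sup: "\<bar>t\<bar> \<le> 4 * R \<and> \<bar>s\<bar> \<le> 4 * R" if x: "x \<in> space M" and n: "f (B t x) \<noteq> 0" "f (A s x) \<noteq> 0" for t s x
  proof -
    have "\<bar>hA x - t\<bar> \<le> R" "\<bar>hC x - t\<bar> \<le> R" using R1[OF B.flow_space[OF x] n(1)] by (simp_all only: B.ht_flow[OF x, of t] hC_B[OF x, of t])
    moreover have "\<bar>hA x - s\<bar> \<le> R" "\<bar>hC x\<bar> \<le> R" using R1[OF A.flow_space[OF x] n(2)] by (simp_all only: hC_A[OF x, of s] A.ht_flow[OF x, of s])
    ultimately show ?thesis by linarith
  qed
  have int: "integrable (lborel \<Otimes>\<^sub>M lborel) (\<lambda>p. l (snd p) * k (fst p - snd p) * corr2 f (fst p) (snd p))"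
    by (rule corr2_integrable[OF f, where \<Phi> = "\<lambda>p. l (snd p) * k (fst p - snd p)" and c = "c * c"]) (measurable, rule bnd2)
  have "l2_ip M (\<lambda>x. \<integral>t. f (B t x) * l t \<partial>lborel) (\<lambda>x. \<integral>t. f (A t x) * k t \<partial>lborel)
     = (\<integral>t. \<integral>s. l t * k s * (\<integral>x. f (B t x) * f (A s x) \<partial>M) \<partial>lborel \<partial>lborel)"
    by (rule gram_bounded[OF sq _ _ B.sq_int_flow[OF sq] B.l2_nrm_flow[OF meas] A.sq_int_flow[OF sq] A.l2_nrm_flow[OF meas] sup _ _ l k]) measurable
  also have "\<dots> = (\<integral>t. \<integral>s. l t * k s * corr2 f (s - t) (-t) \<partial>lborel \<partial>lborel)" by (simp add: corr2_BA)
  also have "\<dots> = (\<integral>t. \<integral>s. l (-t) * k s * corr2 f (s + t) t \<partial>lborel \<partial>lborel)"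
    by (subst flow_reflect_integral[symmetric]) simp
  also have "\<dots> = (\<integral>t. \<integral>s. l (-t) * k (s - t) * corr2 f s t \<partial>lborel \<partial>lborel)"
  proof (rule Bochner_Integration.integral_cong[OF refl])
    fix t :: real
    show "(\<integral>s. l (-t) * k s * corr2 f (s + t) t \<partial>lborel) = (\<integral>s. l (-t) * k (s - t) * corr2 f s t \<partial>lborel)"
      using flow_translate_integral[of "\<lambda>s. l (-t) * k (s - t) * corr2 f s t" t] by simp
  qed
  also have "\<dots> = \<sigma> * (\<integral>t. \<integral>s. l t * k (s - t) * corr2 f s t \<partial>lborel \<partial>lborel)"
    by (simp add: l\<sigma> mult.assoc)
  also have "(\<integral>t. \<integral>s. l t * k (s - t) * corr2 f s t \<partial>lborel \<partial>lborel) = pairing f (\<lambda>s t. l t * k (s - t))"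
    unfolding pairing_def using lborel_pair.integral_snd[of "\<lambda>s t. l t * k (s - t) * corr2 f s t"] int by (simp add: case_prod_beta')
  finally show ?thesis .
qed

lemma ip_AC:
  "l2_ip M (\<lambda>x. \<integral>t. f (A t x) * k t \<partial>lborel) (\<lambda>x. \<integral>t. f (C t x) * l t \<partial>lborel) = \<sigma> * pairing f (\<lambda>s t. k s * l t)"
proof -
  have sup: "\<bar>t\<bar> \<le> 4 * R \<and> \<bar>s\<bar> \<le> 4 * R" if x: "x \<in> space M" and n: "f (A t x) \<noteq> 0" "f (C s x) \<noteq> 0" for t s x
  proof -
    have "\<bar>hA x - t\<bar> \<le> R" "\<bar>hC x\<bar> \<le> R" using R1[OF A.flow_space[OF x] n(1)] by (simp_all only: A.ht_flow[OF x, of t] hC_A[OF x, of t])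
    moreover have "\<bar>hA x\<bar> \<le> R" "\<bar>hC x - s\<bar> \<le> R" using R1[OF C.flow_space[OF x] n(2)] by (simp_all only: hA_C[OF x, of s] C.ht_flow[OF x, of s])
    ultimately show ?thesis by linarith
  qed
  have int: "integrable (lborel \<Otimes>\<^sub>M lborel) (\<lambda>p. k (fst p) * l (snd p) * corr2 f (fst p) (snd p))"
    by (rule corr2_integrable[OF f, where \<Phi> = "\<lambda>p. k (fst p) * l (snd p)" and c = "c * c"]) (measurable, rule bnd)
  have "l2_ip M (\<lambda>x. \<integral>t. f (A t x) * k t \<partial>lborel) (\<lambda>x. \<integral>t. f (C t x) * l t \<partial>lborel)
     = (\<integral>s. \<integral>t. k s * l t * (\<integral>x. f (A s x) * f (C t x) \<partial>M) \<partial>lborel \<partial>lborel)"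
    by (rule gram_bounded[OF sq _ _ A.sq_int_flow[OF sq] A.l2_nrm_flow[OF meas] C.sq_int_flow[OF sq] C.l2_nrm_flow[OF meas] sup _ _ k l]) measurable
  also have "\<dots> = (\<integral>s. \<integral>t. k s * l t * corr2 f (-s) t \<partial>lborel \<partial>lborel)" by (simp add: corr2_AC)
  also have "\<dots> = (\<integral>s. \<integral>t. k (-s) * l t * corr2 f s t \<partial>lborel \<partial>lborel)"
    by (subst flow_reflect_integral[symmetric]) simp
  also have "\<dots> = \<sigma> * (\<integral>s. \<integral>t. k s * l t * corr2 f s t \<partial>lborel \<partial>lborel)"
    by (simp add: k\<sigma> mult.assoc)
  also have "(\<integral>s. \<integral>t. k s * l t * corr2 f s t \<partial>lborel \<partial>lborel) = pairing f (\<lambda>s t. k s * l t)"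
    unfolding pairing_def using lborel_pair.integral_fst'[OF int] by simp
  finally show ?thesis .
qed

end

text \<open>This is \<open>kernel_identity\<close> integrated against \<open>corr2\<close>. The
  scale 2e sits where the sum z + w stood, since imaginary parts add. The three signs on the left
  come from the oddness of the conjugate kernel, including one from rewriting t - s as s -
  t.\<close>

lemma pairing_identity:
  assumes f: "nice2 f R" and e: "e > 0"
  shows "- l2_ip M (B.conjp f e) (C.conjp f e) - l2_ip M (B.conjp f (2*e)) (A.conjp f e) + l2_ip M (A.conjp f e) (C.conjp f (2*e))
    = l2_ip M (B.pois f e) (C.pois f e) - l2_ip M (B.pois f (2*e)) (A.pois f e) - l2_ip M (A.pois f e) (C.pois f (2*e))"
proof -
  have e2: "2 * e > 0" using e by simp
  define c where "c = 1 / (pi * e)"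
  have le: "1 / (pi * (2 * e)) \<le> c" unfolding c_def using e by (intro divide_left_mono) auto
  have q: "\<bar>conj_kernel e t\<bar> \<le> c" "\<bar>conj_kernel (2*e) t\<bar> \<le> c" and p: "\<bar>poisson_kernel e t\<bar> \<le> c" "\<bar>poisson_kernel (2*e) t\<bar> \<le> c" for t
    using conj_kernel_bounded[OF e, of t] conj_kernel_bounded[OF e2, of t] poisson_kernel_bounded[OF e, of t] poisson_kernel_bounded[OF e2, of t] le
    by (auto simp: c_def)
  have s1: "conj_kernel d (- t) = (-1) * conj_kernel d t" "poisson_kernel d (- t) = 1 * poisson_kernel d t" for d t by simp_all
  have I: "integrable (lborel \<Otimes>\<^sub>M lborel) (\<lambda>p. \<Phi> (fst p) (snd p) * corr2 f (fst p) (snd p))"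
    if "(\<lambda>p. \<Phi> (fst p) (snd p)) \<in> borel_measurable (borel \<Otimes>\<^sub>M borel)" "\<And>s t. \<bar>\<Phi> s t\<bar> \<le> c * c" for \<Phi> :: "real \<Rightarrow> real \<Rightarrow> real"
    by (rule corr2_integrable[OF f that(1)]) (rule that(2))
  have bb: "\<bar>a * b\<bar> \<le> c * c" if "\<bar>a\<bar> \<le> c" "\<bar>b\<bar> \<le> c" for a b
    unfolding abs_mult using that by (intro mult_mono) auto
  have q1: "l2_ip M (B.conjp f e) (C.conjp f e) = (-1) * pairing f (\<lambda>s t. conj_kernel e s * conj_kernel e (t - s))"
    unfolding B.conjp_def C.conjp_def by (rule ip_BC[where k = "conj_kernel e" and l = "conj_kernel e" and \<sigma> = "-1" and c = c, OF f _ _ q(1) q(1) s1(1) s1(1)]) measurable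
  have q2: "l2_ip M (B.conjp f (2*e)) (A.conjp f e) = (-1) * pairing f (\<lambda>s t. conj_kernel (2*e) t * conj_kernel e (s - t))"
    unfolding B.conjp_def A.conjp_def by (rule ip_BA[where k = "conj_kernel e" and l = "conj_kernel (2*e)" and \<sigma> = "-1" and c = c, OF f _ _ q(1) q(2) s1(1) s1(1)]) measurable
  have q3: "l2_ip M (A.conjp f e) (C.conjp f (2*e)) = (-1) * pairing f (\<lambda>s t. conj_kernel e s * conj_kernel (2*e) t)"
    unfolding A.conjp_def C.conjp_def by (rule ip_AC[where k = "conj_kernel e" and l = "conj_kernel (2*e)" and \<sigma> = "-1" and c = c, OF f _ _ q(1) q(2) s1(1) s1(1)]) measurable
  have p1: "l2_ip M (B.pois f e) (C.pois f e) = 1 * pairing f (\<lambda>s t. poisson_kernel e s * poisson_kernel e (t - s))"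
    unfolding B.pois_def C.pois_def by (rule ip_BC[where k = "poisson_kernel e" and l = "poisson_kernel e" and \<sigma> = "1" and c = c, OF f _ _ p(1) p(1) s1(2) s1(2)]) measurable
  have p2: "l2_ip M (B.pois f (2*e)) (A.pois f e) = 1 * pairing f (\<lambda>s t. poisson_kernel (2*e) t * poisson_kernel e (s - t))"
    unfolding B.pois_def A.pois_def by (rule ip_BA[where k = "poisson_kernel e" and l = "poisson_kernel (2*e)" and \<sigma> = "1" and c = c, OF f _ _ p(1) p(2) s1(2) s1(2)]) measurable
  have p3: "l2_ip M (A.pois f e) (C.pois f (2*e)) = 1 * pairing f (\<lambda>s t. poisson_kernel e s * poisson_kernel (2*e) t)"
    unfolding A.pois_def C.pois_def by (rule ip_AC[where k = "poisson_kernel e" and l = "poisson_kernel (2*e)" and \<sigma> = "1" and c = c, OF f _ _ p(1) p(2) s1(2) s1(2)]) measurable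
  let ?P = "\<lambda>\<Phi>. pairing f \<Phi>"
  have add: "?P (\<lambda>s t. \<Phi> s t + \<Psi> s t - \<Theta> s t) = ?P \<Phi> + ?P \<Psi> - ?P \<Theta>"
      "?P (\<lambda>s t. \<Phi> s t - \<Psi> s t - \<Theta> s t) = ?P \<Phi> - ?P \<Psi> - ?P \<Theta>"
    if "integrable (lborel \<Otimes>\<^sub>M lborel) (\<lambda>p. \<Phi> (fst p) (snd p) * corr2 f (fst p) (snd p))"
       "integrable (lborel \<Otimes>\<^sub>M lborel) (\<lambda>p. \<Psi> (fst p) (snd p) * corr2 f (fst p) (snd p))"
       "integrable (lborel \<Otimes>\<^sub>M lborel) (\<lambda>p. \<Theta> (fst p) (snd p) * corr2 f (fst p) (snd p))" for \<Phi> \<Psi> \<Theta>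
    unfolding pairing_def using that by (simp_all add: distrib_right left_diff_distrib)
  have i1: "integrable (lborel \<Otimes>\<^sub>M lborel) (\<lambda>p. conj_kernel e (fst p) * conj_kernel e (snd p - fst p) * corr2 f (fst p) (snd p))"
    by (rule I[where \<Phi> = "\<lambda>s t. conj_kernel e s * conj_kernel e (t - s)"]) (auto intro: bb q)
  have i2: "integrable (lborel \<Otimes>\<^sub>M lborel) (\<lambda>p. conj_kernel (2*e) (snd p) * conj_kernel e (fst p - snd p) * corr2 f (fst p) (snd p))"
    by (rule I[where \<Phi> = "\<lambda>s t. conj_kernel (2*e) t * conj_kernel e (s - t)"]) (auto intro: bb q)
  have i3: "integrable (lborel \<Otimes>\<^sub>M lborel) (\<lambda>p. conj_kernel e (fst p) * conj_kernel (2*e) (snd p) * corr2 f (fst p) (snd p))"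
    by (rule I[where \<Phi> = "\<lambda>s t. conj_kernel e s * conj_kernel (2*e) t"]) (auto intro: bb q)
  have j1: "integrable (lborel \<Otimes>\<^sub>M lborel) (\<lambda>p. poisson_kernel e (fst p) * poisson_kernel e (snd p - fst p) * corr2 f (fst p) (snd p))"
    by (rule I[where \<Phi> = "\<lambda>s t. poisson_kernel e s * poisson_kernel e (t - s)"]) (auto intro: bb p)
  have j2: "integrable (lborel \<Otimes>\<^sub>M lborel) (\<lambda>p. poisson_kernel (2*e) (snd p) * poisson_kernel e (fst p - snd p) * corr2 f (fst p) (snd p))"
    by (rule I[where \<Phi> = "\<lambda>s t. poisson_kernel (2*e) t * poisson_kernel e (s - t)"]) (auto intro: bb p)
  have j3: "integrable (lborel \<Otimes>\<^sub>M lborel) (\<lambda>p. poisson_kernel e (fst p) * poisson_kernel (2*e) (snd p) * corr2 f (fst p) (snd p))"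
    by (rule I[where \<Phi> = "\<lambda>s t. poisson_kernel e s * poisson_kernel (2*e) t"]) (auto intro: bb p)
  have pt: "conj_kernel e s * conj_kernel e (t - s) + conj_kernel (2*e) t * conj_kernel e (s - t) - conj_kernel e s * conj_kernel (2*e) t
     = poisson_kernel e s * poisson_kernel e (t - s) - poisson_kernel (2*e) t * poisson_kernel e (s - t) - poisson_kernel e s * poisson_kernel (2*e) t" for s t
  proof -
    have "conj_kernel e (s - t) = - conj_kernel e (t - s)" "poisson_kernel e (s - t) = poisson_kernel e (t - s)"
      using conj_kernel_minus[of e "t - s"] poisson_kernel_minus[of e "t - s"] by simp_all
    then show ?thesis using kernel_identity[OF e, of s t] by simp
  qed
  have "?P (\<lambda>s t. conj_kernel e s * conj_kernel e (t - s)) + ?P (\<lambda>s t. conj_kernel (2*e) t * conj_kernel e (s - t))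
      - ?P (\<lambda>s t. conj_kernel e s * conj_kernel (2*e) t)
    = ?P (\<lambda>s t. conj_kernel e s * conj_kernel e (t - s) + conj_kernel (2*e) t * conj_kernel e (s - t) - conj_kernel e s * conj_kernel (2*e) t)"
    by (rule add(1)[symmetric]) (rule i1 i2 i3)+
  also have "\<dots> = ?P (\<lambda>s t. poisson_kernel e s * poisson_kernel e (t - s) - poisson_kernel (2*e) t * poisson_kernel e (s - t) - poisson_kernel e s * poisson_kernel (2*e) t)"
    by (simp only: pt)
  also have "\<dots> = ?P (\<lambda>s t. poisson_kernel e s * poisson_kernel e (t - s)) - ?P (\<lambda>s t. poisson_kernel (2*e) t * poisson_kernel e (s - t))
      - ?P (\<lambda>s t. poisson_kernel e s * poisson_kernel (2*e) t)"
    by (rule add(2)) (rule j1 j2 j3)+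
  finally show ?thesis unfolding q1 q2 q3 p1 p2 p3 by simp
qed

text \<open>As e tends to 0 every Poisson product tends to K = ||f||^2, so the identity becomes
  -<B,C> - <B,A> + <A,C> = K - K - K = -K. With <B,B> = K the expansion of <C - B, B - A> is exactly
  0.\<close>

lemma orthogonal_nice:
  assumes f: "nice2 f R"
  shows "l2_ip M (\<lambda>x. C.hilb f x - B.hilb f x) (\<lambda>x. B.hilb f x - A.hilb f x) = 0"
proof -
  have nA: "A.nice f" and nC: "C.nice f" using f by (auto simp: nice2_def)
  have nB: "B.nice f" using nA by (simp add: A.nice_def B.nice_def)
  have s: "sq_int M f" "integrable M f" using nA by (auto simp: A.nice_def)
  obtain b where b: "\<And>x. \<bar>f x\<bar> \<le> b" using nA unfolding A.nice_def by blast
  let ?K = "(l2_nrm M f)\<^sup>2"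
  have ev: "\<forall>\<^sub>F e in at_right 0. (0::real) < e" by (rule eventually_at_right_less)
  note dbl = filterlim_compose[OF _ filterlim_times_pos_at_right_0[of 2, simplified]]
  have evc: "\<forall>\<^sub>F e in at_right 0. sq_int M (A.conjp f e)" "\<forall>\<^sub>F e in at_right 0. sq_int M (B.conjp f e)" "\<forall>\<^sub>F e in at_right 0. sq_int M (C.conjp f e)"
      "\<forall>\<^sub>F e in at_right 0. sq_int M (B.conjp f (2*e))" "\<forall>\<^sub>F e in at_right 0. sq_int M (C.conjp f (2*e))"
    using ev by (eventually_elim, simp add: A.conjp_L2 B.conjp_L2 C.conjp_L2 s)+
  have evp: "\<forall>\<^sub>F e in at_right 0. sq_int M (A.pois f e)" "\<forall>\<^sub>F e in at_right 0. sq_int M (B.pois f e)" "\<forall>\<^sub>F e in at_right 0. sq_int M (C.pois f e)"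
      "\<forall>\<^sub>F e in at_right 0. sq_int M (B.pois f (2*e))" "\<forall>\<^sub>F e in at_right 0. sq_int M (C.pois f (2*e))"
    using ev by (eventually_elim, simp add: A.pois_L2 B.pois_L2 C.pois_L2 s)+
  have lim1: "((\<lambda>e. - l2_ip M (B.conjp f e) (C.conjp f e) - l2_ip M (B.conjp f (2*e)) (A.conjp f e) + l2_ip M (A.conjp f e) (C.conjp f (2*e)))
     \<longlongrightarrow> - l2_ip M (B.hilb f) (C.hilb f) - l2_ip M (B.hilb f) (A.hilb f) + l2_ip M (A.hilb f) (C.hilb f)) (at_right 0)"
    by (intro tendsto_intros l2_ip_tendsto evc A.hilb B.hilb C.hilb s dbl[OF B.hilb(2)] dbl[OF C.hilb(2)])
  have lim2: "((\<lambda>e. l2_ip M (B.pois f e) (C.pois f e) - l2_ip M (B.pois f (2*e)) (A.pois f e) - l2_ip M (A.pois f e) (C.pois f (2*e)))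
     \<longlongrightarrow> l2_ip M f f - l2_ip M f f - l2_ip M f f) (at_right 0)"
    by (intro tendsto_intros l2_ip_tendsto evp s A.pois_L2_tendsto[OF s b] B.pois_L2_tendsto[OF s b] C.pois_L2_tendsto[OF s b]
        dbl[OF B.pois_L2_tendsto[OF s b]] dbl[OF C.pois_L2_tendsto[OF s b]])
  have "\<forall>\<^sub>F e in at_right 0. - l2_ip M (B.conjp f e) (C.conjp f e) - l2_ip M (B.conjp f (2*e)) (A.conjp f e) + l2_ip M (A.conjp f e) (C.conjp f (2*e))
    = l2_ip M (B.pois f e) (C.pois f e) - l2_ip M (B.pois f (2*e)) (A.pois f e) - l2_ip M (A.pois f e) (C.pois f (2*e))"
    using ev by eventually_elim (rule pairing_identity[OF f])
  from Lim_transform_eventually[OF lim1 this] lim2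
  have "- l2_ip M (B.hilb f) (C.hilb f) - l2_ip M (B.hilb f) (A.hilb f) + l2_ip M (A.hilb f) (C.hilb f) = - ?K"
    using tendsto_unique[OF trivial_limit_at_right_real] by (fastforce simp: l2_ip_self)
  moreover have "l2_ip M (B.hilb f) (B.hilb f) = ?K" by (rule B.hilb_ip_nice[OF nB])
  ultimately show ?thesis
    using A.hilb(1)[OF s(1)] B.hilb(1)[OF s(1)] C.hilb(1)[OF s(1)]
    by (simp add: l2_ip_diff_left l2_ip_diff_right sq_int_diff l2_ip_commute)
qed

text \<open>Truncation at the sum of the absolute heights bounds both of them. Each of the three
  Hilbert transforms moves by at most the L^2 error of the truncation, and the inner product is
  continuous.\<close>

theorem hilb_orthogonal:
  assumes f: "sq_int M f"
  shows "l2_ip M (\<lambda>x. C.hilb f x - B.hilb f x) (\<lambda>x. B.hilb f x - A.hilb f x) = 0"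
proof -
  let ?H = "\<lambda>x. \<bar>hA x\<bar> + \<bar>hC x\<bar>"
  let ?f = "\<lambda>m. level_trunc ?H m f"
  have [measurable]: "?H \<in> borel_measurable M" by measurable
  have n: "nice2 (?f m) (real m)" for m
    unfolding nice2_def
  proof (intro conjI ballI impI)
    show "A.nice (?f m)" by (rule A.nice_level_trunc[OF f]) auto
    show "C.nice (?f m)" by (rule C.nice_level_trunc[OF f]) auto
    show "\<bar>hA x\<bar> \<le> real m" "\<bar>hC x\<bar> \<le> real m" if "?f m x \<noteq> 0" for x using level_trunc_support[OF that] by auto
  qed
  have s: "sq_int M (?f m)" for m by (rule nice2_sq[OF n])
  have lim: "(\<lambda>m. l2_nrm M (\<lambda>x. ?f m x - f x)) \<longlonglongrightarrow> 0" by (rule level_trunc_L2_tendsto[OF f]) measurable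
  have d: "(\<lambda>m. l2_nrm M (\<lambda>x. (u m x - v m x) - (u0 x - v0 x))) \<longlonglongrightarrow> 0"
    if u: "\<And>m. sq_int M (u m)" "sq_int M u0" "\<And>m. l2_nrm M (\<lambda>x. u m x - u0 x) \<le> l2_nrm M (\<lambda>x. ?f m x - f x)"
    and v: "\<And>m. sq_int M (v m)" "sq_int M v0" "\<And>m. l2_nrm M (\<lambda>x. v m x - v0 x) \<le> l2_nrm M (\<lambda>x. ?f m x - f x)"
    for u v :: "nat \<Rightarrow> 'a \<Rightarrow> real" and u0 v0
  proof -
    have lim2: "(\<lambda>m. l2_nrm M (\<lambda>x. ?f m x - f x) + l2_nrm M (\<lambda>x. ?f m x - f x)) \<longlonglongrightarrow> 0" using tendsto_add[OF lim lim] by simp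
    show ?thesis
    proof (rule tendsto_sandwich[OF always_eventually always_eventually tendsto_const lim2])
      show "\<forall>m. l2_nrm M (\<lambda>x. (u m x - v m x) - (u0 x - v0 x)) \<le> l2_nrm M (\<lambda>x. ?f m x - f x) + l2_nrm M (\<lambda>x. ?f m x - f x)"
      proof
        fix m
        have "l2_nrm M (\<lambda>x. (u m x - v m x) - (u0 x - v0 x)) = l2_nrm M (\<lambda>x. (u m x - u0 x) + (v0 x - v m x))"
          by (simp add: algebra_simps)
        also have "\<dots> \<le> l2_nrm M (\<lambda>x. u m x - u0 x) + l2_nrm M (\<lambda>x. v0 x - v m x)"
          by (intro l2_nrm_triangle sq_int_diff u v)
        also have "\<dots> \<le> l2_nrm M (\<lambda>x. ?f m x - f x) + l2_nrm M (\<lambda>x. ?f m x - f x)"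
          using u(3)[of m] v(3)[of m] by (simp add: l2_nrm_minus_commute[of M v0])
        finally show "l2_nrm M (\<lambda>x. (u m x - v m x) - (u0 x - v0 x)) \<le> l2_nrm M (\<lambda>x. ?f m x - f x) + l2_nrm M (\<lambda>x. ?f m x - f x)" .
      qed
    qed (simp add: l2_nrm_nonneg)
  qed
  have "(\<lambda>m. l2_ip M (\<lambda>x. C.hilb (?f m) x - B.hilb (?f m) x) (\<lambda>x. B.hilb (?f m) x - A.hilb (?f m) x))
      \<longlonglongrightarrow> l2_ip M (\<lambda>x. C.hilb f x - B.hilb f x) (\<lambda>x. B.hilb f x - A.hilb f x)"
    by (intro l2_ip_tendsto sq_int_diff always_eventually allI d A.hilb(1) B.hilb(1) C.hilb(1) f s
        A.hilb_diff_nrm B.hilb_diff_nrm C.hilb_diff_nrm)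
  then show ?thesis unfolding orthogonal_nice[OF n] by (simp add: LIMSEQ_const_iff)
qed

end

section \<open>Directional flows on Euclidean space\<close>

interpretation lborel_product: product_sigma_finite "\<lambda>_::nat. lborel :: real measure"
  by standard

lemma space_euclid: "space (euclid m) = {1..m} \<rightarrow>\<^sub>E UNIV"
  by (simp add: euclid_def space_PiM)

lemma sigma_finite_euclid: "sigma_finite_measure (euclid m)"
  unfolding euclid_def by (rule lborel_product.sigma_finite) simp

lemma euclid_component: "i \<in> {1..m} \<Longrightarrow> (\<lambda>x. x i) \<in> borel_measurable (euclid m)"
  unfolding euclid_def using measurable_component_singleton[of i "{1..m}" "\<lambda>_. lborel"] by simp

lemma measurable_into_euclid:
  assumes "\<And>i. i \<in> {1..m} \<Longrightarrow> (\<lambda>x. f x i) \<in> borel_measurable N"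
  shows "(\<lambda>x. \<lambda>i\<in>{1..m}. f x i) \<in> N \<rightarrow>\<^sub>M euclid m"
  unfolding euclid_def by (rule measurable_restrict) (use assms in simp)

lemma euclid_translate:
  "distr (euclid m) (euclid m) (\<lambda>x. \<lambda>i\<in>{1..m}. x i + c i) = euclid m"
proof -
  have T: "(\<lambda>x. \<lambda>i\<in>{1..m}. x i + c i) \<in> euclid m \<rightarrow>\<^sub>M euclid m"
    by (intro measurable_into_euclid borel_measurable_add euclid_component borel_measurable_const)
  have "distr (euclid m) (euclid m) (\<lambda>x. \<lambda>i\<in>{1..m}. x i + c i) = (\<Pi>\<^sub>M i\<in>{1..m}. lborel)"
  proof (rule lborel_product.PiM_eqI)
    fix E assume E: "\<And>i. i \<in> {1..m} \<Longrightarrow> E i \<in> sets (lborel :: real measure)"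
    define E' where "E' i = (\<lambda>y. y + c i) -` E i" for i
    have E': "E' i \<in> sets lborel" if "i \<in> {1..m}" for i
    proof -
      have "(\<lambda>y. y + c i) -` E i \<inter> space borel \<in> sets borel" using E[OF that] by (intro measurable_sets[of _ borel borel]) auto
      then show ?thesis by (simp add: E'_def)
    qed
    have em: "emeasure lborel (E' i) = emeasure lborel (E i)" if "i \<in> {1..m}" for i
    proof -
      have "emeasure (distr lborel borel ((+) (c i))) (E i) = emeasure lborel ((+) (c i) -` E i \<inter> space lborel)"
        using E[OF that] by (intro emeasure_distr) auto
      moreover have "(+) (c i) -` E i \<inter> space lborel = E' i" by (auto simp: E'_def add.commute)
      ultimately show ?thesis by (simp add: lborel_distr_plus)
    qed
    have "emeasure (distr (euclid m) (euclid m) (\<lambda>x. \<lambda>i\<in>{1..m}. x i + c i)) (Pi\<^sub>E {1..m} E)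
       = emeasure (euclid m) ((\<lambda>x. \<lambda>i\<in>{1..m}. x i + c i) -` (Pi\<^sub>E {1..m} E) \<inter> space (euclid m))"
      using T E by (intro emeasure_distr) (auto simp: euclid_def intro!: sets_PiM_I_finite)
    also have "(\<lambda>x. \<lambda>i\<in>{1..m}. x i + c i) -` (Pi\<^sub>E {1..m} E) \<inter> space (euclid m) = Pi\<^sub>E {1..m} E'"
      by (auto simp: space_euclid E'_def PiE_iff extensional_def restrict_def)
    also have "emeasure (euclid m) (Pi\<^sub>E {1..m} E') = (\<Prod>i\<in>{1..m}. emeasure lborel (E' i))"
      unfolding euclid_def using E' by (intro lborel_product.emeasure_PiM) auto
    also have "\<dots> = (\<Prod>i\<in>{1..m}. emeasure lborel (E i))" by (intro prod.cong em) auto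
    finally show "emeasure (distr (euclid m) (euclid m) (\<lambda>x. \<lambda>i\<in>{1..m}. x i + c i)) (Pi\<^sub>E {1..m} E) = (\<Prod>i\<in>{1..m}. emeasure lborel (E i))" .
  qed (auto simp: euclid_def)
  then show ?thesis by (simp add: euclid_def)
qed

section \<open>Translation flows along a vector\<close>

definition vflow :: "nat \<Rightarrow> (nat \<Rightarrow> real) \<Rightarrow> real \<Rightarrow> (nat \<Rightarrow> real) \<Rightarrow> (nat \<Rightarrow> real)" where
  "vflow m u t x = (\<lambda>i\<in>{1..m}. x i - t * u i)"

lemma vflow_measurable: "(\<lambda>p. vflow m u (fst p) (snd p)) \<in> borel \<Otimes>\<^sub>M euclid m \<rightarrow>\<^sub>M euclid m"
  unfolding vflow_def
proof (intro measurable_into_euclid)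
  fix i assume "i \<in> {1..m}"
  note [measurable] = euclid_component[OF this]
  show "(\<lambda>x. snd x i - fst x * u i) \<in> borel_measurable (borel \<Otimes>\<^sub>M euclid m)" by measurable
qed

lemma measure_flow_vflow:
  assumes "h \<in> borel_measurable (euclid m)" "\<And>x t. x \<in> space (euclid m) \<Longrightarrow> h (vflow m u t x) = h x - t"
  shows "measure_flow (euclid m) (vflow m u) h"
proof (intro measure_flow.intro measure_flow_axioms.intro sigma_finite_euclid vflow_measurable assms)
  show "distr (euclid m) (euclid m) (vflow m u t) = euclid m" for t
    using euclid_translate[of m "\<lambda>i. - (t * u i)"] by (simp add: vflow_def[abs_def])
  show "vflow m u s (vflow m u t x) = vflow m u (s + t) x" for s t x
    by (auto simp: vflow_def algebra_simps intro!: restrict_ext)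
  show "vflow m u 0 x = x" if "x \<in> space (euclid m)" for x
    using that by (auto simp: vflow_def space_euclid PiE_iff extensional_def restrict_def)
qed

definition dir :: "nat \<Rightarrow> (nat \<Rightarrow> real) \<Rightarrow> nat \<Rightarrow> real" where
  "dir n v i = (if i = Suc n then 1 else v i)"

lemma shift_along_vflow: "shift_along n v = vflow (Suc n) (dir n v)"
  by (intro ext) (simp add: shift_along_def vflow_def dir_def)

lemma measure_flow_scaled_dir:
  assumes "c > 0"
  shows "measure_flow (euclid (Suc n)) (vflow (Suc n) (\<lambda>i. c * dir n v i)) (\<lambda>x. x (Suc n) / c)"
proof (rule measure_flow_vflow)
  show "(\<lambda>x. x (Suc n) / c) \<in> borel_measurable (euclid (Suc n))"
    by (intro borel_measurable_divide euclid_component borel_measurable_const) simp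
qed (use assms in \<open>simp add: vflow_def dir_def diff_divide_distrib\<close>)

lemma measure_flow_dir: "measure_flow (euclid (Suc n)) (vflow (Suc n) (dir n v)) (\<lambda>x. x (Suc n))"
  using measure_flow_scaled_dir[of 1 n v] by simp

definition dhilb :: "nat \<Rightarrow> (nat \<Rightarrow> real) \<Rightarrow> ((nat \<Rightarrow> real) \<Rightarrow> real) \<Rightarrow> (nat \<Rightarrow> real) \<Rightarrow> real" where
  "dhilb n v f = measure_flow.hilb (euclid (Suc n)) (vflow (Suc n) (dir n v)) f"

lemma dhilb:
  assumes f: "sq_int (euclid (Suc n)) f"
  shows "sq_int (euclid (Suc n)) (dhilb n v f)"
    "AE x in euclid (Suc n). (trunc_hilbert (\<lambda>t. f (shift_along n v t x)) \<longlongrightarrow> dhilb n v f x) (at_right 0)"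
    "l2_nrm (euclid (Suc n)) (dhilb n v f) \<le> l2_nrm (euclid (Suc n)) f"
  using measure_flow.hilb[OF measure_flow_dir f] measure_flow.hilb_nrm[OF measure_flow_dir f]
  by (auto simp: dhilb_def shift_along_vflow)

lemma trunc_hilbert_scale:
  assumes c: "c > 0"
  shows "trunc_hilbert (\<lambda>t. g (c * t)) e = trunc_hilbert g (c * e)"
proof -
  have "trunc_hilbert g (c * e) = 1 / pi * (\<bar>c\<bar> *\<^sub>R (\<integral>t. indicator {t. c * e < \<bar>t\<bar>} (0 + c * t) *\<^sub>R (g (0 + c * t) / (0 + c * t)) \<partial>lborel))"
    unfolding trunc_hilbert_def set_lebesgue_integral_def
    using lborel_integral_real_affine[of c "\<lambda>t. indicator {t. c * e < \<bar>t\<bar>} t *\<^sub>R (g t / t)" 0] c by simp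
  also have "\<dots> = 1 / pi * (\<integral>t. \<bar>c\<bar> * (indicator {t. c * e < \<bar>t\<bar>} (0 + c * t) *\<^sub>R (g (0 + c * t) / (0 + c * t))) \<partial>lborel)"
    by (simp only: real_scaleR_def integral_mult_right_zero)
  also have "(\<lambda>t. \<bar>c\<bar> * (indicator {t. c * e < \<bar>t\<bar>} (0 + c * t) *\<^sub>R (g (0 + c * t) / (0 + c * t)))) = (\<lambda>t. indicator {t. e < \<bar>t\<bar>} t *\<^sub>R (g (c * t) / t))"
    using c by (auto simp: fun_eq_iff indicator_def abs_mult)
  finally show ?thesis by (simp add: trunc_hilbert_def set_lebesgue_integral_def)
qed

text \<open>The measure dt/t is invariant under dilation, so rescaling the speed only rescales the
  truncation parameter and leaves the limit unchanged.\<close>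

lemma hilb_scaled_dir:
  assumes f: "sq_int (euclid (Suc n)) f" and c: "c > 0"
  shows "AE x in euclid (Suc n). measure_flow.hilb (euclid (Suc n)) (vflow (Suc n) (\<lambda>i. c * dir n v i)) f x = dhilb n v f x"
  using measure_flow.hilb(3)[OF measure_flow_scaled_dir[OF c, of n v] f] dhilb(2)[OF f, of v]
proof eventually_elim
  case (elim x)
  have e: "vflow (Suc n) (\<lambda>i. c * dir n v i) t x = shift_along n v (c * t) x" for t
    unfolding shift_along_vflow by (auto simp: vflow_def)
  have sc: "trunc_hilbert (\<lambda>t. f (shift_along n v (c * t) x)) = (\<lambda>e. trunc_hilbert (\<lambda>t. f (shift_along n v t x)) (c * e))"
    by (rule ext) (rule trunc_hilbert_scale[OF c])
  have "(trunc_hilbert (\<lambda>t. f (shift_along n v (c * t) x)) \<longlongrightarrow> dhilb n v f x) (at_right 0)"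
    unfolding sc by (rule filterlim_compose[OF elim(2) filterlim_times_pos_at_right_0[OF c]])
  with elim(1) show ?case unfolding e by (rule tendsto_unique[rotated]) simp
qed

text \<open>The middle direction (b,1) is the sum of the vectors \<theta> (a,1) and (1 - \<theta>)
  (c,1), so its flow is the product of theirs, and by scaling invariance these have the Hilbert
  transforms of directions a and c.\<close>

lemma dhilb_orthogonal:
  assumes f: "sq_int (euclid (Suc n)) f" and \<theta>: "0 < \<theta>" "\<theta> < 1" and k: "k \<in> {1..n}" "a k \<noteq> c k"
    and b: "\<And>i. i \<in> {1..n} \<Longrightarrow> b i = \<theta> * a i + (1 - \<theta>) * c i"
  shows "l2_ip (euclid (Suc n)) (\<lambda>x. dhilb n c f x - dhilb n b f x) (\<lambda>x. dhilb n b f x - dhilb n a f x) = 0"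
proof -
  let ?m = "Suc n" let ?M = "euclid (Suc n)"
  let ?u = "\<lambda>i. \<theta> * dir n a i" and ?w = "\<lambda>i. (1 - \<theta>) * dir n c i"
  \<comment> \<open>The determinant of the two vectors in coordinates k and n + 1. The heights
    \<open>hA\<close> and \<open>hC\<close> are the dual basis there: each drops at unit speed along
    its own vector and is constant along the other.\<close>
  define d where "d = \<theta> * (1 - \<theta>) * (a k - c k)"
  have d: "d \<noteq> 0" using \<theta> k by (simp add: d_def)
  have kn: "k \<noteq> Suc n" "k \<in> {1..?m}" "?m \<in> {1..?m}" using k by auto
  define hA where "hA x = (x k * (1 - \<theta>) - (1 - \<theta>) * c k * x ?m) / d" for x :: "nat \<Rightarrow> real"
  define hC where "hC x = (\<theta> * a k * x ?m - \<theta> * x k) / d" for x :: "nat \<Rightarrow> real"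
  note [measurable] = euclid_component[OF kn(2)] euclid_component[OF kn(3)]
  have A: "measure_flow ?M (vflow ?m ?u) hA"
  proof (rule measure_flow_vflow)
    show "hA \<in> borel_measurable ?M" unfolding hA_def by measurable
    show "hA (vflow ?m ?u t x) = hA x - t" for x t
    proof -
      have "(x k - t * (\<theta> * a k)) * (1 - \<theta>) - (1 - \<theta>) * c k * (x ?m - t * \<theta>) = (x k * (1 - \<theta>) - (1 - \<theta>) * c k * x ?m) - t * d"
        unfolding d_def by (simp add: algebra_simps)
      then show ?thesis using kn d by (simp add: hA_def vflow_def dir_def diff_divide_distrib)
    qed
  qed
  have C: "measure_flow ?M (vflow ?m ?w) hC"
  proof (rule measure_flow_vflow)
    show "hC \<in> borel_measurable ?M" unfolding hC_def by measurable
    show "hC (vflow ?m ?w t x) = hC x - t" for x t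
    proof -
      have "\<theta> * a k * (x ?m - t * (1 - \<theta>)) - \<theta> * (x k - t * ((1 - \<theta>) * c k)) = (\<theta> * a k * x ?m - \<theta> * x k) - t * d"
        unfolding d_def by (simp add: algebra_simps)
      then show ?thesis using kn d by (simp add: hC_def vflow_def dir_def diff_divide_distrib)
    qed
  qed
  interpret TF: two_flows ?M "vflow ?m ?u" "vflow ?m ?w" hA hC
  proof (intro two_flows.intro A C two_flows_axioms.intro)
    show "vflow ?m ?u s (vflow ?m ?w t x) = vflow ?m ?w t (vflow ?m ?u s x)" for s t x
      by (auto simp: vflow_def intro!: restrict_ext)
    show "hA (vflow ?m ?w t x) = hA x" for t x
    proof -
      have "(x k - t * ((1 - \<theta>) * c k)) * (1 - \<theta>) - (1 - \<theta>) * c k * (x ?m - t * (1 - \<theta>)) = (x k * (1 - \<theta>) - (1 - \<theta>) * c k * x ?m)"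
        by (simp add: algebra_simps)
      then show ?thesis using kn by (simp add: hA_def vflow_def dir_def)
    qed
    show "hC (vflow ?m ?u t x) = hC x" for t x
    proof -
      have "\<theta> * a k * (x ?m - t * \<theta>) - \<theta> * (x k - t * (\<theta> * a k)) = \<theta> * a k * x ?m - \<theta> * x k" by (simp add: algebra_simps)
      then show ?thesis using kn by (simp add: hC_def vflow_def dir_def)
    qed
  qed
  have B: "TF.B = vflow ?m (dir n b)"
  proof (intro ext)
    fix t x i
    show "TF.B t x i = vflow ?m (dir n b) t x i"
    proof (cases "i \<in> {1..?m}")
      case True
      then have "i = ?m \<or> i \<in> {1..n}" by auto
      then have e: "dir n b i = \<theta> * dir n a i + (1 - \<theta>) * dir n c i" using b[of i] by (auto simp: dir_def)
      show ?thesis using True unfolding TF.B_def vflow_def by (simp add: e algebra_simps)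
    next
      case False
      then show ?thesis unfolding TF.B_def vflow_def by (simp del: atLeastAtMost_iff)
    qed
  qed
  have hB: "TF.B.hilb f = dhilb n b f" by (simp add: dhilb_def B)
  have sA: "AE x in ?M. TF.A.hilb f x = dhilb n a f x" by (rule hilb_scaled_dir[OF f \<theta>(1)])
  have sC: "AE x in ?M. TF.C.hilb f x = dhilb n c f x" by (rule hilb_scaled_dir[OF f]) (use \<theta> in simp)
  note [measurable] = sq_int_measurable[OF TF.A.hilb(1)[OF f]] sq_int_measurable[OF TF.C.hilb(1)[OF f]] sq_int_measurable[OF dhilb(1)[OF f]]
  have "l2_ip ?M (\<lambda>x. dhilb n c f x - dhilb n b f x) (\<lambda>x. dhilb n b f x - dhilb n a f x)
      = l2_ip ?M (\<lambda>x. TF.C.hilb f x - TF.B.hilb f x) (\<lambda>x. TF.B.hilb f x - TF.A.hilb f x)"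
    unfolding l2_ip_def hB
  proof (rule integral_cong_AE)
    show "AE x in ?M. (dhilb n c f x - dhilb n b f x) * (dhilb n b f x - dhilb n a f x) = (TF.C.hilb f x - dhilb n b f x) * (dhilb n b f x - TF.A.hilb f x)"
      using sA sC by eventually_elim simp
  qed measurable
  also have "\<dots> = 0" by (rule TF.hilb_orthogonal[OF f])
  finally show ?thesis .
qed

text \<open>Orthogonality is applied to the indices 0, r, r + 1: the new increment is orthogonal to
  everything accumulated since 0, so Pythagoras adds its square. The bound depends neither on the
  number of slopes nor on their spacing.\<close>

lemma dhilb_consecutive:
  fixes a :: "nat \<Rightarrow> real"
  assumes f: "sq_int (euclid (Suc n)) f" and k: "k \<in> {1..n}" and a: "\<And>i j. i < j \<Longrightarrow> j \<le> q \<Longrightarrow> a i < a j"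
  shows "(\<Sum>i<q. (l2_nrm (euclid (Suc n)) (\<lambda>x. dhilb n (v(k := a (Suc i))) f x - dhilb n (v(k := a i)) f x))\<^sup>2)
    \<le> 4 * (l2_nrm (euclid (Suc n)) f)\<^sup>2"
proof -
  let ?M = "euclid (Suc n)" and ?H = "\<lambda>i. dhilb n (v(k := a i)) f"
  have s: "sq_int ?M (?H i)" for i by (rule dhilb(1)[OF f])
  have "(\<Sum>i<r. (l2_nrm ?M (\<lambda>x. ?H (Suc i) x - ?H i x))\<^sup>2) = (l2_nrm ?M (\<lambda>x. ?H r x - ?H 0 x))\<^sup>2" if "r \<le> q" for r
    using that
  proof (induction r)
    case 0
    then show ?case by (simp add: l2_nrm_def)
  next
    case (Suc r)
    have eq: "(l2_nrm ?M (\<lambda>x. ?H (Suc r) x - ?H 0 x))\<^sup>2 = (l2_nrm ?M (\<lambda>x. ?H (Suc r) x - ?H r x))\<^sup>2 + (l2_nrm ?M (\<lambda>x. ?H r x - ?H 0 x))\<^sup>2"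
    proof (cases "r = 0")
      case True
      then show ?thesis by (simp add: l2_nrm_def)
    next
      case False
      have lt: "a 0 < a r" "a r < a (Suc r)" using a[of 0 r] a[of r "Suc r"] Suc.prems False by auto
      define \<theta> where "\<theta> = (a (Suc r) - a r) / (a (Suc r) - a 0)"
      have \<theta>: "0 < \<theta>" "\<theta> < 1" using lt by (auto simp: \<theta>_def field_simps)
      have "\<theta> * (a (Suc r) - a 0) = a (Suc r) - a r" using lt by (simp add: \<theta>_def)
      then have ar: "a r = \<theta> * a 0 + (1 - \<theta>) * a (Suc r)" by (simp add: algebra_simps)
      have "l2_ip ?M (\<lambda>x. ?H (Suc r) x - ?H r x) (\<lambda>x. ?H r x - ?H 0 x) = 0"
      proof (rule dhilb_orthogonal[OF f \<theta> k])
        show "(v(k := a 0)) k \<noteq> (v(k := a (Suc r))) k" using lt by simp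
        show "(v(k := a r)) i = \<theta> * (v(k := a 0)) i + (1 - \<theta>) * (v(k := a (Suc r))) i" for i
          using ar by (cases "i = k") (auto simp: algebra_simps)
      qed
      then have "l2_ip ?M (\<lambda>x. ?H (Suc r) x - ?H r x) (\<lambda>x. ?H 0 x - ?H r x) = 0"
        using l2_ip_diff_right[OF s[of r] s[of 0] sq_int_diff[OF s[of "Suc r"] s[of r]]] l2_ip_diff_right[OF s[of 0] s[of r] sq_int_diff[OF s[of "Suc r"] s[of r]]]
        by simp
      then have "(l2_nrm ?M (\<lambda>x. (?H (Suc r) x - ?H r x) - (?H 0 x - ?H r x)))\<^sup>2 = (l2_nrm ?M (\<lambda>x. ?H (Suc r) x - ?H r x))\<^sup>2 + (l2_nrm ?M (\<lambda>x. ?H 0 x - ?H r x))\<^sup>2"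
        by (subst l2_nrm_diff_sq) (auto intro: sq_int_diff s)
      then show ?thesis by (simp add: l2_nrm_minus_commute[of ?M "?H 0"])
    qed
    show ?case unfolding sum.lessThan_Suc using Suc.IH[OF Suc_leD[OF Suc.prems]] eq by linarith
  qed
  then have "(\<Sum>i<q. (l2_nrm ?M (\<lambda>x. ?H (Suc i) x - ?H i x))\<^sup>2) = (l2_nrm ?M (\<lambda>x. ?H q x - ?H 0 x))\<^sup>2" by simp
  also have "\<dots> \<le> (2 * l2_nrm ?M f)\<^sup>2"
  proof (rule power_mono[OF _ l2_nrm_nonneg])
    have "l2_nrm ?M (\<lambda>x. ?H q x + (-1) * ?H 0 x) \<le> l2_nrm ?M (?H q) + l2_nrm ?M (\<lambda>x. (-1) * ?H 0 x)"
      by (intro l2_nrm_triangle s sq_int_cmult)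
    moreover have "l2_nrm ?M (\<lambda>x. (-1) * ?H 0 x) = l2_nrm ?M (?H 0)" by (simp add: l2_nrm_def)
    ultimately show "l2_nrm ?M (\<lambda>x. ?H q x - ?H 0 x) \<le> 2 * l2_nrm ?M f"
      using dhilb(3)[OF f, of "v(k := a q)"] dhilb(3)[OF f, of "v(k := a 0)"] by simp
  qed
  finally show ?thesis by (simp add: power_mult_distrib)
qed

section \<open>Dyadic chaining\<close>

lemma weighted_cauchy_schwarz:
  fixes a w :: "'i \<Rightarrow> real"
  assumes w: "\<And>i. i \<in> I \<Longrightarrow> w i > 0"
  shows "(\<Sum>i\<in>I. a i)\<^sup>2 \<le> (\<Sum>i\<in>I. w i) * (\<Sum>i\<in>I. (a i)\<^sup>2 / w i)"
proof -
  have "(\<Sum>i\<in>I. a i)\<^sup>2 = (\<Sum>i\<in>I. sqrt (w i) * (a i / sqrt (w i)))\<^sup>2"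
    using w by (intro arg_cong[where f = "\<lambda>x. x\<^sup>2"] sum.cong) (auto simp: less_imp_neq[THEN not_sym])
  also have "\<dots> \<le> (\<Sum>i\<in>I. (sqrt (w i))\<^sup>2) * (\<Sum>i\<in>I. (a i / sqrt (w i))\<^sup>2)" by (rule Cauchy_Schwarz_ineq_sum)
  also have "(\<Sum>i\<in>I. (sqrt (w i))\<^sup>2) = (\<Sum>i\<in>I. w i)" using w by (intro sum.cong) (auto simp: less_imp_le)
  also have "(\<Sum>i\<in>I. (a i / sqrt (w i))\<^sup>2) = (\<Sum>i\<in>I. (a i)\<^sup>2 / w i)"
    using w by (intro sum.cong) (auto simp: power_divide less_imp_le)
  finally show ?thesis .
qed

text \<open>The ceiling of the binary logarithm: \<open>clog N\<close> binary digits suffice to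
  index N points.\<close>

definition clog :: "nat \<Rightarrow> nat" where
  "clog N = (LEAST l. N \<le> 2 ^ l)"

lemma le_two_power_clog: "N \<le> 2 ^ clog N"
  unfolding clog_def by (rule LeastI[of "\<lambda>l. N \<le> 2 ^ l" N]) (simp add: less_imp_le[OF less_exp])

lemma two_power_clog_less:
  assumes "N \<ge> 1" shows "2 ^ clog N < 2 * N"
proof (cases "clog N")
  case 0
  then show ?thesis using assms by simp
next
  case (Suc l)
  then have "\<not> N \<le> 2 ^ l" using not_less_Least[of l "\<lambda>l. N \<le> 2 ^ l"] by (simp add: clog_def)
  then show ?thesis using Suc by simp
qed

lemma clog_mono: "N \<le> N' \<Longrightarrow> clog N \<le> clog N'"
  unfolding clog_def[of N] by (rule Least_le) (meson le_trans le_two_power_clog)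

text \<open>\<open>c k\<close> is the actual number of slopes and \<open>N k\<close> its prescribed
  bound: indices run below \<open>c\<close>, while all counting uses \<open>N\<close>, which is
  monotone. \<open>inc\<close> is the analytic input, a square-sum bound uniform in the length of
  the sequence.\<close>

locale dyadic_chain =
  fixes M :: "'a measure" and n :: nat and N c :: "nat \<Rightarrow> nat" and D :: real
    and F :: "(nat \<Rightarrow> nat) \<Rightarrow> 'a \<Rightarrow> real"
  assumes n: "n \<ge> 2" and N1: "k \<in> {1..n} \<Longrightarrow> 1 \<le> N k" and Nmono: "k \<in> {1..n} \<Longrightarrow> l \<in> {1..n} \<Longrightarrow> k \<le> l \<Longrightarrow> N l \<le> N k"
    and c: "k \<in> {1..n} \<Longrightarrow> 1 \<le> c k" "k \<in> {1..n} \<Longrightarrow> c k \<le> N k"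
    and F: "sq_int M (F \<iota>)" and FD: "(l2_nrm M (F \<iota>))\<^sup>2 \<le> D"
    and inc: "k \<in> {1..n} \<Longrightarrow> (\<And>i j. i < j \<Longrightarrow> j \<le> q \<Longrightarrow> b i < b j) \<Longrightarrow> b q < c k \<Longrightarrow>
       (\<Sum>i<q. (l2_nrm M (\<lambda>x. F (\<mu>(k := b (Suc i))) x - F (\<mu>(k := b i)) x))\<^sup>2) \<le> D"
begin

definition L :: "nat \<Rightarrow> nat" where "L k = clog (N k)"

(* An index i of coordinate k is rounded down to its j leading binary digits out of L k; for j \<ge> L k,
   truncated subtraction makes this the identity. *)
definition rd :: "nat \<Rightarrow> nat \<Rightarrow> nat \<Rightarrow> nat" where
  "rd j k i = (i div 2 ^ (L k - j)) * 2 ^ (L k - j)"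

definition G :: "nat \<Rightarrow> nat \<Rightarrow> nat set" where
  "G j k = rd j k ` {..<c k}"

definition I :: "(nat \<Rightarrow> nat) set" where "I = (\<Pi>\<^sub>E k\<in>{1..n}. {..<c k})"

(* Interpolates between resolution j (k = 0) and Suc j (k = n) one coordinate at a time. *)
definition mix :: "nat \<Rightarrow> nat \<Rightarrow> (nat \<Rightarrow> nat) \<Rightarrow> nat \<Rightarrow> nat" where
  "mix j k \<iota> = (\<lambda>l\<in>{1..n}. if l \<le> k then rd (Suc j) l (\<iota> l) else rd j l (\<iota> l))"

text \<open>One representative for each grid line in direction k that occurs in the step from
  \<open>mix j (k - 1)\<close> to \<open>mix j k\<close>; the entry 0 at k is a placeholder that
  \<open>S2\<close> overwrites.\<close>

definition U :: "nat \<Rightarrow> nat \<Rightarrow> (nat \<Rightarrow> nat) set" where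
  "U j k = (\<Pi>\<^sub>E l\<in>{1..n}. if l = k then {0} else if l \<le> k then G (Suc j) l else G j l)"

definition S2 :: "nat \<Rightarrow> nat \<Rightarrow> 'a \<Rightarrow> real" where
  "S2 j k x = (\<Sum>\<mu>\<in>U j k. \<Sum>i\<in>G (Suc j) k. (F (\<mu>(k := i)) x - F (\<mu>(k := rd j k i)) x)\<^sup>2)"

(* Bounds the number of grid lines in any one coordinate direction at level j. The square sum along each
   line is at most D, so only the n - 1 transversal coordinates count, at worst all but the longest. *)
definition W :: "nat \<Rightarrow> real" where
  "W j = (\<Prod>l=2..n. 2 ^ min (Suc j) (L l))"

section \<open>Counting grid lines and their square sums\<close>

lemma L_mono: "k \<in> {1..n} \<Longrightarrow> l \<in> {1..n} \<Longrightarrow> k \<le> l \<Longrightarrow> L l \<le> L k"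
  unfolding L_def by (intro clog_mono Nmono)

lemma W_ge1: "W j \<ge> 1"
  unfolding W_def by (intro prod_ge_1) auto

lemma W_pos: "W j > 0"
  using W_ge1[of j] by simp

lemma D_nonneg: "D \<ge> 0"
  using FD[of undefined] zero_le_power2 by (rule order_trans[rotated])

lemma finite_G: "finite (G j k)" by (simp add: G_def)

lemma finite_U: "finite (U j k)"
  unfolding U_def by (intro finite_PiE) (auto simp: finite_G)

lemma rd_rd: "rd j k (rd (Suc j) k i) = rd j k i"
proof (cases "j < L k")
  case True
  define w where "w = (2::nat) ^ (L k - Suc j)"
  have w: "2 ^ (L k - j) = 2 * w" using True by (simp add: w_def Suc_diff_Suc flip: power_Suc)
  have "w > 0" by (simp add: w_def)
  then have "(i div w) * w div (2 * w) = (i div w) div 2" by simp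
  also have "\<dots> = i div (w * 2)" by (rule div_mult2_eq[symmetric])
  also have "w * 2 = 2 * w" by simp
  finally have "(i div w) * w div (2 * w) = i div (2 * w)" .
  then show ?thesis by (simp add: rd_def w flip: w_def)
next
  case False
  then show ?thesis by (simp add: rd_def)
qed

lemma card_G:
  assumes k: "k \<in> {1..n}" shows "card (G j k) \<le> 2 ^ min j (L k)"
proof -
  let ?w = "2 ^ (L k - j) :: nat"
  have "G j k \<subseteq> (\<lambda>q. q * ?w) ` {..<2 ^ min j (L k)}"
  proof
    fix y assume "y \<in> G j k"
    then obtain i where i: "i < c k" "y = (i div ?w) * ?w" by (auto simp: G_def rd_def)
    have "i < 2 ^ L k" using i(1) c(2)[OF k] le_two_power_clog[of "N k"] by (simp add: L_def)
    also have "(2::nat) ^ L k = 2 ^ min j (L k) * ?w" by (simp flip: power_add)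
    finally have "i div ?w < 2 ^ min j (L k)" by (simp add: less_mult_imp_div_less)
    then show "y \<in> (\<lambda>q. q * ?w) ` {..<2 ^ min j (L k)}" using i by auto
  qed
  then have "card (G j k) \<le> card ((\<lambda>q. q * ?w) ` {..<2 ^ min j (L k)})" by (intro card_mono) auto
  also have "\<dots> \<le> 2 ^ min j (L k)" using card_image_le[of "{..<2 ^ min j (L k)}" "\<lambda>q. q * ?w"] by simp
  finally show ?thesis .
qed

lemma card_U:
  assumes k: "k \<in> {1..n}" and j: "j < L k"
  shows "real (card (U j k)) \<le> W j"
proof -
  have k1: "1 \<in> {1..n}" using n by auto
  let ?p = "\<lambda>l. 2 ^ min (Suc j) (L l) :: nat"
  have "card (U j k) = (\<Prod>l\<in>{1..n}. card (if l = k then {0} else if l \<le> k then G (Suc j) l else G j l))"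
    unfolding U_def by (rule card_PiE) simp
  also have "\<dots> \<le> (\<Prod>l\<in>{1..n}. if l = k then 1 else ?p l)"
  proof (rule prod_mono)
    fix l assume l: "l \<in> {1..n}"
    have "card (G j l) \<le> ?p l"
      using card_G[OF l, of j] by (rule order_trans) (auto intro!: power_increasing)
    then show "0 \<le> card (if l = k then {0} else if l \<le> k then G (Suc j) l else G j l) \<and>
        card (if l = k then {0} else if l \<le> k then G (Suc j) l else G j l) \<le> (if l = k then 1 else ?p l)"
      using card_G[OF l, of "Suc j"] by auto
  qed
  also have "\<dots> \<le> (\<Prod>l\<in>{2..n}. ?p l)"
  proof (cases "k = 1")
    case True
    have "{1..n} = insert 1 {2..n}" using n by auto
    then show ?thesis using True by (simp add: prod.cong[of "{2..n}" "{2..n}" "\<lambda>l. if l = 1 then 1 else ?p l" ?p])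
  next
    case False
    have kk: "k \<in> {2..n}" using False k by auto
    have s: "{1..n} = insert 1 {2..n}" using n by auto
    \<comment> \<open>Coordinate 1 is present in the product but absent from \<open>W\<close>. Since
      \<open>j < L k\<close>, the exponent of the missing coordinate k is the full
      \<open>Suc j\<close>, and the factor of coordinate 1 can be charged to it.\<close>
    have "?p 1 \<le> ?p k" using j by (intro power_increasing) auto
    have "(\<Prod>l\<in>{1..n}. if l = k then 1 else ?p l) = ?p 1 * (\<Prod>l\<in>{2..n}. if l = k then 1 else ?p l)"
      unfolding s using False by simp
    also have "(\<Prod>l\<in>{2..n}. if l = k then 1 else ?p l) = (\<Prod>l\<in>{2..n} - {k}. ?p l)"
      by (subst prod.remove[OF _ kk]) (auto intro!: prod.cong)
    also have "?p 1 * (\<Prod>l\<in>{2..n} - {k}. ?p l) \<le> ?p k * (\<Prod>l\<in>{2..n} - {k}. ?p l)"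
      using \<open>?p 1 \<le> ?p k\<close> by (rule mult_right_mono) simp
    also have "\<dots> = (\<Prod>l\<in>{2..n}. ?p l)" by (rule prod.remove[symmetric]) (use kk in auto)
    finally show ?thesis .
  qed
  finally have "real (card (U j k)) \<le> real (\<Prod>l\<in>{2..n}. ?p l)" by (simp only: of_nat_le_iff)
  then show ?thesis by (simp add: W_def)
qed

lemma sq_int_diff_sq: "integrable M (\<lambda>x. (F \<mu> x - F \<nu> x)\<^sup>2)"
  using sq_int_diff[OF F F] by (simp add: sq_int_def)

lemma S2_integrable: "integrable M (S2 j k)"
  unfolding S2_def by (intro Bochner_Integration.integrable_sum sq_int_diff_sq)

lemma S2_nonneg: "S2 j k x \<ge> 0"
  unfolding S2_def by (intro sum_nonneg) auto

text \<open>In units of \<open>w\<close>, an even position is its own coarser rounding and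
  contributes 0, and an odd position rounds down to its immediate neighbour. The sum is thus part of
  a sum over consecutive increments, to which \<open>inc\<close> applies.\<close>

lemma parent_sum:
  assumes k: "k \<in> {1..n}" and j: "j < L k"
  shows "(\<Sum>i\<in>G (Suc j) k. (l2_nrm M (\<lambda>x. F (\<mu>(k := i)) x - F (\<mu>(k := rd j k i)) x))\<^sup>2) \<le> D"
proof -
  define w where "w = (2::nat) ^ (L k - Suc j)"
  have w0: "w > 0" by (simp add: w_def)
  have w: "2 ^ (L k - j) = 2 * w" using j by (simp add: w_def Suc_diff_Suc flip: power_Suc)
  define Q where "Q = (c k - 1) div w"
  define T where "T p = (l2_nrm M (\<lambda>x. F (\<mu>(k := Suc p * w)) x - F (\<mu>(k := p * w)) x))\<^sup>2" for p
  have GG: "G (Suc j) k = (\<lambda>q. q * w) ` {..Q}"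
  proof
    show "G (Suc j) k \<subseteq> (\<lambda>q. q * w) ` {..Q}"
      unfolding G_def rd_def w_def[symmetric] Q_def by (auto intro!: imageI div_le_mono)
    show "(\<lambda>q. q * w) ` {..Q} \<subseteq> G (Suc j) k"
    proof
      fix y assume "y \<in> (\<lambda>q. q * w) ` {..Q}"
      then obtain q where q: "q \<le> Q" "y = q * w" by auto
      have "q * w \<le> Q * w" using q by simp
      also have "\<dots> \<le> c k - 1" by (simp add: Q_def)
      finally have "q * w < c k" using c(1)[OF k] by simp
      moreover have "rd (Suc j) k (q * w) = q * w" using w0 by (simp add: rd_def flip: w_def)
      ultimately show "y \<in> G (Suc j) k" unfolding G_def using q by (metis imageI lessThan_iff)
    qed
  qed
  have inj: "inj_on (\<lambda>q. q * w) {..Q}" using w0 by (auto intro: inj_onI)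
  have rdq: "rd j k (q * w) = (2 * (q div 2)) * w" for q
    using w0 by (simp add: rd_def w)
  have "(\<Sum>i\<in>G (Suc j) k. (l2_nrm M (\<lambda>x. F (\<mu>(k := i)) x - F (\<mu>(k := rd j k i)) x))\<^sup>2)
      = (\<Sum>q\<le>Q. (l2_nrm M (\<lambda>x. F (\<mu>(k := q * w)) x - F (\<mu>(k := (2 * (q div 2)) * w)) x))\<^sup>2)"
    unfolding GG using inj by (subst sum.reindex) (auto simp: rdq)
  also have "\<dots> \<le> (\<Sum>q\<le>Q. if q = 0 then 0 else T (q - 1))"
  proof (rule sum_mono)
    fix q
    show "(l2_nrm M (\<lambda>x. F (\<mu>(k := q * w)) x - F (\<mu>(k := (2 * (q div 2)) * w)) x))\<^sup>2 \<le> (if q = 0 then 0 else T (q - 1))"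
    proof (cases "even q")
      case True
      then have "2 * (q div 2) = q" by simp
      then show ?thesis by (simp add: l2_nrm_def T_def)
    next
      case False
      then obtain p where "q = Suc (2 * p)" by (metis oddE Suc_eq_plus1)
      then show ?thesis by (simp add: T_def)
    qed
  qed
  also have "\<dots> = (\<Sum>p<Q. T p)"
    by (subst lessThan_Suc_atMost[symmetric], subst sum.lessThan_Suc_shift) simp
  also have "\<dots> \<le> D" unfolding T_def
  proof (rule inc[OF k, where b = "\<lambda>p. p * w"])
    have "Q * w \<le> c k - 1" by (simp add: Q_def)
    then show "Q * w < c k" using c(1)[OF k] by simp
  qed (use w0 in auto)
  finally show ?thesis .
qed

lemma S2_integral:
  assumes k: "k \<in> {1..n}" and j: "j < L k"
  shows "(\<integral>x. S2 j k x \<partial>M) \<le> W j * D"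
proof -
  have "(\<integral>x. S2 j k x \<partial>M) = (\<Sum>\<mu>\<in>U j k. \<Sum>i\<in>G (Suc j) k. (l2_nrm M (\<lambda>x. F (\<mu>(k := i)) x - F (\<mu>(k := rd j k i)) x))\<^sup>2)"
    unfolding S2_def l2_nrm_sq
    by (subst Bochner_Integration.integral_sum, intro Bochner_Integration.integrable_sum sq_int_diff_sq,
        intro sum.cong refl, subst Bochner_Integration.integral_sum) (auto intro: sq_int_diff_sq)
  also have "\<dots> \<le> (\<Sum>\<mu>\<in>U j k. D)" by (intro sum_mono parent_sum k j)
  also have "\<dots> = real (card (U j k)) * D" by simp
  also have "\<dots> \<le> W j * D" by (intro mult_right_mono card_U k j D_nonneg)
  finally show ?thesis .
qed

text \<open>The bound is the same for all \<iota>: each increment is one summand of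
  \<open>S2 j k x\<close>, so the supremum over directions costs only the sum over grid
  lines.\<close>

lemma mix_step:
  assumes \<iota>: "\<iota> \<in> I" and k: "k \<in> {1..n}"
  shows "\<bar>F (mix j k \<iota>) x - F (mix j (k - 1) \<iota>) x\<bar> \<le> (if j < L k then sqrt (S2 j k x) else 0)"
proof (cases "j < L k")
  case False
  then have "rd (Suc j) k i = rd j k i" for i by (simp add: rd_def)
  then have "mix j k \<iota> = mix j (k - 1) \<iota>"
    using k unfolding mix_def by (intro restrict_ext) (auto simp: le_less not_le; metis Suc_pred' leD le_antisym not_less_eq_eq)
  then show ?thesis using False by simp
next
  case True
  define \<mu> where "\<mu> = (mix j k \<iota>)(k := 0)"
  define i where "i = rd (Suc j) k (\<iota> k)"
  have \<iota>l: "\<iota> l < c l" if "l \<in> {1..n}" for l using \<iota> that by (auto simp: I_def PiE_iff)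
  have i: "i \<in> G (Suc j) k" using \<iota>l[OF k] by (auto simp: G_def i_def)
  have m1: "mix j k \<iota> = \<mu>(k := i)" using k by (auto simp: \<mu>_def i_def mix_def fun_eq_iff)
  have m2: "mix j (k - 1) \<iota> = \<mu>(k := rd j k i)"
    using k by (auto simp: \<mu>_def i_def mix_def fun_eq_iff rd_rd)
  have \<mu>: "\<mu> \<in> U j k" unfolding U_def
    using \<iota>l k by (auto simp: \<mu>_def mix_def PiE_iff extensional_def G_def)
  have "(F (mix j k \<iota>) x - F (mix j (k - 1) \<iota>) x)\<^sup>2 = (F (\<mu>(k := i)) x - F (\<mu>(k := rd j k i)) x)\<^sup>2"
    unfolding m1 m2 ..
  also have "\<dots> \<le> (\<Sum>i\<in>G (Suc j) k. (F (\<mu>(k := i)) x - F (\<mu>(k := rd j k i)) x)\<^sup>2)"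
    using i finite_G by (intro member_le_sum) auto
  also have "\<dots> \<le> S2 j k x" unfolding S2_def
    using \<mu> finite_U by (intro member_le_sum[where f = "\<lambda>\<mu>. \<Sum>i\<in>G (Suc j) k. (F (\<mu>(k := i)) x - F (\<mu>(k := rd j k i)) x)\<^sup>2"]) (auto intro: sum_nonneg)
  finally have "sqrt ((F (mix j k \<iota>) x - F (mix j (k - 1) \<iota>) x)\<^sup>2) \<le> sqrt (S2 j k x)" by (rule real_sqrt_le_mono)
  then show ?thesis using True by simp
qed

section \<open>Summation over coordinates and levels\<close>

definition base :: "nat \<Rightarrow> nat" where "base = (\<lambda>l\<in>{1..n}. 0)"

definition rdv :: "nat \<Rightarrow> (nat \<Rightarrow> nat) \<Rightarrow> nat \<Rightarrow> nat" where
  "rdv j \<iota> = (\<lambda>l\<in>{1..n}. rd j l (\<iota> l))"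

lemma level_step:
  assumes \<iota>: "\<iota> \<in> I"
  shows "\<bar>F (rdv (Suc j) \<iota>) x - F (rdv j \<iota>) x\<bar> \<le> (\<Sum>k\<in>{1..n}. if j < L k then sqrt (S2 j k x) else 0)"
proof -
  have "\<bar>F (mix j r \<iota>) x - F (mix j 0 \<iota>) x\<bar> \<le> (\<Sum>k\<in>{1..r}. if j < L k then sqrt (S2 j k x) else 0)" if "r \<le> n" for r
    using that
  proof (induction r)
    case (Suc r)
    have "\<bar>F (mix j (Suc r) \<iota>) x - F (mix j r \<iota>) x\<bar> \<le> (if j < L (Suc r) then sqrt (S2 j (Suc r) x) else 0)"
      using mix_step[OF \<iota>, of "Suc r" j x] Suc.prems by simp
    moreover have "\<bar>F (mix j r \<iota>) x - F (mix j 0 \<iota>) x\<bar> \<le> (\<Sum>k\<in>{1..r}. if j < L k then sqrt (S2 j k x) else 0)"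
      using Suc by simp
    moreover have "(\<Sum>k\<in>{1..Suc r}. if j < L k then sqrt (S2 j k x) else 0) = (\<Sum>k\<in>{1..r}. if j < L k then sqrt (S2 j k x) else 0) + (if j < L (Suc r) then sqrt (S2 j (Suc r) x) else 0)"
      by simp
    ultimately show ?case by linarith
  qed simp
  moreover have "mix j n \<iota> = rdv (Suc j) \<iota>" "mix j 0 \<iota> = rdv j \<iota>"
    unfolding mix_def rdv_def by (auto intro!: restrict_ext)
  ultimately show ?thesis by fastforce
qed

lemma chain_bound:
  assumes \<iota>: "\<iota> \<in> I"
  shows "\<bar>F \<iota> x\<bar> \<le> \<bar>F base x\<bar> + (\<Sum>j<L 1. \<Sum>k\<in>{1..n}. if j < L k then sqrt (S2 j k x) else 0)"
proof -
  have \<iota>l: "\<iota> l < c l" if "l \<in> {1..n}" for l using \<iota> that by (auto simp: I_def PiE_iff)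
  have b: "rdv 0 \<iota> = base" unfolding rdv_def base_def
  proof (intro restrict_ext)
    fix l assume l: "l \<in> {1..n}"
    have "\<iota> l < 2 ^ L l" using \<iota>l[OF l] c(2)[OF l] le_two_power_clog[of "N l"] by (simp add: L_def)
    then show "rd 0 l (\<iota> l) = 0" by (simp add: rd_def)
  qed
  have t: "rdv (L 1) \<iota> = \<iota>"
  proof
    fix l
    show "rdv (L 1) \<iota> l = \<iota> l"
    proof (cases "l \<in> {1..n}")
      case True
      then have "L l \<le> L 1" using n by (intro L_mono) auto
      then show ?thesis using True by (simp add: rdv_def rd_def)
    next
      case False
      then show ?thesis using \<iota> by (auto simp: rdv_def I_def PiE_iff extensional_def)
    qed
  qed
  have "\<bar>F (rdv r \<iota>) x - F (rdv 0 \<iota>) x\<bar> \<le> (\<Sum>j<r. \<Sum>k\<in>{1..n}. if j < L k then sqrt (S2 j k x) else 0)" for r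
  proof (induction r)
    case (Suc r)
    then show ?case using level_step[OF \<iota>, of r x] unfolding sum.lessThan_Suc by linarith
  qed simp
  from this[of "L 1"] show ?thesis unfolding b t by linarith
qed

text \<open>The total weight in the Cauchy-Schwarz inequality below: 1 for the base point and
  \<open>sqrt (W j)\<close> for each of the n coordinate moves of level j.\<close>

definition T :: real where "T = 1 + (\<Sum>j<L 1. real n * sqrt (W j))"

lemma T_ge1: "T \<ge> 1"
  unfolding T_def using W_ge1 by (simp add: sum_nonneg order_trans[OF zero_le_one])

text \<open>The weight \<open>sqrt (W j)\<close> balances the two factors: \<open>S2\<close> has
  integral at most \<open>W j * D\<close>, so after division by the weight it contributes
  \<open>sqrt (W j) * D\<close>. Both factors then sum to \<open>T\<close>, up to \<open>D\<close>,
  just as the triangle inequality for norms would give, but with a pointwise majorant.\<close>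

theorem maximal_bound:
  obtains g where "integrable M g" "\<And>\<iota> x. \<iota> \<in> I \<Longrightarrow> (F \<iota> x)\<^sup>2 \<le> g x" "(\<integral>x. g x \<partial>M) \<le> T\<^sup>2 * D"
proof
  let ?J = "{..<L 1} \<times> {1..n}"
  let ?s = "\<lambda>j k x. if j < L k then S2 j k x else 0"
  define R where "R x = (\<Sum>p\<in>?J. ?s (fst p) (snd p) x / sqrt (W (fst p)))" for x
  define g where "g x = T * ((F base x)\<^sup>2 + R x)" for x
  have sW: "sqrt (W j) > 0" for j using W_ge1[of j] by (simp add: less_le_trans[OF zero_less_one])
  have sint: "integrable M (\<lambda>x. ?s j k x)" for j k using S2_integrable by (cases "j < L k") auto
  have Rint: "integrable M R" unfolding R_def by (intro Bochner_Integration.integrable_sum integrable_divide sint)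
  have bint: "integrable M (\<lambda>x. (F base x)\<^sup>2)" using F by (simp add: sq_int_def)
  show "integrable M g" unfolding g_def using Rint bint by (intro integrable_mult_right Bochner_Integration.integrable_add)
  have Tsum: "T = 1 + (\<Sum>p\<in>?J. sqrt (W (fst p)))"
    unfolding T_def sum.cartesian_product[symmetric, of "\<lambda>j k. sqrt (W j)", unfolded case_prod_beta'] by (simp add: sum.cartesian_product')
  show "(F \<iota> x)\<^sup>2 \<le> g x" if "\<iota> \<in> I" for \<iota> x
  proof -
    \<comment> \<open>The index \<open>None\<close> is the base point; \<open>Some (j, k)\<close> is
      the move of coordinate k at level j.\<close>
    define a where "a q = (case q of None \<Rightarrow> \<bar>F base x\<bar> | Some p \<Rightarrow> (if fst p < L (snd p) then sqrt (S2 (fst p) (snd p) x) else 0))" for q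
    define w where "w q = (case q of None \<Rightarrow> 1 | Some p \<Rightarrow> sqrt (W (fst p)))" for q :: "(nat \<times> nat) option"
    let ?O = "insert None (Some ` ?J)"
    have sumO: "(\<Sum>q\<in>?O. h q) = h None + (\<Sum>p\<in>?J. h (Some p))" for h :: "(nat \<times> nat) option \<Rightarrow> real"
      by (subst sum.insert) (auto simp: sum.reindex)
    have "\<bar>F \<iota> x\<bar> \<le> (\<Sum>q\<in>?O. a q)"
      using chain_bound[OF that, of x] unfolding sumO a_def by (simp add: sum.cartesian_product case_prod_beta')
    then have "(F \<iota> x)\<^sup>2 \<le> (\<Sum>q\<in>?O. a q)\<^sup>2" by (metis abs_ge_zero power2_abs power_mono)
    also have "\<dots> \<le> (\<Sum>q\<in>?O. w q) * (\<Sum>q\<in>?O. (a q)\<^sup>2 / w q)"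
      by (rule weighted_cauchy_schwarz) (auto simp: w_def W_pos split: option.splits)
    also have "(\<Sum>q\<in>?O. w q) = T" unfolding sumO Tsum by (simp add: w_def)
    also have "(\<Sum>q\<in>?O. (a q)\<^sup>2 / w q) = (F base x)\<^sup>2 + R x"
      unfolding sumO R_def using S2_nonneg by (auto simp: w_def a_def intro!: sum.cong)
    finally show ?thesis by (simp add: g_def)
  qed
  have "(\<integral>x. g x \<partial>M) = T * ((\<integral>x. (F base x)\<^sup>2 \<partial>M) + (\<Sum>p\<in>?J. (\<integral>x. ?s (fst p) (snd p) x \<partial>M) / sqrt (W (fst p))))"
    unfolding g_def using Rint bint sint by (simp add: R_def)
  also have "\<dots> \<le> T * (D + (\<Sum>p\<in>?J. sqrt (W (fst p)) * D))"
  proof (intro mult_left_mono add_mono sum_mono)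
    show "(\<integral>x. (F base x)\<^sup>2 \<partial>M) \<le> D" using FD[of base] by (simp add: l2_nrm_sq)
    fix p assume p: "p \<in> ?J"
    have "(\<integral>x. ?s (fst p) (snd p) x \<partial>M) \<le> W (fst p) * D"
    proof (cases "fst p < L (snd p)")
      case True
      then show ?thesis using S2_integral[of "snd p" "fst p"] p by auto
    next
      case False
      have "W (fst p) \<ge> 0" using W_ge1[of "fst p"] by simp
      then show ?thesis using False D_nonneg by simp
    qed
    then have "(\<integral>x. ?s (fst p) (snd p) x \<partial>M) / sqrt (W (fst p)) \<le> W (fst p) * D / sqrt (W (fst p))"
      using sW[of "fst p"] by (intro divide_right_mono) auto
    also have "\<dots> = sqrt (W (fst p)) * D" using W_ge1[of "fst p"] by (simp add: real_div_sqrt flip: times_divide_eq_left)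
    finally show "(\<integral>x. ?s (fst p) (snd p) x \<partial>M) / sqrt (W (fst p)) \<le> sqrt (W (fst p)) * D" .
  qed (use T_ge1 in simp)
  also have "\<dots> = T\<^sup>2 * D" unfolding sum_distrib_right[symmetric] Tsum by (simp add: power2_eq_square algebra_simps)
  finally show "(\<integral>x. g x \<partial>M) \<le> T\<^sup>2 * D" .
qed

end

section \<open>The lower bound for uniform direction sets\<close>

lemma l2_norm_le:
  assumes "(\<integral>\<^sup>+ x. (g x)\<^sup>2 \<partial>euclid m) \<le> ennreal (K\<^sup>2)" "K \<ge> 0"
  shows "l2_norm m g \<le> ennreal K"
proof -
  let ?I = "\<integral>\<^sup>+ x. (g x)\<^sup>2 \<partial>euclid m"
  have fin: "?I \<noteq> \<infinity>" using assms(1) by (metis ennreal_less_top infinity_ennreal_def leD)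
  have "enn2real ?I \<le> K\<^sup>2" using assms(1) by (intro enn2real_leI) auto
  then have "sqrt (enn2real ?I) \<le> sqrt (K\<^sup>2)" by (rule real_sqrt_le_mono)
  then have "sqrt (enn2real ?I) \<le> K" using assms(2) by simp
  then show ?thesis using fin by (simp add: l2_norm_def Let_def ennreal_leI)
qed

lemma nn_integral_euclid_Suc:
  assumes "f \<in> borel_measurable (euclid (Suc n))"
  shows "(\<integral>\<^sup>+x. f x \<partial>euclid (Suc n)) = (\<integral>\<^sup>+r. \<integral>\<^sup>+y. f (y(Suc n := r)) \<partial>euclid n \<partial>lborel)"
proof -
  have s: "{1..Suc n} = insert (Suc n) {1..n}" by auto
  show ?thesis unfolding euclid_def s
    by (rule lborel_product.product_nn_integral_insert_rev) (use assms[unfolded euclid_def s] in auto)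
qed

lemma emeasure_euclid_box:
  assumes "\<And>k. k \<in> {1..n} \<Longrightarrow> E k \<in> sets lborel"
  shows "emeasure (euclid n) (\<Pi>\<^sub>E k\<in>{1..n}. E k) = (\<Prod>k\<in>{1..n}. emeasure lborel (E k))"
  unfolding euclid_def using assms by (intro lborel_product.emeasure_PiM) auto

lemma nn_integral_Ioo_Icc:
  fixes g :: "real \<Rightarrow> ennreal"
  shows "(\<integral>\<^sup>+r. g r * indicator {a<..<b} r \<partial>lborel) = (\<integral>\<^sup>+r. g r * indicator {a..b} r \<partial>lborel)"
  by (rule nn_integral_cong_AE, use AE_lborel_singleton[of a] AE_lborel_singleton[of b] in eventually_elim) (auto simp: indicator_def)

(* The points that some slope j / N carries from height r back into [0, w). *)
definition strips :: "nat \<Rightarrow> real \<Rightarrow> real \<Rightarrow> real set" where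
  "strips N w r = (\<Union>j\<in>{1..N}. {r * (real j / real N)..<r * (real j / real N) + w})"

lemma emeasure_strips:
  assumes N: "N \<ge> 1" and w: "0 \<le> w" "w \<le> r / real N"
  shows "strips N w r \<in> sets lborel" "emeasure lborel (strips N w r) = ennreal (real N * w)"
proof -
  let ?A = "\<lambda>j. {r * (real j / real N)..<r * (real j / real N) + w}"
  show "strips N w r \<in> sets lborel" unfolding strips_def by auto
  have "disjoint_family_on ?A {1..N}"
    unfolding disjoint_family_on_def
  proof (intro ballI impI)
    have *: "?A i \<inter> ?A j = {}" if "i < j" for i j :: nat
    proof -
      have "r * (real j / real N) = r * (real i / real N) + (real j - real i) * (r / real N)" using N by (simp add: field_simps)
      moreover have "1 * (r / real N) \<le> (real j - real i) * (r / real N)" using that w by (intro mult_right_mono) auto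
      ultimately have "r * (real i / real N) + w \<le> r * (real j / real N)" using w by simp
      then show ?thesis by auto
    qed
    fix i j :: nat assume "i \<noteq> j"
    then show "?A i \<inter> ?A j = {}" using *[of i j] *[of j i] by (cases "i < j") auto
  qed
  then have "emeasure lborel (\<Union>j\<in>{1..N}. ?A j) = (\<Sum>j\<in>{1..N}. emeasure lborel (?A j))"
    by (intro sum_emeasure[symmetric]) auto
  also have "\<dots> = (\<Sum>j\<in>{1..N}. ennreal w)" using w by (intro sum.cong refl) (simp add: emeasure_lborel_Ico)
  also have "\<dots> = ennreal (real N * w)" using w by (simp add: ennreal_mult ennreal_of_nat_eq_real_of_nat)
  finally show "emeasure lborel (strips N w r) = ennreal (real N * w)" by (simp add: strips_def)
qed

section \<open>Test functions and their maximal function\<close>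

lemma pred_between:
  fixes F G :: "'a \<Rightarrow> real"
  assumes [measurable]: "F \<in> borel_measurable M" "G \<in> borel_measurable M"
  shows "Measurable.pred M (\<lambda>x. 0 \<le> F x \<and> F x \<le> G x)"
  by measurable

lemma pred_strips:
  fixes F G H :: "'a \<Rightarrow> real"
  assumes [measurable]: "F \<in> borel_measurable M" "G \<in> borel_measurable M" "H \<in> borel_measurable M"
  shows "Measurable.pred M (\<lambda>x. F x \<in> strips N (G x) (H x))"
  unfolding strips_def UN_iff atLeastLessThan_iff by measurable

text \<open>The point lies beyond the slab, so on the support t = r - s is at least r - b > 0. Small
  truncations are invisible, the principal value is an ordinary integral, and 1/(r - s) is at least
  1/r.\<close>

lemma directional_hilbert_slab:
  fixes \<psi> :: "real \<Rightarrow> real"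
  assumes \<psi>i: "integrable lborel (\<lambda>s. \<psi> s * indicator {a..b} s)" and \<psi>0: "\<And>s. s \<in> {a..b} \<Longrightarrow> \<psi> s \<ge> 0" and [measurable]: "\<psi> \<in> borel_measurable borel"
    and a: "0 \<le> a" and r: "b < r"
    and line: "\<And>t. f (shift_along n v t x) = complex_of_real (\<psi> (r - t) * indicator {a..b} (r - t))"
  shows "cmod (directional_hilbert n v f x) \<ge> (\<integral>s. \<psi> s * indicator {a..b} s \<partial>lborel) / (pi * r)"
proof (cases "a \<le> b")
  case False
  then show ?thesis by simp
next
  case True
  then have rp: "r > 0" using a r by simp
  let ?h = "\<lambda>t. \<psi> (r - t) * indicator {a..b} (r - t) / t"
  define J where "J = (\<integral>t. ?h t \<partial>lborel)"
  let ?g = "\<lambda>s. \<psi> s * indicator {a..b} s / (r - s)"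
  have gi: "integrable lborel ?g"
  proof (rule Bochner_Integration.integrable_bound)
    show "integrable lborel (\<lambda>s. (1 / (r - b)) * (\<psi> s * indicator {a..b} s))" using \<psi>i by simp
    show "AE s in lborel. norm (?g s) \<le> norm ((1 / (r - b)) * (\<psi> s * indicator {a..b} s))"
    proof (rule AE_I2)
      fix s show "norm (?g s) \<le> norm ((1 / (r - b)) * (\<psi> s * indicator {a..b} s))"
      proof (cases "s \<in> {a..b}")
        case True
        then have "\<bar>\<psi> s\<bar> / (r - s) \<le> \<bar>\<psi> s\<bar> / (r - b)" using r by (intro divide_left_mono) auto
        then show ?thesis using True r by (simp add: abs_mult)
      qed simp
    qed
  qed measurable
  have "J = (\<integral>s. ?g s \<partial>lborel)"
    unfolding J_def using lborel_integral_real_affine[of "-1" ?g r] by simp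
  moreover have "(\<integral>s. \<psi> s * indicator {a..b} s \<partial>lborel) / r = (\<integral>s. \<psi> s * indicator {a..b} s / r \<partial>lborel)" by simp
  moreover have "(\<integral>s. \<psi> s * indicator {a..b} s / r \<partial>lborel) \<le> (\<integral>s. ?g s \<partial>lborel)"
  proof (rule integral_mono)
    show "integrable lborel (\<lambda>s. \<psi> s * indicator {a..b} s / r)" using \<psi>i by simp
    show "integrable lborel ?g" by (rule gi)
    fix s
    show "\<psi> s * indicator {a..b} s / r \<le> ?g s"
    proof (cases "s \<in> {a..b}")
      case True
      then show ?thesis using r a \<psi>0[OF True] by (auto intro!: divide_left_mono)
    qed simp
  qed
  ultimately have J: "(\<integral>s. \<psi> s * indicator {a..b} s \<partial>lborel) / r \<le> J" by simp
  have tr: "(LINT t:{t. e < \<bar>t\<bar>}|lborel. f (shift_along n v t x) / complex_of_real t) = complex_of_real J" if "0 < e" "e < r - b" for e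
  proof -
    have "(LINT t:{t. e < \<bar>t\<bar>}|lborel. f (shift_along n v t x) / complex_of_real t) = (\<integral>t. complex_of_real (?h t) \<partial>lborel)"
      unfolding set_lebesgue_integral_def line
    proof (rule Bochner_Integration.integral_cong[OF refl])
      fix t :: real
      show "indicat_real {t. e < \<bar>t\<bar>} t *\<^sub>R (complex_of_real (\<psi> (r - t) * indicator {a..b} (r - t)) / complex_of_real t) = complex_of_real (?h t)"
        using that by (auto simp: indicator_def)
    qed
    also have "\<dots> = complex_of_real J" unfolding J_def by (rule integral_complex_of_real)
    finally show ?thesis .
  qed
  have "((\<lambda>e. complex_of_real (1 / pi) * (LINT t:{t. e < \<bar>t\<bar>}|lborel. f (shift_along n v t x) / complex_of_real t)) \<longlongrightarrow> complex_of_real (1 / pi) * complex_of_real J) (at_right 0)"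
  proof (rule tendsto_eventually)
    show "\<forall>\<^sub>F e in at_right 0. complex_of_real (1 / pi) * (LINT t:{t. e < \<bar>t\<bar>}|lborel. f (shift_along n v t x) / complex_of_real t) = complex_of_real (1 / pi) * complex_of_real J"
      unfolding eventually_at_right_field using r tr by (intro exI[of _ "r - b"]) auto
  qed
  then have "directional_hilbert n v f x = complex_of_real (1 / pi) * complex_of_real J"
    unfolding directional_hilbert_def by (intro tendsto_Lim) auto
  then have "cmod (directional_hilbert n v f x) = \<bar>J\<bar> / pi" by (simp add: norm_mult norm_divide)
  also have "\<dots> \<ge> (\<integral>s. \<psi> s * indicator {a..b} s \<partial>lborel) / r / pi"
    using J by (intro divide_right_mono) auto
  finally show ?thesis by (simp add: mult.commute)
qed

text \<open>A test function with profile \<open>\<psi>\<close> in the height s and cross-section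
  [0, d k s] in coordinate k. \<open>w\<close> is the strip width: at most
  \<open>r / real (N k)\<close> for disjoint strips, and with \<open>w k r + s \<le> d k s\<close>
  so that lines stay in the support. \<open>V\<close> bounds its squared norm by 1, and
  \<open>X\<close> bounds from below the squared norm of the maximal function over the
  strips.\<close>

lemma maximal_hilbert_lower:
  fixes \<psi> :: "real \<Rightarrow> real" and d :: "nat \<Rightarrow> real \<Rightarrow> real" and w :: "nat \<Rightarrow> real \<Rightarrow> real" and N :: "nat \<Rightarrow> nat"
  assumes N: "\<And>k. k \<in> {1..n} \<Longrightarrow> N k \<ge> 1"
    and \<psi>m [measurable]: "\<psi> \<in> borel_measurable borel" and dm: "\<And>k. d k \<in> borel_measurable borel" and wm: "\<And>k. w k \<in> borel_measurable borel"
    and \<psi>i: "integrable lborel (\<lambda>s. \<psi> s * indicator {a..b} s)" and \<psi>0: "\<And>s. s \<in> {a..b} \<Longrightarrow> \<psi> s \<ge> 0"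
    and a: "0 \<le> a" and ab: "a \<le> b" and br: "b \<le> r0"
    and w: "\<And>k r. k \<in> {1..n} \<Longrightarrow> r0 < r \<Longrightarrow> r < r1 \<Longrightarrow> 0 \<le> w k r \<and> w k r \<le> r / real (N k)"
    and wd: "\<And>k r s. k \<in> {1..n} \<Longrightarrow> r0 < r \<Longrightarrow> r < r1 \<Longrightarrow> a \<le> s \<Longrightarrow> s \<le> b \<Longrightarrow> w k r + s \<le> d k s"
    and V: "(\<integral>\<^sup>+s. ennreal ((\<psi> s)\<^sup>2 * (\<Prod>k\<in>{1..n}. max 0 (d k s))) * indicator {a..b} s \<partial>lborel) \<le> 1"
    and X: "X \<ge> 0" "ennreal X \<le> (\<integral>\<^sup>+r. ennreal (((\<integral>s. \<psi> s * indicator {a..b} s \<partial>lborel) / (pi * r))\<^sup>2 * (\<Prod>k\<in>{1..n}. real (N k) * w k r)) * indicator {r0<..<r1} r \<partial>lborel)"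
  shows "ennreal (sqrt X) \<le> maximal_hilbert_norm n (\<Pi>\<^sub>E k\<in>{1..n}. uniform_set (N k))"
proof -
  let ?M = "euclid (Suc n)" and ?m = "Suc n"
  let ?\<Omega> = "\<Pi>\<^sub>E k\<in>{1..n}. uniform_set (N k)"
  note [measurable] = dm wm
  define \<Psi> where "\<Psi> = (\<integral>s. \<psi> s * indicator {a..b} s \<partial>lborel)"
  have \<Psi>0: "\<Psi> \<ge> 0" unfolding \<Psi>_def using \<psi>0 by (intro integral_nonneg_AE AE_I2) (auto simp: indicator_def)
  define f where "f x = complex_of_real (if a \<le> x ?m \<and> x ?m \<le> b \<and> (\<forall>k\<in>{1..n}. 0 \<le> x k \<and> x k \<le> d k (x ?m)) then \<psi> (x ?m) else 0)" for x :: "nat \<Rightarrow> real"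
  have comp: "(\<lambda>x. x k) \<in> borel_measurable ?M" if "k \<in> {1..n}" for k using that by (intro euclid_component) auto
  have mm: "(\<lambda>x. x ?m) \<in> borel_measurable ?M" by (intro euclid_component) auto
  have predf: "Measurable.pred ?M (\<lambda>x. \<forall>k\<in>{1..n}. 0 \<le> x k \<and> x k \<le> d k (x ?m))"
  proof (intro pred_intros_finite(3))
    fix k assume k: "k \<in> {1..n}"
    show "Measurable.pred ?M (\<lambda>x. 0 \<le> x k \<and> x k \<le> d k (x ?m))"
      by (rule pred_between[OF comp[OF k] measurable_compose[OF mm dm]])
  qed simp
  have fm [measurable]: "f \<in> borel_measurable ?M"
  proof -
    have "(\<lambda>x. complex_of_real (if a \<le> F x \<and> F x \<le> b \<and> R x then \<psi> (F x) else 0)) \<in> borel_measurable ?M"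
      if [measurable]: "F \<in> borel_measurable ?M" "Measurable.pred ?M R" for F R by measurable
    from this[OF mm predf] show ?thesis unfolding f_def .
  qed
  have upd: "(y(?m := r)) k = y k" if "k \<in> {1..n}" for y :: "nat \<Rightarrow> real" and r k using that by auto
  have "(\<integral>\<^sup>+x. (ennreal (cmod (f x)))\<^sup>2 \<partial>?M) = (\<integral>\<^sup>+s. \<integral>\<^sup>+y. (ennreal (cmod (f (y(?m := s)))))\<^sup>2 \<partial>euclid n \<partial>lborel)"
    by (rule nn_integral_euclid_Suc) measurable
  also have "\<dots> = (\<integral>\<^sup>+s. ennreal ((\<psi> s)\<^sup>2 * (\<Prod>k\<in>{1..n}. max 0 (d k s))) * indicator {a..b} s \<partial>lborel)"
  proof (rule nn_integral_cong)
    fix s :: real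
    have "(\<integral>\<^sup>+y. (ennreal (cmod (f (y(?m := s)))))\<^sup>2 \<partial>euclid n) = (\<integral>\<^sup>+y. (ennreal ((\<psi> s)\<^sup>2) * indicator {a..b} s) * indicator (\<Pi>\<^sub>E k\<in>{1..n}. {0..d k s}) y \<partial>euclid n)"
      by (intro nn_integral_cong) (auto simp: f_def space_euclid indicator_def PiE_iff ennreal_power split: if_splits)
    also have "\<dots> = (ennreal ((\<psi> s)\<^sup>2) * indicator {a..b} s) * emeasure (euclid n) (\<Pi>\<^sub>E k\<in>{1..n}. {0..d k s})"
      by (intro nn_integral_cmult_indicator) (auto simp: euclid_def intro!: sets_PiM_I_finite)
    also have "emeasure (euclid n) (\<Pi>\<^sub>E k\<in>{1..n}. {0..d k s}) = (\<Prod>k\<in>{1..n}. ennreal (max 0 (d k s)))"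
      by (subst emeasure_euclid_box) (auto simp: emeasure_lborel_Icc_eq max_def intro!: prod.cong)
    also have "\<dots> = ennreal (\<Prod>k\<in>{1..n}. max 0 (d k s))" by (intro prod_ennreal) auto
    also have "(ennreal ((\<psi> s)\<^sup>2) * indicator {a..b} s) * ennreal (\<Prod>k\<in>{1..n}. max 0 (d k s))
        = ennreal ((\<psi> s)\<^sup>2 * (\<Prod>k\<in>{1..n}. max 0 (d k s))) * indicator {a..b} s"
      by (simp add: ennreal_mult prod_nonneg mult_ac)
    finally show "(\<integral>\<^sup>+y. (ennreal (cmod (f (y(?m := s)))))\<^sup>2 \<partial>euclid n) = ennreal ((\<psi> s)\<^sup>2 * (\<Prod>k\<in>{1..n}. max 0 (d k s))) * indicator {a..b} s" .
  qed
  finally have f1: "(\<integral>\<^sup>+x. (ennreal (cmod (f x)))\<^sup>2 \<partial>?M) \<le> ennreal (1\<^sup>2)" using V by simp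
  have fl: "l2_norm ?m (\<lambda>x. ennreal (cmod (f x))) \<le> 1" using l2_norm_le[OF f1] by simp
  then have fL: "f \<in> L2_functions ?m" unfolding L2_functions_def using fm by (auto intro: le_less_trans)
  have pt: "maximal_hilbert n ?\<Omega> f x \<ge> ennreal (\<Psi> / (pi * x ?m))"
    if x: "x \<in> space ?M" and r: "r0 < x ?m" "x ?m < r1" and E: "\<forall>k\<in>{1..n}. x k \<in> strips (N k) (w k (x ?m)) (x ?m)" for x
  proof -
    have "\<forall>k\<in>{1..n}. \<exists>j. 1 \<le> j \<and> j \<le> N k \<and> x ?m * (real j / real (N k)) \<le> x k \<and> x k < x ?m * (real j / real (N k)) + w k (x ?m)"
    proof
      fix k assume "k \<in> {1..n}"
      then have "x k \<in> strips (N k) (w k (x ?m)) (x ?m)" using E by blast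
      then obtain j where "j \<in> {1..N k}" "x ?m * (real j / real (N k)) \<le> x k" "x k < x ?m * (real j / real (N k)) + w k (x ?m)"
        unfolding strips_def UN_iff atLeastLessThan_iff by blast
      then show "\<exists>j. 1 \<le> j \<and> j \<le> N k \<and> x ?m * (real j / real (N k)) \<le> x k \<and> x k < x ?m * (real j / real (N k)) + w k (x ?m)"
        unfolding atLeastAtMost_iff by blast
    qed
    then obtain j where j: "\<And>k. k \<in> {1..n} \<Longrightarrow> 1 \<le> j k \<and> j k \<le> N k \<and> x ?m * (real (j k) / real (N k)) \<le> x k \<and> x k < x ?m * (real (j k) / real (N k)) + w k (x ?m)" by metis
    define v where "v = (\<lambda>k\<in>{1..n}. real (j k) / real (N k))"
    have v: "v \<in> ?\<Omega>" using j by (auto simp: v_def uniform_set_def)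
    have line: "f (shift_along n v t x) = complex_of_real (\<psi> (x ?m - t) * indicator {a..b} (x ?m - t))" for t
    proof (cases "x ?m - t \<in> {a..b}")
      case False
      then show ?thesis by (auto simp: f_def shift_along_def)
    next
      case True
      define s where "s = x ?m - t"
      have "0 \<le> x k - t * v k \<and> x k - t * v k \<le> d k s" if k: "k \<in> {1..n}" for k
      proof -
        \<comment> \<open>The offset of the line at height 0 lies in [0, w), and going up to height
          s adds between 0 and s because slopes lie in [0, 1].\<close>
        have eq: "x k - t * v k = (x k - x ?m * v k) + s * v k" by (simp add: s_def algebra_simps)
        have v01: "0 \<le> v k" "v k \<le> 1" using j[OF k] k by (auto simp: v_def divide_le_eq)
        have s0: "0 \<le> s" using True a by (simp add: s_def)
        have "0 \<le> s * v k" "s * v k \<le> s" using s0 v01 by (auto intro: mult_left_le)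
        moreover have "0 \<le> x k - x ?m * v k" "x k - x ?m * v k \<le> w k (x ?m)" using j[OF k] k by (auto simp: v_def)
        ultimately show ?thesis using wd[OF k r, of s] True unfolding eq by (auto simp: s_def)
      qed
      then have "\<forall>k\<in>{1..n}. 0 \<le> shift_along n v t x k \<and> shift_along n v t x k \<le> d k s" by (auto simp: shift_along_def)
      moreover have "shift_along n v t x ?m = s" by (simp add: shift_along_def s_def)
      ultimately show ?thesis using True by (simp add: f_def s_def)
    qed
    have "\<Psi> / (pi * x ?m) \<le> cmod (directional_hilbert n v f x)"
      unfolding \<Psi>_def by (rule directional_hilbert_slab[OF \<psi>i \<psi>0 \<psi>m a _ line]) (use br r in auto)
    then have "ennreal (\<Psi> / (pi * x ?m)) \<le> ennreal (cmod (directional_hilbert n v f x))" by (rule ennreal_leI)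
    also have "\<dots> \<le> maximal_hilbert n ?\<Omega> f x" unfolding maximal_hilbert_def by (rule SUP_upper[OF v])
    finally show ?thesis .
  qed
  define P where "P x \<longleftrightarrow> r0 < x ?m \<and> x ?m < r1 \<and> (\<forall>k\<in>{1..n}. x k \<in> strips (N k) (w k (x ?m)) (x ?m))" for x :: "nat \<Rightarrow> real"
  have prs: "Measurable.pred ?M (\<lambda>x. \<forall>k\<in>{1..n}. x k \<in> strips (N k) (w k (x ?m)) (x ?m))"
  proof (intro pred_intros_finite(3))
    fix k assume k: "k \<in> {1..n}"
    show "Measurable.pred ?M (\<lambda>x. x k \<in> strips (N k) (w k (x ?m)) (x ?m))"
      by (rule pred_strips[OF comp[OF k] measurable_compose[OF mm wm] mm])
  qed simp
  have um: "(\<lambda>x. ennreal ((\<Psi> / (pi * x ?m))\<^sup>2) * (if P x then 1 else 0)) \<in> borel_measurable ?M"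
  proof -
    have "(\<lambda>x. ennreal ((\<Psi> / (pi * F x))\<^sup>2) * (if r0 < F x \<and> F x < r1 \<and> R x then 1 else 0)) \<in> borel_measurable ?M"
      if [measurable]: "F \<in> borel_measurable ?M" "Measurable.pred ?M R" for F R by measurable
    from this[OF mm prs] show ?thesis unfolding P_def .
  qed
  let ?u = "\<lambda>x. ennreal ((\<Psi> / (pi * x ?m))\<^sup>2) * (if P x then 1 else 0)"
  have "ennreal X \<le> (\<integral>\<^sup>+r. \<integral>\<^sup>+y. ?u (y(?m := r)) \<partial>euclid n \<partial>lborel)"
  proof (rule order_trans[OF X(2)], unfold \<Psi>_def[symmetric], rule nn_integral_mono)
    fix r :: real
    show "ennreal ((\<Psi> / (pi * r))\<^sup>2 * (\<Prod>k\<in>{1..n}. real (N k) * w k r)) * indicator {r0<..<r1} r \<le> (\<integral>\<^sup>+y. ?u (y(?m := r)) \<partial>euclid n)"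
    proof (cases "r \<in> {r0<..<r1}")
      case True
      have em: "emeasure lborel (strips (N k) (w k r) r) = ennreal (real (N k) * w k r)" "strips (N k) (w k r) r \<in> sets lborel" if "k \<in> {1..n}" for k
        using emeasure_strips[of "N k" "w k r" r] N[OF that] w[OF that, of r] True by auto
      have "(\<integral>\<^sup>+y. ?u (y(?m := r)) \<partial>euclid n) = (\<integral>\<^sup>+y. ennreal ((\<Psi> / (pi * r))\<^sup>2) * indicator (\<Pi>\<^sub>E k\<in>{1..n}. strips (N k) (w k r) r) y \<partial>euclid n)"
        using True by (intro nn_integral_cong) (auto simp: P_def space_euclid indicator_def PiE_iff)
      also have "\<dots> = ennreal ((\<Psi> / (pi * r))\<^sup>2) * emeasure (euclid n) (\<Pi>\<^sub>E k\<in>{1..n}. strips (N k) (w k r) r)"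
        using em(2) by (intro nn_integral_cmult_indicator) (auto simp: euclid_def intro!: sets_PiM_I_finite)
      also have "emeasure (euclid n) (\<Pi>\<^sub>E k\<in>{1..n}. strips (N k) (w k r) r) = (\<Prod>k\<in>{1..n}. ennreal (real (N k) * w k r))"
        by (subst emeasure_euclid_box[OF em(2)]) (auto intro!: prod.cong simp: em(1))
      also have "\<dots> = ennreal (\<Prod>k\<in>{1..n}. real (N k) * w k r)" using w True by (intro prod_ennreal) auto
      also have "ennreal ((\<Psi> / (pi * r))\<^sup>2) * \<dots> = ennreal ((\<Psi> / (pi * r))\<^sup>2 * (\<Prod>k\<in>{1..n}. real (N k) * w k r))"
        using w True by (intro ennreal_mult[symmetric] prod_nonneg) auto
      finally have e: "(\<integral>\<^sup>+y. ?u (y(?m := r)) \<partial>euclid n) = ennreal ((\<Psi> / (pi * r))\<^sup>2 * (\<Prod>k\<in>{1..n}. real (N k) * w k r))" .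
      show ?thesis unfolding e using True by simp
    qed simp
  qed
  also have "\<dots> = (\<integral>\<^sup>+x. ?u x \<partial>?M)" by (rule nn_integral_euclid_Suc[OF um, symmetric])
  also have "\<dots> \<le> (\<integral>\<^sup>+x. (maximal_hilbert n ?\<Omega> f x)\<^sup>2 \<partial>?M)"
  proof (rule nn_integral_mono)
    fix x assume x: "x \<in> space ?M"
    show "?u x \<le> (maximal_hilbert n ?\<Omega> f x)\<^sup>2"
    proof (cases "P x")
      case True
      have x0: "x ?m > 0" using True br ab a by (auto simp: P_def)
      have "?u x = (ennreal (\<Psi> / (pi * x ?m)))\<^sup>2" using True x0 \<Psi>0 by (simp add: ennreal_power)
      also have "\<dots> \<le> (maximal_hilbert n ?\<Omega> f x)\<^sup>2" using True by (intro power_mono pt x) (auto simp: P_def)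
      finally show ?thesis .
    qed simp
  qed
  finally have I: "ennreal X \<le> (\<integral>\<^sup>+x. (maximal_hilbert n ?\<Omega> f x)\<^sup>2 \<partial>?M)" .
  have "ennreal (sqrt X) \<le> l2_norm ?m (maximal_hilbert n ?\<Omega> f)"
  proof (cases "(\<integral>\<^sup>+x. (maximal_hilbert n ?\<Omega> f x)\<^sup>2 \<partial>?M) = \<infinity>")
    case False
    then have "X \<le> enn2real (\<integral>\<^sup>+x. (maximal_hilbert n ?\<Omega> f x)\<^sup>2 \<partial>?M)"
      using I X(1) by (metis enn2real_ennreal enn2real_mono infinity_ennreal_def less_top)
    then show ?thesis using False by (simp add: l2_norm_def Let_def ennreal_leI)
  qed (simp add: l2_norm_def Let_def)
  also have "\<dots> \<le> maximal_hilbert_norm n ?\<Omega>"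
    unfolding maximal_hilbert_norm_def by (rule SUP_upper) (use fL fl in simp)
  finally show ?thesis .
qed

lemma prod_split_first:
  fixes g :: "nat \<Rightarrow> 'b::comm_monoid_mult"
  assumes "n \<ge> 2" shows "(\<Prod>k\<in>{1..n}. g k) = g 1 * (\<Prod>k=2..n. g k)"
proof -
  have "{1..n} = insert 1 {2..n}" using assms by auto
  then show ?thesis by simp
qed

text \<open>With R^2 = N 1 / N 2 the range [1, R] of s and the range (R N 2, N 1) of r have the same
  logarithmic length ln R. The squared value on the strips gives (ln R)^2, integration in r a
  further ln R, and normalization removes one factor ln R.\<close>

lemma lower_large_ratio:
  assumes n: "n \<ge> 2" and N: "\<And>k. k \<in> {1..n} \<Longrightarrow> N k \<ge> 1" and mono: "\<And>k. k \<in> {2..n} \<Longrightarrow> N k \<le> N 2"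
    and ratio: "2 \<le> real (N 1) / real (N 2)"
  shows "ennreal (sqrt ((\<Prod>k=2..n. real (N k)) / (pi\<^sup>2 * 2 ^ n)) * (ln (real (N 1) / real (N 2)) / 2))
    \<le> maximal_hilbert_norm n (\<Pi>\<^sub>E k\<in>{1..n}. uniform_set (N k))"
proof -
  have in12: "1 \<in> {1..n}" "2 \<in> {1..n}" using n by auto
  define X where "X = real (N 1) / real (N 2)"
  define R where "R = sqrt X"
  have N12: "real (N 1) \<ge> 1" "real (N 2) \<ge> 1" using N[OF in12(1)] N[OF in12(2)] by auto
  have X2: "X \<ge> 2" using ratio by (simp add: X_def)
  have R1: "R > 1" unfolding R_def using X2 by (simp add: real_less_rsqrt)
  have RR: "R * R = X" unfolding R_def using X2 by simp
  have lnR: "ln R = ln X / 2" unfolding R_def using X2 by (simp add: ln_sqrt)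
  have lnR0: "ln R > 0" using R1 by simp
  \<comment> \<open>The squared norm of 1/s on the support: the integral over [1, R] of s^(-2) times
    the cross-section 2 s (2 R)^(n - 1).\<close>
  define V where "V = 2 ^ n * R ^ (n - 1) * ln R"
  have V0: "V > 0" unfolding V_def using R1 lnR0 by simp
  define c where "c = 1 / sqrt V"
  have c2: "c\<^sup>2 = 1 / V" unfolding c_def using V0 by (simp add: power_divide)
  have c0: "c > 0" unfolding c_def using V0 by simp
  define \<psi> where "\<psi> s = c / s" for s :: real
  define d where "d k s = (if k = 1 then 2 * s else 2 * R)" for k :: nat and s :: real
  \<comment> \<open>In coordinate 1 the strips have the largest disjoint width, below 1 <= s as r <
    N 1, which fits the cross-section 2 s. In the other coordinates R <= r / N k, because r > R * N
    2.\<close>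
  define w where "w k r = (if k = 1 then r / real (N 1) else R)" for k :: nat and r :: real
  define P where "P = (\<Prod>k=2..n. real (N k))"
  have P0: "P \<ge> 0" unfolding P_def by (simp add: prod_nonneg)
  have [measurable]: "\<psi> \<in> borel_measurable borel" "\<And>k. d k \<in> borel_measurable borel" "\<And>k. w k \<in> borel_measurable borel"
    unfolding \<psi>_def d_def w_def by measurable
  have ftc: "has_bochner_integral lborel (\<lambda>s. \<psi> s * indicator {1..R} s) (c * ln R - c * ln 1)"
  proof (rule has_bochner_integral_FTC_Icc_nonneg)
    show "DERIV (\<lambda>s. c * ln s) x :> \<psi> x" if "x \<in> {1..R}" for x
      using that unfolding \<psi>_def by (auto intro!: derivative_eq_intros)
    show "0 \<le> \<psi> x" if "x \<in> {1..R}" for x using that c0 by (simp add: \<psi>_def)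
  qed (use R1 in auto)
  have \<Psi>: "(\<integral>s. \<psi> s * indicator {1..R} s \<partial>lborel) = c * ln R" using ftc by (simp add: has_bochner_integral_iff)
  have pw: "(\<psi> s)\<^sup>2 * (\<Prod>k\<in>{1..n}. max 0 (d k s)) = (c\<^sup>2 * 2 ^ n * R ^ (n - 1)) / s" if "s \<ge> 1" for s
  proof -
    have "(\<Prod>k\<in>{1..n}. max 0 (d k s)) = 2 * s * (\<Prod>k=2..n. 2 * R)"
      unfolding prod_split_first[OF n] using that R1 by (auto simp: d_def intro!: prod.cong)
    also have "(\<Prod>k=2..n. 2 * R) = (2 * R) ^ (n - 1)" by simp
    finally have "(\<psi> s)\<^sup>2 * (\<Prod>k\<in>{1..n}. max 0 (d k s)) = (c / s)\<^sup>2 * (2 * s * (2 * R) ^ (n - 1))" by (simp add: \<psi>_def)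
    also have "\<dots> = (c\<^sup>2 * (2 * 2 ^ (n - 1)) * R ^ (n - 1)) / s"
      using that by (simp add: power_divide power_mult_distrib power2_eq_square)
    also have "(2::real) * 2 ^ (n - 1) = 2 ^ n" using n by (simp flip: power_Suc)
    finally show ?thesis .
  qed
  show ?thesis
  proof -
    let ?X = "P / (pi\<^sup>2 * 2 ^ n) * (ln R)\<^sup>2"
    have X0: "?X \<ge> 0" using P0 by simp
    have main: "ennreal (sqrt ?X) \<le> maximal_hilbert_norm n (\<Pi>\<^sub>E k\<in>{1..n}. uniform_set (N k))"
    proof (rule maximal_hilbert_lower[where \<psi> = \<psi> and d = d and w = w and a = 1 and b = R and ?r0.0 = "R * real (N 2)" and ?r1.0 = "real (N 1)"])
      show "integrable lborel (\<lambda>s. \<psi> s * indicator {1..R} s)" using ftc by (simp add: has_bochner_integral_iff)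
      show "\<psi> s \<ge> 0" if "s \<in> {1..R}" for s using that c0 by (simp add: \<psi>_def)
      show "R \<le> R * real (N 2)" using R1 N12 by simp
      show "0 \<le> w k r \<and> w k r \<le> r / real (N k)" if k: "k \<in> {1..n}" and r: "R * real (N 2) < r" "r < real (N 1)" for k r
      proof (cases "k = 1")
        case True
        have "0 < R * real (N 2)" using R1 N12 by (intro mult_pos_pos) auto
        then show ?thesis using True r by (simp add: w_def)
      next
        case False
        then have "real (N k) \<le> real (N 2)" using mono[of k] k by auto
        then have "R * real (N k) \<le> r" using mult_left_mono[of "real (N k)" "real (N 2)" R] R1 r by linarith
        moreover have "real (N k) \<ge> 1" using N[OF k] by simp
        ultimately show ?thesis using False R1 by (simp add: w_def pos_le_divide_eq)
      qed
      show "w k r + s \<le> d k s" if "k \<in> {1..n}" "R * real (N 2) < r" "r < real (N 1)" "1 \<le> s" "s \<le> R" for k r s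
      proof -
        have "r / real (N 1) \<le> 1" using that N12 by simp
        then show ?thesis using that by (auto simp: w_def d_def)
      qed
      show "(\<integral>\<^sup>+s. ennreal ((\<psi> s)\<^sup>2 * (\<Prod>k\<in>{1..n}. max 0 (d k s))) * indicator {1..R} s \<partial>lborel) \<le> 1"
      proof -
        define K where "K = c\<^sup>2 * 2 ^ n * R ^ (n - 1)"
        have "(\<integral>\<^sup>+s. ennreal ((\<psi> s)\<^sup>2 * (\<Prod>k\<in>{1..n}. max 0 (d k s))) * indicator {1..R} s \<partial>lborel) = (\<integral>\<^sup>+s. ennreal (K / s) * indicator {1..R} s \<partial>lborel)"
        proof (rule nn_integral_cong)
          fix s
          show "ennreal ((\<psi> s)\<^sup>2 * (\<Prod>k\<in>{1..n}. max 0 (d k s))) * indicator {1..R} s = ennreal (K / s) * indicator {1..R} s"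
          proof (cases "s \<in> {1..R}")
            case True
            then have "s \<ge> 1" by simp
            show ?thesis unfolding pw[OF \<open>s \<ge> 1\<close>] K_def ..
          next
            case False
            then have "indicator {1..R} s = (0::ennreal)" by simp
            then show ?thesis by (simp only: mult_zero_right)
          qed
        qed
        also have "\<dots> = ennreal (K * ln R - K * ln 1)"
        proof (rule nn_integral_FTC_Icc)
          show "DERIV (\<lambda>s. K * ln s) x :> K / x" if "x \<in> {1..R}" for x using that by (auto intro!: derivative_eq_intros)
          show "0 \<le> K / x" if "x \<in> {1..R}" for x using that R1 by (simp add: K_def)
        qed (use R1 in auto)
        also have "K * ln R - K * ln 1 = 1" using R1 lnR0 by (simp add: K_def c2 V_def)
        finally show ?thesis by simp
      qed
      show "ennreal ?X \<le> (\<integral>\<^sup>+r. ennreal (((\<integral>s. \<psi> s * indicator {1..R} s \<partial>lborel) / (pi * r))\<^sup>2 * (\<Prod>k\<in>{1..n}. real (N k) * w k r)) * indicator {R * real (N 2)<..<real (N 1)} r \<partial>lborel)"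
      proof -
        define K where "K = (c * ln R)\<^sup>2 / pi\<^sup>2 * (R ^ (n - 1) * P)"
        have le: "R * real (N 2) \<le> real (N 1)"
        proof -
          have "R \<le> R * R" using R1 by simp
          then have "R * real (N 2) \<le> X * real (N 2)" unfolding RR using N12 by (intro mult_right_mono) auto
          then show ?thesis using N12 by (simp add: X_def)
        qed
        have pos: "R * real (N 2) > 0" using R1 N12 by (intro mult_pos_pos) auto
        have "(\<integral>\<^sup>+r. ennreal (((\<integral>s. \<psi> s * indicator {1..R} s \<partial>lborel) / (pi * r))\<^sup>2 * (\<Prod>k\<in>{1..n}. real (N k) * w k r)) * indicator {R * real (N 2)<..<real (N 1)} r \<partial>lborel)
            = (\<integral>\<^sup>+r. ennreal (((\<integral>s. \<psi> s * indicator {1..R} s \<partial>lborel) / (pi * r))\<^sup>2 * (\<Prod>k\<in>{1..n}. real (N k) * w k r)) * indicator {R * real (N 2)..real (N 1)} r \<partial>lborel)"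
          by (rule nn_integral_Ioo_Icc)
        also have "\<dots> = (\<integral>\<^sup>+r. ennreal (K / r) * indicator {R * real (N 2)..real (N 1)} r \<partial>lborel)"
        proof (rule nn_integral_cong)
          fix r
          show "ennreal (((\<integral>s. \<psi> s * indicator {1..R} s \<partial>lborel) / (pi * r))\<^sup>2 * (\<Prod>k\<in>{1..n}. real (N k) * w k r)) * indicator {R * real (N 2)..real (N 1)} r
              = ennreal (K / r) * indicator {R * real (N 2)..real (N 1)} r"
          proof (cases "r \<in> {R * real (N 2)..real (N 1)}")
            case True
            then have r0: "r > 0" using pos by simp
            have "(\<Prod>k\<in>{1..n}. real (N k) * w k r) = r * (\<Prod>k=2..n. real (N k) * R)"
              unfolding prod_split_first[OF n] using N12 by (auto simp: w_def intro!: prod.cong)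
            also have "(\<Prod>k=2..n. real (N k) * R) = P * R ^ (n - 1)" by (simp add: prod.distrib P_def)
            finally have "(c * ln R / (pi * r))\<^sup>2 * (\<Prod>k\<in>{1..n}. real (N k) * w k r) = (c * ln R / (pi * r))\<^sup>2 * (r * (P * R ^ (n - 1)))" by simp
            also have "\<dots> = K / r" using r0 by (simp add: K_def power_divide power_mult_distrib) (simp add: power2_eq_square mult_ac)
            finally show ?thesis unfolding \<Psi> by simp
          qed simp
        qed
        also have "\<dots> = ennreal (K * ln (real (N 1)) - K * ln (R * real (N 2)))"
        proof (rule nn_integral_FTC_Icc[OF _ _ _ le])
          show "DERIV (\<lambda>s. K * ln s) x :> K / x" if "x \<in> {R * real (N 2)..real (N 1)}" for x using that pos by (auto intro!: derivative_eq_intros)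
          show "0 \<le> K / x" if "x \<in> {R * real (N 2)..real (N 1)}" for x using that R1 P0 pos by (simp add: K_def)
        qed measurable
        also have "K * ln (real (N 1)) - K * ln (R * real (N 2)) = K * ln R"
        proof -
          have "real (N 1) = R * (R * real (N 2))" using N12 by (simp add: mult.assoc[symmetric] RR X_def)
          then have "ln (real (N 1)) = ln R + ln (R * real (N 2))" using R1 pos by (simp add: ln_mult_pos)
          then show ?thesis by (simp add: algebra_simps)
        qed
        also have "K * ln R = ?X"
        proof -
          have "K * ln R = (R ^ (n - 1) * ln R / V) * (P / pi\<^sup>2 * (ln R)\<^sup>2)" by (simp add: K_def power_mult_distrib c2)
          also have "R ^ (n - 1) * ln R / V = 1 / 2 ^ n" using R1 lnR0 by (simp add: V_def)
          finally show ?thesis by simp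
        qed
        finally show ?thesis by simp
      qed
    qed (use N X0 R1 in auto)
    have "sqrt ?X = sqrt (P / (pi\<^sup>2 * 2 ^ n)) * sqrt ((ln R)\<^sup>2)"
      unfolding real_sqrt_mult[symmetric] by simp
    also have "sqrt ((ln R)\<^sup>2) = ln R" using lnR0 by simp
    finally have eq: "sqrt ?X = sqrt (P / (pi\<^sup>2 * 2 ^ n)) * ln R" .
    show ?thesis using main[unfolded eq] by (simp add: P_def lnR X_def)
  qed
qed

text \<open>For a bounded ratio no logarithm has to be produced, so a constant on the box [0, 1] x
  [0, 2]^n suffices, seen from heights between N 1 and 2 N 1 through strips of width 1.\<close>

lemma lower_small_ratio:
  assumes n: "n \<ge> 2" and N: "\<And>k. k \<in> {1..n} \<Longrightarrow> N k \<ge> 1" and mono: "\<And>k. k \<in> {1..n} \<Longrightarrow> N k \<le> N 1"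
  shows "ennreal (sqrt ((\<Prod>k=2..n. real (N k)) / (pi\<^sup>2 * 2 ^ n) / 2))
    \<le> maximal_hilbert_norm n (\<Pi>\<^sub>E k\<in>{1..n}. uniform_set (N k))"
proof -
  have in1: "1 \<in> {1..n}" using n by auto
  have N1: "real (N 1) \<ge> 1" using N[OF in1] by simp
  define c where "c = 1 / sqrt (2 ^ n)"
  have c2: "c\<^sup>2 = 1 / 2 ^ n" by (simp add: c_def power_divide)
  have c0: "c > 0" by (simp add: c_def)
  define P where "P = (\<Prod>k=2..n. real (N k))"
  have P0: "P \<ge> 0" unfolding P_def by (simp add: prod_nonneg)
  have i01: "integrable lborel (\<lambda>s. c * indicator {0..1::real} s)" by (intro integrable_mult_right integrable_real_indicator) auto
  have \<Psi>: "(\<integral>s. c * indicator {0..1::real} s \<partial>lborel) = c" by simp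
  show ?thesis
  proof (rule maximal_hilbert_lower[where \<psi> = "\<lambda>_. c" and d = "\<lambda>_ _. 2" and w = "\<lambda>_ _. 1" and a = 0 and b = 1 and ?r0.0 = "real (N 1)" and ?r1.0 = "2 * real (N 1)"])
    show "0 \<le> (1::real) \<and> 1 \<le> r / real (N k)" if k: "k \<in> {1..n}" and r: "real (N 1) < r" for k r
    proof -
      have "real (N k) \<le> r" using mono[OF k] r by linarith
      then show ?thesis using N[OF k] by (simp add: pos_le_divide_eq)
    qed
    show "(\<integral>\<^sup>+s. ennreal (c\<^sup>2 * (\<Prod>k\<in>{1..n}. max 0 2)) * indicator {0..1::real} s \<partial>lborel) \<le> 1"
      using nn_integral_indicator[of "{0..1::real}" lborel] by (simp add: c2)
    show "ennreal ((\<Prod>k=2..n. real (N k)) / (pi\<^sup>2 * 2 ^ n) / 2) \<le> (\<integral>\<^sup>+r. ennreal (((\<integral>s. c * indicator {0..1::real} s \<partial>lborel) / (pi * r))\<^sup>2 * (\<Prod>k\<in>{1..n}. real (N k) * 1)) * indicator {real (N 1)<..<2 * real (N 1)} r \<partial>lborel)"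
    proof -
      define K where "K = c\<^sup>2 / pi\<^sup>2 * (real (N 1) * P)"
      have K0: "K \<ge> 0" using P0 by (simp add: K_def)
      have "(\<integral>\<^sup>+r. ennreal (((\<integral>s. c * indicator {0..1::real} s \<partial>lborel) / (pi * r))\<^sup>2 * (\<Prod>k\<in>{1..n}. real (N k) * 1)) * indicator {real (N 1)<..<2 * real (N 1)} r \<partial>lborel)
          = (\<integral>\<^sup>+r. ennreal (K / r\<^sup>2) * indicator {real (N 1)..2 * real (N 1)} r \<partial>lborel)"
        unfolding nn_integral_Ioo_Icc \<Psi> prod_split_first[OF n]
        by (intro nn_integral_cong) (simp add: K_def P_def power_divide power_mult_distrib)
      also have "\<dots> = ennreal (- (K / (2 * real (N 1))) - (- (K / real (N 1))))"
      proof (rule nn_integral_FTC_Icc)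
        show "DERIV (\<lambda>s. - (K / s)) x :> K / x\<^sup>2" if "x \<in> {real (N 1)..2 * real (N 1)}" for x
          using that N1 by (auto intro!: derivative_eq_intros simp: power2_eq_square)
        show "0 \<le> K / x\<^sup>2" for x using K0 by simp
      qed (use N1 in auto)
      also have "- (K / (2 * real (N 1))) - (- (K / real (N 1))) = K / real (N 1) / 2" using N1 by (simp add: field_simps)
      also have "K / real (N 1) / 2 = P / (pi\<^sup>2 * 2 ^ n) / 2" using N1 by (simp add: K_def c2)
      finally show ?thesis by (simp add: P_def)
    qed
  qed (use N N1 c0 i01 P0 in \<open>auto simp: P_def\<close>)
qed

theorem maximal_hilbert_uniform_lower:
  assumes n: "n \<ge> 2" and N: "antimono_on {1..n} N" "\<forall>k\<in>{1..n}. N k \<ge> 1"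
  shows "ennreal (1 / (4 * pi * sqrt (2 ^ n)) * sqrt (\<Prod>k=2..n. real (N k)) * ln (real (N 1) / real (N 2) + 1))
    \<le> maximal_hilbert_norm n (\<Pi>\<^sub>E k\<in>{1..n}. uniform_set (N k))"
proof -
  have in12: "1 \<in> {1..n}" "2 \<in> {1..n}" using n by auto
  have mono: "N l \<le> N k" if "k \<in> {1..n}" "l \<in> {1..n}" "k \<le> l" for k l using N(1) that by (auto simp: monotone_on_def)
  define X where "X = real (N 1) / real (N 2)"
  define p where "p = sqrt (\<Prod>k=2..n. real (N k))"
  define s where "s = pi * sqrt (2 ^ n)"
  have s0: "s > 0" by (simp add: s_def)
  have p0: "p \<ge> 0" by (simp add: p_def prod_nonneg)
  have "N 2 \<le> N 1" by (rule mono[OF in12]) simp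
  moreover have "N 2 \<ge> 1" using N(2) in12(2) by blast
  ultimately have X1: "X \<ge> 1" unfolding X_def by (simp add: pos_le_divide_eq)
  have root: "sqrt ((\<Prod>k=2..n. real (N k)) / (pi\<^sup>2 * 2 ^ n)) = p / s"
    by (simp add: real_sqrt_divide real_sqrt_mult p_def s_def)
  show ?thesis
  proof (cases "2 \<le> X")
    case True
    \<comment> \<open>From X >= 2 on, X + 1 <= X^2, so the shifted logarithm costs a factor 2; the
      remaining 1/2 comes from ln R = ln X / 2. Together they give the constant 1/4.\<close>
    have "X + 1 \<le> X * X" using True mult_right_mono[of 2 X X] by linarith
    then have "ln (X + 1) \<le> ln (X * X)" using True by (subst ln_le_cancel_iff) auto
    also have "\<dots> = 2 * ln X" using True by (simp add: ln_mult_pos)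
    finally have l: "ln (X + 1) \<le> 2 * ln X" .
    have "1 / (4 * s) * p * ln (X + 1) \<le> 1 / (4 * s) * p * (2 * ln X)" using s0 p0 by (intro mult_left_mono l) auto
    also have "\<dots> = p / s * (ln X / 2)" by simp
    finally have "ennreal (1 / (4 * s) * p * ln (X + 1)) \<le> ennreal (p / s * (ln X / 2))" by (rule ennreal_leI)
    also have "\<dots> \<le> maximal_hilbert_norm n (\<Pi>\<^sub>E k\<in>{1..n}. uniform_set (N k))"
      unfolding root[symmetric] X_def
      by (rule lower_large_ratio[OF n]) (use N(2) mono in12 True in \<open>auto simp: X_def\<close>)
    finally show ?thesis by (simp add: s_def p_def X_def mult.assoc)
  next
    case False
    \<comment> \<open>Here the logarithm is at most 2, and the same constant 1/4 leaves 1/2, which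
      is below the available 1/sqrt 2.\<close>
    have "ln (X + 1) \<le> ln 4" using False X1 by (subst ln_le_cancel_iff) auto
    also have "\<dots> = 2 * ln 2" using ln_realpow[of 2 2] by simp
    also have "\<dots> \<le> 2" using ln_2_less_1 by simp
    finally have l: "ln (X + 1) \<le> 2" .
    have r2: "1 / 2 \<le> 1 / sqrt 2" by (intro divide_left_mono) (auto simp: real_le_lsqrt)
    have "1 / (4 * s) * p * ln (X + 1) \<le> 1 / (4 * s) * p * 2" using s0 p0 by (intro mult_left_mono l) auto
    also have "\<dots> = p / s * (1 / 2)" by simp
    also have "\<dots> \<le> p / s * (1 / sqrt 2)" using s0 p0 by (intro mult_left_mono r2) auto
    finally have "ennreal (1 / (4 * s) * p * ln (X + 1)) \<le> ennreal (p / s * (1 / sqrt 2))" by (rule ennreal_leI)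
    also have "p / s * (1 / sqrt 2) = sqrt ((\<Prod>k=2..n. real (N k)) / (pi\<^sup>2 * 2 ^ n) / 2)"
      unfolding root[symmetric] real_sqrt_divide[of _ 2] by simp
    also have "ennreal \<dots> \<le> maximal_hilbert_norm n (\<Pi>\<^sub>E k\<in>{1..n}. uniform_set (N k))"
      by (rule lower_small_ratio[OF n]) (use N(2) mono in12 in auto)
    finally show ?thesis by (simp add: s_def p_def X_def mult.assoc)
  qed
qed

section \<open>The upper bound\<close>

lemma sum_three_quarters: "(\<Sum>i<m. (3/4::real) ^ i) \<le> 4"
proof -
  have "(\<Sum>i<m. (3/4::real) ^ i) = (1 - (3/4) ^ m) / (1 - 3/4)" by (subst sum_gp_strict) auto
  also have "\<dots> \<le> 4" by simp
  finally show ?thesis .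
qed

text \<open>The 1 stands for the base point; 6 is 4 for the geometric levels plus 2 for those
  between \<open>L 2\<close> and \<open>L 1\<close>; the square root pays for rounding N 2, ..., N n
  up to powers of two; division by ln 2 turns constants into multiples of the logarithm, which is at
  least ln 2.\<close>

definition upper_const :: "nat \<Rightarrow> real" where
  "upper_const n = (1 + 6 * real n * sqrt (2 ^ (n - 1))) / ln 2"

lemma (in dyadic_chain) T_le:
  "T \<le> upper_const n * sqrt (\<Prod>k=2..n. real (N k)) * ln (real (N 1) / real (N 2) + 1)"
proof -
  have in12: "1 \<in> {1..n}" "2 \<in> {1..n}" using n by auto
  define Q where "Q = (\<Prod>l=2..n. 2 ^ L l :: real)"
  define P where "P = sqrt (\<Prod>k=2..n. real (N k))"
  define \<Lambda> where "\<Lambda> = ln (real (N 1) / real (N 2) + 1)"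
  have Q0: "Q > 0" by (simp add: Q_def prod_pos)
  have N12: "real (N 2) \<ge> 1" "real (N 1) \<ge> real (N 2)" using N1[OF in12(2)] Nmono[OF in12] by auto
  have \<Lambda>: "ln 2 \<le> \<Lambda>" unfolding \<Lambda>_def using N12 by (subst ln_le_cancel_iff) (auto simp: field_simps)
  have l2: "ln 2 > (0::real)" by simp
  have \<Lambda>0: "\<Lambda> \<ge> 0" using \<Lambda> l2 by linarith
  have "1 \<le> (\<Prod>k=2..n. real (N k))" by (rule prod_ge_1) (use N1 in force)
  then have P1: "P \<ge> 1" by (simp add: P_def)
  have QP: "sqrt Q \<le> sqrt (2 ^ (n - 1)) * P"
  proof -
    have "Q \<le> (\<Prod>l=2..n. 2 * real (N l))" unfolding Q_def
    proof (rule prod_mono)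
      fix l assume "l \<in> {2..n}"
      then have "2 ^ L l < 2 * N l" unfolding L_def using N1[of l] by (intro two_power_clog_less) auto
      then have "real (2 ^ L l) < real (2 * N l)" by (simp only: of_nat_less_iff)
      then show "0 \<le> (2::real) ^ L l \<and> 2 ^ L l \<le> 2 * real (N l)" by simp
    qed
    also have "\<dots> = 2 ^ (n - 1) * (\<Prod>l=2..n. real (N l))" by (simp add: prod.distrib)
    finally have "sqrt Q \<le> sqrt (2 ^ (n - 1) * (\<Prod>l=2..n. real (N l)))" by (rule real_sqrt_le_mono)
    then show ?thesis by (simp add: P_def real_sqrt_mult)
  qed
  have WQ: "W j \<le> Q" for j unfolding W_def Q_def by (intro prod_mono) (auto intro!: power_increasing)
  \<comment> \<open>The factor of coordinate 2 alone provides the decay, the others being bounded by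
    their final values. The ratio 3/4 is a convenient upper bound for 1/sqrt 2.\<close>
  have Wsmall: "sqrt (W j) \<le> sqrt Q * (3/4) ^ (L 2 - Suc j)" if j: "j < L 2" for j
  proof -
    define m where "m = L 2 - Suc j"
    have s: "{2..n} = insert 2 {3..n}" using n by auto
    have "W j = 2 ^ min (Suc j) (L 2) * (\<Prod>l=3..n. 2 ^ min (Suc j) (L l))" unfolding W_def s by (subst prod.insert) auto
    also have "\<dots> \<le> 2 ^ Suc j * (\<Prod>l=3..n. 2 ^ L l)"
    proof (intro mult_mono)
      show "(2::real) ^ min (Suc j) (L 2) \<le> 2 ^ Suc j" by (rule power_increasing) auto
      show "(\<Prod>l=3..n. 2 ^ min (Suc j) (L l)) \<le> (\<Prod>l=3..n. (2::real) ^ L l)" by (intro prod_mono) (auto intro!: power_increasing)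
    qed (auto intro: prod_nonneg)
    also have "(2::real) ^ Suc j = 2 ^ L 2 * (1/2) ^ m"
    proof -
      have "(2::real) ^ L 2 = 2 ^ Suc j * 2 ^ m" using j by (simp add: m_def flip: power_add power_Suc)
      then show ?thesis by (simp add: power_one_over)
    qed
    also have "2 ^ L 2 * (1/2) ^ m * (\<Prod>l=3..n. 2 ^ L l) = Q * (1/2::real) ^ m" unfolding Q_def s by (subst prod.insert) auto
    also have "\<dots> \<le> Q * ((3/4)\<^sup>2) ^ m" using Q0 by (intro mult_left_mono power_mono) (auto simp: power2_eq_square)
    also have "((3/4)\<^sup>2) ^ m = ((3/4::real) ^ m)\<^sup>2" by (simp only: power_mult[symmetric] mult.commute[of 2])
    finally have "sqrt (W j) \<le> sqrt (Q * ((3/4) ^ m)\<^sup>2)" by (rule real_sqrt_le_mono)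
    then show ?thesis by (simp add: real_sqrt_mult m_def)
  qed
  have L21: "L 2 \<le> L 1" by (rule L_mono[OF in12]) simp
  have len: "real (L 1 - L 2) \<le> 2 * \<Lambda> / ln 2"
  proof -
    have a: "real (2 ^ L 1) < real (2 * N 1)" unfolding L_def of_nat_less_iff by (rule two_power_clog_less[OF N1[OF in12(1)]])
    have b: "real (N 2) \<le> real (2 ^ L 2)" unfolding L_def of_nat_le_iff by (rule le_two_power_clog)
    \<comment> \<open>Rounding to powers of two costs one factor 2; the resulting ln 2 is absorbed
      by a second copy of \<Lambda>.\<close>
    have "(2::real) ^ (L 1 - L 2) = 2 ^ L 1 / 2 ^ L 2" using L21 by (simp add: power_diff)
    also have "\<dots> \<le> (2 * real (N 1)) / real (N 2)" using a b N12 by (intro frac_le) auto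
    finally have "ln ((2::real) ^ (L 1 - L 2)) \<le> ln (2 * (real (N 1) / real (N 2)))" using N12 by (subst ln_le_cancel_iff) auto
    also have "\<dots> = ln 2 + ln (real (N 1) / real (N 2))" using N12 by (intro ln_mult_pos) auto
    also have "\<dots> \<le> \<Lambda> + \<Lambda>"
      unfolding \<Lambda>_def using \<Lambda>[unfolded \<Lambda>_def] N12 by (intro add_mono) (subst ln_le_cancel_iff; auto intro: add_pos_nonneg)+
    finally have "real (L 1 - L 2) * ln 2 \<le> 2 * \<Lambda>" by (simp add: ln_realpow)
    then show ?thesis using l2 by (simp add: pos_le_divide_eq)
  qed
  have "(\<Sum>j<L 1. sqrt (W j)) = (\<Sum>j<L 2. sqrt (W j)) + (\<Sum>j=L 2..<L 1. sqrt (W j))"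
    using L21 by (subst sum.union_disjoint[symmetric]) (auto intro!: sum.cong)
  also have "\<dots> \<le> (\<Sum>j<L 2. sqrt Q * (3/4) ^ (L 2 - Suc j)) + (\<Sum>j=L 2..<L 1. sqrt Q)"
    by (intro add_mono sum_mono Wsmall real_sqrt_le_mono WQ) auto
  also have "(\<Sum>j<L 2. sqrt Q * (3/4) ^ (L 2 - Suc j)) = sqrt Q * (\<Sum>j<L 2. (3/4) ^ j)"
    by (subst sum_distrib_left[symmetric], subst sum.nat_diff_reindex) simp
  also have "\<dots> + (\<Sum>j=L 2..<L 1. sqrt Q) \<le> sqrt Q * 4 + sqrt Q * (2 * \<Lambda> / ln 2)"
  proof (intro add_mono mult_left_mono sum_three_quarters)
    have "(\<Sum>j=L 2..<L 1. sqrt Q) = sqrt Q * real (L 1 - L 2)" by simp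
    also have "\<dots> \<le> sqrt Q * (2 * \<Lambda> / ln 2)" using Q0 by (intro mult_left_mono len) auto
    finally show "(\<Sum>j=L 2..<L 1. sqrt Q) \<le> sqrt Q * (2 * \<Lambda> / ln 2)" .
  qed (use Q0 in auto)
  also have "\<dots> \<le> sqrt Q * (6 * \<Lambda> / ln 2)"
  proof -
    \<comment> \<open>The geometric part has no logarithm of its own, but \<Lambda> >= ln 2 since N
      1 >= N 2.\<close>
    have "4 \<le> 4 * \<Lambda> / ln 2" using \<Lambda> l2 by (simp add: pos_le_divide_eq)
    then have "4 + 2 * \<Lambda> / ln 2 \<le> 6 * \<Lambda> / ln 2" by (simp add: add_divide_distrib[symmetric])
    then have "sqrt Q * (4 + 2 * \<Lambda> / ln 2) \<le> sqrt Q * (6 * \<Lambda> / ln 2)" using Q0 by (intro mult_left_mono) auto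
    then show ?thesis by (simp add: algebra_simps)
  qed
  also have "\<dots> \<le> (sqrt (2 ^ (n - 1)) * P) * (6 * \<Lambda> / ln 2)" by (rule mult_right_mono[OF QP]) (use \<Lambda>0 l2 in simp)
  finally have S: "(\<Sum>j<L 1. sqrt (W j)) \<le> (sqrt (2 ^ (n - 1)) * P) * (6 * \<Lambda> / ln 2)" .
  have one: "1 \<le> P * (\<Lambda> / ln 2)"
  proof -
    have "1 \<le> \<Lambda> / ln 2" using \<Lambda> l2 by (simp add: pos_le_divide_eq)
    from mult_mono[OF P1 this] P1 show ?thesis by simp
  qed
  have "T \<le> P * (\<Lambda> / ln 2) + real n * ((sqrt (2 ^ (n - 1)) * P) * (6 * \<Lambda> / ln 2))"
    unfolding T_def sum_distrib_left[symmetric] by (intro add_mono one mult_left_mono S) auto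
  also have "\<dots> = upper_const n * P * \<Lambda>" unfolding upper_const_def by (simp add: field_simps)
  finally show ?thesis by (simp add: P_def \<Lambda>_def)
qed

text \<open>Slopes are replaced by their ranks in each \<Omega> j. Increasing indices then give
  increasing slopes, and \<open>dhilb_consecutive\<close> asks for nothing more, so arbitrary
  spacings are covered by dyadic rounding of the ranks.\<close>

lemma dhilb_maximal:
  fixes \<Omega> :: "nat \<Rightarrow> real set" and N :: "nat \<Rightarrow> nat"
  assumes n: "n \<ge> 2" and N: "antimono_on {1..n} N" "\<forall>k\<in>{1..n}. N k \<ge> 1"
    and \<Omega>: "\<forall>j\<in>{1..n}. finite (\<Omega> j) \<and> card (\<Omega> j) \<le> N j" and ne: "\<forall>j\<in>{1..n}. \<Omega> j \<noteq> {}"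
    and f: "sq_int (euclid (Suc n)) f"
  obtains g where "integrable (euclid (Suc n)) g" "\<And>v x. v \<in> (\<Pi>\<^sub>E j\<in>{1..n}. \<Omega> j) \<Longrightarrow> (dhilb n v f x)\<^sup>2 \<le> g x"
    "(\<integral>x. g x \<partial>euclid (Suc n)) \<le> (upper_const n * sqrt (\<Prod>k=2..n. real (N k)) * ln (real (N 1) / real (N 2) + 1))\<^sup>2
        * (4 * (l2_nrm (euclid (Suc n)) f)\<^sup>2)"
proof -
  let ?M = "euclid (Suc n)"
  define e where "e k i = sorted_list_of_set (\<Omega> k) ! i" for k i
  define c where "c k = card (\<Omega> k)" for k
  define pt where "pt \<iota> = (\<lambda>k\<in>{1..n}. e k (\<iota> k))" for \<iota> :: "nat \<Rightarrow> nat"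
  define F where "F \<iota> = dhilb n (pt \<iota>) f" for \<iota>
  have e_less: "e k i < e k j" if "k \<in> {1..n}" "i < j" "j < c k" for k i j
  proof -
    have "sorted_wrt (<) (sorted_list_of_set (\<Omega> k))" by (rule strict_sorted_list_of_set)
    then show ?thesis unfolding e_def
      by (rule sorted_wrt_nth_less[OF _ that(2)]) (use that \<Omega> in \<open>simp add: c_def\<close>)
  qed
  interpret ch: dyadic_chain ?M n N c "4 * (l2_nrm ?M f)\<^sup>2" F
  proof
    show "n \<ge> 2" by (rule n)
    show "1 \<le> N k" if "k \<in> {1..n}" for k using N that by auto
    show "N l \<le> N k" if "k \<in> {1..n}" "l \<in> {1..n}" "k \<le> l" for k l using N(1) that by (auto simp: monotone_on_def)
    show "1 \<le> c k" if "k \<in> {1..n}" for k using \<Omega> ne that by (auto simp: c_def Suc_le_eq card_gt_0_iff)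
    show "c k \<le> N k" if "k \<in> {1..n}" for k using \<Omega> that by (auto simp: c_def)
    show "sq_int ?M (F \<iota>)" for \<iota> unfolding F_def by (rule dhilb(1)[OF f])
    show "(l2_nrm ?M (F \<iota>))\<^sup>2 \<le> 4 * (l2_nrm ?M f)\<^sup>2" for \<iota>
    proof -
      have "(l2_nrm ?M (F \<iota>))\<^sup>2 \<le> (l2_nrm ?M f)\<^sup>2" unfolding F_def by (intro power_mono dhilb(3)[OF f] l2_nrm_nonneg)
      then show ?thesis using zero_le_power2[of "l2_nrm ?M f"] by linarith
    qed
    fix k q and b :: "nat \<Rightarrow> nat" and \<mu> assume k: "k \<in> {1..n}" and b: "\<And>i j. i < j \<Longrightarrow> j \<le> q \<Longrightarrow> b i < b j" and bq: "b q < c k"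
    have p: "pt (\<mu>(k := i)) = (pt \<mu>)(k := e k i)" for i using k by (auto simp: pt_def fun_eq_iff)
    show "(\<Sum>i<q. (l2_nrm ?M (\<lambda>x. F (\<mu>(k := b (Suc i))) x - F (\<mu>(k := b i)) x))\<^sup>2) \<le> 4 * (l2_nrm ?M f)\<^sup>2"
      unfolding F_def p
    proof (rule dhilb_consecutive[OF f k])
      fix i j assume ij: "i < j" "j \<le> q"
      have "b j \<le> b q" using b[of j q] ij by (cases "j = q") auto
      then show "e k (b i) < e k (b j)" using b[OF ij] bq by (intro e_less k) auto
    qed
  qed
  obtain g where g: "integrable ?M g" "\<And>\<iota> x. \<iota> \<in> ch.I \<Longrightarrow> (F \<iota> x)\<^sup>2 \<le> g x" "(\<integral>x. g x \<partial>?M) \<le> ch.T\<^sup>2 * (4 * (l2_nrm ?M f)\<^sup>2)"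
    by (rule ch.maximal_bound) blast
  show thesis
  proof (rule that[OF g(1)])
    fix v x assume v: "v \<in> (\<Pi>\<^sub>E j\<in>{1..n}. \<Omega> j)"
    have "\<exists>i. i < c k \<and> e k i = v k" if "k \<in> {1..n}" for k
    proof -
      have "v k \<in> set (sorted_list_of_set (\<Omega> k))" using v that \<Omega> by (auto simp: PiE_iff)
      then show ?thesis unfolding e_def c_def in_set_conv_nth by auto
    qed
    then obtain i where i: "\<And>k. k \<in> {1..n} \<Longrightarrow> i k < c k \<and> e k (i k) = v k" by metis
    have "restrict i {1..n} \<in> ch.I" using i by (auto simp: ch.I_def)
    moreover have "pt (restrict i {1..n}) = v"
    proof
      fix k show "pt (restrict i {1..n}) k = v k"
        using i[of k] v by (cases "k \<in> {1..n}") (auto simp: pt_def PiE_iff extensional_def)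
    qed
    ultimately show "(dhilb n v f x)\<^sup>2 \<le> g x" using g(2)[of "restrict i {1..n}" x] by (simp add: F_def)
  next
    have "ch.T\<^sup>2 \<le> (upper_const n * sqrt (\<Prod>k=2..n. real (N k)) * ln (real (N 1) / real (N 2) + 1))\<^sup>2"
      using ch.T_ge1 by (intro power_mono ch.T_le) simp
    then have "ch.T\<^sup>2 * (4 * (l2_nrm ?M f)\<^sup>2) \<le> (upper_const n * sqrt (\<Prod>k=2..n. real (N k)) * ln (real (N 1) / real (N 2) + 1))\<^sup>2 * (4 * (l2_nrm ?M f)\<^sup>2)"
      by (rule mult_right_mono) simp
    with g(3) show "(\<integral>x. g x \<partial>?M) \<le> (upper_const n * sqrt (\<Prod>k=2..n. real (N k)) * ln (real (N 1) / real (N 2) + 1))\<^sup>2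
        * (4 * (l2_nrm ?M f)\<^sup>2)" by (rule order_trans)
  qed
qed

section \<open>From real to complex functions\<close>

lemma complex_trunc_hilbert:
  fixes g :: "real \<Rightarrow> complex"
  assumes [measurable]: "g \<in> borel_measurable borel"
    and r: "integrable lborel (\<lambda>t. (Re (g t))\<^sup>2)" and i: "integrable lborel (\<lambda>t. (Im (g t))\<^sup>2)" and e: "e > 0"
  shows "complex_of_real (1 / pi) * (LINT t:{t. e < \<bar>t\<bar>}|lborel. g t / complex_of_real t)
    = Complex (trunc_hilbert (\<lambda>t. Re (g t)) e) (trunc_hilbert (\<lambda>t. Im (g t)) e)"
proof -
  let ?a = "\<lambda>t. indicator {t. e < \<bar>t\<bar>} t *\<^sub>R (Re (g t) / t)" and ?b = "\<lambda>t. indicator {t. e < \<bar>t\<bar>} t *\<^sub>R (Im (g t) / t)"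
  have a: "integrable lborel ?a" and b: "integrable lborel ?b"
    using integrable_trunc[OF _ r e] integrable_trunc[OF _ i e] by (auto simp: set_integrable_def)
  have "(LINT t:{t. e < \<bar>t\<bar>}|lborel. g t / complex_of_real t) = (\<integral>t. complex_of_real (?a t) + \<i> * complex_of_real (?b t) \<partial>lborel)"
    unfolding set_lebesgue_integral_def
    by (intro Bochner_Integration.integral_cong refl) (simp add: complex_eq_iff scaleR_conv_of_real indicator_def)
  also have "\<dots> = complex_of_real (\<integral>t. ?a t \<partial>lborel) + \<i> * complex_of_real (\<integral>t. ?b t \<partial>lborel)"
    using a b by (subst Bochner_Integration.integral_add) (auto simp del: of_real_mult real_scaleR_def scaleR_conv_of_real simp: integral_complex_of_real)
  finally show ?thesis by (simp add: trunc_hilbert_def set_lebesgue_integral_def complex_eq_iff)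
qed

text \<open>Links the limit in \<open>directional_hilbert\<close>, meaningful only where it exists,
  to the L^2 functions \<open>dhilb\<close>. The null set depends on v, which is harmless for
  finitely many directions.\<close>

lemma directional_hilbert_AE:
  assumes [measurable]: "f \<in> borel_measurable (euclid (Suc n))"
    and r: "sq_int (euclid (Suc n)) (\<lambda>x. Re (f x))" and i: "sq_int (euclid (Suc n)) (\<lambda>x. Im (f x))"
  shows "AE x in euclid (Suc n). directional_hilbert n v f x = Complex (dhilb n v (\<lambda>x. Re (f x)) x) (dhilb n v (\<lambda>x. Im (f x)) x)"
proof -
  let ?M = "euclid (Suc n)"
  interpret fl: measure_flow ?M "vflow (Suc n) (dir n v)" "\<lambda>x. x (Suc n)" by (rule measure_flow_dir)
  have "AE x in ?M. x \<in> space ?M" by simp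
  then show ?thesis
    using fl.AE_line_sq[OF r] fl.AE_line_sq[OF i] dhilb(2)[OF r, of v] dhilb(2)[OF i, of v]
  proof eventually_elim
    case (elim x)
    let ?g = "\<lambda>t. f (shift_along n v t x)"
    have gm: "?g \<in> borel_measurable borel"
      unfolding shift_along_vflow using elim(1) by measurable
    have L: "((\<lambda>e. Complex (trunc_hilbert (\<lambda>t. Re (?g t)) e) (trunc_hilbert (\<lambda>t. Im (?g t)) e))
        \<longlongrightarrow> Complex (dhilb n v (\<lambda>x. Re (f x)) x) (dhilb n v (\<lambda>x. Im (f x)) x)) (at_right 0)"
      by (intro tendsto_Complex elim)
    have "((\<lambda>e. complex_of_real (1 / pi) * (LINT t:{t. e < \<bar>t\<bar>}|lborel. ?g t / complex_of_real t))
        \<longlongrightarrow> Complex (dhilb n v (\<lambda>x. Re (f x)) x) (dhilb n v (\<lambda>x. Im (f x)) x)) (at_right 0)"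
    proof (rule Lim_transform_eventually[OF L])
      show "\<forall>\<^sub>F e in at_right 0. Complex (trunc_hilbert (\<lambda>t. Re (?g t)) e) (trunc_hilbert (\<lambda>t. Im (?g t)) e)
          = complex_of_real (1 / pi) * (LINT t:{t. e < \<bar>t\<bar>}|lborel. ?g t / complex_of_real t)"
        using eventually_at_right_less[of 0]
      proof eventually_elim
        case (elim e)
        show ?case
          using \<open>fl.line_sq (\<lambda>x. Re (f x)) x\<close> \<open>fl.line_sq (\<lambda>x. Im (f x)) x\<close> elim
          by (intro complex_trunc_hilbert[symmetric, OF gm]) (auto simp: fl.line_sq_def shift_along_vflow)
      qed
    qed
    then show ?case unfolding directional_hilbert_def by (intro tendsto_Lim) auto
  qed
qed

lemma l2_norm_le_1D:
  assumes "l2_norm m g \<le> 1"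
  shows "(\<integral>\<^sup>+ x. (g x)\<^sup>2 \<partial>euclid m) \<le> 1"
proof -
  let ?I = "\<integral>\<^sup>+ x. (g x)\<^sup>2 \<partial>euclid m"
  have fin: "?I \<noteq> \<infinity>" using assms by (auto simp: l2_norm_def Let_def top_unique)
  then have "ennreal (sqrt (enn2real ?I)) \<le> ennreal 1" using assms by (simp add: l2_norm_def Let_def)
  then have "enn2real ?I \<le> 1" by (simp add: ennreal_le_iff)
  then have "ennreal (enn2real ?I) \<le> ennreal 1" by (rule ennreal_leI)
  then show ?thesis using fin by (simp add: less_top)
qed

theorem C_prod_upper:
  assumes n: "n \<ge> 2" and N: "antimono_on {1..n} N" "\<forall>k\<in>{1..n}. N k \<ge> 1"
  shows "C_prod n N \<le> ennreal (2 * upper_const n * sqrt (\<Prod>k=2..n. real (N k)) * ln (real (N 1) / real (N 2) + 1))"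
  unfolding C_prod_def maximal_hilbert_norm_def
proof (intro SUP_least)
  let ?M = "euclid (Suc n)"
  define K where "K = upper_const n * sqrt (\<Prod>k=2..n. real (N k)) * ln (real (N 1) / real (N 2) + 1)"
  have K0: "K \<ge> 0" unfolding K_def upper_const_def by (intro mult_nonneg_nonneg divide_nonneg_nonneg) (auto simp: prod_nonneg)
  fix \<Omega> :: "nat \<Rightarrow> real set" and f
  assume "\<Omega> \<in> {\<Omega>. \<forall>j\<in>{1..n}. finite (\<Omega> j) \<and> card (\<Omega> j) \<le> N j}"
  then have \<Omega>: "\<forall>j\<in>{1..n}. finite (\<Omega> j) \<and> card (\<Omega> j) \<le> N j" by simp
  assume "f \<in> {f \<in> L2_functions (Suc n). l2_norm (Suc n) (\<lambda>x. ennreal (cmod (f x))) \<le> 1}"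
  then have f [measurable]: "f \<in> borel_measurable ?M" and f1: "l2_norm (Suc n) (\<lambda>x. ennreal (cmod (f x))) \<le> 1"
    by (auto simp: L2_functions_def)
  let ?\<Omega> = "\<Pi>\<^sub>E j\<in>{1..n}. \<Omega> j"
  show "l2_norm (Suc n) (maximal_hilbert n ?\<Omega> f) \<le> ennreal (2 * upper_const n * sqrt (\<Prod>k=2..n. real (N k)) * ln (real (N 1) / real (N 2) + 1))"
  proof (cases "\<forall>j\<in>{1..n}. \<Omega> j \<noteq> {}")
    case False
    \<comment> \<open>An empty factor leaves no direction, and the empty supremum in
      \<open>ennreal\<close> is 0.\<close>
    then have "?\<Omega> = {}" by (auto simp: PiE_eq_empty_iff)
    then have "maximal_hilbert n ?\<Omega> f = (\<lambda>x. 0)" by (simp add: maximal_hilbert_def fun_eq_iff bot_ennreal)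
    then show ?thesis by (simp add: l2_norm_def)
  next
    case True
    have "(\<integral>\<^sup>+ x. (ennreal (cmod (f x)))\<^sup>2 \<partial>?M) \<le> 1" by (rule l2_norm_le_1D[OF f1])
    then have f2: "(\<integral>\<^sup>+ x. ennreal ((cmod (f x))\<^sup>2) \<partial>?M) \<le> 1" by (simp add: ennreal_power)
    have f2i: "integrable ?M (\<lambda>x. (cmod (f x))\<^sup>2)"
      using f2 by (intro integrableI_nonneg) (auto intro: le_less_trans)
    have f2n: "(\<integral>x. (cmod (f x))\<^sup>2 \<partial>?M) \<le> 1"
      using f2 nn_integral_eq_integral[OF f2i] by simp
    have r: "sq_int ?M (\<lambda>x. Re (f x))" and i: "sq_int ?M (\<lambda>x. Im (f x))"
      unfolding sq_int_def by (auto intro!: Bochner_Integration.integrable_bound[OF f2i] simp: cmod_power2)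
    have ri: "(l2_nrm ?M (\<lambda>x. Re (f x)))\<^sup>2 + (l2_nrm ?M (\<lambda>x. Im (f x)))\<^sup>2 \<le> 1"
      using r i f2n unfolding l2_nrm_sq by (subst Bochner_Integration.integral_add[symmetric]) (auto simp: sq_int_def cmod_power2)
    obtain g1 where g1: "integrable ?M g1" "\<And>v x. v \<in> ?\<Omega> \<Longrightarrow> (dhilb n v (\<lambda>x. Re (f x)) x)\<^sup>2 \<le> g1 x"
        "(\<integral>x. g1 x \<partial>?M) \<le> K\<^sup>2 * (4 * (l2_nrm ?M (\<lambda>x. Re (f x)))\<^sup>2)"
      unfolding K_def by (rule dhilb_maximal[OF n N \<Omega> True r]) blast
    obtain g2 where g2: "integrable ?M g2" "\<And>v x. v \<in> ?\<Omega> \<Longrightarrow> (dhilb n v (\<lambda>x. Im (f x)) x)\<^sup>2 \<le> g2 x"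
        "(\<integral>x. g2 x \<partial>?M) \<le> K\<^sup>2 * (4 * (l2_nrm ?M (\<lambda>x. Im (f x)))\<^sup>2)"
      unfolding K_def by (rule dhilb_maximal[OF n N \<Omega> True i]) blast
    have fin: "finite ?\<Omega>" using \<Omega> by (intro finite_PiE) auto
    have ne: "?\<Omega> \<noteq> {}" using True by (auto simp: PiE_eq_empty_iff)
    have gnn: "0 \<le> g1 x + g2 x" for x
    proof -
      obtain v where "v \<in> ?\<Omega>" using ne by blast
      then have "0 \<le> g1 x" "0 \<le> g2 x" using g1(2)[of v x] g2(2)[of v x] by (meson zero_le_power2 order_trans)+
      then show ?thesis by simp
    qed
    have "AE x in ?M. \<forall>v\<in>?\<Omega>. directional_hilbert n v f x = Complex (dhilb n v (\<lambda>x. Re (f x)) x) (dhilb n v (\<lambda>x. Im (f x)) x)"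
      using fin by (intro AE_finite_allI directional_hilbert_AE f r i)
    then have "AE x in ?M. (maximal_hilbert n ?\<Omega> f x)\<^sup>2 \<le> ennreal (g1 x + g2 x)"
    proof eventually_elim
      case (elim x)
      have "maximal_hilbert n ?\<Omega> f x \<le> ennreal (sqrt (g1 x + g2 x))"
        unfolding maximal_hilbert_def
      proof (rule SUP_least)
        fix v assume v: "v \<in> ?\<Omega>"
        have "(cmod (directional_hilbert n v f x))\<^sup>2 \<le> g1 x + g2 x"
          using elim v g1(2)[OF v, of x] g2(2)[OF v, of x] by (simp add: cmod_power2)
        then show "ennreal (cmod (directional_hilbert n v f x)) \<le> ennreal (sqrt (g1 x + g2 x))"
          by (intro ennreal_leI real_le_rsqrt)
      qed
      then have "(maximal_hilbert n ?\<Omega> f x)\<^sup>2 \<le> (ennreal (sqrt (g1 x + g2 x)))\<^sup>2" by (rule power_mono) simp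
      also have "\<dots> = ennreal (g1 x + g2 x)" using gnn by (simp add: ennreal_power)
      finally show ?case .
    qed
    then have "(\<integral>\<^sup>+ x. (maximal_hilbert n ?\<Omega> f x)\<^sup>2 \<partial>?M) \<le> (\<integral>\<^sup>+ x. ennreal (g1 x + g2 x) \<partial>?M)" by (rule nn_integral_mono_AE)
    also have "\<dots> = ennreal (\<integral>x. g1 x + g2 x \<partial>?M)" using g1 g2 gnn by (intro nn_integral_eq_integral) auto
    \<comment> \<open>The factor 2 comes from the 4 in \<open>dhilb_consecutive\<close>; real and
      imaginary part together have squared norm at most 1, so splitting costs nothing more.\<close>
    also have "\<dots> \<le> ennreal ((2 * K)\<^sup>2)"
    proof (rule ennreal_leI)
      have "(\<integral>x. g1 x + g2 x \<partial>?M) = (\<integral>x. g1 x \<partial>?M) + (\<integral>x. g2 x \<partial>?M)" using g1 g2 by simp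
      also have "\<dots> \<le> K\<^sup>2 * (4 * (l2_nrm ?M (\<lambda>x. Re (f x)))\<^sup>2) + K\<^sup>2 * (4 * (l2_nrm ?M (\<lambda>x. Im (f x)))\<^sup>2)" by (intro add_mono g1 g2)
      also have "\<dots> = (4 * K\<^sup>2) * ((l2_nrm ?M (\<lambda>x. Re (f x)))\<^sup>2 + (l2_nrm ?M (\<lambda>x. Im (f x)))\<^sup>2)" by (simp add: algebra_simps)
      also have "\<dots> \<le> (4 * K\<^sup>2) * 1" by (intro mult_left_mono ri) auto
      finally show "(\<integral>x. g1 x + g2 x \<partial>?M) \<le> (2 * K)\<^sup>2" by (simp add: power_mult_distrib)
    qed
    finally have "l2_norm (Suc n) (maximal_hilbert n ?\<Omega> f) \<le> ennreal (2 * K)" using K0 by (intro l2_norm_le) auto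
    then show ?thesis by (simp add: K_def mult.assoc)
  qed
qed

theorem theorem3p3:
  fixes n :: nat
  assumes "n \<ge> 2"
  shows "(\<exists>C::real. C > 0 \<and>
           (\<forall>N :: nat \<Rightarrow> nat. antimono_on {1..n} N \<and> (\<forall>k\<in>{1..n}. N k \<ge> 1) \<longrightarrow>
              C_prod n N
                \<le> ennreal (C * sqrt (\<Prod>k=2..n. real (N k)) * ln (real (N 1) / real (N 2) + 1))))
       \<and> (\<exists>c::real. c > 0 \<and>
           (\<forall>N :: nat \<Rightarrow> nat. antimono_on {1..n} N \<and> (\<forall>k\<in>{1..n}. N k \<ge> 1) \<longrightarrow>
              maximal_hilbert_norm n (\<Pi>\<^sub>E k\<in>{1..n}. uniform_set (N k))
                \<ge> ennreal (c * sqrt (\<Prod>k=2..n. real (N k)) * ln (real (N 1) / real (N 2) + 1))))"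
proof (intro conjI)
  have "upper_const n > 0" using assms by (simp add: upper_const_def add_pos_nonneg)
  then show "\<exists>C::real. C > 0 \<and>
           (\<forall>N :: nat \<Rightarrow> nat. antimono_on {1..n} N \<and> (\<forall>k\<in>{1..n}. N k \<ge> 1) \<longrightarrow>
              C_prod n N
                \<le> ennreal (C * sqrt (\<Prod>k=2..n. real (N k)) * ln (real (N 1) / real (N 2) + 1)))"
    by (intro exI[of _ "2 * upper_const n"] conjI allI impI C_prod_upper assms) auto
  show "\<exists>c::real. c > 0 \<and>
           (\<forall>N :: nat \<Rightarrow> nat. antimono_on {1..n} N \<and> (\<forall>k\<in>{1..n}. N k \<ge> 1) \<longrightarrow>
              maximal_hilbert_norm n (\<Pi>\<^sub>E k\<in>{1..n}. uniform_set (N k))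
                \<ge> ennreal (c * sqrt (\<Prod>k=2..n. real (N k)) * ln (real (N 1) / real (N 2) + 1)))"
    by (intro exI[of _ "1 / (4 * pi * sqrt (2 ^ n))"] conjI allI impI maximal_hilbert_uniform_lower assms) auto
qed

end
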